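(* Let $d,n\ge 1$ be integers, let $0<s<\frac d2$ and $k>0$ be real numbers, and let $h=(h_{ij})_{i,j=1,\dots,n}$ be an $n\times n$ matrix-valued symbol with $h_{ij}:\mathbb R^d\to\mathbb C$, homogeneous of degree $k$, i.e. $h(\lambda\xi)=\lambda^k h(\xi)$ for all $\lambda>0$ and all $\xi$. Fix an arbitrary norm $|\cdot|_{\mathbb C^n}$ on $\mathbb C^n$ and use it to define the norms $L^p_tL^q_x$ and $L^r_{t,x}$ of $\mathbb C^n$-valued functions. Assume that: (i) the Cauchy problem $i\partial_t u+h(D)u=0$, $u(0,x)=f(x)$, for $u:\mathbb R^{1+d}\to\mathbb C^n$, is globally well-posed in $\dot H^s$, and its unique solution is given by the propagator $u(t,x)=e^{ith(D)}f(x)$; (ii) the flow $e^{ith(D)}$ is unitary onto $\dot H^s$, i.e. $\|e^{ith(D)}f\|_{\dot H^s}=\|f\|_{\dot H^s}$ for all $t\in\mathbb R$ and all $f\in\dot H^s$; (iii) for some $2\le p<q\le\infty$ and some constant $C>0$, $$\left\|e^{ith(D)}f\right\|_{L^p_tL^q_x}\le C\|f\|_{\dot H^s}\qquad\text{for all } f\in\dot H^s.$$ Set $r=\frac{2(k+d)}{d-2s}$, so that the estimate $\|e^{ith(D)}f\|_{L^r_{t,x}}\le M\|f\|_{\dot H^s}$ also holds for all $f\in\dot H^s$, with the (finite) best constant $$M:=\sup_{\|f\|_{\dot H^s}=1}\left\|e^{ith(D)}f\right\|_{L^r_{t,x}}.$$ Then there exists $f_0\in\dot H^s$ such that $$\|f_0\|_{\dot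 H^s}=1,\qquad \left\|e^{ith(D)}f_0\right\|_{L^r_{t,x}}=M.$$
   Context: For vector-valued functions $f=(f_1,\dots,f_n):\mathbb R^d\to\mathbb C^n$, $\dot H^s$ denotes the homogeneous Sobolev space on $\mathbb R^d$ with the Hilbert norm $\|f\|_{\dot H^s}^2=\sum_{j=1}^n\|f_j\|_{\dot H^s}^2$, where on each component $\|\cdot\|_{\dot H^s}$ is the standard scalar homogeneous Sobolev norm. The operator $h(D)$ is the Fourier multiplier $h(D)=\mathcal F^{-1}(h(\xi)\mathcal F)$, where $\mathcal F$ is the standard Fourier transform on $\mathbb R^d$ (acting componentwise), and $e^{ith(D)}$ is the associated propagator, i.e. $e^{ith(D)}=\mathcal F^{-1}(e^{ith(\xi)}\mathcal F)$. Given a norm $|\cdot|_{\mathbb C^n}$ on $\mathbb C^n$, for $F=F(t,x):\mathbb R^{1+d}\to\mathbb C^n$ and $1\le p,q\le\infty$ one sets $$\|F\|_{L^p_tL^q_x}^p=\int_{\mathbb R}\Big(\int_{\mathbb R^d}|F(t,x)|_{\mathbb C^n}^q\,dx\Big)^{p/q}dt,$$ with the usual modification when $p$ or $q$ is $\infty$, and $L^r_{t,x}=L^r_tL^r_x$. *)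

theory Defs
  imports "HOL-Analysis.Analysis" "HOL-Probability.Essential_Supremum"
begin

section \<open>Fourier transform\<close>

definition partial_deriv :: "'d \<Rightarrow> (real ^ 'd::finite \<Rightarrow> complex) \<Rightarrow> real ^ 'd \<Rightarrow> complex" where
  "partial_deriv i \<phi> = (\<lambda>x. frechet_derivative \<phi> (at x) (axis i 1))"

text \<open>The list \<open>\<alpha>\<close> plays the role of a multi-index. Differentiability of all iterated partial
  derivatives is smoothness.\<close>

definition schwartz :: "(real ^ 'd::finite \<Rightarrow> complex) set" where
  "schwartz = {\<phi>. \<forall>\<alpha>. (\<forall>x. foldr partial_deriv \<alpha> \<phi> differentiable (at x)) \<and>
     (\<forall>N::nat. bounded (range (\<lambda>x. (1 + norm x) ^ N *\<^sub>R foldr partial_deriv \<alpha> \<phi> x)))}"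

definition schwartz_fourier :: "(real ^ 'd::finite \<Rightarrow> complex) \<Rightarrow> real ^ 'd \<Rightarrow> complex" where
  "schwartz_fourier \<phi> \<xi> =
     of_real ((2 * pi) powr (- (real CARD('d) / 2))) *
     (LINT x|lebesgue. exp (- \<i> * of_real (x \<bullet> \<xi>)) * \<phi> x)"

text \<open>The measurable functions that define a tempered distribution by absolutely convergent
  integrals against Schwartz functions.\<close>

definition tempered :: "(real ^ 'd::finite \<Rightarrow> complex) \<Rightarrow> bool" where
  "tempered f \<longleftrightarrow> (\<exists>N::nat. integrable lebesgue (\<lambda>x. f x /\<^sub>R (1 + norm x) ^ N))"

text \<open>\<open>g\<close> is the Fourier transform of \<open>f\<close> in the sense of tempered distributions. Functions are
  identified when they agree almost everywhere, so \<open>fourier\<close> and \<open>inv_fourier\<close> below select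
  representatives; their values are meaningful only when a transform exists.\<close>

definition has_fourier_scalar ::
    "(real ^ 'd::finite \<Rightarrow> complex) \<Rightarrow> (real ^ 'd \<Rightarrow> complex) \<Rightarrow> bool" where
  "has_fourier_scalar f g \<longleftrightarrow> tempered f \<and> tempered g \<and>
     (\<forall>\<phi>\<in>schwartz. (LINT x|lebesgue. f x * schwartz_fourier \<phi> x) = (LINT \<xi>|lebesgue. g \<xi> * \<phi> \<xi>))"

definition fourier_scalar :: "(real ^ 'd::finite \<Rightarrow> complex) \<Rightarrow> real ^ 'd \<Rightarrow> complex" where
  "fourier_scalar f = (SOME g. has_fourier_scalar f g)"

definition has_fourier ::
    "(real ^ 'd::finite \<Rightarrow> complex ^ 'n::finite) \<Rightarrow> (real ^ 'd \<Rightarrow> complex ^ 'n) \<Rightarrow> bool" where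
  "has_fourier f g \<longleftrightarrow> (\<forall>j. has_fourier_scalar (\<lambda>x. f x $ j) (\<lambda>\<xi>. g \<xi> $ j))"

definition fourier ::
    "(real ^ 'd::finite \<Rightarrow> complex ^ 'n::finite) \<Rightarrow> real ^ 'd \<Rightarrow> complex ^ 'n" where
  "fourier f \<xi> = (\<chi> j. fourier_scalar (\<lambda>x. f x $ j) \<xi>)"

definition inv_fourier ::
    "(real ^ 'd::finite \<Rightarrow> complex ^ 'n::finite) \<Rightarrow> real ^ 'd \<Rightarrow> complex ^ 'n" where
  "inv_fourier g = (SOME f. has_fourier f g)"

section \<open>Homogeneous Sobolev spaces\<close>

text \<open>These definitions are intended for \<open>0 < s < d/2\<close>, where every tempered distribution with
  locally integrable Fourier transform and finite homogeneous Sobolev norm is a function (in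
  \<open>L\<^sup>q\<close> with \<open>q = 2d/(d-2s)\<close>), and where finiteness of the norm forces the transform to be
  locally integrable at the origin.\<close>

definition Hdot_scalar :: "real \<Rightarrow> (real ^ 'd::finite \<Rightarrow> complex) set" where
  "Hdot_scalar s = {f. (\<exists>g. has_fourier_scalar f g) \<and>
     integrable lebesgue (\<lambda>\<xi>. norm \<xi> powr (2 * s) * (cmod (fourier_scalar f \<xi>))\<^sup>2)}"

definition Hdot_scalar_norm :: "real \<Rightarrow> (real ^ 'd::finite \<Rightarrow> complex) \<Rightarrow> real" where
  "Hdot_scalar_norm s f =
     sqrt (LINT \<xi>|lebesgue. norm \<xi> powr (2 * s) * (cmod (fourier_scalar f \<xi>))\<^sup>2)"

definition Hdot :: "real \<Rightarrow> (real ^ 'd::finite \<Rightarrow> complex ^ 'n::finite) set" where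
  "Hdot s = {f. \<forall>j. (\<lambda>x. f x $ j) \<in> Hdot_scalar s}"

definition Hdot_norm :: "real \<Rightarrow> (real ^ 'd::finite \<Rightarrow> complex ^ 'n::finite) \<Rightarrow> real" where
  "Hdot_norm s f = sqrt (\<Sum>j\<in>UNIV. (Hdot_scalar_norm s (\<lambda>x. f x $ j))\<^sup>2)"

section \<open>Fourier multipliers and the propagator\<close>

definition multiplier_defined ::
    "(real ^ 'd::finite \<Rightarrow> complex ^ 'n ^ 'n) \<Rightarrow> (real ^ 'd \<Rightarrow> complex ^ 'n::finite) \<Rightarrow> bool" where
  "multiplier_defined m f \<longleftrightarrow> (\<exists>g. has_fourier g (\<lambda>\<xi>. m \<xi> *v fourier f \<xi>))"

definition fourier_multiplier ::
    "(real ^ 'd::finite \<Rightarrow> complex ^ 'n ^ 'n) \<Rightarrow> (real ^ 'd \<Rightarrow> complex ^ 'n::finite) \<Rightarrow>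
     real ^ 'd \<Rightarrow> complex ^ 'n" where
  "fourier_multiplier m f = inv_fourier (\<lambda>\<xi>. m \<xi> *v fourier f \<xi>)"

text \<open>The library's \<open>exp\<close> does not apply: the type of square matrices carries no Banach algebra
  structure with matrix multiplication.\<close>

definition matrix_exp :: "complex ^ 'n ^ 'n \<Rightarrow> complex ^ 'n ^ 'n::finite" where
  "matrix_exp A = (\<Sum>m. (1 / fact m) *\<^sub>R (((**) A) ^^ m) (mat 1))"

definition propagator_symbol ::
    "(real ^ 'd::finite \<Rightarrow> complex ^ 'n ^ 'n) \<Rightarrow> real \<Rightarrow> real ^ 'd \<Rightarrow> complex ^ 'n ^ 'n::finite" where
  "propagator_symbol h t \<xi> = matrix_exp (\<chi> i j. \<i> * of_real t * h \<xi> $ i $ j)"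

definition propagator ::
    "(real ^ 'd::finite \<Rightarrow> complex ^ 'n ^ 'n) \<Rightarrow> real \<Rightarrow> (real ^ 'd \<Rightarrow> complex ^ 'n::finite) \<Rightarrow>
     real ^ 'd \<Rightarrow> complex ^ 'n" where
  "propagator h t f = fourier_multiplier (propagator_symbol h t) f"

section \<open>The Cauchy problem\<close>

definition Hdot_continuous ::
    "real \<Rightarrow> (real \<Rightarrow> real ^ 'd::finite \<Rightarrow> complex ^ 'n::finite) \<Rightarrow> bool" where
  "Hdot_continuous s u \<longleftrightarrow> (\<forall>t. u t \<in> Hdot s) \<and>
     (\<forall>t. ((\<lambda>\<tau>. Hdot_norm s (\<lambda>x. u \<tau> x - u t x)) \<longlongrightarrow> 0) (at t))"

definition Hdot_has_derivative ::
    "real \<Rightarrow> (real \<Rightarrow> real ^ 'd::finite \<Rightarrow> complex ^ 'n::finite) \<Rightarrow>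
     (real \<Rightarrow> real ^ 'd \<Rightarrow> complex ^ 'n) \<Rightarrow> bool" where
  "Hdot_has_derivative s U u \<longleftrightarrow> (\<forall>t. U t \<in> Hdot s) \<and> (\<forall>t.
     ((\<lambda>\<tau>. Hdot_norm s (\<lambda>x. (U \<tau> x - U t x) /\<^sub>R (\<tau> - t) - u t x)) \<longlongrightarrow> 0) (at t))"

text \<open>Mild solutions \<open>u \<in> C(\<real>; Hdot s)\<close> of \<open>i u' + h(D) u = 0\<close>, \<open>u(0) = f\<close>, in the usual sense of
  semigroup theory: the equation is integrated in time,
  \<open>i (u(t) - f) + h(D) U(t) = 0\<close> with \<open>U(t)\<close> the integral of \<open>u\<close> over \<open>[0,t]\<close>. As \<open>u\<close> is
  continuous, \<open>U\<close> is the unique primitive of \<open>u\<close> in \<open>Hdot s\<close> vanishing at \<open>0\<close>.\<close>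

definition cauchy_solution ::
    "real \<Rightarrow> (real ^ 'd::finite \<Rightarrow> complex ^ 'n ^ 'n) \<Rightarrow> (real ^ 'd \<Rightarrow> complex ^ 'n::finite) \<Rightarrow>
     (real \<Rightarrow> real ^ 'd \<Rightarrow> complex ^ 'n) \<Rightarrow> bool" where
  "cauchy_solution s h f u \<longleftrightarrow> Hdot_continuous s u \<and> (AE x in lebesgue. u 0 x = f x) \<and>
     (\<exists>U. Hdot_has_derivative s U u \<and> (AE x in lebesgue. U 0 x = 0) \<and>
        (\<forall>t. multiplier_defined h (U t) \<and>
             (AE x in lebesgue. \<i> *s (u t x - f x) + fourier_multiplier h (U t) x = 0)))"

text \<open>Hadamard well-posedness: existence, uniqueness, and continuous dependence on the data,
  locally uniformly in time.\<close>

definition globally_well_posed ::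
    "real \<Rightarrow> (real ^ 'd::finite \<Rightarrow> complex ^ 'n ^ 'n::finite) \<Rightarrow> bool" where
  "globally_well_posed s h \<longleftrightarrow>
     (\<forall>f\<in>Hdot s. \<exists>u. cauchy_solution s h f u) \<and>
     (\<forall>f\<in>Hdot s. \<forall>u v. cauchy_solution s h f u \<longrightarrow> cauchy_solution s h f v \<longrightarrow>
        (\<forall>t. AE x in lebesgue. u t x = v t x)) \<and>
     (\<forall>f\<in>Hdot s. \<forall>u. cauchy_solution s h f u \<longrightarrow> (\<forall>T>0. \<forall>\<epsilon>>0. \<exists>\<delta>>0.
        \<forall>g\<in>Hdot s. \<forall>v. cauchy_solution s h g v \<longrightarrow> Hdot_norm s (\<lambda>x. g x - f x) < \<delta> \<longrightarrow>
          (\<forall>t\<in>{-T..T}. Hdot_norm s (\<lambda>x. v t x - u t x) < \<epsilon>)))"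

section \<open>Mixed Lebesgue norms\<close>

definition complex_norm :: "(complex ^ 'n::finite \<Rightarrow> real) \<Rightarrow> bool" where
  "complex_norm N \<longleftrightarrow> (\<forall>v. 0 \<le> N v) \<and> (\<forall>v. N v = 0 \<longleftrightarrow> v = 0) \<and>
     (\<forall>c v. N (c *s v) = cmod c * N v) \<and> (\<forall>v w. N (v + w) \<le> N v + N w)"

text \<open>Only used for exponents \<open>a > 0\<close>.\<close>

definition ennreal_powr :: "ennreal \<Rightarrow> real \<Rightarrow> ennreal" where
  "ennreal_powr x a = (if x = top then top else ennreal (enn2real x powr a))"

definition Lp_norm :: "ennreal \<Rightarrow> 'a measure \<Rightarrow> ('a \<Rightarrow> ennreal) \<Rightarrow> ennreal" where
  "Lp_norm p M g = (if p = top then esssup M g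
     else ennreal_powr (\<integral>\<^sup>+ x. ennreal_powr (g x) (enn2real p) \<partial>M) (1 / enn2real p))"

definition mixed_norm ::
    "(complex ^ 'n::finite \<Rightarrow> real) \<Rightarrow> ennreal \<Rightarrow> ennreal \<Rightarrow>
     (real \<Rightarrow> real ^ 'd::finite \<Rightarrow> complex ^ 'n) \<Rightarrow> ennreal" where
  "mixed_norm N p q F =
     Lp_norm p lebesgue (\<lambda>t. Lp_norm q lebesgue (\<lambda>x. ennreal (N (F t x))))"

end

theory Submission
  imports Defs "HOL-Probability.Probability" "HOL-Complex_Analysis.Great_Picard"
begin

text \<open>Elements of the homogeneous Sobolev space are inverse Fourier transforms of \<open>|\<xi>|\<^sup>-\<^sup>s G\<close> with \<open>G\<close>
  in \<open>L\<^sup>2\<close>. Unitarity, applied to all truncations of \<open>G\<close>, shows that the symbol of the propagator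
  preserves \<open>|G(\<xi>)|\<close> almost everywhere, which controls, uniformly in time, the frequencies outside
  \<open>|\<xi>| \<le> A\<close>. Interpolating the Strichartz estimate with a refined Sobolev inequality at fixed time bounds
  the \<open>L\<^sup>r\<close> norm of a solution \<open>u\<close> by a positive power of the supremum of
  \<open>A\<^bsup>-(d/2-s)\<^esup> |u\<^sub>A(t, x)|\<close>, where \<open>u\<^sub>A\<close> is the band-limited part of \<open>u\<close>.
  (If \<open>p\<close> and \<open>q\<close> violate the scaling relation needed for this, then the Strichartz estimate forces
  \<open>u = 0\<close> and nothing is to be shown.) By translations and dilations one may thus keep
  \<open>u\<^sub>1(0, 0)\<close> away from \<open>0\<close> along a maximizing sequence, which makes its weak limit \<open>G\<close> nonzero.
  Band-limited parts converge pointwise under weak convergence, so the solutions converge almost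
  everywhere along a subsequence, and a Brezis--Lieb inequality gives
  \<open>\<Lambda> \<le> \<Lambda> ((1 - b)\<^bsup>r/2\<^esup> + b\<^bsup>r/2\<^esup>)\<close> for the \<open>r\<close>-th power \<open>\<Lambda>\<close> of the best constant and
  \<open>b = \<parallel>G\<parallel>\<^sup>2 > 0\<close>. As \<open>r > 2\<close>, this forces \<open>b = 1\<close>, and \<open>G\<close> is a maximizer.\<close>

section \<open>Integration on Euclidean space\<close>

text \<open>Everything takes place on the frequency side, with G = |xi|^s f^ in \<open>L^2\<close>.
  Put alpha = d/2 - s: Cauchy-Schwarz bounds the part of u below frequency A by a multiple of
  A^alpha times the norm of G. The dilations that preserve this norm act as A^(-alpha) u(t / A^k, x
  / A), and r is fixed by alpha r = k + d, the exponent at which they also preserve the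
  \<open>L^r\<close> norm in space-time. The obstacle is that weak convergence of the data says
  nothing about high frequencies of u, while h brings neither smoothness nor a dispersive estimate.
  The pointwise isometry takes their place: the part above A is O(A^(-s)) in \<open>L^2\<close> of
  space at every time, so under a Gaussian weight in (t, x) it is uniformly small and only
  band-limited parts have to converge. The condition p < q makes the power of the supremum in the
  improved estimate positive, which is what excludes a vanishing weak limit. In the last comparison
  an upper Brezis--Lieb bound suffices, because the squared norms of the limit and of the remainder
  add up to 1 asymptotically.\<close>

lemma lebesgue_affine:
  fixes t :: "'a::euclidean_space"
  assumes "c \<noteq> 0"
  shows "lebesgue = density (distr lebesgue lebesgue (\<lambda>x. t + c *\<^sub>R x)) (\<lambda>_. ennreal (\<bar>c\<bar> ^ DIM('a)))"
    and "(\<lambda>x. t + c *\<^sub>R x) \<in> lebesgue \<rightarrow>\<^sub>M lebesgue"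
proof -
  have eq: "(\<lambda>x. t + (\<Sum>j\<in>Basis. (c * (x \<bullet> j)) *\<^sub>R j)) = (\<lambda>x. t + c *\<^sub>R x)"
    unfolding scaleR_scaleR[symmetric] scaleR_sum_right[symmetric] euclidean_representation by simp
  show "lebesgue = density (distr lebesgue lebesgue (\<lambda>x. t + c *\<^sub>R x)) (\<lambda>_. ennreal (\<bar>c\<bar> ^ DIM('a)))"
    using lebesgue_affine_euclidean[of "\<lambda>_. c" t] assms unfolding eq by simp
  show "(\<lambda>x. t + c *\<^sub>R x) \<in> lebesgue \<rightarrow>\<^sub>M lebesgue"
    using lebesgue_affine_measurable[of "\<lambda>_. c" t] assms unfolding eq by simp
qed

lemma nn_integral_affine_lebesgue:
  fixes t :: "'a::euclidean_space" and f :: "'a \<Rightarrow> ennreal"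
  assumes c: "c \<noteq> 0" and f: "f \<in> borel_measurable lebesgue"
  shows "(\<integral>\<^sup>+x. f x \<partial>lebesgue) = ennreal (\<bar>c\<bar> ^ DIM('a)) * (\<integral>\<^sup>+x. f (t + c *\<^sub>R x) \<partial>lebesgue)"
proof -
  note m = lebesgue_affine(2)[OF c, of t]
  have "(\<integral>\<^sup>+x. f x \<partial>lebesgue) =
      (\<integral>\<^sup>+x. f x \<partial>density (distr lebesgue lebesgue (\<lambda>x. t + c *\<^sub>R x)) (\<lambda>_. ennreal (\<bar>c\<bar> ^ DIM('a))))"
    using lebesgue_affine(1)[OF c, of t] by simp
  also have "\<dots> = (\<integral>\<^sup>+x. ennreal (\<bar>c\<bar> ^ DIM('a)) * f x \<partial>distr lebesgue lebesgue (\<lambda>x. t + c *\<^sub>R x))"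
    using f by (subst nn_integral_density) auto
  also have "\<dots> = (\<integral>\<^sup>+x. ennreal (\<bar>c\<bar> ^ DIM('a)) * f (t + c *\<^sub>R x) \<partial>lebesgue)"
    using f m by (subst nn_integral_distr) auto
  also have "\<dots> = ennreal (\<bar>c\<bar> ^ DIM('a)) * (\<integral>\<^sup>+x. f (t + c *\<^sub>R x) \<partial>lebesgue)"
    using measurable_compose[OF m f] by (subst nn_integral_cmult) auto
  finally show ?thesis .
qed

lemma borel_measurable_affine_lebesgue:
  fixes t :: "'a::euclidean_space"
  assumes "c \<noteq> 0" and "f \<in> borel_measurable lebesgue"
  shows "(\<lambda>x. f (t + c *\<^sub>R x)) \<in> borel_measurable lebesgue"
  using measurable_compose[OF lebesgue_affine(2)[OF assms(1)] assms(2)] .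

lemma integral_affine_lebesgue:
  fixes t :: "'a::euclidean_space" and f :: "'a \<Rightarrow> 'b::{banach, second_countable_topology}"
  assumes c: "c \<noteq> 0" and f: "f \<in> borel_measurable lebesgue"
  shows "(LINT x|lebesgue. f x) = \<bar>c\<bar> ^ DIM('a) *\<^sub>R (LINT x|lebesgue. f (t + c *\<^sub>R x))"
    and "integrable lebesgue (\<lambda>x. f (t + c *\<^sub>R x)) \<longleftrightarrow> integrable lebesgue f"
proof -
  note m = lebesgue_affine(2)[OF c, of t]
  have "(LINT x|lebesgue. f x) =
      (LINT x|density (distr lebesgue lebesgue (\<lambda>x. t + c *\<^sub>R x)) (\<lambda>_. ennreal (\<bar>c\<bar> ^ DIM('a))). f x)"
    using lebesgue_affine(1)[OF c, of t] by simp
  also have "\<dots> = (LINT x|distr lebesgue lebesgue (\<lambda>x. t + c *\<^sub>R x). \<bar>c\<bar> ^ DIM('a) *\<^sub>R f x)"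
    using f by (subst integral_density) auto
  also have "\<dots> = (LINT x|lebesgue. \<bar>c\<bar> ^ DIM('a) *\<^sub>R f (t + c *\<^sub>R x))"
    using f m by (subst integral_distr) auto
  finally show "(LINT x|lebesgue. f x) = \<bar>c\<bar> ^ DIM('a) *\<^sub>R (LINT x|lebesgue. f (t + c *\<^sub>R x))"
    by simp
  have "integrable lebesgue f \<longleftrightarrow> (\<integral>\<^sup>+x. norm (f x) \<partial>lebesgue) < \<infinity>"
    using f by (simp add: integrable_iff_bounded)
  also have "\<dots> \<longleftrightarrow> ennreal (\<bar>c\<bar> ^ DIM('a)) * (\<integral>\<^sup>+x. norm (f (t + c *\<^sub>R x)) \<partial>lebesgue) < \<infinity>"
    using f by (subst nn_integral_affine_lebesgue[OF c, of _ t]) auto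
  also have "\<dots> \<longleftrightarrow> (\<integral>\<^sup>+x. norm (f (t + c *\<^sub>R x)) \<partial>lebesgue) < \<infinity>"
    using c by (auto simp: ennreal_mult_less_top ennreal_mult_eq_top_iff less_top[symmetric])
  also have "\<dots> \<longleftrightarrow> integrable lebesgue (\<lambda>x. f (t + c *\<^sub>R x))"
    using measurable_compose[OF m f] by (simp add: integrable_iff_bounded)
  finally show "integrable lebesgue (\<lambda>x. f (t + c *\<^sub>R x)) \<longleftrightarrow> integrable lebesgue f" ..
qed

lemma AE_affine_lebesgue:
  fixes t :: "'a::euclidean_space"
  assumes c: "c \<noteq> 0" and P: "AE x in lebesgue. P x"
  shows "AE x in lebesgue. P (t + c *\<^sub>R x)"
proof -
  have "AE x in density (distr lebesgue lebesgue (\<lambda>x. t + c *\<^sub>R x)) (\<lambda>_. ennreal (\<bar>c\<bar> ^ DIM('a))). P x"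
    by (subst lebesgue_affine(1)[OF c, of t, symmetric]) (rule P)
  then have "AE x in distr lebesgue lebesgue (\<lambda>x. t + c *\<^sub>R x). P x"
    using c by (subst (asm) AE_density) auto
  then show ?thesis
    using AE_distrD[OF lebesgue_affine(2)[OF c, of t]] by blast
qed

section \<open>Product integrals, polynomial weights, Gaussian integrals and the Riesz kernel on
  balls\<close>

lemma
  fixes f :: "'a::euclidean_space \<Rightarrow> real \<Rightarrow> 'b::{real_normed_field,banach,second_countable_topology}"
  assumes f: "\<And>b. b \<in> Basis \<Longrightarrow> integrable lborel (f b)"
  shows integrable_lborel_prod: "integrable lborel (\<lambda>x::'a. \<Prod>b\<in>Basis. f b (x \<bullet> b))"
    and integral_lborel_prod: "(LINT x|lborel. (\<Prod>b\<in>Basis. f b ((x::'a) \<bullet> b))) = (\<Prod>b\<in>Basis. LINT x|lborel. f b x)"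
proof -
  interpret product_sigma_finite "\<lambda>_::'a. lborel :: real measure"
    by standard
  have [measurable]: "b \<in> Basis \<Longrightarrow> f b \<in> borel_measurable borel" for b
    using borel_measurable_integrable[OF f] by simp
  have eq: "(\<Prod>b\<in>Basis. f b ((\<Sum>b\<in>Basis. g b *\<^sub>R b) \<bullet> b)) = (\<Prod>b\<in>Basis. f b (g b))" for g :: "'a \<Rightarrow> real"
    by (intro prod.cong) auto
  show "integrable lborel (\<lambda>x::'a. \<Prod>b\<in>Basis. f b (x \<bullet> b))"
    by (subst lborel_eq, subst integrable_distr_eq) (auto simp: eq intro!: product_integrable_prod f)
  show "(LINT x|lborel. (\<Prod>b\<in>Basis. f b ((x::'a) \<bullet> b))) = (\<Prod>b\<in>Basis. LINT x|lborel. f b x)"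
    by (subst lborel_eq, subst integral_distr) (auto simp: eq intro!: product_integral_prod f)
qed

text \<open>Every factor 1 + (x . b)^2 is at most (1 + |x|)^2, so already the exponent 2
  \<open>DIM('a)\<close> puts the weight below a product of one-dimensional integrable
  functions.\<close>

lemma integrable_inverse_1_plus_norm_power:
  assumes N: "2 * DIM('a) \<le> N"
  shows "integrable lebesgue (\<lambda>x::'a::euclidean_space. 1 / (1 + norm x) ^ N)"
proof -
  have 1: "integrable lborel (\<lambda>x::real. inverse (1 + x\<^sup>2))"
    using integrable_inverse_1_plus_square by (simp add: set_integrable_def)
  have 2: "integrable lborel (\<lambda>x::'a. \<Prod>b\<in>Basis. inverse (1 + (x \<bullet> b)\<^sup>2))"
    by (rule integrable_lborel_prod) (rule 1)
  have le: "1 / (1 + norm x) ^ N \<le> (\<Prod>b\<in>Basis. inverse (1 + (x \<bullet> b)\<^sup>2))" for x :: 'a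
  proof -
    have "1 + (x \<bullet> b)\<^sup>2 \<le> (1 + norm x)\<^sup>2" if "b \<in> Basis" for b
    proof -
      have "(x \<bullet> b)\<^sup>2 \<le> (norm x)\<^sup>2"
        using Basis_le_norm[OF that, of x] power_mono[of "\<bar>x \<bullet> b\<bar>" "norm x" 2] by simp
      then have "1 + (x \<bullet> b)\<^sup>2 \<le> 1\<^sup>2 + (norm x)\<^sup>2 + 2 * 1 * norm x"
        using norm_ge_zero[of x] unfolding power_one by linarith
      then show ?thesis unfolding power2_sum .
    qed
    then have "(\<Prod>b\<in>Basis. 1 + (x \<bullet> b)\<^sup>2) \<le> (\<Prod>b\<in>(Basis::'a set). (1 + norm x)\<^sup>2)"
      by (intro prod_mono) (auto intro: add_nonneg_nonneg)
    also have "\<dots> = (1 + norm x) ^ (2 * DIM('a))" by (simp add: power_mult)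
    also have "\<dots> \<le> (1 + norm x) ^ N" using N by (intro power_increasing) auto
    finally have le: "(\<Prod>b\<in>Basis. 1 + (x \<bullet> b)\<^sup>2) \<le> (1 + norm x) ^ N" .
    have "0 < (\<Prod>b\<in>Basis. 1 + (x \<bullet> b)\<^sup>2)"
      by (intro prod_pos) (auto intro: add_pos_nonneg)
    then have "inverse ((1 + norm x) ^ N) \<le> inverse (\<Prod>b\<in>Basis. 1 + (x \<bullet> b)\<^sup>2)"
      using le by (intro le_imp_inverse_le)
    moreover have "inverse (\<Prod>b\<in>Basis. 1 + (x \<bullet> b)\<^sup>2) = (\<Prod>b\<in>Basis. inverse (1 + (x \<bullet> b)\<^sup>2))"
      by (simp add: prod_inversef[symmetric] comp_def)
    ultimately show ?thesis by (simp add: inverse_eq_divide)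
  qed
  have "integrable lborel (\<lambda>x::'a. 1 / (1 + norm x) ^ N)"
    by (rule Bochner_Integration.integrable_bound[OF 2])
       (use le in \<open>auto intro!: AE_I2 order_trans[OF le] abs_ge_self simp: abs_of_nonneg\<close>)
  then show ?thesis by (subst integrable_completion) auto
qed

text \<open>This is the characteristic function of the standard normal law at xi / e, after the
  substitution x -> e x.\<close>

lemma has_bochner_integral_gaussian_1:
  fixes e \<xi> :: real
  assumes e: "0 < e"
  shows "has_bochner_integral lborel (\<lambda>x. exp (\<i> * of_real (x * \<xi>)) * of_real (exp (- (e * x)\<^sup>2 / 2)))
     (of_real (sqrt (2 * pi) / e * exp (- \<xi>\<^sup>2 / (2 * e\<^sup>2))) :: complex)"
proof -
  define u where "u = \<xi> / e"
  have ch: "char std_normal_distribution u = of_real (exp (- u\<^sup>2 / 2))"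
    by (simp add: char_std_normal_distribution)
  have i1: "integrable lborel (\<lambda>x. std_normal_density x *\<^sub>R iexp (u * x))"
    by (rule Bochner_Integration.integrable_bound[OF integrable_normal_density[of 1 0]]) auto
  have "(LINT x|lborel. std_normal_density x *\<^sub>R iexp (u * x)) = of_real (exp (- u\<^sup>2 / 2))"
    using ch unfolding char_def by (subst (asm) integral_density) auto
  with i1 have "has_bochner_integral lborel (\<lambda>x. std_normal_density x *\<^sub>R iexp (u * x)) (of_real (exp (- u\<^sup>2 / 2)))"
    by (simp add: has_bochner_integral_iff)
  then have "has_bochner_integral lborel (\<lambda>x. std_normal_density (0 + e * x) *\<^sub>R iexp (u * (0 + e * x)))
      (of_real (exp (- u\<^sup>2 / 2)) /\<^sub>R \<bar>e\<bar>)"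
    using e by (subst (asm) lborel_has_bochner_integral_real_affine_iff[of e _ _ 0]) simp_all
  then have "has_bochner_integral lborel (\<lambda>x. (of_real (sqrt (2 * pi)) :: complex) * (std_normal_density (0 + e * x) *\<^sub>R iexp (u * (0 + e * x))))
      (of_real (sqrt (2 * pi)) * (of_real (exp (- u\<^sup>2 / 2)) /\<^sub>R \<bar>e\<bar>))"
    by (rule has_bochner_integral_mult_right)
  moreover have "(of_real (sqrt (2 * pi)) :: complex) * (std_normal_density (0 + e * x) *\<^sub>R iexp (u * (0 + e * x)))
      = exp (\<i> * of_real (x * \<xi>)) * of_real (exp (- (e * x)\<^sup>2 / 2))" for x
    using e by (simp add: std_normal_density_def scaleR_conv_of_real u_def field_simps)
  moreover have "(of_real (sqrt (2 * pi)) * (of_real (exp (- u\<^sup>2 / 2)) /\<^sub>R \<bar>e\<bar>)) =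
      (of_real (sqrt (2 * pi) / e * exp (- \<xi>\<^sup>2 / (2 * e\<^sup>2))) :: complex)"
    using e by (simp add: scaleR_conv_of_real u_def field_simps power_divide exp_of_real[symmetric])
  ultimately show ?thesis by simp
qed

lemma has_bochner_integral_gaussian:
  fixes \<xi> :: "'a::euclidean_space"
  assumes e: "0 < e"
  shows "has_bochner_integral lborel (\<lambda>x. exp (\<i> * of_real (x \<bullet> \<xi>)) * of_real (exp (- (e * norm x)\<^sup>2 / 2)))
     (of_real ((sqrt (2 * pi) / e) ^ DIM('a) * exp (- (norm \<xi>)\<^sup>2 / (2 * e\<^sup>2))) :: complex)"
proof -
  let ?f = "\<lambda>b x. exp (\<i> * of_real (x * (\<xi> \<bullet> b))) * of_real (exp (- (e * x)\<^sup>2 / 2)) :: complex"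
  have nsq: "(norm x)\<^sup>2 = (\<Sum>b\<in>Basis. (x \<bullet> b)\<^sup>2)" for x :: 'a
    unfolding power2_norm_eq_inner by (subst euclidean_inner) (simp add: power2_eq_square)
  have i: "integrable lborel (?f b)" "integral\<^sup>L lborel (?f b) = of_real (sqrt (2 * pi) / e * exp (- (\<xi> \<bullet> b)\<^sup>2 / (2 * e\<^sup>2)))" for b
    using has_bochner_integral_gaussian_1[OF e, of "\<xi> \<bullet> b"] by (auto simp: has_bochner_integral_iff)
  have eq: "(\<Prod>b\<in>Basis. ?f b (x \<bullet> b)) = exp (\<i> * of_real (x \<bullet> \<xi>)) * of_real (exp (- (e * norm x)\<^sup>2 / 2))" for x :: 'a
  proof -
    have "(\<Prod>b\<in>Basis. exp (\<i> * of_real ((x \<bullet> b) * (\<xi> \<bullet> b)))) = exp (\<i> * of_real (x \<bullet> \<xi>))"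
      by (subst euclidean_inner[of x]) (simp add: exp_sum[symmetric] sum_distrib_left)
    moreover have "(\<Prod>b\<in>Basis. exp (- (e * (x \<bullet> b))\<^sup>2 / 2)) = exp (- (e * norm x)\<^sup>2 / 2)"
      by (simp add: exp_sum[symmetric] power_mult_distrib nsq sum_distrib_left sum_negf sum_divide_distrib)
    ultimately show ?thesis
      unfolding prod.distrib of_real_prod[symmetric] by simp
  qed
  have "(\<Prod>b\<in>Basis. sqrt (2 * pi) / e * exp (- (\<xi> \<bullet> b)\<^sup>2 / (2 * e\<^sup>2))) =
      (sqrt (2 * pi) / e) ^ DIM('a) * exp (- (norm \<xi>)\<^sup>2 / (2 * e\<^sup>2))"
    by (simp only: prod.distrib prod_constant exp_sum[symmetric] finite_Basis nsq sum_divide_distrib sum_negf[symmetric])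
  then have "(\<Prod>b\<in>Basis. (of_real (sqrt (2 * pi) / e * exp (- (\<xi> \<bullet> b)\<^sup>2 / (2 * e\<^sup>2))) :: complex)) =
      of_real ((sqrt (2 * pi) / e) ^ DIM('a) * exp (- (norm \<xi>)\<^sup>2 / (2 * e\<^sup>2)))"
    unfolding of_real_prod[symmetric] by simp
  then show ?thesis
    unfolding has_bochner_integral_iff eq[symmetric]
    using integrable_lborel_prod[of ?f] integral_lborel_prod[of ?f] i by simp
qed

lemma term_le_suminf_ennreal: "f j \<le> (\<Sum>i. f i)" for f :: "nat \<Rightarrow> ennreal"
  using sum_le_suminf[of f "{j}"] by (simp add: summableI)

text \<open>Dyadic shells show finiteness on the unit ball: on the j-th shell the kernel is at most
  2^(2s(j+1)) and the volume is of order 2^(-jd), so the series is geometric with ratio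
  \<open>\<theta>\<close>, and \<open>\<theta> < 1\<close> is exactly 2s < d. Dilation then produces
  the power of A.\<close>

lemma riesz_kernel_ball:
  fixes s :: real
  assumes s: "0 \<le> s" "2 * s < DIM('a)"
  obtains C where "0 \<le> C" "\<And>A. 0 < A \<Longrightarrow>
    (\<integral>\<^sup>+x. indicator (cball 0 A) x * ennreal (norm (x::'a::euclidean_space) powr (- 2 * s)) \<partial>lebesgue) = ennreal (C * A powr (DIM('a) - 2 * s))"
proof -
  let ?D = "DIM('a)"
  have [measurable]: "cball (0::'a) A \<in> sets borel" for A by simp
  have [measurable]: "(\<lambda>x::'a. norm x powr (- 2 * s)) \<in> borel_measurable borel"
    by (intro powr_real_measurable) auto
  define I where "I A = (\<integral>\<^sup>+x. indicator (cball 0 A) x * ennreal (norm (x::'a) powr (- 2 * s)) \<partial>lebesgue)" for A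
  define \<theta> where "\<theta> = 2 powr (2 * s - ?D)"
  have \<theta>: "0 < \<theta>" "\<theta> < 1" using s by (auto simp: \<theta>_def powr_less_one)
  have pt: "indicator (cball 0 1) x * ennreal (norm (x::'a) powr (- 2 * s)) \<le>
     (\<Sum>j. ennreal (2 powr (2 * s * real (Suc j))) * indicator (cball 0 ((1/2) ^ j)) x)" for x
  proof (cases "0 < norm x \<and> norm x \<le> 1")
    case True
    obtain j0 where j0: "(1/2) ^ j0 < norm x"
      using True real_arch_pow_inv[of "norm x" "1/2"] by auto
    \<comment> \<open>The index of the shell of x: (1/2)^(j+1) < |x| <= (1/2)^j.\<close>
    define j where "j = (LEAST j. (1/2::real) ^ Suc j < norm x)"
    have "\<exists>j. (1/2::real) ^ Suc j < norm x"
      using j0 power_decreasing[of j0 "Suc j0" "1/2::real"] by (intro exI[of _ j0]) linarith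
    then have j1: "(1/2) ^ Suc j < norm x" unfolding j_def by (rule LeastI_ex)
    have j2: "norm x \<le> (1/2) ^ j"
    proof (cases j)
      case 0 then show ?thesis using True by simp
    next
      case (Suc i)
      have "\<not> (1/2) ^ Suc i < norm x"
        by (rule not_less_Least[of i "\<lambda>j. (1/2) ^ Suc j < norm x"]) (use Suc in \<open>simp add: j_def\<close>)
      then show ?thesis using Suc by simp
    qed
    have "norm x powr (- 2 * s) \<le> ((1/2) ^ Suc j) powr (- 2 * s)"
      using j1 s by (intro powr_mono2') (auto intro: less_imp_le)
    also have "((1/2::real) ^ Suc j) = 2 powr (- real (Suc j))"
      by (simp only: powr_minus powr_realpow zero_less_numeral power_one_over inverse_eq_divide)
    also have "(2 powr (- real (Suc j))) powr (- 2 * s) = 2 powr (2 * s * real (Suc j))"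
      by (simp only: powr_powr mult_ac minus_mult_minus)
    finally have "indicator (cball 0 1) x * ennreal (norm (x::'a) powr (- 2 * s)) \<le> ennreal (2 powr (2 * s * real (Suc j))) * indicator (cball 0 ((1/2) ^ j)) x"
      using True j2 by (auto simp: ennreal_leI)
    also have "\<dots> \<le> (\<Sum>j. ennreal (2 powr (2 * s * real (Suc j))) * indicator (cball 0 ((1/2) ^ j)) x)"
      by (rule term_le_suminf_ennreal)
    finally show ?thesis .
  next
    case False
    then have "indicator (cball 0 1) x * ennreal (norm x powr (- 2 * s)) = 0"
      by (auto simp: indicator_def)
    then show ?thesis by (simp only: zero_le)
  qed
  have "I 1 \<le> (\<integral>\<^sup>+x. (\<Sum>j. ennreal (2 powr (2 * s * real (Suc j))) * indicator (cball (0::'a) ((1/2) ^ j)) x) \<partial>lebesgue)"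
    unfolding I_def by (intro nn_integral_mono pt)
  also have "\<dots> = (\<Sum>j. \<integral>\<^sup>+x. ennreal (2 powr (2 * s * real (Suc j))) * indicator (cball (0::'a) ((1/2) ^ j)) x \<partial>lebesgue)"
    by (intro nn_integral_suminf borel_measurable_times_ennreal borel_measurable_const borel_measurable_indicator) simp
  also have "\<dots> = (\<Sum>j. ennreal (2 powr (2 * s) * unit_ball_vol ?D * \<theta> ^ j))"
  proof (intro suminf_cong)
    fix j
    have "(\<integral>\<^sup>+x. ennreal (2 powr (2 * s * real (Suc j))) * indicator (cball (0::'a) ((1/2) ^ j)) x \<partial>lebesgue) =
       ennreal (2 powr (2 * s * real (Suc j))) * ennreal (unit_ball_vol ?D * ((1/2) ^ j) ^ ?D)"
      by (simp add: nn_integral_cmult_indicator emeasure_cball)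
    also have "\<dots> = ennreal (2 powr (2 * s) * unit_ball_vol ?D * \<theta> ^ j)"
    proof -
      have e1: "((1/2::real) ^ j) ^ ?D = 2 powr (- real (j * ?D))"
        by (simp only: power_mult[symmetric] powr_minus powr_realpow zero_less_numeral power_one_over inverse_eq_divide)
      have e2: "\<theta> ^ j = 2 powr ((2 * s - ?D) * real j)"
        unfolding powr_realpow[OF \<theta>(1), symmetric] by (simp only: \<theta>_def powr_powr)
      have "2 powr (2 * s * real (Suc j)) * 2 powr (- real (j * ?D)) = 2 powr (2 * s) * \<theta> ^ j"
        unfolding e2 powr_add[symmetric] by (simp add: algebra_simps)
      then have "2 powr (2 * s * real (Suc j)) * (unit_ball_vol ?D * ((1/2) ^ j) ^ ?D) = 2 powr (2 * s) * unit_ball_vol ?D * \<theta> ^ j"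
        unfolding e1 by (simp only: mult_ac)
      then show ?thesis
        unfolding ennreal_mult'[OF powr_ge_zero, symmetric] by (rule arg_cong)
    qed
    finally show "(\<integral>\<^sup>+x. ennreal (2 powr (2 * s * real (Suc j))) * indicator (cball (0::'a) ((1/2) ^ j)) x \<partial>lebesgue) =
       ennreal (2 powr (2 * s) * unit_ball_vol ?D * \<theta> ^ j)" .
  qed
  also have "\<dots> < \<infinity>"
    using \<theta> by (subst suminf_ennreal2) (auto intro!: summable_mult summable_geometric)
  finally have fin: "I 1 < \<infinity>" .
  \<comment> \<open>Dilation by A: the Jacobian contributes A^d and the kernel A^(-2s). The constant
    C is the integral over the unit ball.\<close>
  have "I A = ennreal (enn2real (I 1) * A powr (?D - 2 * s))" if A: "0 < A" for A
  proof -
    have "I A = ennreal (\<bar>A\<bar> ^ ?D) * (\<integral>\<^sup>+x. indicator (cball 0 A) (0 + A *\<^sub>R x) * ennreal (norm (0 + A *\<^sub>R x :: 'a) powr (- 2 * s)) \<partial>lebesgue)"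
      unfolding I_def
    proof (rule nn_integral_affine_lebesgue)
      show "(\<lambda>x. indicator (cball 0 A) x * ennreal (norm (x::'a) powr (- 2 * s))) \<in> borel_measurable lebesgue"
        by (rule measurable_completion) measurable
    qed (use A in auto)
    also have "(\<lambda>x. indicator (cball 0 A) (0 + A *\<^sub>R x) * ennreal (norm (0 + A *\<^sub>R x :: 'a) powr (- 2 * s))) =
      (\<lambda>x. ennreal (A powr (- 2 * s)) * (indicator (cball 0 1) x * ennreal (norm x powr (- 2 * s))))"
      using A by (auto simp: fun_eq_iff indicator_def powr_mult ennreal_mult)
    also have "(\<integral>\<^sup>+x. ennreal (A powr (- 2 * s)) * (indicator (cball 0 1) x * ennreal (norm (x::'a) powr (- 2 * s))) \<partial>lebesgue) =
        ennreal (A powr (- 2 * s)) * I 1"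
      unfolding I_def by (rule nn_integral_cmult) (rule measurable_completion, measurable)
    also have "I 1 = ennreal (enn2real (I 1))" using fin by simp
    also have "ennreal (\<bar>A\<bar> ^ ?D) * (ennreal (A powr (- 2 * s)) * ennreal (enn2real (I 1))) = ennreal (enn2real (I 1) * A powr (?D - 2 * s))"
    proof -
      have "A ^ ?D * A powr (- 2 * s) = A powr (?D - 2 * s)"
        unfolding powr_realpow[OF A, symmetric] powr_add[symmetric] by simp
      then have "\<bar>A\<bar> ^ ?D * (A powr (- 2 * s) * enn2real (I 1)) = enn2real (I 1) * A powr (?D - 2 * s)"
        using A by (simp only: abs_of_pos mult_ac)
      then show ?thesis
        unfolding ennreal_mult'[OF powr_ge_zero, symmetric] ennreal_mult'[OF zero_le_power[OF abs_ge_zero], symmetric]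
        by (rule arg_cong)
    qed
    finally show ?thesis .
  qed
  then show ?thesis
    unfolding I_def by (intro that) (rule enn2real_nonneg)
qed

section \<open>Square-integrable functions\<close>

text \<open>Half of the geometric decay is spent on integrability: with
  \<open>\<eta> = sqrt \<theta>\<close> the sum of (d k)^2 / eta^k has integral at most C times the
  sum of eta^k, so it is finite almost everywhere. There d k is at most a constant times eta^(k/2),
  which is summable.\<close>

lemma AE_summable_of_geometric_L2:
  fixes d :: "nat \<Rightarrow> 'a \<Rightarrow> real"
  assumes [measurable]: "\<And>k. d k \<in> borel_measurable M" and d0: "\<And>k x. 0 \<le> d k x"
    and bnd: "\<And>k. (\<integral>\<^sup>+x. ennreal ((d k x)\<^sup>2) \<partial>M) \<le> ennreal (C * \<theta> ^ k)"
    and C: "0 \<le> C" and \<theta>: "0 < \<theta>" "\<theta> < 1"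
  shows "AE x in M. summable (\<lambda>k. d k x)"
proof -
  define \<eta> where "\<eta> = sqrt \<theta>"
  have \<eta>: "0 < \<eta>" "\<eta> < 1" "\<eta> * \<eta> = \<theta>" using \<theta> by (auto simp: \<eta>_def)
  have "(\<integral>\<^sup>+x. (\<Sum>k. ennreal ((1 / \<eta>) ^ k) * ennreal ((d k x)\<^sup>2)) \<partial>M) = (\<Sum>k. \<integral>\<^sup>+x. ennreal ((1 / \<eta>) ^ k) * ennreal ((d k x)\<^sup>2) \<partial>M)"
    by (intro nn_integral_suminf) auto
  also have "\<dots> = (\<Sum>k. ennreal ((1 / \<eta>) ^ k) * (\<integral>\<^sup>+x. ennreal ((d k x)\<^sup>2) \<partial>M))"
    by (intro suminf_cong nn_integral_cmult) auto
  also have "\<dots> \<le> (\<Sum>k. ennreal (C * \<eta> ^ k))"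
  proof (intro suminf_le)
    fix k
    have "ennreal ((1 / \<eta>) ^ k) * (\<integral>\<^sup>+x. ennreal ((d k x)\<^sup>2) \<partial>M) \<le> ennreal ((1 / \<eta>) ^ k) * ennreal (C * \<theta> ^ k)"
      by (intro mult_left_mono bnd) auto
    also have "\<dots> = ennreal (C * \<eta> ^ k)"
      using \<eta> C unfolding \<eta>(3)[symmetric] by (simp add: ennreal_mult[symmetric] power_mult_distrib field_simps)
    finally show "ennreal ((1 / \<eta>) ^ k) * (\<integral>\<^sup>+x. ennreal ((d k x)\<^sup>2) \<partial>M) \<le> ennreal (C * \<eta> ^ k)" .
  qed auto
  also have "\<dots> < \<infinity>"
    using \<eta> C by (subst suminf_ennreal2) (auto intro!: summable_mult summable_geometric)
  finally have "(\<integral>\<^sup>+x. (\<Sum>k. ennreal ((1 / \<eta>) ^ k) * ennreal ((d k x)\<^sup>2)) \<partial>M) \<noteq> \<infinity>" by simp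
  then have "AE x in M. (\<Sum>k. ennreal ((1 / \<eta>) ^ k) * ennreal ((d k x)\<^sup>2)) \<noteq> \<infinity>"
    by (intro nn_integral_PInf_AE) auto
  then show ?thesis
  proof eventually_elim
    case (elim x)
    define K where "K = enn2real (\<Sum>k. ennreal ((1 / \<eta>) ^ k) * ennreal ((d k x)\<^sup>2))"
    have K: "(1 / \<eta>) ^ k * (d k x)\<^sup>2 \<le> K" for k
    proof -
      have "ennreal ((1 / \<eta>) ^ k * (d k x)\<^sup>2) = ennreal ((1 / \<eta>) ^ k) * ennreal ((d k x)\<^sup>2)"
        using \<eta> by (simp add: ennreal_mult)
      also have "\<dots> \<le> (\<Sum>k. ennreal ((1 / \<eta>) ^ k) * ennreal ((d k x)\<^sup>2))"
        by (rule term_le_suminf_ennreal)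
      also have "\<dots> = ennreal K" using elim unfolding K_def by (simp add: less_top)
      finally show ?thesis by (subst (asm) ennreal_le_iff) (auto simp: K_def)
    qed
    have "d k x \<le> sqrt K * sqrt \<eta> ^ k" for k
    proof -
      have "(d k x)\<^sup>2 \<le> K * \<eta> ^ k" using K[of k] \<eta> by (simp add: field_simps)
      then have "sqrt ((d k x)\<^sup>2) \<le> sqrt (K * \<eta> ^ k)" by (rule real_sqrt_le_mono)
      then show ?thesis using d0[of k x] by (simp add: real_sqrt_mult real_sqrt_power)
    qed
    then show "summable (\<lambda>k. d k x)"
      using d0 \<eta> by (intro summable_comparison_test'[OF summable_mult[OF summable_geometric[of "sqrt \<eta>"]], of 0 _ "sqrt K"])
         (auto)
  qed
qed

lemma AE_convergent_of_geometric_L2: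
  fixes f :: "nat \<Rightarrow> 'a \<Rightarrow> 'b::{banach, second_countable_topology}"
  assumes [measurable]: "\<And>k. f k \<in> borel_measurable M"
    and bnd: "\<And>k. (\<integral>\<^sup>+x. ennreal ((norm (f (Suc k) x - f k x))\<^sup>2) \<partial>M) \<le> ennreal (C * \<theta> ^ k)"
    and C: "0 \<le> C" and \<theta>: "0 < \<theta>" "\<theta> < 1"
  shows "AE x in M. convergent (\<lambda>k. f k x)"
proof -
  have "AE x in M. summable (\<lambda>k. norm (f (Suc k) x - f k x))"
    by (rule AE_summable_of_geometric_L2[OF _ _ bnd C \<theta>]) auto
  then show ?thesis
  proof eventually_elim
    case (elim x)
    then have "summable (\<lambda>k. f (Suc k) x - f k x)" by (rule summable_norm_cancel)
    then have "convergent (\<lambda>n. \<Sum>k<n. f (Suc k) x - f k x)" by (simp add: summable_iff_convergent)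
    then have "convergent (\<lambda>n. f n x - f 0 x)" 
      unfolding sum_lessThan_telescope[of "\<lambda>k. f k x"] .
    then have "convergent (\<lambda>n. (f n x - f 0 x) + f 0 x)" by (intro convergent_add convergent_const)
    then show ?case by simp
  qed
qed

section \<open>The real inner product on square-integrable functions, completeness and weak
  compactness\<close>

definition square_integrable :: "'a measure \<Rightarrow> ('a \<Rightarrow> 'b::euclidean_space) \<Rightarrow> bool" where
  "square_integrable M f \<longleftrightarrow> f \<in> borel_measurable M \<and> integrable M (\<lambda>x. (norm (f x))\<^sup>2)"

text \<open>For complex values this is the real part of the Hermitian pairing. Imaginary parts are
  recovered later by a second test function multiplied by an imaginary unit.\<close>

definition ip :: "'a measure \<Rightarrow> ('a \<Rightarrow> 'b::euclidean_space) \<Rightarrow> ('a \<Rightarrow> 'b) \<Rightarrow> real" where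
  "ip M f g = (LINT x|M. f x \<bullet> g x)"

lemma square_integrable_measurable[measurable_dest]:
  "square_integrable M f \<Longrightarrow> f \<in> borel_measurable M"
  by (simp add: square_integrable_def)

lemma square_integrable_bound:
  assumes "square_integrable M f" "g \<in> borel_measurable M" "AE x in M. norm (g x) \<le> norm (f x)"
  shows "square_integrable M g"
  unfolding square_integrable_def
proof
  have [measurable]: "g \<in> borel_measurable M" by fact
  show "integrable M (\<lambda>x. (norm (g x))\<^sup>2)"
    by (rule Bochner_Integration.integrable_bound[of M "\<lambda>x. (norm (f x))\<^sup>2"])
       (use assms in \<open>auto simp: square_integrable_def elim!: eventually_mono intro!: power_mono\<close>)
qed fact

lemma square_integrable_iff_nn:
  "square_integrable M f \<longleftrightarrow> f \<in> borel_measurable M \<and> (\<integral>\<^sup>+x. ennreal ((norm (f x))\<^sup>2) \<partial>M) < \<infinity>"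
  unfolding square_integrable_def by (auto simp: integrable_iff_bounded)

lemma square_integrable_add:
  assumes "square_integrable M f" "square_integrable M g"
  shows "square_integrable M (\<lambda>x. f x + g x)"
  unfolding square_integrable_def
proof
  note [measurable] = assms[THEN square_integrable_measurable]
  show "(\<lambda>x. f x + g x) \<in> borel_measurable M" by measurable
  have i: "integrable M (\<lambda>x. 2 * (norm (f x))\<^sup>2 + 2 * (norm (g x))\<^sup>2)"
    using assms by (auto simp: square_integrable_def)
  have le: "(norm (u + v))\<^sup>2 \<le> 2 * (norm u)\<^sup>2 + 2 * (norm v)\<^sup>2" for u v :: 'b
  proof -
    have "(norm (u + v))\<^sup>2 \<le> (norm u + norm v)\<^sup>2" by (intro power_mono norm_triangle_ineq) auto
    also have "\<dots> \<le> 2 * (norm u)\<^sup>2 + 2 * (norm v)\<^sup>2"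
      using zero_le_power2[of "norm u - norm v"] by (simp add: power2_sum power2_diff)
    finally show ?thesis .
  qed
  show "integrable M (\<lambda>x. (norm (f x + g x))\<^sup>2)"
    by (rule Bochner_Integration.integrable_bound[OF i]) (auto intro!: AE_I2 order_trans[OF le])
qed

lemma square_integrable_scaleR:
  assumes "square_integrable M f"
  shows "square_integrable M (\<lambda>x. c *\<^sub>R f x)"
  using assms by (auto simp: square_integrable_def power_mult_distrib)

lemma square_integrable_diff:
  assumes "square_integrable M f" "square_integrable M g"
  shows "square_integrable M (\<lambda>x. f x - g x)"
  using square_integrable_add[OF assms(1) square_integrable_scaleR[OF assms(2), of "-1"]] by simp

lemma integrable_inner:
  assumes "square_integrable M f" "square_integrable M g"
  shows "integrable M (\<lambda>x. f x \<bullet> g x)"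
proof -
  note [measurable] = assms[THEN square_integrable_measurable]
  have i: "integrable M (\<lambda>x. (norm (f x))\<^sup>2 + (norm (g x))\<^sup>2)"
    using assms by (auto simp: square_integrable_def)
  have le: "\<bar>u \<bullet> v\<bar> \<le> (norm u)\<^sup>2 + (norm v)\<^sup>2" for u v :: 'b
  proof -
    have "\<bar>u \<bullet> v\<bar> \<le> norm u * norm v" by (rule Cauchy_Schwarz_ineq2)
    also have "\<dots> \<le> (norm u)\<^sup>2 + (norm v)\<^sup>2"
      using zero_le_power2[of "norm u - norm v"] zero_le_power2[of "norm u"] zero_le_power2[of "norm v"]
      unfolding power2_diff by linarith
    finally show ?thesis .
  qed
  show ?thesis
    by (rule Bochner_Integration.integrable_bound[OF i]) (auto intro!: AE_I2 order_trans[OF le])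
qed

lemma ip_commute: "ip M f g = ip M g f"
  by (simp add: ip_def inner_commute)

lemma ip_self: "ip M f f = (LINT x|M. (norm (f x))\<^sup>2)"
  by (simp add: ip_def power2_norm_eq_inner)

lemma ip_self_nonneg[simp]: "0 \<le> ip M f f"
  unfolding ip_self by simp

lemma nn_integral_norm_square:
  "square_integrable M f \<Longrightarrow> (\<integral>\<^sup>+x. ennreal ((norm (f x))\<^sup>2) \<partial>M) = ennreal (ip M f f)"
  unfolding ip_self by (intro nn_integral_eq_integral) (auto simp: square_integrable_def)

lemma ip_add_left:
  assumes "square_integrable M f" "square_integrable M g" "square_integrable M h"
  shows "ip M (\<lambda>x. f x + g x) h = ip M f h + ip M g h"
  unfolding ip_def using assms by (simp add: inner_add_left Bochner_Integration.integral_add integrable_inner)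

lemma ip_diff_left:
  assumes "square_integrable M f" "square_integrable M g" "square_integrable M h"
  shows "ip M (\<lambda>x. f x - g x) h = ip M f h - ip M g h"
  unfolding ip_def using assms by (simp add: inner_diff_left Bochner_Integration.integral_diff integrable_inner)

lemma ip_scaleR_left: "ip M (\<lambda>x. c *\<^sub>R f x) h = c * ip M f h"
  unfolding ip_def by simp

lemma ip_scaleR_right: "ip M h (\<lambda>x. c *\<^sub>R f x) = c * ip M h f"
  unfolding ip_def by simp

lemma ip_diff_right:
  assumes "square_integrable M f" "square_integrable M g" "square_integrable M h"
  shows "ip M h (\<lambda>x. f x - g x) = ip M h f - ip M h g"
  unfolding ip_commute[of M h] using assms by (rule ip_diff_left)

lemma ip_add_right:
  assumes "square_integrable M f" "square_integrable M g" "square_integrable M h"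
  shows "ip M h (\<lambda>x. f x + g x) = ip M h f + ip M h g"
  unfolding ip_commute[of M h] using assms by (rule ip_add_left)

lemma ip_diff_self:
  assumes "square_integrable M f" "square_integrable M g"
  shows "ip M (\<lambda>x. f x - g x) (\<lambda>x. f x - g x) = ip M f f - 2 * ip M f g + ip M g g"
proof -
  have d: "square_integrable M (\<lambda>x. f x - g x)" using assms by (rule square_integrable_diff)
  show ?thesis
    unfolding ip_diff_left[OF assms d] ip_diff_right[OF assms assms(1)] ip_diff_right[OF assms assms(2)]
    using ip_commute[of M f g] by simp
qed

lemma ip_add_self:
  assumes "square_integrable M f" "square_integrable M g"
  shows "ip M (\<lambda>x. f x + g x) (\<lambda>x. f x + g x) = ip M f f + 2 * ip M f g + ip M g g"
proof -
  have d: "square_integrable M (\<lambda>x. f x + g x)" using assms by (rule square_integrable_add)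
  show ?thesis
    unfolding ip_add_left[OF assms d] ip_add_right[OF assms assms(1)] ip_add_right[OF assms assms(2)]
    using ip_commute[of M f g] by simp
qed

text \<open>The squared norm of f - t g is a nonnegative quadratic in t; its value at the minimum, t
  = <f, g> / <g, g>, is the claim.\<close>

lemma ip_Cauchy_Schwarz:
  assumes f: "square_integrable M f" and g: "square_integrable M g"
  shows "\<bar>ip M f g\<bar> \<le> sqrt (ip M f f) * sqrt (ip M g g)"
proof -
  have q: "0 \<le> ip M f f - 2 * t * ip M f g + t\<^sup>2 * ip M g g" for t
  proof -
    have "ip M (\<lambda>x. f x - t *\<^sub>R g x) (\<lambda>x. f x - t *\<^sub>R g x) =
      ip M f f - 2 * ip M f (\<lambda>x. t *\<^sub>R g x) + ip M (\<lambda>x. t *\<^sub>R g x) (\<lambda>x. t *\<^sub>R g x)"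
      by (rule ip_diff_self[OF f square_integrable_scaleR[OF g]])
    moreover have "ip M f (\<lambda>x. t *\<^sub>R g x) = t * ip M f g"
      by (rule ip_scaleR_right)
    moreover have "ip M (\<lambda>x. t *\<^sub>R g x) (\<lambda>x. t *\<^sub>R g x) = t\<^sup>2 * ip M g g"
      by (simp add: ip_def power2_eq_square mult.assoc)
    ultimately show ?thesis using ip_self_nonneg[of M "\<lambda>x. f x - t *\<^sub>R g x"] by simp
  qed
  have "(ip M f g)\<^sup>2 \<le> ip M f f * ip M g g"
  proof (cases "ip M g g = 0")
    case True
    have "ip M f g = 0"
    proof (rule ccontr)
      assume n: "ip M f g \<noteq> 0"
      \<comment> \<open>If <g, g> = 0 the quadratic is affine in t, and this t makes it equal to
        -<f, f> - 2.\<close>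
      have "0 \<le> ip M f f - 2 * ((ip M f f + 1) / ip M f g) * ip M f g"
        using q[of "(ip M f f + 1) / ip M f g"] True by simp
      moreover have "2 * ((ip M f f + 1) / ip M f g) * ip M f g = 2 * (ip M f f + 1)" using n by simp
      ultimately have "0 \<le> ip M f f - 2 * (ip M f f + 1)" by simp
      moreover have "\<not> 0 \<le> I - 2 * (I + 1)" if "0 \<le> I" for I :: real
        using that by simp
      ultimately show False using ip_self_nonneg[of M f] by blast
    qed
    then show ?thesis by simp
  next
    case False
    then have pos: "0 < ip M g g" using ip_self_nonneg[of M g] by linarith
    have "0 \<le> ip M f f - 2 * (ip M f g / ip M g g) * ip M f g + (ip M f g / ip M g g)\<^sup>2 * ip M g g"
      by (rule q)
    also have "\<dots> = ip M f f - (ip M f g)\<^sup>2 / ip M g g"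
      using pos by (simp add: power2_eq_square field_simps)
    finally show ?thesis using pos by (simp add: field_simps)
  qed
  then have "sqrt ((ip M f g)\<^sup>2) \<le> sqrt (ip M f f * ip M g g)" by (rule real_sqrt_le_mono)
  then show ?thesis by (simp add: real_sqrt_mult)
qed

text \<open>The Riesz--Fischer argument: a subsequence with geometrically small increments converges
  almost everywhere, and Fatou's lemma along it bounds the distance of every late member of the
  whole sequence to the limit.\<close>

lemma square_integrable_complete:
  fixes c :: "nat \<Rightarrow> 'a \<Rightarrow> 'b::euclidean_space"
  assumes c: "\<And>m. square_integrable M (c m)"
    and cau: "\<And>e. 0 < e \<Longrightarrow> \<exists>N. \<forall>m\<ge>N. \<forall>n\<ge>N. ip M (\<lambda>x. c m x - c n x) (\<lambda>x. c m x - c n x) \<le> e"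
  obtains l where "square_integrable M l" "(\<lambda>m. ip M (\<lambda>x. c m x - l x) (\<lambda>x. c m x - l x)) \<longlonglongrightarrow> 0"
proof -
  note [measurable] = c[THEN square_integrable_measurable]
  have "\<forall>k. \<exists>N. \<forall>m\<ge>N. \<forall>n\<ge>N. ip M (\<lambda>x. c m x - c n x) (\<lambda>x. c m x - c n x) \<le> (1/2) ^ k"
    using cau by simp
  then obtain N where N: "\<And>k m n. N k \<le> m \<Longrightarrow> N k \<le> n \<Longrightarrow> ip M (\<lambda>x. c m x - c n x) (\<lambda>x. c m x - c n x) \<le> (1/2) ^ k"
    by metis
  \<comment> \<open>The sum dominates \<open>N k\<close> at both indices k and k + 1, as consecutive
    members have to be compared; the summand k makes r tend to infinity.\<close>
  define r where "r k = (\<Sum>i\<le>k. N i) + k" for k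
  have rN: "N k \<le> r k" "N k \<le> r (Suc k)" "k \<le> r k" for k
    using member_le_sum[of k "{..k}" N] by (auto simp: r_def)
  have nn: "(\<integral>\<^sup>+x. ennreal ((norm (c m x - c n x))\<^sup>2) \<partial>M) = ennreal (ip M (\<lambda>x. c m x - c n x) (\<lambda>x. c m x - c n x))" for m n
    using nn_integral_norm_square[OF square_integrable_diff[OF c c]] .
  have "AE x in M. convergent (\<lambda>k. c (r k) x)"
    by (rule AE_convergent_of_geometric_L2[of _ M 1 "1/2"]) (auto simp: nn intro!: ennreal_leI N rN)
  then have lim: "AE x in M. (\<lambda>k. c (r k) x) \<longlonglongrightarrow> lim (\<lambda>k. c (r k) x)"
    by (auto elim!: eventually_mono simp: convergent_LIMSEQ_iff)
  define l where "l x = lim (\<lambda>k. c (r k) x)" for x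
  have [measurable]: "l \<in> borel_measurable M"
    unfolding l_def by (intro borel_measurable_lim_metric) auto
  have fatou: "(\<integral>\<^sup>+x. ennreal ((norm (c m x - l x))\<^sup>2) \<partial>M) \<le> ennreal e"
    if e: "0 < e" and m: "\<And>n. K \<le> n \<Longrightarrow> ip M (\<lambda>x. c m x - c n x) (\<lambda>x. c m x - c n x) \<le> e" for m K e
  proof -
    have "AE x in M. ennreal ((norm (c m x - l x))\<^sup>2) = liminf (\<lambda>k. ennreal ((norm (c m x - c (r k) x))\<^sup>2))"
      using lim
    proof eventually_elim
      case (elim x)
      then have "(\<lambda>k. c (r k) x) \<longlonglongrightarrow> l x" by (simp add: l_def)
      then have "(\<lambda>k. ennreal ((norm (c m x - c (r k) x))\<^sup>2)) \<longlonglongrightarrow> ennreal ((norm (c m x - l x))\<^sup>2)"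
        by (intro tendsto_ennrealI tendsto_intros)
      then show ?case by (intro lim_imp_Liminf[symmetric]) auto
    qed
    then have "(\<integral>\<^sup>+x. ennreal ((norm (c m x - l x))\<^sup>2) \<partial>M) = (\<integral>\<^sup>+x. liminf (\<lambda>k. ennreal ((norm (c m x - c (r k) x))\<^sup>2)) \<partial>M)"
      by (rule nn_integral_cong_AE)
    also have "\<dots> \<le> liminf (\<lambda>k. \<integral>\<^sup>+x. ennreal ((norm (c m x - c (r k) x))\<^sup>2) \<partial>M)"
      by (intro nn_integral_liminf) auto
    also have "\<dots> \<le> ennreal e"
    proof -
      have ev: "eventually (\<lambda>k. (\<integral>\<^sup>+x. ennreal ((norm (c m x - c (r k) x))\<^sup>2) \<partial>M) \<le> ennreal e) sequentially"
        using eventually_ge_at_top[of K]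
      proof eventually_elim
        case (elim k)
        then have "K \<le> r k" using rN(3)[of k] by linarith
        then show ?case unfolding nn by (intro ennreal_leI m)
      qed
      have "liminf (\<lambda>k. \<integral>\<^sup>+x. ennreal ((norm (c m x - c (r k) x))\<^sup>2) \<partial>M) \<le> liminf (\<lambda>k. ennreal e)"
        by (rule Liminf_mono[OF ev])
      also have "\<dots> = ennreal e" by (simp add: Liminf_const)
      finally show ?thesis .
    qed
    finally show ?thesis .
  qed
  have dl: "square_integrable M (\<lambda>x. c (N 0) x - l x)"
    unfolding square_integrable_iff_nn
    using fatou[of 1 "N 0" "N 0"] N[of 0 "N 0"] by (auto intro: le_less_trans)
  have l: "square_integrable M l"
    using square_integrable_diff[OF c dl, of "N 0"] by simp
  moreover have "(\<lambda>m. ip M (\<lambda>x. c m x - l x) (\<lambda>x. c m x - l x)) \<longlonglongrightarrow> 0"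
  proof (rule LIMSEQ_I)
    fix e :: real assume e: "0 < e"
    obtain K where K: "\<forall>m\<ge>K. \<forall>n\<ge>K. ip M (\<lambda>x. c m x - c n x) (\<lambda>x. c m x - c n x) \<le> e / 2"
      using cau[of "e/2"] e by auto
    have "ip M (\<lambda>x. c m x - l x) (\<lambda>x. c m x - l x) \<le> e / 2" if "K \<le> m" for m
      using fatou[of "e/2" K m] K that e nn_integral_norm_square[OF square_integrable_diff[OF c l, of m]]
      by (auto simp: ennreal_le_iff)
    then show "\<exists>no. \<forall>n\<ge>no. norm (ip M (\<lambda>x. c n x - l x) (\<lambda>x. c n x - l x) - 0) < e"
      using e by (intro exI[of _ K]) (force intro: le_less_trans)
  qed
  ultimately show ?thesis by (rule that)
qed

text \<open>Weak limits are obtained without the Riesz representation theorem: elements of almost minimal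
  norm in the midpoint hulls of the tails form a Cauchy sequence.\<close>

inductive midpoint_hull :: "(nat \<Rightarrow> 'a \<Rightarrow> 'b::real_vector) \<Rightarrow> nat \<Rightarrow> ('a \<Rightarrow> 'b) \<Rightarrow> bool" for g m where
  base: "m \<le> j \<Longrightarrow> midpoint_hull g m (g j)"
| midpoint: "midpoint_hull g m f \<Longrightarrow> midpoint_hull g m f' \<Longrightarrow> midpoint_hull g m (\<lambda>x. (1/2) *\<^sub>R (f x + f' x))"

lemma midpoint_hull_square_integrable:
  assumes "\<And>j. square_integrable M (g j)" "midpoint_hull g m f"
  shows "square_integrable M f"
  using assms(2) by induction (auto intro: assms(1) square_integrable_add square_integrable_scaleR)

lemma midpoint_hull_antimono: "midpoint_hull g m f \<Longrightarrow> m' \<le> m \<Longrightarrow> midpoint_hull g m' f"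
  by (induction rule: midpoint_hull.induct) (auto intro: midpoint_hull.intros)

text \<open>An interval around a is stable under midpoints and the pairing is linear, so a bound on
  the generators extends to the hull.\<close>

lemma midpoint_hull_ip:
  assumes g: "\<And>j. square_integrable M (g j)" and phi: "square_integrable M \<phi>"
    and le: "\<And>j. m \<le> j \<Longrightarrow> \<bar>ip M (g j) \<phi> - a\<bar> \<le> e" and f: "midpoint_hull g m f"
  shows "\<bar>ip M f \<phi> - a\<bar> \<le> e"
  using f
proof induction
  case (base j)
  then show ?case by (rule le)
next
  case (midpoint f f')
  have "ip M (\<lambda>x. (1/2) *\<^sub>R (f x + f' x)) \<phi> = (1/2) * (ip M f \<phi> + ip M f' \<phi>)"
    unfolding ip_scaleR_left
    by (subst ip_add_left) (use midpoint g phi midpoint_hull_square_integrable[of M g] in auto)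
  then show ?case using midpoint.IH unfolding abs_le_iff by (auto simp: field_simps)
qed

text \<open>\<open>d m\<close> is the infimum of the squared norms over the hull of the tail from m.
  It increases with m and stays below B, hence is Cauchy, and this transfers to near-minimizers.
  Elements of late hulls pair with phi almost like late members of g, so the limit pairs to a
  whenever the pairings converge to a.\<close>

lemma midpoint_hull_limit:
  fixes g :: "nat \<Rightarrow> 'a \<Rightarrow> 'b::euclidean_space"
  assumes g: "\<And>j. square_integrable M (g j)" and B: "\<And>j. ip M (g j) (g j) \<le> B"
  obtains l where "square_integrable M l"
    "\<And>\<phi> a. square_integrable M \<phi> \<Longrightarrow> (\<lambda>j. ip M (g j) \<phi>) \<longlonglongrightarrow> a \<Longrightarrow> ip M l \<phi> = a"
proof -
  define H where "H m = {f. midpoint_hull g m f}" for m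
  define d where "d m = Inf ((\<lambda>f. ip M f f) ` H m)" for m
  have sq: "square_integrable M f" if "f \<in> H m" for f m
    using midpoint_hull_square_integrable[of M g, OF g] that unfolding H_def by blast
  have gH: "g m \<in> H m" for m by (auto simp: H_def intro: midpoint_hull.base)
  have bdd: "bdd_below ((\<lambda>f. ip M f f) ` H m)" for m by (rule bdd_belowI[of _ 0]) auto
  have d_le: "d m \<le> ip M f f" if "f \<in> H m" for f m
    unfolding d_def using that by (intro cInf_lower bdd) auto
  have HH: "H n \<subseteq> H m" if "m \<le> n" for m n
    using that midpoint_hull_antimono by (auto simp: H_def)
  have d_mono: "d m \<le> d n" if "m \<le> n" for m n
    unfolding d_def using HH[OF that] gH by (intro cInf_superset_mono bdd) auto
  have d_B: "d m \<le> B" for m using d_le[OF gH] B order_trans by blast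
  have "\<exists>f\<in>H m. ip M f f < d m + 1 / real (Suc m)" for m
  proof -
    have "Inf ((\<lambda>f. ip M f f) ` H m) < d m + 1 / real (Suc m)" unfolding d_def by simp
    then show ?thesis using gH[of m] bdd[of m] by (subst (asm) cInf_less_iff) auto
  qed
  then obtain c where cH: "\<And>m. c m \<in> H m" and c_less: "\<And>m. ip M (c m) (c m) < d m + 1 / real (Suc m)"
    by metis
  have c: "square_integrable M (c m)" for m using sq cH by blast
  \<comment> \<open>Parallelogram law. The midpoint of \<open>c m\<close> and \<open>c n\<close>
    lies in \<open>H m\<close>, so four times its squared norm is at least 4 \<open>d m\<close>,
    while the two squared norms exceed \<open>d m\<close> and \<open>d n\<close> by at most 1 / (m +
    1).\<close>
  have key: "ip M (\<lambda>x. c m x - c n x) (\<lambda>x. c m x - c n x) \<le> 2 * (d n - d m) + 4 / real (Suc m)" if mn: "m \<le> n" for m n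
  proof -
    have "(\<lambda>x. (1/2) *\<^sub>R (c m x + c n x)) \<in> H m"
      using cH[of m] cH[of n] HH[OF mn] unfolding H_def by (auto intro: midpoint_hull.midpoint)
    then have "d m \<le> ip M (\<lambda>x. (1/2) *\<^sub>R (c m x + c n x)) (\<lambda>x. (1/2) *\<^sub>R (c m x + c n x))" by (rule d_le)
    also have "\<dots> = (1/4) * ip M (\<lambda>x. c m x + c n x) (\<lambda>x. c m x + c n x)"
      unfolding ip_scaleR_left ip_scaleR_right by simp
    finally have "4 * d m \<le> ip M (c m) (c m) + 2 * ip M (c m) (c n) + ip M (c n) (c n)"
      unfolding ip_add_self[OF c c] by simp
    moreover have "1 / real (Suc n) \<le> 1 / real (Suc m)" using mn by (auto simp: field_simps)
    ultimately show ?thesis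
      unfolding ip_diff_self[OF c c] using c_less[of m] c_less[of n] by simp
  qed
  have cau: "\<exists>N. \<forall>m\<ge>N. \<forall>n\<ge>N. ip M (\<lambda>x. c m x - c n x) (\<lambda>x. c m x - c n x) \<le> e" if e: "0 < e" for e
  proof -
    have "convergent d"
      by (rule incseq_convergent[of d B]) (auto simp: incseq_def d_mono d_B convergent_def)
    then have "Cauchy d" by (rule convergent_Cauchy)
    then obtain N1 where N1: "\<And>m n. N1 \<le> m \<Longrightarrow> N1 \<le> n \<Longrightarrow> \<bar>d m - d n\<bar> < e / 4"
      using e unfolding Cauchy_def dist_real_def by (meson divide_pos_pos zero_less_numeral)
    obtain N2 where N2: "1 / real (Suc N2) < e / 8"
      using e reals_Archimedean[of "e/8"] by (auto simp: inverse_eq_divide)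
    have *: "ip M (\<lambda>x. c m x - c n x) (\<lambda>x. c m x - c n x) \<le> e"
      if "max N1 N2 \<le> m" "m \<le> n" for m n
    proof -
      have "1 / real (Suc m) \<le> 1 / real (Suc N2)" using that by (auto simp: field_simps)
      then have "4 / real (Suc m) \<le> e / 2" using N2 by simp
      moreover have "\<bar>d n - d m\<bar> < e / 4" by (rule N1) (use that in auto)
      then have "2 * (d n - d m) \<le> e / 2" by argo
      ultimately show ?thesis using key[OF that(2)] by linarith
    qed
    have sym: "ip M (\<lambda>x. c m x - c n x) (\<lambda>x. c m x - c n x) = ip M (\<lambda>x. c n x - c m x) (\<lambda>x. c n x - c m x)" for m n
      unfolding ip_self by (simp add: norm_minus_commute)
    show ?thesis
      using * sym by (intro exI[of _ "max N1 N2"]) (metis linear)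
  qed
  obtain l where l: "square_integrable M l" and lim: "(\<lambda>m. ip M (\<lambda>x. c m x - l x) (\<lambda>x. c m x - l x)) \<longlonglongrightarrow> 0"
    using square_integrable_complete[OF c cau] by blast
  have "ip M l \<phi> = a" if phi: "square_integrable M \<phi>" and conv: "(\<lambda>j. ip M (g j) \<phi>) \<longlonglongrightarrow> a" for \<phi> a
  proof -
    have 1: "(\<lambda>m. ip M (c m) \<phi>) \<longlonglongrightarrow> a"
    proof (rule LIMSEQ_I)
      fix e :: real assume e: "0 < e"
      obtain K where K: "\<And>j. K \<le> j \<Longrightarrow> \<bar>ip M (g j) \<phi> - a\<bar> < e / 2"
        using LIMSEQ_D[OF conv, of "e/2"] e by auto
      have "\<bar>ip M (c m) \<phi> - a\<bar> \<le> e / 2" if "K \<le> m" for m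
      proof (rule midpoint_hull_ip[OF g phi])
        show "\<And>j. m \<le> j \<Longrightarrow> \<bar>ip M (g j) \<phi> - a\<bar> \<le> e / 2" using K that by (meson order_trans less_imp_le)
        show "midpoint_hull g m (c m)" using cH by (simp add: H_def)
      qed
      then show "\<exists>no. \<forall>n\<ge>no. norm (ip M (c n) \<phi> - a) < e"
        using e by (intro exI[of _ K]) (force intro: le_less_trans)
    qed
    have 2: "(\<lambda>m. ip M (c m) \<phi> - ip M l \<phi>) \<longlonglongrightarrow> 0"
    proof (rule Lim_null_comparison)
      show "\<forall>\<^sub>F m in sequentially. norm (ip M (c m) \<phi> - ip M l \<phi>) \<le>
          sqrt (ip M (\<lambda>x. c m x - l x) (\<lambda>x. c m x - l x)) * sqrt (ip M \<phi> \<phi>)"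
        unfolding ip_diff_left[OF c l phi, symmetric] real_norm_def
        using ip_Cauchy_Schwarz[OF square_integrable_diff[OF c l] phi] by simp
      show "(\<lambda>m. sqrt (ip M (\<lambda>x. c m x - l x) (\<lambda>x. c m x - l x)) * sqrt (ip M \<phi> \<phi>)) \<longlonglongrightarrow> 0"
        using tendsto_mult_right[OF tendsto_real_sqrt[OF lim], of "sqrt (ip M \<phi> \<phi>)"] by simp
    qed
    have "(\<lambda>m. ip M (c m) \<phi> - (ip M (c m) \<phi> - ip M l \<phi>)) \<longlonglongrightarrow> a - 0"
      by (rule tendsto_diff[OF 1 2])
    then show ?thesis by (simp add: LIMSEQ_const_iff)
  qed
  with l show ?thesis by (rule that)
qed

text \<open>A diagonal subsequence makes the pairings with every g i converge. Should the pairings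
  with some phi fail to converge to <l, phi>, a further subsequence would have a hull limit l' with
  a different pairing; but psi = l' - l is orthogonal to all g i, hence to l and l', which are
  limits of pairings with these, and so psi = 0.\<close>

theorem square_integrable_weak_compactness:
  fixes g :: "nat \<Rightarrow> 'a \<Rightarrow> 'b::euclidean_space"
  assumes g: "\<And>j. square_integrable M (g j)" and B: "\<And>j. ip M (g j) (g j) \<le> B"
  obtains r l where "strict_mono (r :: nat \<Rightarrow> nat)" "square_integrable M l"
    "\<And>\<phi>. square_integrable M \<phi> \<Longrightarrow> (\<lambda>j. ip M (g (r j)) \<phi>) \<longlonglongrightarrow> ip M l \<phi>"
proof -
  have CS: "\<bar>ip M (g j) \<phi>\<bar> \<le> sqrt B * sqrt (ip M \<phi> \<phi>)" if "square_integrable M \<phi>" for j \<phi>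
    using ip_Cauchy_Schwarz[OF g that, of j] B[of j]
    by (meson order_trans mult_right_mono real_sqrt_le_mono real_sqrt_ge_zero ip_self_nonneg)
  have "B \<ge> 0" using B[of 0] ip_self_nonneg[of M "g 0"] by linarith
  have bnd: "norm (ip M (g n) (g i)) \<le> B" for n i
  proof -
    have "norm (ip M (g n) (g i)) \<le> sqrt B * sqrt (ip M (g i) (g i))" using CS[OF g] by simp
    also have "\<dots> \<le> sqrt B * sqrt B" using B \<open>B \<ge> 0\<close> by (intro mult_left_mono) auto
    finally show ?thesis using \<open>B \<ge> 0\<close> by simp
  qed
  obtain r where r: "strict_mono (r :: nat \<Rightarrow> nat)" and r_lim: "\<And>i. \<exists>L. (\<lambda>n. ip M (g (r n)) (g i)) \<longlonglongrightarrow> L"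
    using function_convergent_subsequence[of UNIV "\<lambda>n i. ip M (g n) (g i)" B] bnd by auto
  obtain l where l: "square_integrable M l"
    and l_lim: "\<And>\<phi> a. square_integrable M \<phi> \<Longrightarrow> (\<lambda>j. ip M (g (r j)) \<phi>) \<longlonglongrightarrow> a \<Longrightarrow> ip M l \<phi> = a"
    using midpoint_hull_limit[of M "\<lambda>j. g (r j)" B] g B by blast
  have gi: "(\<lambda>n. ip M (g (r n)) (g i)) \<longlonglongrightarrow> ip M l (g i)" for i
    using r_lim[of i] l_lim[OF g] by blast
  have "(\<lambda>j. ip M (g (r j)) \<phi>) \<longlonglongrightarrow> ip M l \<phi>" if phi: "square_integrable M \<phi>" for \<phi>
  proof (rule ccontr)
    assume "\<not> ?thesis"
    then obtain e where e: "0 < e" and ne: "\<forall>K. \<exists>j\<ge>K. e \<le> \<bar>ip M (g (r j)) \<phi> - ip M l \<phi>\<bar>"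
      unfolding LIMSEQ_iff by (auto simp: not_less)
    from ne have "infinite {j. e \<le> \<bar>ip M (g (r j)) \<phi> - ip M l \<phi>\<bar>}"
      unfolding infinite_nat_iff_unbounded_le by auto
    then obtain q where q: "strict_mono (q :: nat \<Rightarrow> nat)" and q_ge: "\<And>j. e \<le> \<bar>ip M (g (r (q j))) \<phi> - ip M l \<phi>\<bar>"
      using infinite_enumerate by blast
    obtain p where p: "strict_mono (p :: nat \<Rightarrow> nat)" and "\<exists>L. (\<lambda>n. ip M (g (r (q (p n)))) \<phi>) \<longlonglongrightarrow> L"
      using function_convergent_subsequence[of "{\<phi>}" "\<lambda>n \<phi>. ip M (g (r (q n))) \<phi>" "sqrt B * sqrt (ip M \<phi> \<phi>)"] CS[OF phi]
      by auto
    then obtain L where L: "(\<lambda>n. ip M (g (r (q (p n)))) \<phi>) \<longlonglongrightarrow> L" by blast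
    have "e \<le> \<bar>L - ip M l \<phi>\<bar>"
      by (rule LIMSEQ_le_const[OF tendsto_rabs[OF tendsto_diff[OF L tendsto_const]]]) (use q_ge in auto)
    obtain l' where l': "square_integrable M l'"
      and l'_lim: "\<And>\<phi> a. square_integrable M \<phi> \<Longrightarrow> (\<lambda>j. ip M (g (r (q (p j)))) \<phi>) \<longlonglongrightarrow> a \<Longrightarrow> ip M l' \<phi> = a"
      using midpoint_hull_limit[of M "\<lambda>j. g (r (q (p j)))" B] g B by blast
    have qp: "strict_mono (\<lambda>n. q (p n))" using q p by (simp add: strict_mono_def)
    define \<psi> where "\<psi> x = l' x - l x" for x
    have psi: "square_integrable M \<psi>" unfolding \<psi>_def by (rule square_integrable_diff[OF l' l])
    have g_psi: "ip M (g i) \<psi> = 0" for i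
    proof -
      have "(\<lambda>n. ip M (g (r (q (p n)))) (g i)) \<longlonglongrightarrow> ip M l (g i)"
        using LIMSEQ_subseq_LIMSEQ[OF gi qp] by (simp add: comp_def)
      then have "ip M l' (g i) = ip M l (g i)" by (rule l'_lim[OF g])
      then show ?thesis unfolding \<psi>_def by (subst ip_diff_right[OF l' l g]) (simp add: ip_commute[of M "g i"])
    qed
    have "ip M l \<psi> = 0" by (rule l_lim[OF psi]) (simp add: g_psi)
    moreover have "ip M l' \<psi> = 0" by (rule l'_lim[OF psi]) (simp add: g_psi)
    ultimately have "ip M \<psi> \<psi> = 0"
      using ip_diff_left[OF l' l psi] unfolding \<psi>_def[symmetric] by simp
    then have "ip M \<psi> \<phi> = 0" using ip_Cauchy_Schwarz[OF psi phi] by simp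
    then have "ip M l' \<phi> = ip M l \<phi>"
      using ip_diff_left[OF l' l phi] unfolding \<psi>_def[symmetric] by simp
    moreover have "ip M l' \<phi> = L" by (rule l'_lim[OF phi L])
    ultimately show False using \<open>e \<le> \<bar>L - ip M l \<phi>\<bar>\<close> e by simp
  qed
  with r l show ?thesis by (rule that)
qed

section \<open>Schwartz functions\<close>

lemma partial_derivI:
  assumes "\<And>x. (\<phi> has_derivative D x) (at x)"
  shows "partial_deriv i \<phi> = (\<lambda>x. D x (axis i 1))"
  unfolding partial_deriv_def using frechet_derivative_at[OF assms] by metis

text \<open>Schwartz functions form the largest class of differentiable, rapidly decreasing
  functions that is closed under partial derivatives. Membership is thus shown by exhibiting any
  such class, instead of computing iterated derivatives.\<close>

lemma schwartz_coinduct: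
  assumes "\<phi> \<in> S"
    and "\<And>\<psi> x. \<psi> \<in> S \<Longrightarrow> \<psi> differentiable (at x)"
    and "\<And>\<psi> N. \<psi> \<in> S \<Longrightarrow> bounded (range (\<lambda>x. (1 + norm x) ^ N *\<^sub>R \<psi> x))"
    and "\<And>\<psi> i. \<psi> \<in> S \<Longrightarrow> partial_deriv i \<psi> \<in> S"
  shows "\<phi> \<in> schwartz"
proof -
  have "foldr partial_deriv \<alpha> \<phi> \<in> S" for \<alpha>
    by (induction \<alpha>) (auto intro: assms)
  then show ?thesis unfolding schwartz_def using assms by blast
qed

lemma schwartz_differentiable: "\<phi> \<in> schwartz \<Longrightarrow> \<phi> differentiable (at x)"
  unfolding schwartz_def by (metis (mono_tags, lifting) foldr_Nil id_apply mem_Collect_eq)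

lemma schwartz_partial_deriv: "\<phi> \<in> schwartz \<Longrightarrow> partial_deriv i \<phi> \<in> schwartz"
  unfolding schwartz_def
proof (clarify, intro conjI allI)
  fix \<alpha> x N
  assume a: "\<forall>\<alpha>. (\<forall>x. foldr partial_deriv \<alpha> \<phi> differentiable (at x)) \<and>
     (\<forall>N::nat. bounded (range (\<lambda>x. (1 + norm x) ^ N *\<^sub>R foldr partial_deriv \<alpha> \<phi> x)))"
  have "foldr partial_deriv \<alpha> (partial_deriv i \<phi>) = foldr partial_deriv (\<alpha> @ [i]) \<phi>" by simp
  then show "foldr partial_deriv \<alpha> (partial_deriv i \<phi>) differentiable (at x)"
    and "bounded (range (\<lambda>x. (1 + norm x) ^ N *\<^sub>R foldr partial_deriv \<alpha> (partial_deriv i \<phi>) x))"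
    using a by metis+
qed

lemma schwartz_has_derivative:
  assumes "\<phi> \<in> schwartz"
  shows "(\<phi> has_derivative frechet_derivative \<phi> (at x)) (at x)"
  using schwartz_differentiable[OF assms] frechet_derivative_works by blast

lemma schwartz_continuous_on: "\<phi> \<in> schwartz \<Longrightarrow> continuous_on S \<phi>"
  by (meson continuous_at_imp_continuous_on differentiable_imp_continuous_within schwartz_differentiable)

lemma schwartz_measurable[measurable_dest]: "\<phi> \<in> schwartz \<Longrightarrow> \<phi> \<in> borel_measurable borel"
  by (intro borel_measurable_continuous_onI schwartz_continuous_on)

lemma schwartz_bound:
  assumes "\<phi> \<in> schwartz"
  obtains B where "0 < B" "\<And>x. norm (\<phi> x) \<le> B / (1 + norm x) ^ N"
proof -
  have "bounded (range (\<lambda>x. (1 + norm x) ^ N *\<^sub>R foldr partial_deriv [] \<phi> x))"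
    using assms unfolding schwartz_def by blast
  then obtain B where B: "0 < B" "\<And>x. norm ((1 + norm x) ^ N *\<^sub>R \<phi> x) \<le> B"
    unfolding bounded_pos by auto
  have "norm (\<phi> x) \<le> B / (1 + norm x) ^ N" for x
  proof -
    have p: "0 < (1 + norm x) ^ N" by (intro zero_less_power add_pos_nonneg) auto
    then show ?thesis using B(2)[of x] by (simp add: pos_le_divide_eq mult.commute)
  qed
  with B(1) show ?thesis by (rule that)
qed

lemma one_plus_norm_pos[simp]: "0 < 1 + norm x" "1 + norm x \<noteq> 0" "0 \<le> 1 + norm x"
  using norm_ge_zero[of x] by linarith+

text \<open>A Gaussian with a complex linear term in the exponent. With v = 0 it is, up to a
  constant, a translated Gaussian; with u = 0 it is a modulated one, whose transform is again a
  translated Gaussian.\<close>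

definition gauss_char :: "real \<Rightarrow> real ^ 'd::finite \<Rightarrow> real ^ 'd \<Rightarrow> real ^ 'd \<Rightarrow> complex" where
  "gauss_char c u v x = exp (of_real (- c * (x \<bullet> x) + x \<bullet> u) + \<i> * of_real (x \<bullet> v))"

text \<open>The polynomial multiples of one Gaussian. This class is closed under partial derivatives
  and serves as the invariant for \<open>schwartz_coinduct\<close>.\<close>

inductive_set gauss_poly :: "real \<Rightarrow> real ^ 'd::finite \<Rightarrow> real ^ 'd \<Rightarrow> (real ^ 'd \<Rightarrow> complex) set" for c u v where
  base: "gauss_char c u v \<in> gauss_poly c u v"
| coord: "f \<in> gauss_poly c u v \<Longrightarrow> (\<lambda>x. of_real (x $ i) * f x) \<in> gauss_poly c u v"
| scale: "f \<in> gauss_poly c u v \<Longrightarrow> (\<lambda>x. k * f x) \<in> gauss_poly c u v"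
| add: "f \<in> gauss_poly c u v \<Longrightarrow> g \<in> gauss_poly c u v \<Longrightarrow> (\<lambda>x. f x + g x) \<in> gauss_poly c u v"

lemma gauss_poly_derivative:
  fixes f :: "real ^ 'd::finite \<Rightarrow> complex"
  assumes "f \<in> gauss_poly c u v"
  shows "\<exists>D. (\<forall>x. (f has_derivative D x) (at x)) \<and> (\<forall>i. (\<lambda>x. D x (axis i 1)) \<in> gauss_poly c u v)"
  using assms
proof induction
  case base
  let ?D = "\<lambda>x h. (of_real (- c * (2 * (x \<bullet> h)) + h \<bullet> u) + \<i> * of_real (h \<bullet> v)) * gauss_char c u v x"
  have "(gauss_char c u v has_derivative ?D x) (at x)" for x
  proof -
    let ?g = "\<lambda>x. of_real (- c * (x \<bullet> x) + x \<bullet> u) + \<i> * of_real (x \<bullet> v) :: complex"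
    have 1: "((\<lambda>x. x \<bullet> x) has_derivative (\<lambda>h. 2 * (x \<bullet> h))) (at x)"
      by (rule has_derivative_eq_rhs[OF has_derivative_inner[OF has_derivative_ident has_derivative_ident]])
         (simp add: fun_eq_iff inner_commute)
    have g: "(?g has_derivative (\<lambda>h. of_real (- c * (2 * (x \<bullet> h)) + h \<bullet> u) + \<i> * of_real (h \<bullet> v))) (at x)"
      by (intro has_derivative_add has_derivative_of_real has_derivative_mult_right 1
          has_derivative_inner_left has_derivative_ident)
    have "(exp has_derivative (*) (exp (?g x))) (at (?g x))"
      using DERIV_exp[of "?g x"] unfolding has_field_derivative_def .
    from has_derivative_compose[OF g this] show ?thesis
      by (simp add: gauss_char_def[abs_def] mult.commute)
  qed
  moreover have "(\<lambda>x. ?D x (axis i 1)) \<in> gauss_poly c u v" for i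
  proof -
    have "(\<lambda>x. of_real (- 2 * c) * (of_real (x $ i) * gauss_char c u v x) + (of_real (u $ i) + \<i> * of_real (v $ i)) * gauss_char c u v x) \<in> gauss_poly c u v"
      by (intro gauss_poly.intros)
    also have "(\<lambda>x. of_real (- 2 * c) * (of_real (x $ i) * gauss_char c u v x) + (of_real (u $ i) + \<i> * of_real (v $ i)) * gauss_char c u v x) = (\<lambda>x. ?D x (axis i 1))"
      by (auto simp: fun_eq_iff inner_axis inner_axis' algebra_simps)
    finally show ?thesis .
  qed
  ultimately show ?case by (intro exI[of _ ?D]) auto
next
  case (coord f j)
  then obtain D where D: "\<And>x. (f has_derivative D x) (at x)" "\<And>i. (\<lambda>x. D x (axis i 1)) \<in> gauss_poly c u v" by blast
  let ?D = "\<lambda>x h. of_real (x $ j) * D x h + of_real (h $ j) * f x"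
  have "((\<lambda>x. of_real (x $ j)) has_derivative (\<lambda>h. of_real (h $ j) :: complex)) (at x)" for x :: "real ^ 'd"
    by (intro bounded_linear_imp_has_derivative bounded_linear_compose[OF bounded_linear_of_real bounded_linear_vec_nth])
  from has_derivative_mult[OF this D(1)]
  have "((\<lambda>x. of_real (x $ j) * f x) has_derivative ?D x) (at x)" for x .
  moreover have "(\<lambda>x. ?D x (axis i 1)) \<in> gauss_poly c u v" for i
    using coord.hyps D(2)[of i] by (intro gauss_poly.intros)
  ultimately show ?case by (intro exI[of _ ?D]) auto
next
  case (scale f k)
  then obtain D where D: "\<And>x. (f has_derivative D x) (at x)" "\<And>i. (\<lambda>x. D x (axis i 1)) \<in> gauss_poly c u v" by blast
  have "((\<lambda>x. k * f x) has_derivative (\<lambda>h. k * D x h)) (at x)" for x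
    by (rule has_derivative_mult_right[OF D(1)])
  moreover have "(\<lambda>x. k * D x (axis i 1)) \<in> gauss_poly c u v" for i
    using D(2)[of i] by (intro gauss_poly.intros)
  ultimately show ?case by (intro exI[of _ "\<lambda>x h. k * D x h"]) auto
next
  case (add f g)
  then obtain D D' where D: "\<And>x. (f has_derivative D x) (at x)" "\<And>i. (\<lambda>x. D x (axis i 1)) \<in> gauss_poly c u v"
    and D': "\<And>x. (g has_derivative D' x) (at x)" "\<And>i. (\<lambda>x. D' x (axis i 1)) \<in> gauss_poly c u v" by blast
  have "((\<lambda>x. f x + g x) has_derivative (\<lambda>h. D x h + D' x h)) (at x)" for x
    by (rule has_derivative_add[OF D(1) D'(1)])
  moreover have "(\<lambda>x. D x (axis i 1) + D' x (axis i 1)) \<in> gauss_poly c u v" for i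
    using D(2)[of i] D'(2)[of i] by (intro gauss_poly.intros)
  ultimately show ?case by (intro exI[of _ "\<lambda>x h. D x h + D' x h"]) auto
qed

lemma power_le_fact_exp:
  fixes y :: real
  assumes "0 \<le> y"
  shows "y ^ N \<le> fact N * exp y"
proof -
  have "y ^ N /\<^sub>R fact N \<le> (\<Sum>n. y ^ n /\<^sub>R fact n)"
    using sum_le_suminf[of "\<lambda>n. y ^ n /\<^sub>R fact n" "{N}"] summable_exp_generic[of y] assms by auto
  then have "y ^ N / fact N \<le> exp y" by (simp add: exp_def divide_inverse mult.commute)
  then show ?thesis by (simp add: field_simps)
qed

text \<open>N has to vary in the induction, since multiplication by a coordinate costs one power of
  1 + |x|.\<close>

lemma gauss_poly_bound:
  assumes c: "0 < c" and "f \<in> gauss_poly c u v"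
  shows "\<exists>B. \<forall>x. (1 + norm x) ^ N * norm (f x) \<le> B"
  using assms(2)
proof (induction arbitrary: N)
  case base
  have "(1 + norm x) ^ N * norm (gauss_char c u v x) \<le> fact N * exp (1 + (norm u + 1)\<^sup>2 / (4 * c))" for x
  proof -
    \<comment> \<open>The additional 1 absorbs exp |x|, the majorant of the polynomial weight;
      completing the square in -c |x|^2 + b |x| gives the constant b^2 / (4c).\<close>
    define b where "b = norm u + 1"
    have "- c * (x \<bullet> x) + x \<bullet> u \<le> - c * (norm x)\<^sup>2 + norm x * norm u"
      using Cauchy_Schwarz_ineq2[of x u] by (simp add: power2_norm_eq_inner)
    moreover have "- c * (norm x)\<^sup>2 + b * norm x \<le> b\<^sup>2 / (4 * c)"
      using c zero_le_power2[of "2 * c * norm x - b"] by (simp add: field_simps power2_eq_square)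
    ultimately have e: "1 + norm x + (- c * (x \<bullet> x) + x \<bullet> u) \<le> 1 + b\<^sup>2 / (4 * c)"
      unfolding b_def by (simp add: algebra_simps)
    have "(1 + norm x) ^ N * norm (gauss_char c u v x) \<le> (fact N * exp (1 + norm x)) * exp (- c * (x \<bullet> x) + x \<bullet> u)"
      unfolding gauss_char_def by (intro mult_mono power_le_fact_exp) auto
    also have "\<dots> = fact N * exp (1 + norm x + (- c * (x \<bullet> x) + x \<bullet> u))" by (simp add: exp_add)
    also have "\<dots> \<le> fact N * exp (1 + b\<^sup>2 / (4 * c))" using e by simp
    finally show ?thesis unfolding b_def .
  qed
  then show ?case by blast
next
  case (coord f i)
  from coord.IH[of "Suc N"] obtain B where B: "\<And>x. (1 + norm x) ^ Suc N * norm (f x) \<le> B" by blast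
  have "(1 + norm x) ^ N * norm (of_real (x $ i) * f x) \<le> B" for x
  proof -
    have "\<bar>x $ i\<bar> \<le> 1 + norm x" using component_le_norm_cart[of x i] by linarith
    then have "(1 + norm x) ^ N * norm (of_real (x $ i) * f x) \<le> (1 + norm x) ^ N * ((1 + norm x) * norm (f x))"
      by (auto simp: norm_mult intro!: mult_left_mono mult_right_mono)
    also have "\<dots> = (1 + norm x) ^ Suc N * norm (f x)" by simp
    finally show ?thesis using B[of x] by linarith
  qed
  then show ?case by blast
next
  case (scale f k)
  from scale.IH[of N] obtain B where B: "\<And>x. (1 + norm x) ^ N * norm (f x) \<le> B" by blast
  have "(1 + norm x) ^ N * norm (k * f x) \<le> norm k * B" for x
    using mult_left_mono[OF B[of x], of "norm k"] by (simp add: norm_mult mult_ac)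
  then show ?case by blast
next
  case (add f g)
  from add.IH[of N] obtain B B' where B: "\<And>x. (1 + norm x) ^ N * norm (f x) \<le> B"
     "\<And>x. (1 + norm x) ^ N * norm (g x) \<le> B'" by blast
  have "(1 + norm x) ^ N * norm (f x + g x) \<le> B + B'" for x
  proof -
    have "(1 + norm x) ^ N * norm (f x + g x) \<le> (1 + norm x) ^ N * (norm (f x) + norm (g x))"
      by (intro mult_left_mono norm_triangle_ineq) simp
    then show ?thesis using B(1)[of x] B(2)[of x] by (simp add: distrib_left)
  qed
  then show ?case by blast
qed

lemma gauss_char_schwartz:
  assumes c: "0 < c"
  shows "gauss_char c u v \<in> schwartz"
proof (rule schwartz_coinduct[of _ "gauss_poly c u v"])
  show "gauss_char c u v \<in> gauss_poly c u v" by (rule gauss_poly.base)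
  fix f assume f: "f \<in> gauss_poly c u v"
  obtain D where D: "\<And>x. (f has_derivative D x) (at x)" "\<And>i. (\<lambda>x. D x (axis i 1)) \<in> gauss_poly c u v"
    using gauss_poly_derivative[OF f] by blast
  show "f differentiable (at x)" for x using D(1) by (auto simp: differentiable_def)
  show "partial_deriv i f \<in> gauss_poly c u v" for i unfolding partial_derivI[OF D(1)] by (rule D(2))
  show "bounded (range (\<lambda>x. (1 + norm x) ^ N *\<^sub>R f x))" for N
    using gauss_poly_bound[OF c f, of N] unfolding bounded_iff by auto
qed

lemma schwartz_integrable:
  fixes \<phi> :: "real ^ 'd::finite \<Rightarrow> complex"
  assumes "\<phi> \<in> schwartz"
  shows "integrable lebesgue (\<lambda>x. (1 + norm x) ^ N *\<^sub>R \<phi> x)"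
proof -
  obtain B where B: "0 < B" "\<And>x. norm (\<phi> x) \<le> B / (1 + norm x) ^ (N + 2 * CARD('d))"
    using schwartz_bound[OF assms] by metis
  have i: "integrable lebesgue (\<lambda>x::real ^ 'd. B * (1 / (1 + norm x) ^ (2 * CARD('d))))"
    by (intro integrable_mult_right integrable_inverse_1_plus_norm_power) simp
  show ?thesis
  proof (rule Bochner_Integration.integrable_bound[OF i])
    show "(\<lambda>x. (1 + norm x) ^ N *\<^sub>R \<phi> x) \<in> borel_measurable lebesgue"
      using schwartz_measurable[OF assms] by (intro measurable_completion) measurable
    show "AE x in lebesgue. norm ((1 + norm x) ^ N *\<^sub>R \<phi> x) \<le> norm (B * (1 / (1 + norm x) ^ (2 * CARD('d))))"
    proof (rule AE_I2)
      fix x :: "real ^ 'd"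
      have "norm ((1 + norm x) ^ N *\<^sub>R \<phi> x) \<le> (1 + norm x) ^ N * (B / (1 + norm x) ^ (N + 2 * CARD('d)))"
        using mult_left_mono[OF B(2)[of x], of "(1 + norm x) ^ N"] by simp
      also have "\<dots> = B * (1 / (1 + norm x) ^ (2 * CARD('d)))" by (simp add: power_add)
      finally show "norm ((1 + norm x) ^ N *\<^sub>R \<phi> x) \<le> norm (B * (1 / (1 + norm x) ^ (2 * CARD('d))))"
        using B(1) by simp
    qed
  qed
qed

lemma gaussian_eq_gauss_char:
  fixes x y :: "real ^ 'd::finite"
  assumes e: "0 < e"
  shows "of_real (exp (- (norm (x - y))\<^sup>2 / (2 * e\<^sup>2))) =
    of_real (exp (- (norm y)\<^sup>2 / (2 * e\<^sup>2))) * gauss_char (1 / (2 * e\<^sup>2)) (y /\<^sub>R e\<^sup>2) 0 x"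
proof -
  have "- (norm (x - y))\<^sup>2 / (2 * e\<^sup>2) = - (norm y)\<^sup>2 / (2 * e\<^sup>2) + (- (1 / (2 * e\<^sup>2)) * (x \<bullet> x) + x \<bullet> (y /\<^sub>R e\<^sup>2))"
    using e unfolding power2_norm_eq_inner by (simp add: inner_diff_left inner_diff_right inner_commute field_simps)
  then have "exp (- (norm (x - y))\<^sup>2 / (2 * e\<^sup>2)) = exp (- (norm y)\<^sup>2 / (2 * e\<^sup>2)) * exp (- (1 / (2 * e\<^sup>2)) * (x \<bullet> x) + x \<bullet> (y /\<^sub>R e\<^sup>2))"
    by (simp only: exp_add)
  then show ?thesis
    by (simp only: gauss_char_def exp_of_real[symmetric] of_real_mult) (simp add: exp_of_real)
qed

lemma gaussian_translate_schwartz: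
  assumes e: "0 < e"
  shows "(\<lambda>x. of_real (exp (- (norm (x - y))\<^sup>2 / (2 * e\<^sup>2))) :: complex) \<in> (schwartz :: (real ^ 'd::finite \<Rightarrow> complex) set)"
proof (rule schwartz_coinduct[of _ "gauss_poly (1 / (2 * e\<^sup>2)) (y /\<^sub>R e\<^sup>2) 0"])
  let ?S = "gauss_poly (1 / (2 * e\<^sup>2)) (y /\<^sub>R e\<^sup>2) 0"
  show "(\<lambda>x. of_real (exp (- (norm (x - y))\<^sup>2 / (2 * e\<^sup>2))) :: complex) \<in> ?S"
    unfolding gaussian_eq_gauss_char[OF e] by (intro gauss_poly.intros)
  fix f assume f: "f \<in> ?S"
  obtain D where D: "\<And>x. (f has_derivative D x) (at x)" "\<And>i. (\<lambda>x. D x (axis i 1)) \<in> ?S"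
    using gauss_poly_derivative[OF f] by blast
  show "f differentiable (at x)" for x using D(1) by (auto simp: differentiable_def)
  show "partial_deriv i f \<in> ?S" for i unfolding partial_derivI[OF D(1)] by (rule D(2))
  show "bounded (range (\<lambda>x. (1 + norm x) ^ N *\<^sub>R f x))" for N
    using gauss_poly_bound[OF _ f, of N] e unfolding bounded_iff by auto
qed

text \<open>Translated Gaussians are therefore transforms of Schwartz functions up to a factor,
  which makes them available as test functions on both sides of the Fourier transform.\<close>

lemma schwartz_fourier_gauss_char:
  fixes y \<xi> :: "real ^ 'd::finite"
  assumes e: "0 < e"
  shows "schwartz_fourier (gauss_char (e\<^sup>2 / 2) 0 y) \<xi> = of_real ((1 / e) ^ CARD('d) * exp (- (norm (\<xi> - y))\<^sup>2 / (2 * e\<^sup>2)))"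
proof -
  have eq: "exp (- \<i> * of_real (x \<bullet> \<xi>)) * gauss_char (e\<^sup>2 / 2) 0 y x =
      exp (\<i> * of_real (x \<bullet> (y - \<xi>))) * of_real (exp (- (e * norm x)\<^sup>2 / 2))" for x
    by (simp add: gauss_char_def exp_add[symmetric] exp_of_real[symmetric] inner_diff_right power_mult_distrib
        power2_norm_eq_inner algebra_simps)
  have "(LINT x|lebesgue. exp (- \<i> * of_real (x \<bullet> \<xi>)) * gauss_char (e\<^sup>2 / 2) 0 y x) =
     of_real ((sqrt (2 * pi) / e) ^ CARD('d) * exp (- (norm (y - \<xi>))\<^sup>2 / (2 * e\<^sup>2)))"
    unfolding eq using has_bochner_integral_gaussian[OF e, of "y - \<xi>"]
    by (subst integral_completion) (auto simp: has_bochner_integral_iff)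
  moreover have "(2 * pi) powr (- (real CARD('d) / 2)) * (sqrt (2 * pi) / e) ^ CARD('d) = (1 / e) ^ CARD('d)"
  proof -
    have "sqrt (2 * pi) ^ CARD('d) = (2 * pi) powr (real CARD('d) / 2)"
      by (simp add: powr_half_sqrt[symmetric] powr_realpow[symmetric] powr_powr)
    then show ?thesis by (simp add: power_divide powr_minus)
  qed
  ultimately show ?thesis
    unfolding schwartz_fourier_def by (metis (no_types, lifting) mult.assoc norm_minus_commute of_real_mult)
qed

text \<open>Fubini's theorem is applied below on products of \<open>lborel\<close>, so Lebesgue
  measurable functions are first replaced by Borel functions equal to them almost
  everywhere.\<close>

lemma lebesgue_borel_version:
  fixes f :: "'a::euclidean_space \<Rightarrow> complex"
  assumes f: "f \<in> borel_measurable lebesgue"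
  obtains f' where "f' \<in> borel_measurable borel" "AE x in lebesgue. f x = f' x"
proof -
  have "(\<lambda>x. Re (f x)) \<in> borel_measurable lebesgue" "(\<lambda>x. Im (f x)) \<in> borel_measurable lebesgue"
    using f by measurable
  then obtain a b where ab: "a \<in> borel_measurable lborel" "AE x in lborel. Re (f x) = a x"
     "b \<in> borel_measurable lborel" "AE x in lborel. Im (f x) = b x"
    using completion_ex_borel_measurable_real by metis
  have "(\<lambda>x. Complex (a x) (b x)) \<in> borel_measurable borel"
    using ab by (simp add: complex_eq[unfolded complex.sel] Complex_eq)
  moreover have "AE x in lborel. f x = Complex (a x) (b x)"
    using ab(2,4) by eventually_elim (simp add: complex_eq_iff)
  then have "AE x in lebesgue. f x = Complex (a x) (b x)" by (rule AE_completion)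
  ultimately show ?thesis by (rule that)
qed

section \<open>Gaussian averages separate tempered functions\<close>

lemma integrable_gaussian_weight:
  "integrable lborel (\<lambda>z::real ^ 'd::finite. (1 + norm z) ^ N * exp (- (norm z)\<^sup>2 / 2))"
proof -
  have "integrable lebesgue (\<lambda>x::real ^ 'd. norm ((1 + norm x) ^ N *\<^sub>R gauss_char (1/2) 0 0 x))"
    by (intro integrable_norm schwartz_integrable gauss_char_schwartz) simp
  moreover have "norm ((1 + norm x) ^ N *\<^sub>R gauss_char (1/2) 0 0 x) = (1 + norm x) ^ N * exp (- (norm x)\<^sup>2 / 2)" for x :: "real ^ 'd"
    by (simp add: gauss_char_def power2_norm_eq_inner)
  ultimately show ?thesis by (subst (asm) integrable_completion) auto
qed

lemma has_bochner_integral_gaussian_real: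
  assumes e: "0 < e"
  shows "has_bochner_integral lborel (\<lambda>x::'a::euclidean_space. exp (- (e * norm x)\<^sup>2 / 2)) ((sqrt (2 * pi) / e) ^ DIM('a))"
proof -
  have "has_bochner_integral lborel (\<lambda>x::'a. Re (exp (\<i> * of_real (x \<bullet> 0)) * of_real (exp (- (e * norm x)\<^sup>2 / 2))))
    (Re (of_real ((sqrt (2 * pi) / e) ^ DIM('a) * exp (- (norm (0::'a))\<^sup>2 / (2 * e\<^sup>2)))))"
    by (rule has_bochner_integral_bounded_linear[OF bounded_linear_Re has_bochner_integral_gaussian[OF e]])
  then show ?thesis by simp
qed

text \<open>Off the frontier the indicator is eventually constant along x + e n z for every z, so
  dominated convergence applies.\<close>

lemma gaussian_average_box_tendsto:
  fixes x a b :: "real ^ 'd::finite"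
  assumes x: "x \<notin> frontier (box a b)" and e: "e \<longlonglongrightarrow> 0"
  shows "(\<lambda>n. LINT z|lborel. indicator (box a b) (x + e n *\<^sub>R z) * exp (- (norm z)\<^sup>2 / 2)) \<longlonglongrightarrow>
    indicator (box a b) x * sqrt (2 * pi) ^ CARD('d)"
proof -
  let ?E = "\<lambda>z::real ^ 'd. exp (- (norm z)\<^sup>2 / 2)"
  have i: "integrable lborel ?E" "(LINT z|lborel. ?E z) = sqrt (2 * pi) ^ CARD('d)"
    using has_bochner_integral_gaussian_real[where 'a="real ^ 'd", of 1] by (auto simp: has_bochner_integral_iff)
  have "(\<lambda>n. LINT z|lborel. indicator (box a b) (x + e n *\<^sub>R z) * ?E z) \<longlonglongrightarrow> (LINT z|lborel. indicator (box a b) x * ?E z)"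
  proof (rule integral_dominated_convergence[where w="?E"])
    show "AE z in lborel. (\<lambda>n. indicator (box a b) (x + e n *\<^sub>R z) * ?E z) \<longlonglongrightarrow> indicator (box a b) x * ?E z"
    proof (rule AE_I2)
      fix z :: "real ^ 'd"
      have l: "(\<lambda>n. x + e n *\<^sub>R z) \<longlonglongrightarrow> x"
        using tendsto_add[OF tendsto_const tendsto_scaleR[OF e tendsto_const], of x z] by simp
      have "\<forall>\<^sub>F n in sequentially. indicator (box a b) (x + e n *\<^sub>R z) = (indicator (box a b) x :: real)"
      proof (cases "x \<in> box a b")
        case True
        then show ?thesis
          using topological_tendstoD[OF l open_box, of a b] by (auto elim: eventually_mono)
      next
        case False
        then have xn: "x \<in> - closure (box a b)"
          using x interior_subset[of "box a b"] by (auto simp: frontier_def)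
        have "\<forall>\<^sub>F n in sequentially. x + e n *\<^sub>R z \<in> - closure (box a b)"
          by (rule topological_tendstoD[OF l _ xn]) auto
        then show ?thesis
          using False closure_subset[of "box a b"] by (auto elim!: eventually_mono simp: indicator_def)
      qed
      then show "(\<lambda>n. indicator (box a b) (x + e n *\<^sub>R z) * ?E z) \<longlonglongrightarrow> indicator (box a b) x * ?E z"
        by (intro tendsto_mult tendsto_const tendsto_eventually)
    qed
  qed (use i in \<open>auto simp: indicator_def\<close>)
  then show ?thesis using i by simp
qed

text \<open>If x + e z lies in the box and e <= 1, then 1 + |x| <= (1 + R) (1 + |z|); decay in x is
  thus paid for by the Gaussian in z. Uniformity in e supplies the dominating function for tempered
  f.\<close>

lemma gaussian_average_box_bound:
  fixes a b :: "real ^ 'd::finite"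
  obtains C where "\<And>x e. 0 < e \<Longrightarrow> e \<le> 1 \<Longrightarrow>
    (LINT z|lborel. indicator (box a b) (x + e *\<^sub>R z) * exp (- (norm z)\<^sup>2 / 2)) \<le> C / (1 + norm x) ^ N"
proof -
  let ?E = "\<lambda>z::real ^ 'd. exp (- (norm z)\<^sup>2 / 2)"
  obtain R where R: "0 < R" "\<And>y. y \<in> box a b \<Longrightarrow> norm y \<le> R"
    using bounded_box[of a b] unfolding bounded_pos by auto
  have iE: "integrable lborel ?E"
    using has_bochner_integral_gaussian_real[where 'a="real ^ 'd", of 1] by (auto simp: has_bochner_integral_iff)
  let ?W = "\<lambda>z::real ^ 'd. (1 + norm z) ^ N * ?E z"
  have "(LINT z|lborel. indicator (box a b) (x + e *\<^sub>R z) * ?E z) \<le> (1 + R) ^ N * (LINT z|lborel. ?W z) / (1 + norm x) ^ N"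
    if e: "0 < e" "e \<le> 1" for x e
  proof -
    have "(LINT z|lborel. indicator (box a b) (x + e *\<^sub>R z) * ?E z) \<le> (LINT z|lborel. ((1 + R) ^ N / (1 + norm x) ^ N) * ?W z)"
    proof (rule integral_mono)
      show "integrable lborel (\<lambda>z. indicator (box a b) (x + e *\<^sub>R z) * ?E z)"
        by (rule Bochner_Integration.integrable_bound[OF iE]) (auto simp: indicator_def)
      show "integrable lborel (\<lambda>z. ((1 + R) ^ N / (1 + norm x) ^ N) * ?W z)"
        by (intro integrable_mult_right integrable_gaussian_weight)
      fix z :: "real ^ 'd"
      show "indicator (box a b) (x + e *\<^sub>R z) * ?E z \<le> ((1 + R) ^ N / (1 + norm x) ^ N) * ?W z"
      proof (cases "x + e *\<^sub>R z \<in> box a b")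
        case True
        have "norm x \<le> norm (x + e *\<^sub>R z) + norm (e *\<^sub>R z)"
          using norm_triangle_ineq4[of "x + e *\<^sub>R z" "e *\<^sub>R z"] by simp
        also have "\<dots> \<le> R + norm z"
          using R(2)[OF True] e mult_left_le_one_le[of "norm z" e] by (intro add_mono) auto
        finally have "1 + norm x \<le> (1 + R) * (1 + norm z)"
          using R(1) by (simp add: algebra_simps) (smt (verit) mult_nonneg_nonneg norm_ge_zero)
        then have "(1 + norm x) ^ N \<le> (1 + R) ^ N * (1 + norm z) ^ N"
          unfolding power_mult_distrib[symmetric] by (intro power_mono) auto
        then have "1 \<le> ((1 + R) ^ N / (1 + norm x) ^ N) * (1 + norm z) ^ N"
          by (simp only: times_divide_eq_left pos_le_divide_eq zero_less_power one_plus_norm_pos mult_1)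
        from mult_right_mono[OF this, of "?E z"] show ?thesis using True by (simp add: mult.assoc)
      qed (use R in auto)
    qed
    then show ?thesis by simp
  qed
  then show ?thesis by (rule that)
qed

text \<open>Integrating the tests over centres y in a box replaces the Gaussian by a smoothed
  indicator of the box. As the width tends to 0, the integral of f over every box vanishes; boxes
  form an intersection-stable generator of the Borel sets.\<close>

lemma zero_of_gaussian_tests_borel:
  fixes f :: "real ^ 'd::finite \<Rightarrow> complex"
  assumes f[measurable]: "f \<in> borel_measurable borel"
    and fN: "integrable lborel (\<lambda>x. f x /\<^sub>R (1 + norm x) ^ N)"
    and test: "\<And>y e. 0 < e \<Longrightarrow> (LINT x|lborel. f x * of_real (exp (- (norm (x - y))\<^sup>2 / (2 * e\<^sup>2)))) = 0"
  shows "AE x in lborel. f x = 0"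
proof -
  \<comment> \<open>The smoothed indicator after the substitution y = x + e z, which keeps the
    Gaussian weight independent of e.\<close>
  define \<Psi> where "\<Psi> a b e x = (LINT z|lborel. indicator (box a b) (x + e *\<^sub>R z) * exp (- (norm z)\<^sup>2 / 2))" for a b x :: "real ^ 'd" and e :: real
  have Psi_meas[measurable]: "\<Psi> a b e \<in> borel_measurable borel" for a b e
    unfolding \<Psi>_def by measurable
  have Psi_bound: "\<exists>C. \<forall>x e. 0 < e \<longrightarrow> e \<le> 1 \<longrightarrow> \<Psi> a b e x \<le> C / (1 + norm x) ^ N" for a b
    unfolding \<Psi>_def by (rule gaussian_average_box_bound[of a b N]) blast
  have Psi_nonneg: "0 \<le> \<Psi> a b e x" for a b e x
    unfolding \<Psi>_def by (intro integral_nonneg_AE) auto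
  have Psi_eq: "(LINT y|lborel. indicator (box a b) y * exp (- (norm (x - y))\<^sup>2 / (2 * e\<^sup>2))) = e ^ CARD('d) * \<Psi> a b e x"
    if e: "0 < e" for a b x e
  proof -
    have 1: "(\<lambda>y. indicator (box a b) y * exp (- (norm (x - y))\<^sup>2 / (2 * e\<^sup>2))) \<in> borel_measurable lborel" by measurable
    have "(LINT y|lborel. indicator (box a b) y * exp (- (norm (x - y))\<^sup>2 / (2 * e\<^sup>2))) =
      (LINT y|lebesgue. indicator (box a b) y * exp (- (norm (x - y))\<^sup>2 / (2 * e\<^sup>2)))"
      using integral_completion[OF 1] by simp
    also have "\<dots> = \<bar>e\<bar> ^ DIM(real ^ 'd) *\<^sub>R (LINT z|lebesgue. indicator (box a b) (x + e *\<^sub>R z) * exp (- (norm (x - (x + e *\<^sub>R z)))\<^sup>2 / (2 * e\<^sup>2)))"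
      using e by (intro integral_affine_lebesgue(1) measurable_completion 1) auto
    also have "(\<lambda>z. indicator (box a b) (x + e *\<^sub>R z) * exp (- (norm (x - (x + e *\<^sub>R z)))\<^sup>2 / (2 * e\<^sup>2))) =
       (\<lambda>z. indicator (box a b) (x + e *\<^sub>R z) * exp (- (norm z)\<^sup>2 / 2))"
      using e by (simp add: power_mult_distrib)
    also have "(LINT z|lebesgue. indicator (box a b) (x + e *\<^sub>R z) * exp (- (norm z)\<^sup>2 / 2)) = \<Psi> a b e x"
      unfolding \<Psi>_def by (intro integral_completion) measurable
    finally show ?thesis using e by simp
  qed
  \<comment> \<open>Fubini: with y innermost the double integral is a multiple of the one claimed,
    with x innermost it vanishes by the hypothesis on Gaussian tests.\<close>
  have fPsi: "(LINT x|lborel. f x * of_real (\<Psi> a b e x)) = 0" if e: "0 < e" "e \<le> 1" for a b e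
  proof -
    let ?E = "\<lambda>x y. exp (- (norm (x - y))\<^sup>2 / (2 * e\<^sup>2))"
    let ?F = "\<lambda>x y. f x * of_real (indicator (box a b) y * ?E x y) :: complex"
    obtain C where C: "\<And>x. \<Psi> a b e x \<le> C / (1 + norm x) ^ N"
      using Psi_bound[of a b] e by blast
    have int_y: "integrable lborel (\<lambda>y. indicator (box a b) y * ?E x y)" for x
    proof (rule Bochner_Integration.integrable_bound[of _ "indicator (box a b) :: _ \<Rightarrow> real"])
      show "integrable lborel (indicator (box a b) :: _ \<Rightarrow> real)"
        using emeasure_bounded_finite[OF bounded_box, of a b] by (intro integrable_real_indicator) auto
      show "AE y in lborel. norm (indicator (box a b) y * ?E x y) \<le> norm (indicator (box a b) y :: real)"
        by (rule AE_I2) (simp split: split_indicator)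
    qed measurable
    have "integrable (lborel \<Otimes>\<^sub>M lborel) (case_prod ?F)"
    proof (rule lborel_pair.Fubini_integrable)
      show "case_prod ?F \<in> borel_measurable (lborel \<Otimes>\<^sub>M lborel)" by measurable
      have eq: "(LINT y|lborel. norm (case_prod ?F (x, y))) = norm (f x) * (e ^ CARD('d) * \<Psi> a b e x)" for x
        using Psi_eq[OF e(1), of a b x] by (simp add: norm_mult abs_mult)
      have "integrable lborel (\<lambda>x. norm (f x) * (e ^ CARD('d) * \<Psi> a b e x))"
      proof (rule Bochner_Integration.integrable_bound)
        show "integrable lborel (\<lambda>x. e ^ CARD('d) * C *\<^sub>R (f x /\<^sub>R (1 + norm x) ^ N))"
          by (intro integrable_mult_right integrable_scaleR_right fN)
        show "AE x in lborel. norm (norm (f x) * (e ^ CARD('d) * \<Psi> a b e x)) \<le> norm (e ^ CARD('d) * C *\<^sub>R (f x /\<^sub>R (1 + norm x) ^ N))"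
        proof (rule AE_I2)
          fix x :: "real ^ 'd"
          have "\<Psi> a b e x \<le> \<bar>C\<bar> / (1 + norm x) ^ N"
            using C[of x] by (rule order_trans) (auto intro!: divide_right_mono)
          then have "norm (f x) * (e ^ CARD('d) * \<Psi> a b e x) \<le> norm (f x) * (e ^ CARD('d) * (\<bar>C\<bar> / (1 + norm x) ^ N))"
            using e by (intro mult_left_mono) auto
          then show "norm (norm (f x) * (e ^ CARD('d) * \<Psi> a b e x)) \<le> norm (e ^ CARD('d) * C *\<^sub>R (f x /\<^sub>R (1 + norm x) ^ N))"
            using e Psi_nonneg[of a b e x] by (simp add: norm_mult divide_inverse mult_ac norm_power abs_mult)
        qed
      qed measurable
      then show "integrable lborel (\<lambda>x. LINT y|lborel. norm (case_prod ?F (x, y)))" unfolding eq .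
      show "AE x in lborel. integrable lborel (\<lambda>y. case_prod ?F (x, y))"
        using integrable_of_real[OF int_y] by (auto intro!: AE_I2 integrable_mult_right)
    qed
    from lborel_pair.Fubini_integral[OF this]
    have F1: "(LINT y|lborel. LINT x|lborel. ?F x y) = (LINT x|lborel. LINT y|lborel. ?F x y)" .
    have F2: "(LINT x|lborel. ?F x y) = 0" for y
    proof -
      have "(LINT x|lborel. ?F x y) = of_real (indicator (box a b) y) * (LINT x|lborel. f x * of_real (?E x y))"
        by (subst integral_mult_right_zero[symmetric]) (simp add: mult_ac)
      then show ?thesis using test[OF e(1), of y] by simp
    qed
    have F3: "(LINT y|lborel. ?F x y) = of_real (e ^ CARD('d)) * (f x * of_real (\<Psi> a b e x))" for x
    proof -
      have "(LINT y|lborel. ?F x y) = f x * of_real (LINT y|lborel. indicator (box a b) y * ?E x y)"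
        by (subst integral_mult_right_zero, subst integral_complex_of_real) simp
      then show ?thesis unfolding Psi_eq[OF e(1)] by simp
    qed
    have "of_real (e ^ CARD('d)) * (LINT x|lborel. f x * of_real (\<Psi> a b e x)) = (LINT x|lborel. LINT y|lborel. ?F x y)"
      unfolding F3 by (rule integral_mult_right_zero[symmetric])
    also have "\<dots> = 0" unfolding F1[symmetric] F2 by simp
    finally show ?thesis using e by simp
  qed
  have box0: "(LINT x|lborel. f x * of_real (indicator (box a b) x)) = 0" for a b
  proof -
    define ee where "ee n = 1 / real (Suc n)" for n
    have ee: "ee \<longlonglongrightarrow> 0" "\<And>n. 0 < ee n" "\<And>n. ee n \<le> 1"
      unfolding ee_def using LIMSEQ_inverse_real_of_nat by (auto simp: inverse_eq_divide)
    obtain C where C: "\<And>x e. 0 < e \<Longrightarrow> e \<le> 1 \<Longrightarrow> \<Psi> a b e x \<le> C / (1 + norm x) ^ N"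
      using Psi_bound[of a b] by blast
    have "(\<lambda>n. LINT x|lborel. f x * of_real (\<Psi> a b (ee n) x)) \<longlonglongrightarrow>
      (LINT x|lborel. f x * of_real (indicator (box a b) x * sqrt (2 * pi) ^ CARD('d)))"
    proof (rule integral_dominated_convergence[where w="\<lambda>x. norm (C *\<^sub>R (f x /\<^sub>R (1 + norm x) ^ N))"])
      show "integrable lborel (\<lambda>x. norm (C *\<^sub>R (f x /\<^sub>R (1 + norm x) ^ N)))"
        using fN by (intro integrable_norm integrable_scaleR_right)
      have "AE x in lborel. x \<notin> frontier (box a b)"
      proof -
        have "negligible (frontier (box a b))" by (rule negligible_convex_frontier[OF convex_box(2)])
        then have "frontier (box a b) \<in> null_sets lebesgue" by (simp add: negligible_iff_null_sets)
        then have "frontier (box a b) \<in> null_sets lborel"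
          by (simp add: null_sets_completion_iff frontier_closed borel_closed)
        then show ?thesis by (rule AE_not_in)
      qed
      then show "AE x in lborel. (\<lambda>n. f x * of_real (\<Psi> a b (ee n) x)) \<longlonglongrightarrow> f x * of_real (indicator (box a b) x * sqrt (2 * pi) ^ CARD('d))"
      proof eventually_elim
        case (elim x)
        then show ?case unfolding \<Psi>_def by (intro tendsto_intros gaussian_average_box_tendsto ee)
      qed
      show "AE x in lborel. norm (f x * of_real (\<Psi> a b (ee n) x)) \<le> norm (C *\<^sub>R (f x /\<^sub>R (1 + norm x) ^ N))" for n
      proof (rule AE_I2)
        fix x :: "real ^ 'd"
        have "\<Psi> a b (ee n) x \<le> \<bar>C\<bar> / (1 + norm x) ^ N"
          using C[OF ee(2,3), of n x] by (rule order_trans) (auto intro!: divide_right_mono)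
        then have "norm (f x) * \<Psi> a b (ee n) x \<le> norm (f x) * (\<bar>C\<bar> / (1 + norm x) ^ N)"
          by (intro mult_left_mono) auto
        then show "norm (f x * of_real (\<Psi> a b (ee n) x)) \<le> norm (C *\<^sub>R (f x /\<^sub>R (1 + norm x) ^ N))"
          using Psi_nonneg[of a b "ee n" x] by (simp add: norm_mult divide_inverse mult_ac norm_power abs_mult)
      qed
    qed measurable
    then have "(LINT x|lborel. f x * of_real (indicator (box a b) x * sqrt (2 * pi) ^ CARD('d))) = 0"
      using fPsi[OF ee(2,3)] by (simp add: LIMSEQ_const_iff)
    moreover have "(LINT x|lborel. f x * of_real (indicator (box a b) x * sqrt (2 * pi) ^ CARD('d))) =
       (LINT x|lborel. f x * of_real (indicator (box a b) x)) * of_real (sqrt (2 * pi) ^ CARD('d))"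
      by (subst integral_mult_left_zero[symmetric]) (simp add: mult_ac)
    ultimately show ?thesis by simp
  qed
  \<comment> \<open>Cutting off to a bounded box makes f integrable, so that complements and
    countable unions can be treated in the sigma-algebra induction.\<close>
  define Q where "Q n = box (- (real n *\<^sub>R One)) (real n *\<^sub>R One :: real ^ 'd)" for n
  have int_Q: "integrable lborel (\<lambda>x. f x * of_real (indicator (Q n) x))" for n
  proof -
    obtain R where R: "0 < R" "\<And>y. y \<in> Q n \<Longrightarrow> norm y \<le> R"
      using bounded_box unfolding bounded_pos Q_def by metis
    show ?thesis
    proof (rule Bochner_Integration.integrable_bound)
      show "integrable lborel (\<lambda>x. (1 + R) ^ N *\<^sub>R (f x /\<^sub>R (1 + norm x) ^ N))"
        by (intro integrable_scaleR_right fN)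
      show "AE x in lborel. norm (f x * of_real (indicator (Q n) x)) \<le> norm ((1 + R) ^ N *\<^sub>R (f x /\<^sub>R (1 + norm x) ^ N))"
      proof (rule AE_I2)
        fix x
        show "norm (f x * of_real (indicator (Q n) x)) \<le> norm ((1 + R) ^ N *\<^sub>R (f x /\<^sub>R (1 + norm x) ^ N))"
        proof (cases "x \<in> Q n")
          case True
          then have "(1 + norm x) ^ N \<le> (1 + R) ^ N" using R(2) by (intro power_mono) auto
          then have "norm (f x) * (1 + norm x) ^ N \<le> norm (f x) * (1 + R) ^ N" by (intro mult_left_mono) auto
          then have "norm (f x) \<le> norm (f x) * (1 + R) ^ N / (1 + norm x) ^ N" by (simp add: pos_le_divide_eq)
          then show ?thesis using True R(1) by (simp add: divide_inverse norm_power mult_ac abs_mult)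
        qed simp
      qed
    qed (simp add: Q_def)
  qed
  have "(LINT x|lborel. indicator A x *\<^sub>R (f x * of_real (indicator (Q n) x))) = 0" if A: "A \<in> sets borel" for A n
  proof -
    let ?G = "range (\<lambda>(a, b). box a b :: (real ^ 'd) set)"
    let ?g = "\<lambda>x. f x * of_real (indicator (Q n) x)"
    have borel: "borel = sigma UNIV ?G" by (rule borel_eq_box)
    have sets: "sets borel = sigma_sets UNIV ?G" unfolding borel by simp
    have A': "A \<in> sigma_sets UNIV ?G" using A sets by simp
    have st: "Int_stable ?G" by (auto simp: Int_stable_def box_Int_box)
    have gi: "integrable lborel (\<lambda>x. indicator B x *\<^sub>R ?g x)" if "B \<in> sets borel" for B
      using integrable_mult_indicator[of B lborel ?g] int_Q that by simp
    show ?thesis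
    proof (induction rule: sigma_sets_induct_disjoint[OF st _ A'])
      case 1 then show ?case by auto
    next
      case (2 B)
      then obtain a b where B: "B = box a b" by auto
      obtain a' b' where "box a b \<inter> Q n = box a' b'" unfolding Q_def box_Int_box by blast
      then have "indicator B x *\<^sub>R ?g x = f x * of_real (indicator (box a' b') x)" for x
        unfolding B by (auto simp: indicator_def set_eq_iff)
      then show ?case using box0 by simp
    next
      case 3 then show ?case by simp
    next
      case (4 B)
      then have B: "B \<in> sets borel" using sets by simp
      have "(LINT x|lborel. indicator (UNIV - B) x *\<^sub>R ?g x) = (LINT x|lborel. ?g x - indicator B x *\<^sub>R ?g x)"
        by (intro Bochner_Integration.integral_cong) (auto simp: indicator_def)
      also have "\<dots> = (LINT x|lborel. ?g x) - (LINT x|lborel. indicator B x *\<^sub>R ?g x)"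
        by (rule Bochner_Integration.integral_diff[OF int_Q gi[OF B]])
      also have "(LINT x|lborel. ?g x) = 0" unfolding Q_def by (rule box0)
      finally show ?case using 4 by simp
    next
      case (5 B)
      have Bs: "\<And>i. B i \<in> sets lborel" using 5 sets by auto
      have "(LINT x:(\<Union>i. B i)|lborel. ?g x) = (\<Sum>i. (LINT x:(B i)|lborel. ?g x))"
      proof (rule lebesgue_integral_countable_add)
        show "set_integrable lborel (\<Union>i. B i) ?g"
          unfolding set_integrable_def using Bs by (intro gi) auto
      qed (use 5 Bs in \<open>auto simp: disjoint_family_on_def\<close>)
      then show ?case using 5 by (simp add: set_lebesgue_integral_def)
    qed
  qed
  then have "AE x in lborel. f x * of_real (indicator (Q n) x) = 0" for n
    by (intro sigma_finite_measure.density_zero[OF sigma_finite_lborel] int_Q) (auto simp: set_lebesgue_integral_def)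
  then have "AE x in lborel. \<forall>n. f x * of_real (indicator (Q n) x) = 0"
    unfolding AE_all_countable by blast
  then show ?thesis
  proof eventually_elim
    case (elim x)
    have "(\<Union>n. Q n) = UNIV" unfolding Q_def by (rule UN_box_eq_UNIV)
    then obtain n where "x \<in> Q n" by auto
    then show ?case using elim[rule_format, of n] by simp
  qed
qed

lemma zero_of_gaussian_tests:
  fixes f :: "real ^ 'd::finite \<Rightarrow> complex"
  assumes f: "tempered f"
    and test: "\<And>y e. 0 < e \<Longrightarrow> (LINT x|lebesgue. f x * of_real (exp (- (norm (x - y))\<^sup>2 / (2 * e\<^sup>2)))) = 0"
  shows "AE x in lebesgue. f x = 0"
proof -
  obtain N where fN: "integrable lebesgue (\<lambda>x. f x /\<^sub>R (1 + norm x) ^ N)" using f unfolding tempered_def by blast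
  have "(\<lambda>x::real ^ 'd. (1 + norm x) ^ N) \<in> borel_measurable lebesgue"
    by (rule measurable_completion) measurable
  from borel_measurable_scaleR[OF this borel_measurable_integrable[OF fN]]
  have "(\<lambda>x. (1 + norm x) ^ N *\<^sub>R (f x /\<^sub>R (1 + norm x) ^ N)) \<in> borel_measurable lebesgue" .
  then have "f \<in> borel_measurable lebesgue" by simp
  then obtain f' where f'[measurable]: "f' \<in> borel_measurable borel" and ff': "AE x in lebesgue. f x = f' x"
    by (rule lebesgue_borel_version)
  have "integrable lebesgue (\<lambda>x. f' x /\<^sub>R (1 + norm x) ^ N)"
    by (rule integrable_cong_AE_imp[OF fN]) (use ff' in \<open>auto elim!: eventually_mono intro!: measurable_completion[of _ lborel]\<close>)
  then have 1: "integrable lborel (\<lambda>x. f' x /\<^sub>R (1 + norm x) ^ N)"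
    by (subst (asm) integrable_completion) auto
  have 2: "(LINT x|lborel. f' x * of_real (exp (- (norm (x - y))\<^sup>2 / (2 * e\<^sup>2)))) = 0" if "0 < e" for y e
  proof -
    have m: "(\<lambda>x. f' x * of_real (exp (- (norm (x - y))\<^sup>2 / (2 * e\<^sup>2)))) \<in> borel_measurable lborel" by measurable
    have "(LINT x|lborel. f' x * of_real (exp (- (norm (x - y))\<^sup>2 / (2 * e\<^sup>2)))) =
      (LINT x|lebesgue. f' x * of_real (exp (- (norm (x - y))\<^sup>2 / (2 * e\<^sup>2))))"
      using integral_completion[OF m] by simp
    also have "\<dots> = (LINT x|lebesgue. f x * of_real (exp (- (norm (x - y))\<^sup>2 / (2 * e\<^sup>2))))"
    proof (rule integral_cong_AE)
      show "(\<lambda>x. f' x * of_real (exp (- (norm (x - y))\<^sup>2 / (2 * e\<^sup>2)))) \<in> borel_measurable lebesgue"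
        using m by (rule measurable_completion)
      show "(\<lambda>x. f x * of_real (exp (- (norm (x - y))\<^sup>2 / (2 * e\<^sup>2)))) \<in> borel_measurable lebesgue"
        by (intro borel_measurable_times \<open>f \<in> borel_measurable lebesgue\<close> measurable_completion[of _ lborel]) measurable
    qed (use ff' in \<open>auto elim!: eventually_mono\<close>)
    finally show ?thesis using test[OF that] by simp
  qed
  have "AE x in lborel. f' x = 0" by (rule zero_of_gaussian_tests_borel[OF f' 1 2])
  then have "AE x in lebesgue. f' x = 0" by (rule AE_completion)
  with ff' show ?thesis by eventually_elim simp
qed

section \<open>Fourier transforms of Schwartz functions: derivatives, decay and inversion\<close>

lemma schwartz_add:
  assumes "\<phi> \<in> schwartz" "\<psi> \<in> schwartz"
  shows "(\<lambda>x. \<phi> x + \<psi> x) \<in> schwartz"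
proof (rule schwartz_coinduct[of _ "{\<lambda>x. \<phi> x + \<psi> x |\<phi> \<psi>. \<phi> \<in> schwartz \<and> \<psi> \<in> schwartz}"])
  show "(\<lambda>x. \<phi> x + \<psi> x) \<in> {\<lambda>x. \<phi> x + \<psi> x |\<phi> \<psi>. \<phi> \<in> schwartz \<and> \<psi> \<in> schwartz}" using assms by blast
  fix f assume "f \<in> {\<lambda>x. \<phi> x + \<psi> x |\<phi> \<psi>. \<phi> \<in> schwartz \<and> \<psi> \<in> schwartz}"
  then obtain \<phi> \<psi> where f: "f = (\<lambda>x. \<phi> x + \<psi> x)" and s: "\<phi> \<in> schwartz" "\<psi> \<in> schwartz" by blast
  have D: "(f has_derivative (\<lambda>h. frechet_derivative \<phi> (at x) h + frechet_derivative \<psi> (at x) h)) (at x)" for x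
    unfolding f by (intro has_derivative_add schwartz_has_derivative s)
  then show "f differentiable (at x)" for x by (auto simp: differentiable_def)
  have "partial_deriv i f = (\<lambda>x. partial_deriv i \<phi> x + partial_deriv i \<psi> x)" for i
    unfolding partial_derivI[OF D] by (simp add: partial_deriv_def)
  then show "partial_deriv i f \<in> {\<lambda>x. \<phi> x + \<psi> x |\<phi> \<psi>. \<phi> \<in> schwartz \<and> \<psi> \<in> schwartz}" for i
    using s schwartz_partial_deriv by blast
  fix N
  obtain B1 where B1: "\<And>x. norm (\<phi> x) \<le> B1 / (1 + norm x) ^ N" using schwartz_bound[OF s(1)] by metis
  obtain B2 where B2: "\<And>x. norm (\<psi> x) \<le> B2 / (1 + norm x) ^ N" using schwartz_bound[OF s(2)] by metis
  have "norm ((1 + norm x) ^ N *\<^sub>R f x) \<le> B1 + B2" for x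
  proof -
    have "norm (f x) \<le> (B1 + B2) / (1 + norm x) ^ N"
      unfolding f add_divide_distrib by (rule order_trans[OF norm_triangle_ineq add_mono[OF B1 B2]])
    then show ?thesis by (simp add: pos_le_divide_eq mult.commute)
  qed
  then show "bounded (range (\<lambda>x. (1 + norm x) ^ N *\<^sub>R f x))" unfolding bounded_iff by blast
qed

lemma schwartz_cmult:
  assumes "\<phi> \<in> schwartz"
  shows "(\<lambda>x. k * \<phi> x) \<in> schwartz"
proof (rule schwartz_coinduct[of _ "{\<lambda>x. k * \<phi> x |\<phi>. \<phi> \<in> schwartz}"])
  show "(\<lambda>x. k * \<phi> x) \<in> {\<lambda>x. k * \<phi> x |\<phi>. \<phi> \<in> schwartz}" using assms by blast
  fix f assume "f \<in> {\<lambda>x. k * \<phi> x |\<phi>. \<phi> \<in> schwartz}"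
  then obtain \<phi> where f: "f = (\<lambda>x. k * \<phi> x)" and s: "\<phi> \<in> schwartz" by blast
  have D: "(f has_derivative (\<lambda>h. k * frechet_derivative \<phi> (at x) h)) (at x)" for x
    unfolding f by (intro has_derivative_mult_right schwartz_has_derivative s)
  then show "f differentiable (at x)" for x by (auto simp: differentiable_def)
  have "partial_deriv i f = (\<lambda>x. k * partial_deriv i \<phi> x)" for i
    unfolding partial_derivI[OF D] by (simp add: partial_deriv_def)
  then show "partial_deriv i f \<in> {\<lambda>x. k * \<phi> x |\<phi>. \<phi> \<in> schwartz}" for i
    using s schwartz_partial_deriv by blast
  fix N
  obtain B1 where B1: "\<And>x. norm (\<phi> x) \<le> B1 / (1 + norm x) ^ N" using schwartz_bound[OF s(1)] by metis
  have "norm ((1 + norm x) ^ N *\<^sub>R f x) \<le> norm k * B1" for x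
  proof -
    have "(1 + norm x) ^ N * norm (\<phi> x) \<le> B1" using B1[of x] by (simp add: pos_le_divide_eq mult.commute)
    from mult_left_mono[OF this, of "norm k"] show ?thesis unfolding f by (simp add: norm_mult mult_ac)
  qed
  then show "bounded (range (\<lambda>x. (1 + norm x) ^ N *\<^sub>R f x))" unfolding bounded_iff by blast
qed

lemma schwartz_modulation_derivative:
  fixes \<phi> :: "real ^ 'd::finite \<Rightarrow> complex"
  assumes s: "\<phi> \<in> schwartz"
  shows "((\<lambda>x. exp (- \<i> * of_real (x \<bullet> \<xi>)) * \<phi> x) has_derivative
      (\<lambda>h. exp (- \<i> * of_real (x \<bullet> \<xi>)) * (frechet_derivative \<phi> (at x) h - \<i> * of_real (h \<bullet> \<xi>) * \<phi> x))) (at x)"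
proof -
  have g: "((\<lambda>x. - \<i> * of_real (x \<bullet> \<xi>)) has_derivative (\<lambda>h. - \<i> * of_real (h \<bullet> \<xi>))) (at x)"
    by (intro has_derivative_mult_right has_derivative_of_real has_derivative_inner_left has_derivative_ident)
  have "(exp has_derivative (*) (exp (- \<i> * of_real (x \<bullet> \<xi>)))) (at (- \<i> * of_real (x \<bullet> \<xi>)))"
    using DERIV_exp[of "- \<i> * of_real (x \<bullet> \<xi>) :: complex"] unfolding has_field_derivative_def .
  from has_derivative_mult[OF has_derivative_compose[OF g this] schwartz_has_derivative[OF s]]
  show ?thesis by (rule has_derivative_eq_rhs) (simp add: fun_eq_iff algebra_simps)
qed

lemma schwartz_modulation:
  fixes \<phi> :: "real ^ 'd::finite \<Rightarrow> complex"
  assumes "\<phi> \<in> schwartz"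
  shows "(\<lambda>x. exp (- \<i> * of_real (x \<bullet> \<xi>)) * \<phi> x) \<in> schwartz"
proof (rule schwartz_coinduct[of _ "{\<lambda>x. exp (- \<i> * of_real (x \<bullet> \<xi>)) * \<phi> x |\<phi>. \<phi> \<in> schwartz}"])
  let ?S = "{\<lambda>x. exp (- \<i> * of_real (x \<bullet> \<xi>)) * \<phi> x |\<phi>. \<phi> \<in> schwartz}"
  show "(\<lambda>x. exp (- \<i> * of_real (x \<bullet> \<xi>)) * \<phi> x) \<in> ?S" using assms by blast
  fix f assume "f \<in> ?S"
  then obtain \<phi> where f: "f = (\<lambda>x. exp (- \<i> * of_real (x \<bullet> \<xi>)) * \<phi> x)" and s: "\<phi> \<in> schwartz" by blast
  note D = schwartz_modulation_derivative[OF s, of \<xi>]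
  then show "f differentiable (at x)" for x unfolding f by (auto simp: differentiable_def)
  show "partial_deriv i f \<in> ?S" for i
  proof -
    have eq: "partial_deriv i f = (\<lambda>x. exp (- \<i> * of_real (x \<bullet> \<xi>)) * (partial_deriv i \<phi> x + (- \<i> * of_real (\<xi> $ i)) * \<phi> x))"
      unfolding f partial_derivI[OF D] by (simp add: partial_deriv_def inner_axis inner_axis' fun_eq_iff)
    have "(\<lambda>x. partial_deriv i \<phi> x + (- \<i> * of_real (\<xi> $ i)) * \<phi> x) \<in> schwartz"
      by (intro schwartz_add schwartz_cmult schwartz_partial_deriv s)
    then show ?thesis unfolding eq
      by (intro CollectI exI[of _ "\<lambda>x. partial_deriv i \<phi> x + (- \<i> * of_real (\<xi> $ i)) * \<phi> x"] conjI refl)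
  qed
  fix N
  obtain B1 where B1: "\<And>x. norm (\<phi> x) \<le> B1 / (1 + norm x) ^ N" using schwartz_bound[OF s] by metis
  have "norm ((1 + norm x) ^ N *\<^sub>R f x) \<le> B1" for x
    using B1[of x] unfolding f by (simp add: norm_mult pos_le_divide_eq mult.commute)
  then show "bounded (range (\<lambda>x. (1 + norm x) ^ N *\<^sub>R f x))" unfolding bounded_iff by blast
qed

text \<open>Difference quotients integrate to 0 by translation invariance, and the mean value
  inequality dominates them by an integrable weight, so their limit integrates to 0 as well.\<close>

lemma integral_partial_deriv_schwartz:
  fixes \<phi> :: "real ^ 'd::finite \<Rightarrow> complex"
  assumes s: "\<phi> \<in> schwartz"
  shows "(LINT x|lebesgue. partial_deriv i \<phi> x) = 0"
proof -
  define e where "e = (axis i 1 :: real ^ 'd)"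
  have ne: "norm e = 1" by (simp add: e_def)
  define t where "t n = 1 / real (Suc n)" for n
  have t: "t \<longlonglongrightarrow> 0" "\<And>n. 0 < t n" "\<And>n. t n \<le> 1"
    unfolding t_def using LIMSEQ_inverse_real_of_nat by (auto simp: inverse_eq_divide)
  define s_n where "s_n n x = (\<phi> (x + t n *\<^sub>R e) - \<phi> x) /\<^sub>R t n" for n x
  have iphi: "integrable lebesgue \<phi>" using schwartz_integrable[OF s, of 0] by simp
  have mphi: "\<phi> \<in> borel_measurable lebesgue" using iphi by simp
  have it: "integrable lebesgue (\<lambda>x. \<phi> (y + 1 *\<^sub>R x))" "(LINT x|lebesgue. \<phi> (y + 1 *\<^sub>R x)) = (LINT x|lebesgue. \<phi> x)" for y
    using integral_affine_lebesgue[of 1 \<phi> y] iphi mphi by auto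
  have s0: "(LINT x|lebesgue. s_n n x) = 0" for n
    unfolding s_n_def using it[of "t n *\<^sub>R e"] iphi by (simp add: Bochner_Integration.integral_diff add.commute)
  let ?M = "2 * CARD('d)"
  obtain B where B: "0 < B" "\<And>x. norm (partial_deriv i \<phi> x) \<le> B / (1 + norm x) ^ ?M"
    using schwartz_bound[OF schwartz_partial_deriv[OF s]] by metis
  have "(\<lambda>n. LINT x|lebesgue. s_n n x) \<longlonglongrightarrow> (LINT x|lebesgue. partial_deriv i \<phi> x)"
  \<comment> \<open>The factor 2^M comes from 1 + |x| <= 2 (1 + |x + tau e|) for 0 <= tau <= 1,
    which moves the decay from an intermediate point back to x.\<close>
  proof (rule integral_dominated_convergence[where w="\<lambda>x. B * 2 ^ ?M * (1 / (1 + norm x) ^ ?M)"])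
    show "partial_deriv i \<phi> \<in> borel_measurable lebesgue"
      using schwartz_integrable[OF schwartz_partial_deriv[OF s], of 0] by auto
    show "s_n n \<in> borel_measurable lebesgue" for n
      unfolding s_n_def using it[of "t n *\<^sub>R e"] mphi by (auto simp: add.commute)
    show "integrable lebesgue (\<lambda>x::real ^ 'd. B * 2 ^ ?M * (1 / (1 + norm x) ^ ?M))"
      by (intro integrable_mult_right integrable_inverse_1_plus_norm_power) simp
    show "AE x in lebesgue. (\<lambda>n. s_n n x) \<longlonglongrightarrow> partial_deriv i \<phi> x"
    proof (rule AE_I2)
      fix x
      let ?D = "frechet_derivative \<phi> (at x)"
      have lin: "bounded_linear ?D" and l: "((\<lambda>h. norm (\<phi> (x + h) - \<phi> x - ?D h) / norm h) \<longlongrightarrow> 0) (at 0)"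
        using schwartz_has_derivative[OF s, of x] unfolding has_derivative_at by auto
      have fl: "filterlim (\<lambda>n. t n *\<^sub>R e) (at 0) sequentially"
        unfolding filterlim_at using t(2) ne tendsto_scaleR[OF t(1) tendsto_const, of e]
        by (auto simp: less_imp_neq[THEN not_sym])
      have "(\<lambda>n. norm (\<phi> (x + t n *\<^sub>R e) - \<phi> x - ?D (t n *\<^sub>R e)) / norm (t n *\<^sub>R e)) \<longlonglongrightarrow> 0"
        using filterlim_compose[OF l fl] .
      also have "(\<lambda>n. norm (\<phi> (x + t n *\<^sub>R e) - \<phi> x - ?D (t n *\<^sub>R e)) / norm (t n *\<^sub>R e)) = (\<lambda>n. norm (s_n n x - partial_deriv i \<phi> x))"
      proof
        fix n
        have "\<phi> (x + t n *\<^sub>R e) - \<phi> x - ?D (t n *\<^sub>R e) = t n *\<^sub>R (s_n n x - partial_deriv i \<phi> x)"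
          unfolding s_n_def partial_deriv_def e_def[symmetric] linear_scale[OF bounded_linear.linear[OF lin]]
          using t(2)[of n] by (simp add: scaleR_diff_right)
        then show "norm (\<phi> (x + t n *\<^sub>R e) - \<phi> x - ?D (t n *\<^sub>R e)) / norm (t n *\<^sub>R e) = norm (s_n n x - partial_deriv i \<phi> x)"
          using t(2)[of n] ne by simp
      qed
      finally show "(\<lambda>n. s_n n x) \<longlonglongrightarrow> partial_deriv i \<phi> x"
        by (subst LIM_zero_iff[symmetric], subst tendsto_norm_zero_iff[symmetric])
    qed
    show "AE x in lebesgue. norm (s_n n x) \<le> B * 2 ^ ?M * (1 / (1 + norm x) ^ ?M)" for n
    proof (rule AE_I2)
      fix x :: "real ^ 'd"
      let ?K = "B * 2 ^ ?M * (1 / (1 + norm x) ^ ?M)"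
      let ?g = "\<lambda>\<tau>::real. \<phi> (x + \<tau> *\<^sub>R e)"
      have gd: "(?g has_derivative (\<lambda>h. h *\<^sub>R partial_deriv i \<phi> (x + \<tau> *\<^sub>R e))) (at \<tau> within {0..t n})" for \<tau>
      proof -
        have lin: "bounded_linear (frechet_derivative \<phi> (at (x + \<tau> *\<^sub>R e)))"
          using schwartz_has_derivative[OF s] by (rule has_derivative_bounded_linear)
        have "((\<lambda>\<tau>. x + \<tau> *\<^sub>R e) has_derivative (\<lambda>h. h *\<^sub>R e)) (at \<tau> within {0..t n})"
          by (rule has_derivative_eq_rhs[OF has_derivative_add[OF has_derivative_const has_derivative_scaleR_left[OF has_derivative_ident]]]) simp
        from has_derivative_compose[OF this schwartz_has_derivative[OF s]]
        show ?thesis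
          by (simp add: partial_deriv_def e_def[symmetric] linear_scale[OF bounded_linear.linear[OF lin]])
      qed
      have on: "onorm (\<lambda>h. h *\<^sub>R partial_deriv i \<phi> (x + \<tau> *\<^sub>R e)) \<le> ?K" if "\<tau> \<in> {0..t n}" for \<tau>
      proof (rule onorm_bound)
        show "0 \<le> ?K" using B(1) by simp
        fix h :: real
        have "norm x \<le> norm (x + \<tau> *\<^sub>R e) + norm (\<tau> *\<^sub>R e)"
          using norm_triangle_ineq4[of "x + \<tau> *\<^sub>R e" "\<tau> *\<^sub>R e"] by simp
        then have "norm x \<le> norm (x + \<tau> *\<^sub>R e) + 1" using that t(3)[of n] ne by simp
        then have "1 + norm x \<le> 2 * (1 + norm (x + \<tau> *\<^sub>R e))"
          using norm_ge_zero[of "x + \<tau> *\<^sub>R e"] by argo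
        then have "(1 + norm x) ^ ?M \<le> 2 ^ ?M * (1 + norm (x + \<tau> *\<^sub>R e)) ^ ?M"
          unfolding power_mult_distrib[symmetric] by (intro power_mono) auto
        then have "B / (1 + norm (x + \<tau> *\<^sub>R e)) ^ ?M \<le> ?K"
          using B(1) by (simp add: divide_simps mult_ac)
        then have "norm (partial_deriv i \<phi> (x + \<tau> *\<^sub>R e)) \<le> ?K" using B(2)[of "x + \<tau> *\<^sub>R e"] by linarith
        from mult_right_mono[OF this, of "norm h"]
        show "norm (h *\<^sub>R partial_deriv i \<phi> (x + \<tau> *\<^sub>R e)) \<le> ?K * norm h" by (simp add: mult.commute)
      qed
      have "norm (?g (t n) - ?g 0) \<le> ?K * norm (t n - 0)"
        by (rule differentiable_bound[where S="{0..t n}"]) (use gd on t(2)[of n] in auto)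
      then have "norm (\<phi> (x + t n *\<^sub>R e) - \<phi> x) / t n \<le> ?K"
        using t(2)[of n] by (simp add: pos_divide_le_eq)
      then show "norm (s_n n x) \<le> ?K"
        unfolding s_n_def using t(2)[of n] by (simp add: divide_inverse mult.commute)
    qed
  qed
  then show ?thesis using s0 by (simp add: LIMSEQ_const_iff)
qed

text \<open>Integration by parts: the derivative of the modulated function integrates to 0, and the
  product rule splits it into the two terms.\<close>

lemma schwartz_fourier_partial_deriv:
  fixes \<phi> :: "real ^ 'd::finite \<Rightarrow> complex"
  assumes s: "\<phi> \<in> schwartz"
  shows "schwartz_fourier (partial_deriv i \<phi>) \<xi> = \<i> * of_real (\<xi> $ i) * schwartz_fourier \<phi> \<xi>"
proof -
  let ?e = "\<lambda>x. exp (- \<i> * of_real (x \<bullet> \<xi>))"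
  have i: "integrable lebesgue (\<lambda>x. ?e x * \<psi> x)" if "\<psi> \<in> schwartz" for \<psi>
    using schwartz_integrable[OF schwartz_modulation[OF that, of \<xi>], of 0] by simp
  have eq: "partial_deriv i (\<lambda>x. ?e x * \<phi> x) = (\<lambda>x. ?e x * partial_deriv i \<phi> x - \<i> * of_real (\<xi> $ i) * (?e x * \<phi> x))"
    unfolding partial_derivI[OF schwartz_modulation_derivative[OF s, of \<xi>]]
    by (simp add: partial_deriv_def inner_axis inner_axis' fun_eq_iff algebra_simps)
  have "0 = (LINT x|lebesgue. ?e x * partial_deriv i \<phi> x - \<i> * of_real (\<xi> $ i) * (?e x * \<phi> x))"
    using integral_partial_deriv_schwartz[OF schwartz_modulation[OF s, of \<xi>], of i] unfolding eq by simp
  also have "\<dots> = (LINT x|lebesgue. ?e x * partial_deriv i \<phi> x) - (LINT x|lebesgue. \<i> * of_real (\<xi> $ i) * (?e x * \<phi> x))"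
    by (intro Bochner_Integration.integral_diff integrable_mult_right i schwartz_partial_deriv s)
  also have "(LINT x|lebesgue. \<i> * of_real (\<xi> $ i) * (?e x * \<phi> x)) = \<i> * of_real (\<xi> $ i) * (LINT x|lebesgue. ?e x * \<phi> x)"
    by (rule integral_mult_right_zero)
  finally show ?thesis unfolding schwartz_fourier_def by simp
qed

lemma schwartz_fourier_bounded:
  fixes \<phi> :: "real ^ 'd::finite \<Rightarrow> complex"
  obtains B where "\<And>\<xi>. norm (schwartz_fourier \<phi> \<xi>) \<le> B"
proof -
  have "norm (schwartz_fourier \<phi> \<xi>) \<le> (2 * pi) powr (- (real CARD('d) / 2)) * (LINT x|lebesgue. norm (\<phi> x))" for \<xi>
  proof -
    have "norm (LINT x|lebesgue. exp (- \<i> * of_real (x \<bullet> \<xi>)) * \<phi> x) \<le> (LINT x|lebesgue. norm (exp (- \<i> * of_real (x \<bullet> \<xi>)) * \<phi> x))"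
      by (rule integral_norm_bound)
    then show ?thesis unfolding schwartz_fourier_def norm_mult by (intro mult_mono) auto
  qed
  then show ?thesis by (rule that)
qed

text \<open>M derivatives in direction i bound |xi_i|^M times the transform. Doing this for each
  coordinate direction is enough, because one coordinate is always comparable to |xi|; if that
  coordinate is at most 1, boundedness of the transform suffices.\<close>

lemma schwartz_fourier_decay:
  fixes \<phi> :: "real ^ 'd::finite \<Rightarrow> complex"
  assumes s: "\<phi> \<in> schwartz"
  obtains B where "\<And>\<xi>. norm (schwartz_fourier \<phi> \<xi>) \<le> B / (1 + norm \<xi>) ^ M"
proof -
  have it: "(partial_deriv i ^^ m) \<phi> \<in> schwartz \<and>
     (\<forall>\<xi>. schwartz_fourier ((partial_deriv i ^^ m) \<phi>) \<xi> = (\<i> * of_real (\<xi> $ i)) ^ m * schwartz_fourier \<phi> \<xi>)" for i m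
    by (induction m) (auto simp: s schwartz_fourier_partial_deriv intro: schwartz_partial_deriv)
  obtain B0 where B0: "\<And>\<xi>. norm (schwartz_fourier \<phi> \<xi>) \<le> B0" using schwartz_fourier_bounded by blast
  have "\<exists>B. \<forall>\<xi>. \<bar>\<xi> $ i\<bar> ^ M * norm (schwartz_fourier \<phi> \<xi>) \<le> B" for i
  proof -
    obtain B where "\<And>\<xi>. norm (schwartz_fourier ((partial_deriv i ^^ M) \<phi>) \<xi>) \<le> B"
      using schwartz_fourier_bounded by blast
    then show ?thesis using it[of M i] by (auto simp: norm_mult norm_power)
  qed
  then obtain B where B: "\<And>i \<xi>. \<bar>\<xi> $ i\<bar> ^ M * norm (schwartz_fourier \<phi> \<xi>) \<le> B i" by metis
  have B0': "0 \<le> B0" using B0[of 0] norm_ge_zero order_trans by blast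
  have Bi': "0 \<le> B i" for i using B[of 0 i] by (rule order_trans[rotated]) auto
  have "norm (schwartz_fourier \<phi> \<xi>) \<le> ((1 + real CARD('d)) ^ M * (B0 + (\<Sum>i\<in>UNIV. B i))) / (1 + norm \<xi>) ^ M" for \<xi>
  proof -
    \<comment> \<open>\<open>i0\<close> is a coordinate of largest modulus, so that |xi| <= d
      |xi_i0|.\<close>
    have "Max (range (\<lambda>i. \<bar>\<xi> $ i\<bar>)) \<in> range (\<lambda>i. \<bar>\<xi> $ i\<bar>)" by (intro Max_in) auto
    then obtain i0 where i0: "\<bar>\<xi> $ i0\<bar> = Max (range (\<lambda>i. \<bar>\<xi> $ i\<bar>))"
      by (elim imageE) (rule that, erule sym)
    have "norm \<xi> \<le> (\<Sum>i\<in>UNIV. \<bar>\<xi> $ i\<bar>)" by (rule norm_le_l1_cart)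
    also have "\<dots> \<le> (\<Sum>i\<in>(UNIV::'d set). \<bar>\<xi> $ i0\<bar>)" unfolding i0 by (intro sum_mono Max_ge) auto
    finally have n: "norm \<xi> \<le> real CARD('d) * \<bar>\<xi> $ i0\<bar>" by simp
    have "(1 + norm \<xi>) ^ M * norm (schwartz_fourier \<phi> \<xi>) \<le> (1 + real CARD('d)) ^ M * (B0 + B i0)"
    proof (cases "\<bar>\<xi> $ i0\<bar> \<le> 1")
      case True
      then have "1 + norm \<xi> \<le> 1 + real CARD('d)"
        using order_trans[OF n mult_left_le[OF True of_nat_0_le_iff]] by simp
      then have "(1 + norm \<xi>) ^ M * norm (schwartz_fourier \<phi> \<xi>) \<le> (1 + real CARD('d)) ^ M * B0"
        by (intro mult_mono power_mono B0) auto
      also have "\<dots> \<le> (1 + real CARD('d)) ^ M * (B0 + B i0)" using Bi' by (intro mult_left_mono) auto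
      finally show ?thesis .
    next
      case False
      then have "1 + norm \<xi> \<le> (1 + real CARD('d)) * \<bar>\<xi> $ i0\<bar>"
        using n by (simp add: algebra_simps)
      then have "(1 + norm \<xi>) ^ M * norm (schwartz_fourier \<phi> \<xi>) \<le> ((1 + real CARD('d)) * \<bar>\<xi> $ i0\<bar>) ^ M * norm (schwartz_fourier \<phi> \<xi>)"
        by (intro mult_right_mono power_mono) auto
      also have "\<dots> = (1 + real CARD('d)) ^ M * (\<bar>\<xi> $ i0\<bar> ^ M * norm (schwartz_fourier \<phi> \<xi>))"
        by (simp add: power_mult_distrib mult.assoc)
      also have "\<dots> \<le> (1 + real CARD('d)) ^ M * (B0 + B i0)"
        using B[of \<xi> i0] B0' by (intro mult_left_mono) auto
      finally show ?thesis .
    qed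
    also have "\<dots> \<le> (1 + real CARD('d)) ^ M * (B0 + (\<Sum>i\<in>UNIV. B i))"
      using member_le_sum[of i0 UNIV B] Bi' by (intro mult_left_mono add_left_mono) auto
    finally show ?thesis by (simp add: pos_le_divide_eq mult.commute)
  qed
  then show ?thesis by (rule that)
qed

lemma schwartz_fourier_lborel:
  assumes "\<phi> \<in> borel_measurable borel"
  shows "schwartz_fourier \<phi> \<xi> =
    of_real ((2 * pi) powr (- (real CARD('d) / 2))) * (LINT x|lborel. exp (- \<i> * of_real (x \<bullet> \<xi>)) * \<phi> (x::real ^ 'd::finite))"
  unfolding schwartz_fourier_def using assms by (subst integral_completion) auto

lemma schwartz_fourier_measurable[measurable]:
  fixes \<phi> :: "real ^ 'd::finite \<Rightarrow> complex"
  assumes [measurable]: "\<phi> \<in> borel_measurable borel"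
  shows "schwartz_fourier \<phi> \<in> borel_measurable borel"
  unfolding schwartz_fourier_lborel[OF assms, abs_def] by measurable

lemma schwartz_fourier_integrable:
  fixes \<phi> :: "real ^ 'd::finite \<Rightarrow> complex"
  assumes s: "\<phi> \<in> schwartz"
  shows "integrable lebesgue (\<lambda>x. (1 + norm x) ^ N *\<^sub>R schwartz_fourier \<phi> x)"
proof -
  note [measurable] = schwartz_measurable[OF s]
  obtain B where B: "\<And>x. norm (schwartz_fourier \<phi> x) \<le> B / (1 + norm x) ^ (N + 2 * CARD('d))"
    using schwartz_fourier_decay[OF s] by metis
  have i: "integrable lebesgue (\<lambda>x::real ^ 'd. B * (1 / (1 + norm x) ^ (2 * CARD('d))))"
    by (intro integrable_mult_right integrable_inverse_1_plus_norm_power) simp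
  show ?thesis
  proof (rule Bochner_Integration.integrable_bound[OF i])
    show "(\<lambda>x. (1 + norm x) ^ N *\<^sub>R schwartz_fourier \<phi> x) \<in> borel_measurable lebesgue"
      by (intro measurable_completion) measurable
    show "AE x in lebesgue. norm ((1 + norm x) ^ N *\<^sub>R schwartz_fourier \<phi> x) \<le> norm (B * (1 / (1 + norm x) ^ (2 * CARD('d))))"
    proof (rule AE_I2)
      fix x :: "real ^ 'd"
      have "norm ((1 + norm x) ^ N *\<^sub>R schwartz_fourier \<phi> x) \<le> (1 + norm x) ^ N * (B / (1 + norm x) ^ (N + 2 * CARD('d)))"
        using mult_left_mono[OF B[of x], of "(1 + norm x) ^ N"] by simp
      also have "\<dots> = B * (1 / (1 + norm x) ^ (2 * CARD('d)))" by (simp add: power_add)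
      also have "\<dots> \<le> norm (B * (1 / (1 + norm x) ^ (2 * CARD('d))))"
        unfolding real_norm_def by (rule abs_ge_self)
      finally show "norm ((1 + norm x) ^ N *\<^sub>R schwartz_fourier \<phi> x) \<le> norm (B * (1 / (1 + norm x) ^ (2 * CARD('d))))" .
    qed
  qed
qed

lemma two_pi_powr_half:
  fixes D :: nat
  shows "sqrt (2 * pi) ^ D = (2 * pi) powr (real D / 2)"
    and "(2 * pi) powr (- (real D / 2)) * sqrt (2 * pi) ^ D = 1"
proof -
  show 1: "sqrt (2 * pi) ^ D = (2 * pi) powr (real D / 2)"
    by (simp add: powr_half_sqrt[symmetric] powr_realpow[symmetric] powr_powr)
  show "(2 * pi) powr (- (real D / 2)) * sqrt (2 * pi) ^ D = 1"
    unfolding 1 powr_add[symmetric] by simp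
qed

text \<open>A factor exp (-(e |x|)^2 / 2) makes the double integral absolutely convergent. Its limit
  as e -> 0 is computed twice: directly, giving the inversion integral, and after exchanging the
  integrals, where the Gaussian becomes an approximate identity at xi.\<close>

lemma schwartz_fourier_inversion:
  fixes \<phi> :: "real ^ 'd::finite \<Rightarrow> complex"
  assumes s: "\<phi> \<in> schwartz"
  shows "of_real ((2 * pi) powr (- (real CARD('d) / 2))) * (LINT x|lborel. exp (\<i> * of_real (x \<bullet> \<xi>)) * schwartz_fourier \<phi> x) = \<phi> \<xi>"
proof -
  note [measurable] = schwartz_measurable[OF s]
  define c where "c = (2 * pi) powr (- (real CARD('d) / 2))"
  define q where "q = sqrt (2 * pi) ^ CARD('d)"
  have cq: "c * q = 1" unfolding c_def q_def by (rule two_pi_powr_half)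
  have iphi: "integrable lborel \<phi>"
    using schwartz_integrable[OF s, of 0] by (subst (asm) integrable_completion) auto
  have ihat: "integrable lborel (schwartz_fourier \<phi>)"
    using schwartz_fourier_integrable[OF s, of 0] by (subst (asm) integrable_completion) auto
  obtain B where B: "\<And>x. norm (\<phi> x) \<le> B / (1 + norm x) ^ 0" using schwartz_bound[OF s] by metis
  define e where "e n = 1 / real (Suc n)" for n
  have e: "e \<longlonglongrightarrow> 0" "\<And>n. 0 < e n"
    unfolding e_def using LIMSEQ_inverse_real_of_nat by (auto simp: inverse_eq_divide)
  let ?G = "\<lambda>n x::real ^ 'd. exp (- (e n * norm x)\<^sup>2 / 2)"
  have iG: "integrable lborel (?G n)" for n
    using has_bochner_integral_gaussian_real[OF e(2)] by (auto simp: has_bochner_integral_iff)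
  have i1: "integrable lborel (\<lambda>z::real ^ 'd. exp (- (norm z)\<^sup>2 / 2))" "(LINT z|lborel. exp (- (norm (z::real ^ 'd))\<^sup>2 / 2)) = q"
    using has_bochner_integral_gaussian_real[where 'a="real ^ 'd", of 1] by (auto simp: has_bochner_integral_iff q_def)
  have lim1: "(\<lambda>n. LINT x|lborel. exp (\<i> * of_real (x \<bullet> \<xi>)) * schwartz_fourier \<phi> x * of_real (?G n x)) \<longlonglongrightarrow>
     (LINT x|lborel. exp (\<i> * of_real (x \<bullet> \<xi>)) * schwartz_fourier \<phi> x)"
  proof (rule integral_dominated_convergence[where w="\<lambda>x. norm (schwartz_fourier \<phi> x)"])
    show "AE x in lborel. (\<lambda>n. exp (\<i> * of_real (x \<bullet> \<xi>)) * schwartz_fourier \<phi> x * of_real (?G n x)) \<longlonglongrightarrow> exp (\<i> * of_real (x \<bullet> \<xi>)) * schwartz_fourier \<phi> x"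
    proof (rule AE_I2)
      fix x :: "real ^ 'd"
      have "(\<lambda>n. exp (\<i> * of_real (x \<bullet> \<xi>)) * schwartz_fourier \<phi> x * of_real (?G n x)) \<longlonglongrightarrow> exp (\<i> * of_real (x \<bullet> \<xi>)) * schwartz_fourier \<phi> x * of_real (exp (- (0 * norm x)\<^sup>2 / 2))"
        by (intro tendsto_intros e) simp
      then show "(\<lambda>n. exp (\<i> * of_real (x \<bullet> \<xi>)) * schwartz_fourier \<phi> x * of_real (?G n x)) \<longlonglongrightarrow> exp (\<i> * of_real (x \<bullet> \<xi>)) * schwartz_fourier \<phi> x"
        by simp
    qed
  qed (use ihat in \<open>auto simp: norm_mult mult_left_le\<close>)
  \<comment> \<open>Integrating in x first produces a Gaussian of width e n around xi; the
    substitution y = xi + e n z cancels the factor (1 / e n)^d.\<close>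
  have step: "(LINT x|lborel. exp (\<i> * of_real (x \<bullet> \<xi>)) * schwartz_fourier \<phi> x * of_real (?G n x)) =
     of_real (c * q) * (LINT z|lborel. \<phi> (\<xi> + e n *\<^sub>R z) * of_real (exp (- (norm z)\<^sup>2 / 2)))" for n
  proof -
    let ?F = "\<lambda>x y. of_real c * \<phi> y * (exp (\<i> * of_real (x \<bullet> (\<xi> - y))) * of_real (?G n x)) :: complex"
    have "integrable (lborel \<Otimes>\<^sub>M lborel) (case_prod ?F)"
    proof (rule lborel_pair.Fubini_integrable)
      show "case_prod ?F \<in> borel_measurable (lborel \<Otimes>\<^sub>M lborel)" by measurable
      have "(LINT y|lborel. norm (case_prod ?F (x, y))) = \<bar>c\<bar> * (LINT y|lborel. norm (\<phi> y)) * ?G n x" for x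
        by (simp add: norm_mult)
      then show "integrable lborel (\<lambda>x. LINT y|lborel. norm (case_prod ?F (x, y)))"
        using iG by simp
      show "AE x in lborel. integrable lborel (\<lambda>y. case_prod ?F (x, y))"
      proof (rule AE_I2)
        fix x
        have "integrable lborel (\<lambda>y. norm (\<bar>c\<bar> * norm (\<phi> y) * ?G n x))" using iphi by (intro integrable_norm integrable_mult_left integrable_mult_right) auto
        then show "integrable lborel (\<lambda>y. case_prod ?F (x, y))"
          by (rule Bochner_Integration.integrable_bound) (auto simp: norm_mult abs_mult)
      qed
    qed
    from lborel_pair.Fubini_integral[OF this]
    have fub: "(LINT y|lborel. LINT x|lborel. ?F x y) = (LINT x|lborel. LINT y|lborel. ?F x y)" .
    have inner_y: "(LINT y|lborel. ?F x y) = exp (\<i> * of_real (x \<bullet> \<xi>)) * schwartz_fourier \<phi> x * of_real (?G n x)" for x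
    proof -
      have "(LINT y|lborel. ?F x y) = (LINT y|lborel. (of_real c * exp (\<i> * of_real (x \<bullet> \<xi>)) * of_real (?G n x)) * (exp (- \<i> * of_real (y \<bullet> x)) * \<phi> y))"
        by (intro Bochner_Integration.integral_cong)
           (simp_all add: inner_diff_right inner_commute exp_diff exp_minus field_simps)
      also have "\<dots> = (of_real c * exp (\<i> * of_real (x \<bullet> \<xi>)) * of_real (?G n x)) * (LINT y|lborel. exp (- \<i> * of_real (y \<bullet> x)) * \<phi> y)"
        by (rule integral_mult_right_zero)
      also have "\<dots> = exp (\<i> * of_real (x \<bullet> \<xi>)) * schwartz_fourier \<phi> x * of_real (?G n x)"
        unfolding schwartz_fourier_lborel[OF schwartz_measurable[OF s]] c_def by (simp only: mult_ac)
      finally show ?thesis .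
    qed
    have inner_x: "(LINT x|lborel. ?F x y) = of_real c * \<phi> y * of_real (q * (1 / e n) ^ CARD('d) * exp (- (norm (\<xi> - y))\<^sup>2 / (2 * (e n)\<^sup>2)))" for y
    proof -
      have "(LINT x|lborel. ?F x y) = of_real c * \<phi> y * (LINT x|lborel. exp (\<i> * of_real (x \<bullet> (\<xi> - y))) * of_real (?G n x))"
        by (rule integral_mult_right_zero)
      also have "(LINT x|lborel. exp (\<i> * of_real (x \<bullet> (\<xi> - y))) * of_real (?G n x)) = of_real (q * (1 / e n) ^ CARD('d) * exp (- (norm (\<xi> - y))\<^sup>2 / (2 * (e n)\<^sup>2)))"
        using has_bochner_integral_gaussian[OF e(2), of "\<xi> - y" n] by (simp add: has_bochner_integral_iff q_def power_divide)
      finally show ?thesis .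
    qed
    let ?H = "\<lambda>y. of_real c * \<phi> y * of_real (q * (1 / e n) ^ CARD('d) * exp (- (norm (\<xi> - y))\<^sup>2 / (2 * (e n)\<^sup>2))) :: complex"
    have mH: "?H \<in> borel_measurable lborel" by measurable
    have "(LINT y|lborel. ?H y) = (LINT y|lebesgue. ?H y)" using integral_completion[OF mH] by simp
    also have "\<dots> = \<bar>e n\<bar> ^ DIM(real ^ 'd) *\<^sub>R (LINT z|lebesgue. ?H (\<xi> + e n *\<^sub>R z))"
      by (rule integral_affine_lebesgue(1)) (use e(2)[of n] mH in \<open>auto intro: measurable_completion\<close>)
    also have "(LINT z|lebesgue. ?H (\<xi> + e n *\<^sub>R z)) = (LINT z|lborel. ?H (\<xi> + e n *\<^sub>R z))"
      by (rule integral_completion) measurable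
    also have "\<bar>e n\<bar> ^ DIM(real ^ 'd) *\<^sub>R (LINT z|lborel. ?H (\<xi> + e n *\<^sub>R z)) = (LINT z|lborel. of_real (c * q) * (\<phi> (\<xi> + e n *\<^sub>R z) * of_real (exp (- (norm z)\<^sup>2 / 2))))"
      unfolding integral_scaleR_right[symmetric]
      using e(2)[of n] by (intro Bochner_Integration.integral_cong refl)
         (simp add: scaleR_conv_of_real[where 'a=complex] power_mult_distrib power_divide field_simps)
    also have "\<dots> = of_real (c * q) * (LINT z|lborel. \<phi> (\<xi> + e n *\<^sub>R z) * of_real (exp (- (norm z)\<^sup>2 / 2)))"
      by (rule integral_mult_right_zero)
    finally show ?thesis using fub unfolding inner_x inner_y by simp
  qed
  have lim2: "(\<lambda>n. LINT z|lborel. \<phi> (\<xi> + e n *\<^sub>R z) * of_real (exp (- (norm z)\<^sup>2 / 2))) \<longlonglongrightarrow>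
      (LINT z|lborel. \<phi> \<xi> * of_real (exp (- (norm (z::real ^ 'd))\<^sup>2 / 2)))"
  proof (rule integral_dominated_convergence[where w="\<lambda>z. \<bar>B\<bar> * exp (- (norm z)\<^sup>2 / 2)"])
    show "AE z in lborel. (\<lambda>n. \<phi> (\<xi> + e n *\<^sub>R z) * of_real (exp (- (norm z)\<^sup>2 / 2))) \<longlonglongrightarrow> \<phi> \<xi> * of_real (exp (- (norm z)\<^sup>2 / 2))"
    proof (rule AE_I2)
      fix z :: "real ^ 'd"
      have "(\<lambda>n. \<xi> + e n *\<^sub>R z) \<longlonglongrightarrow> \<xi> + 0 *\<^sub>R z" by (intro tendsto_intros e)
      then have "(\<lambda>n. \<phi> (\<xi> + e n *\<^sub>R z)) \<longlonglongrightarrow> \<phi> \<xi>"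
        using differentiable_imp_continuous_within[OF schwartz_differentiable[OF s, of \<xi>]]
        by (intro isCont_tendsto_compose[of \<xi> \<phi>]) auto
      then show "(\<lambda>n. \<phi> (\<xi> + e n *\<^sub>R z) * of_real (exp (- (norm z)\<^sup>2 / 2))) \<longlonglongrightarrow> \<phi> \<xi> * of_real (exp (- (norm z)\<^sup>2 / 2))"
        by (intro tendsto_intros)
    qed
    show "integrable lborel (\<lambda>z::real ^ 'd. \<bar>B\<bar> * exp (- (norm z)\<^sup>2 / 2))" using i1 by simp
    show "AE z in lborel. norm (\<phi> (\<xi> + e n *\<^sub>R z) * of_real (exp (- (norm z)\<^sup>2 / 2))) \<le> \<bar>B\<bar> * exp (- (norm z)\<^sup>2 / 2)" for n
      using B by (auto simp: norm_mult intro!: mult_right_mono order_trans[OF _ abs_ge_self])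
  qed measurable
  have "(LINT z|lborel. \<phi> \<xi> * of_real (exp (- (norm (z::real ^ 'd))\<^sup>2 / 2))) = \<phi> \<xi> * of_real q"
    using i1 by (subst integral_mult_right_zero, subst integral_complex_of_real) simp
  note lim2 = lim2[unfolded this]
  have "(\<lambda>n. of_real (c * q) * (LINT z|lborel. \<phi> (\<xi> + e n *\<^sub>R z) * of_real (exp (- (norm z)\<^sup>2 / 2)))) \<longlonglongrightarrow> of_real (c * q) * (\<phi> \<xi> * of_real q)"
    using tendsto_mult[OF tendsto_const lim2] by simp
  from LIMSEQ_unique[OF lim1[unfolded step] this]
  have "(LINT x|lborel. exp (\<i> * of_real (x \<bullet> \<xi>)) * schwartz_fourier \<phi> x) = \<phi> \<xi> * of_real q" using cq by simp
  then have "of_real c * (LINT x|lborel. exp (\<i> * of_real (x \<bullet> \<xi>)) * schwartz_fourier \<phi> x) = of_real (c * q) * \<phi> \<xi>" by simp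
  then show ?thesis using cq unfolding c_def by simp
qed

section \<open>The inverse Fourier transform of integrable functions\<close>

definition inv_ft :: "(real ^ 'd::finite \<Rightarrow> complex) \<Rightarrow> real ^ 'd \<Rightarrow> complex" where
  "inv_ft F x = of_real ((2 * pi) powr (- (real CARD('d) / 2))) * (LINT \<xi>|lebesgue. exp (\<i> * of_real (x \<bullet> \<xi>)) * F \<xi>)"

lemma borel_measurable_cnj[measurable (raw)]:
  "f \<in> borel_measurable M \<Longrightarrow> (\<lambda>x. cnj (f x)) \<in> borel_measurable M"
  by (rule measurable_compose[OF _ borel_measurable_continuous_onI]) (auto intro: continuous_intros)

lemma exp_i_measurable_lebesgue: "(\<lambda>\<xi>. exp (\<i> * of_real (x \<bullet> \<xi>))) \<in> borel_measurable lebesgue"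
  by (rule measurable_completion) measurable

lemma integrable_exp_i_mult:
  assumes "integrable lebesgue F"
  shows "integrable lebesgue (\<lambda>\<xi>. exp (\<i> * of_real (x \<bullet> \<xi>)) * F \<xi>)"
  by (rule Bochner_Integration.integrable_bound[OF assms])
     (use assms in \<open>auto intro!: borel_measurable_times exp_i_measurable_lebesgue simp: norm_mult\<close>)

lemma inv_ft_cong_AE:
  assumes "F \<in> borel_measurable lebesgue" "G \<in> borel_measurable lebesgue" "AE \<xi> in lebesgue. F \<xi> = G \<xi>"
  shows "inv_ft F x = inv_ft G x"
proof -
  have "(LINT \<xi>|lebesgue. exp (\<i> * of_real (x \<bullet> \<xi>)) * F \<xi>) = (LINT \<xi>|lebesgue. exp (\<i> * of_real (x \<bullet> \<xi>)) * G \<xi>)"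
    by (rule integral_cong_AE)
       (use assms in \<open>auto intro!: borel_measurable_times exp_i_measurable_lebesgue elim!: eventually_mono\<close>)
  then show ?thesis by (simp add: inv_ft_def)
qed

lemma inv_ft_lborel:
  fixes F :: "real ^ 'd::finite \<Rightarrow> complex"
  assumes "F \<in> borel_measurable borel"
  shows "inv_ft F x = of_real ((2 * pi) powr (- (real CARD('d) / 2))) * (LINT \<xi>|lborel. exp (\<i> * of_real (x \<bullet> \<xi>)) * F \<xi>)"
  unfolding inv_ft_def using assms by (subst integral_completion) auto

lemma integrable_borel_version:
  fixes F :: "real ^ 'd::finite \<Rightarrow> complex"
  assumes F: "integrable lebesgue F"
  obtains F' where "F' \<in> borel_measurable borel" "AE \<xi> in lebesgue. F \<xi> = F' \<xi>" "integrable lborel F'"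
    "inv_ft F = inv_ft F'"
proof -
  obtain F' where F': "F' \<in> borel_measurable borel" and eq: "AE \<xi> in lebesgue. F \<xi> = F' \<xi>"
    using lebesgue_borel_version[OF borel_measurable_integrable[OF F]] .
  have m: "F' \<in> borel_measurable lebesgue" using F' by (intro measurable_completion) simp
  have "integrable lebesgue F'" by (rule integrable_cong_AE_imp[OF F m]) (use eq in \<open>auto elim: eventually_mono\<close>)
  then have "integrable lborel F'" using F' by (subst (asm) integrable_completion) auto
  moreover have "inv_ft F = inv_ft F'"
    by (rule ext, rule inv_ft_cong_AE) (use F m eq in auto)
  ultimately show ?thesis by (rule that[OF F' eq])
qed

lemma norm_inv_ft_le:
  fixes F :: "real ^ 'd::finite \<Rightarrow> complex"
  shows "norm (inv_ft F x) \<le> (2 * pi) powr (- (real CARD('d) / 2)) * (LINT \<xi>|lebesgue. norm (F \<xi>))"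
proof -
  have "norm (LINT \<xi>|lebesgue. exp (\<i> * of_real (x \<bullet> \<xi>)) * F \<xi>) \<le> (LINT \<xi>|lebesgue. norm (exp (\<i> * of_real (x \<bullet> \<xi>)) * F \<xi>))"
    by (rule integral_norm_bound)
  also have "\<dots> = (LINT \<xi>|lebesgue. norm (F \<xi>))" by (simp add: norm_mult)
  finally have "(2 * pi) powr (- (real CARD('d) / 2)) * norm (LINT \<xi>|lebesgue. exp (\<i> * of_real (x \<bullet> \<xi>)) * F \<xi>) \<le>
    (2 * pi) powr (- (real CARD('d) / 2)) * (LINT \<xi>|lebesgue. norm (F \<xi>))"
    by (rule mult_left_mono) simp
  then show ?thesis unfolding inv_ft_def norm_mult by simp
qed

lemma inv_ft_continuous:
  fixes F :: "real ^ 'd::finite \<Rightarrow> complex"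
  assumes F: "integrable lebesgue F"
  shows "continuous_on UNIV (inv_ft F)"
proof -
  have "(\<lambda>n. LINT \<xi>|lebesgue. exp (\<i> * of_real (u n \<bullet> \<xi>)) * F \<xi>) \<longlonglongrightarrow> (LINT \<xi>|lebesgue. exp (\<i> * of_real (x \<bullet> \<xi>)) * F \<xi>)"
    if u: "u \<longlonglongrightarrow> x" for u x
  proof (rule integral_dominated_convergence[where w="\<lambda>\<xi>. norm (F \<xi>)"])
    show "AE \<xi> in lebesgue. (\<lambda>n. exp (\<i> * of_real (u n \<bullet> \<xi>)) * F \<xi>) \<longlonglongrightarrow> exp (\<i> * of_real (x \<bullet> \<xi>)) * F \<xi>"
      by (intro AE_I2 tendsto_intros u)
  qed (use integrable_exp_i_mult[OF F] F in \<open>auto simp: norm_mult\<close>)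
  then have "\<forall>x u. u \<longlonglongrightarrow> x \<longrightarrow> (\<lambda>n. inv_ft F (u n)) \<longlonglongrightarrow> inv_ft F x"
    unfolding inv_ft_def by (auto intro!: tendsto_intros)
  then show ?thesis unfolding continuous_on_sequentially by (auto simp: comp_def)
qed

lemma inv_ft_measurable: "integrable lebesgue F \<Longrightarrow> inv_ft F \<in> borel_measurable borel"
  by (intro borel_measurable_continuous_onI inv_ft_continuous)

lemma inv_ft_diff:
  assumes "integrable lebesgue F" "integrable lebesgue G"
  shows "inv_ft (\<lambda>\<xi>. F \<xi> - G \<xi>) x = inv_ft F x - inv_ft G x"
  using assms[THEN integrable_exp_i_mult, of x] by (simp add: inv_ft_def right_diff_distrib Bochner_Integration.integral_diff)

lemma inv_ft_cmult: "inv_ft (\<lambda>\<xi>. k * F \<xi>) x = k * inv_ft F x"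
proof -
  have "(LINT \<xi>|lebesgue. exp (\<i> * of_real (x \<bullet> \<xi>)) * (k * F \<xi>)) = k * (LINT \<xi>|lebesgue. exp (\<i> * of_real (x \<bullet> \<xi>)) * F \<xi>)"
    by (subst integral_mult_right_zero[symmetric]) (simp add: mult_ac)
  then show ?thesis by (simp add: inv_ft_def mult_ac)
qed

text \<open>Fubini moves the character onto the transform of phi, and inversion for Schwartz
  functions removes it. This is what makes F the distributional Fourier transform of
  \<open>inv_ft F\<close>.\<close>

lemma inv_ft_pairing:
  fixes F :: "real ^ 'd::finite \<Rightarrow> complex"
  assumes F: "integrable lebesgue F" and s: "\<phi> \<in> schwartz"
  shows "(LINT x|lebesgue. inv_ft F x * schwartz_fourier \<phi> x) = (LINT \<xi>|lebesgue. F \<xi> * \<phi> \<xi>)"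
proof -
  obtain F' where [measurable]: "F' \<in> borel_measurable borel" and eq: "AE \<xi> in lebesgue. F \<xi> = F' \<xi>"
    and iF': "integrable lborel F'" and ieq: "inv_ft F = inv_ft F'"
    by (rule integrable_borel_version[OF F])
  note [measurable] = schwartz_measurable[OF s] inv_ft_measurable[OF F, unfolded ieq]
  define c where "c = (2 * pi) powr (- (real CARD('d) / 2))"
  have ihat: "integrable lborel (schwartz_fourier \<phi>)"
    using schwartz_fourier_integrable[OF s, of 0] by (subst (asm) integrable_completion) auto
  let ?H = "\<lambda>x \<xi>. (of_real c * (exp (\<i> * of_real (x \<bullet> \<xi>)) * F' \<xi>)) * schwartz_fourier \<phi> x"
  have "integrable (lborel \<Otimes>\<^sub>M lborel) (case_prod ?H)"
  proof (rule lborel_pair.Fubini_integrable)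
    show "case_prod ?H \<in> borel_measurable (lborel \<Otimes>\<^sub>M lborel)" by measurable
    have "(LINT \<xi>|lborel. norm (case_prod ?H (x, \<xi>))) = \<bar>c\<bar> * (LINT \<xi>|lborel. norm (F' \<xi>)) * norm (schwartz_fourier \<phi> x)" for x
      by (simp add: norm_mult)
    then show "integrable lborel (\<lambda>x. LINT \<xi>|lborel. norm (case_prod ?H (x, \<xi>)))"
      using ihat by simp
    show "AE x in lborel. integrable lborel (\<lambda>\<xi>. case_prod ?H (x, \<xi>))"
    proof (rule AE_I2)
      fix x
      have "integrable lborel (\<lambda>\<xi>. \<bar>c\<bar> * norm (F' \<xi>) * norm (schwartz_fourier \<phi> x))"
        using iF' by (intro integrable_mult_left integrable_mult_right) auto
      then show "integrable lborel (\<lambda>\<xi>. case_prod ?H (x, \<xi>))"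
        by (rule Bochner_Integration.integrable_bound) (auto simp: norm_mult abs_mult)
    qed
  qed
  from lborel_pair.Fubini_integral[OF this]
  have fub: "(LINT \<xi>|lborel. LINT x|lborel. ?H x \<xi>) = (LINT x|lborel. LINT \<xi>|lborel. ?H x \<xi>)" .
  have 1: "(LINT \<xi>|lborel. ?H x \<xi>) = inv_ft F' x * schwartz_fourier \<phi> x" for x
    unfolding inv_ft_lborel[OF \<open>F' \<in> borel_measurable borel\<close>] c_def
    by (subst integral_mult_left_zero, subst integral_mult_right_zero) simp
  have 2: "(LINT x|lborel. ?H x \<xi>) = F' \<xi> * \<phi> \<xi>" for \<xi>
  proof -
    have "(LINT x|lborel. ?H x \<xi>) = (LINT x|lborel. (F' \<xi> * of_real c) * (exp (\<i> * of_real (x \<bullet> \<xi>)) * schwartz_fourier \<phi> x))"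
      by (simp only: mult_ac)
    also have "\<dots> = F' \<xi> * (of_real c * (LINT x|lborel. exp (\<i> * of_real (x \<bullet> \<xi>)) * schwartz_fourier \<phi> x))"
      by (subst integral_mult_right_zero) simp
    also have "\<dots> = F' \<xi> * \<phi> \<xi>"
      unfolding c_def by (simp only: schwartz_fourier_inversion[OF s])
    finally show ?thesis .
  qed
  have "(LINT x|lebesgue. inv_ft F x * schwartz_fourier \<phi> x) = (LINT x|lborel. inv_ft F' x * schwartz_fourier \<phi> x)"
    unfolding ieq by (rule integral_completion) measurable
  also have "\<dots> = (LINT \<xi>|lborel. F' \<xi> * \<phi> \<xi>)" using fub unfolding 1 2 by simp
  also have "\<dots> = (LINT \<xi>|lebesgue. F' \<xi> * \<phi> \<xi>)" by (rule integral_completion[symmetric]) measurable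
  also have "\<dots> = (LINT \<xi>|lebesgue. F \<xi> * \<phi> \<xi>)"
  proof (rule integral_cong_AE)
    have m: "\<phi> \<in> borel_measurable lebesgue" by (rule measurable_completion) measurable
    show "(\<lambda>\<xi>. F \<xi> * \<phi> \<xi>) \<in> borel_measurable lebesgue" using F m by (intro borel_measurable_times) auto
    show "(\<lambda>\<xi>. F' \<xi> * \<phi> \<xi>) \<in> borel_measurable lebesgue" by (rule measurable_completion) measurable
  qed (use eq in \<open>auto elim: eventually_mono\<close>)
  finally show ?thesis .
qed

section \<open>The Plancherel inequality for integrable functions\<close>

lemma nn_integral_gaussian_kernel:
  fixes \<xi> :: "real ^ 'd::finite"
  assumes e: "0 < e"
  shows "(\<integral>\<^sup>+\<eta>. ennreal ((2 * pi) powr (- (real CARD('d) / 2)) * ((1 / e) ^ CARD('d) * exp (- (norm (\<xi> - \<eta>))\<^sup>2 / (2 * e\<^sup>2)))) \<partial>lborel) = 1"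
proof -
  define c where "c = (2 * pi) powr (- (real CARD('d) / 2))"
  let ?k = "\<lambda>\<eta>. ennreal (c * ((1 / e) ^ CARD('d) * exp (- (norm (\<xi> - \<eta>))\<^sup>2 / (2 * e\<^sup>2))))"
  have m: "?k \<in> borel_measurable lborel" by measurable
  have "(\<integral>\<^sup>+\<eta>. ?k \<eta> \<partial>lborel) = (\<integral>\<^sup>+\<eta>. ?k \<eta> \<partial>lebesgue)" by (rule nn_integral_completion[symmetric])
  also have "\<dots> = ennreal (\<bar>e\<bar> ^ DIM(real ^ 'd)) * (\<integral>\<^sup>+z. ?k (\<xi> + e *\<^sub>R z) \<partial>lebesgue)"
    by (rule nn_integral_affine_lebesgue) (use e m in \<open>auto intro: measurable_completion\<close>)
  also have "(\<integral>\<^sup>+z. ?k (\<xi> + e *\<^sub>R z) \<partial>lebesgue) = (\<integral>\<^sup>+z. ?k (\<xi> + e *\<^sub>R z) \<partial>lborel)" by (rule nn_integral_completion)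
  also have "ennreal (\<bar>e\<bar> ^ DIM(real ^ 'd)) * (\<integral>\<^sup>+z. ?k (\<xi> + e *\<^sub>R z) \<partial>lborel) = (\<integral>\<^sup>+z. ennreal (\<bar>e\<bar> ^ DIM(real ^ 'd)) * ?k (\<xi> + e *\<^sub>R z) \<partial>lborel)"
    by (rule nn_integral_cmult[symmetric]) measurable
  also have "\<dots> = (\<integral>\<^sup>+z. ennreal (c * exp (- (1 * norm (z::real ^ 'd))\<^sup>2 / 2)) \<partial>lborel)"
    using e by (intro nn_integral_cong) (simp add: ennreal_mult'[symmetric] power_mult_distrib power_divide)
  also have "\<dots> = ennreal (c * (sqrt (2 * pi) / 1) ^ DIM(real ^ 'd))"
  proof (subst nn_integral_eq_integral)
    have h: "has_bochner_integral lborel (\<lambda>z::real ^ 'd. c * exp (- (1 * norm z)\<^sup>2 / 2)) (c * (sqrt (2 * pi) / 1) ^ DIM(real ^ 'd))"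
      by (intro has_bochner_integral_mult_right has_bochner_integral_gaussian_real) simp
    show "integrable lborel (\<lambda>z::real ^ 'd. c * exp (- (1 * norm z)\<^sup>2 / 2))"
      using h by (simp add: has_bochner_integral_iff)
    show "ennreal (LINT z|lborel. c * exp (- (1 * norm (z::real ^ 'd))\<^sup>2 / 2)) = ennreal (c * (sqrt (2 * pi) / 1) ^ DIM(real ^ 'd))"
      unfolding has_bochner_integral_integral_eq[OF h] ..
  qed (simp add: c_def)
  also have "c * (sqrt (2 * pi) / 1) ^ DIM(real ^ 'd) = 1"
    using two_pi_powr_half(2)[of "CARD('d)"] by (simp add: c_def)
  finally show ?thesis by (simp add: c_def)
qed

text \<open>Only the inequality in Plancherel's theorem is needed. After inserting a Gaussian, the square of
  the transform is a double integral against a positive kernel of mass one, which is bounded by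
  \<open>2 |F \<xi>| |F \<eta>| \<le> |F \<xi>|\<^sup>2 + |F \<eta>|\<^sup>2\<close>.\<close>

lemma inv_ft_gaussian_energy:
  fixes F :: "real ^ 'd::finite \<Rightarrow> complex"
  assumes [measurable]: "F \<in> borel_measurable borel" and iF: "integrable lborel F" and e: "0 < e"
  shows "(\<integral>\<^sup>+x. ennreal ((norm (inv_ft F x))\<^sup>2 * exp (- (e * norm x)\<^sup>2 / 2)) \<partial>lborel) \<le> (\<integral>\<^sup>+\<xi>. ennreal ((norm (F \<xi>))\<^sup>2) \<partial>lborel)"
proof -
  define c where "c = (2 * pi) powr (- (real CARD('d) / 2))"
  have c: "0 \<le> c" by (simp add: c_def)
  let ?G = "\<lambda>x::real ^ 'd. exp (- (e * norm x)\<^sup>2 / 2)"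
  define k where "k \<xi> \<eta> = (1 / e) ^ CARD('d) * exp (- (norm (\<xi> - \<eta>))\<^sup>2 / (2 * e\<^sup>2))" for \<xi> \<eta> :: "real ^ 'd"
  have k_meas[measurable]: "case_prod k \<in> borel_measurable (borel \<Otimes>\<^sub>M borel)"
    unfolding k_def by measurable
  have k0: "0 \<le> k \<xi> \<eta>" for \<xi> \<eta> using e by (simp add: k_def)
  have iG: "integrable lborel ?G"
    using has_bochner_integral_gaussian_real[OF e] by (auto simp: has_bochner_integral_iff)
  have iF': "integrable lebesgue F" using iF by (subst integrable_completion) auto
  note [measurable] = inv_ft_measurable[OF iF']
  define B where "B = c * (LINT \<xi>|lebesgue. norm (F \<xi>))"
  have B: "norm (inv_ft F x) \<le> B" "0 \<le> B" for x
    unfolding B_def using norm_inv_ft_le[of F] c by (auto simp: c_def)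
  let ?P = "\<lambda>x \<xi>. (of_real c * (exp (\<i> * of_real (x \<bullet> \<xi>)) * F \<xi>)) * (cnj (inv_ft F x) * of_real (?G x))"
  have i: "integrable (lborel \<Otimes>\<^sub>M lborel) (case_prod ?P)"
  proof (rule lborel_pair.Fubini_integrable)
    show "case_prod ?P \<in> borel_measurable (lborel \<Otimes>\<^sub>M lborel)" by measurable
    have 1: "(LINT \<xi>|lborel. norm (case_prod ?P (x, \<xi>))) = \<bar>c\<bar> * (LINT \<xi>|lborel. norm (F \<xi>)) * (norm (inv_ft F x) * ?G x)" for x
      by (simp add: norm_mult)
    have 2: "integrable lborel (\<lambda>x. norm (inv_ft F x) * ?G x)"
      by (rule Bochner_Integration.integrable_bound[OF integrable_mult_right[OF iG, of B]])
         (use B in \<open>auto simp: abs_mult intro!: mult_right_mono\<close>)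
    show "integrable lborel (\<lambda>x. LINT \<xi>|lborel. norm (case_prod ?P (x, \<xi>)))"
      unfolding 1 by (rule integrable_mult_right[OF 2])
    show "AE x in lborel. integrable lborel (\<lambda>\<xi>. case_prod ?P (x, \<xi>))"
    proof (rule AE_I2)
      fix x
      have "integrable lborel (\<lambda>\<xi>. \<bar>c\<bar> * norm (F \<xi>) * (norm (inv_ft F x) * ?G x))"
        using iF by (intro integrable_mult_left integrable_mult_right) auto
      then show "integrable lborel (\<lambda>\<xi>. case_prod ?P (x, \<xi>))"
        by (rule Bochner_Integration.integrable_bound) (auto simp: norm_mult abs_mult)
    qed
  qed
  have fub1: "(LINT \<xi>|lborel. LINT x|lborel. ?P x \<xi>) = (LINT x|lborel. LINT \<xi>|lborel. ?P x \<xi>)"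
    by (rule lborel_pair.Fubini_integral[OF i])
  have int1: "integrable lborel (\<lambda>\<xi>. LINT x|lborel. ?P x \<xi>)"
    using lborel_pair.integrable_snd[OF i] .
  have P1: "(LINT \<xi>|lborel. ?P x \<xi>) = of_real ((norm (inv_ft F x))\<^sup>2 * ?G x)" for x
  proof -
    have "(LINT \<xi>|lborel. ?P x \<xi>) = inv_ft F x * (cnj (inv_ft F x) * of_real (?G x))"
      unfolding inv_ft_lborel[OF assms(1)] c_def
      by (subst integral_mult_left_zero, subst integral_mult_right_zero) simp
    then show ?thesis unfolding of_real_mult complex_norm_square by (simp only: mult.assoc)
  qed
  define H where "H \<xi> = (LINT x|lborel. exp (\<i> * of_real (x \<bullet> \<xi>)) * (cnj (inv_ft F x) * of_real (?G x)))" for \<xi>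
  have P2: "(LINT x|lborel. ?P x \<xi>) = of_real c * F \<xi> * H \<xi>" for \<xi>
    unfolding H_def by (subst integral_mult_right_zero[symmetric]) (simp add: mult_ac)
  \<comment> \<open>Expanding the conjugate of the inverse transform and integrating in x first
    leaves the Gaussian kernel k, whose positivity allows passing to absolute values.\<close>
  have H_le: "ennreal (norm (H \<xi>)) \<le> (\<integral>\<^sup>+\<eta>. ennreal (norm (F \<eta>) * k \<xi> \<eta>) \<partial>lborel)" for \<xi>
  proof -
    let ?Q = "\<lambda>x \<eta>. (of_real c * (exp (\<i> * of_real (x \<bullet> (\<xi> - \<eta>))) * cnj (F \<eta>))) * of_real (?G x)"
    have i: "integrable (lborel \<Otimes>\<^sub>M lborel) (case_prod ?Q)"
    proof (rule lborel_pair.Fubini_integrable)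
      show "case_prod ?Q \<in> borel_measurable (lborel \<Otimes>\<^sub>M lborel)" by measurable
      have 1: "(LINT \<eta>|lborel. norm (case_prod ?Q (x, \<eta>))) = \<bar>c\<bar> * (LINT \<eta>|lborel. norm (F \<eta>)) * ?G x" for x
        by (simp add: norm_mult)
      show "integrable lborel (\<lambda>x. LINT \<eta>|lborel. norm (case_prod ?Q (x, \<eta>)))"
        unfolding 1 by (rule integrable_mult_right[OF iG])
      show "AE x in lborel. integrable lborel (\<lambda>\<eta>. case_prod ?Q (x, \<eta>))"
      proof (rule AE_I2)
        fix x
        have "integrable lborel (\<lambda>\<eta>. \<bar>c\<bar> * norm (F \<eta>) * ?G x)"
          using iF by (intro integrable_mult_left integrable_mult_right) auto
        then show "integrable lborel (\<lambda>\<eta>. case_prod ?Q (x, \<eta>))"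
          by (rule Bochner_Integration.integrable_bound) (auto simp: norm_mult abs_mult)
      qed
    qed
    have Q1: "(LINT \<eta>|lborel. ?Q x \<eta>) = exp (\<i> * of_real (x \<bullet> \<xi>)) * (cnj (inv_ft F x) * of_real (?G x))" for x
    proof -
      have "cnj (inv_ft F x) = of_real c * cnj (LINT \<eta>|lborel. exp (\<i> * of_real (x \<bullet> \<eta>)) * F \<eta>)"
        unfolding inv_ft_lborel[OF assms(1)] c_def by simp
      also have "cnj (LINT \<eta>|lborel. exp (\<i> * of_real (x \<bullet> \<eta>)) * F \<eta>) = (LINT \<eta>|lborel. cnj (exp (\<i> * of_real (x \<bullet> \<eta>)) * F \<eta>))"
        by (subst integral_bounded_linear'[OF bounded_linear_cnj bounded_linear_cnj, symmetric]) simp_all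
      finally have "exp (\<i> * of_real (x \<bullet> \<xi>)) * (cnj (inv_ft F x) * of_real (?G x)) =
         (of_real c * exp (\<i> * of_real (x \<bullet> \<xi>)) * of_real (?G x)) * (LINT \<eta>|lborel. cnj (exp (\<i> * of_real (x \<bullet> \<eta>)) * F \<eta>))"
        by (simp only: mult_ac)
      also have "\<dots> = (LINT \<eta>|lborel. (of_real c * exp (\<i> * of_real (x \<bullet> \<xi>)) * of_real (?G x)) * cnj (exp (\<i> * of_real (x \<bullet> \<eta>)) * F \<eta>))"
        by (rule integral_mult_right_zero[symmetric])
      also have "\<dots> = (LINT \<eta>|lborel. ?Q x \<eta>)"
      proof (rule Bochner_Integration.integral_cong[OF refl])
        fix \<eta>
        have e: "exp (\<i> * of_real (x \<bullet> \<xi>)) * cnj (exp (\<i> * of_real (x \<bullet> \<eta>))) = exp (\<i> * of_real (x \<bullet> (\<xi> - \<eta>)))"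
          by (simp add: exp_cnj exp_add[symmetric] inner_diff_right algebra_simps)
        show "(of_real c * exp (\<i> * of_real (x \<bullet> \<xi>)) * of_real (?G x)) * cnj (exp (\<i> * of_real (x \<bullet> \<eta>)) * F \<eta>) = ?Q x \<eta>"
          unfolding e[symmetric] complex_cnj_mult by (simp only: mult_ac)
      qed
      finally show ?thesis by (rule sym)
    qed
    have Q2: "(LINT x|lborel. ?Q x \<eta>) = of_real (k \<xi> \<eta>) * cnj (F \<eta>)" for \<eta>
    proof -
      have "(LINT x|lborel. ?Q x \<eta>) = of_real c * cnj (F \<eta>) * (LINT x|lborel. exp (\<i> * of_real (x \<bullet> (\<xi> - \<eta>))) * of_real (?G x))"
        by (subst integral_mult_right_zero[symmetric]) (simp only: mult_ac)
      also have "(LINT x|lborel. exp (\<i> * of_real (x \<bullet> (\<xi> - \<eta>))) * of_real (?G x)) =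
          of_real ((sqrt (2 * pi) / e) ^ CARD('d) * exp (- (norm (\<xi> - \<eta>))\<^sup>2 / (2 * e\<^sup>2)))"
        using has_bochner_integral_gaussian[OF e, of "\<xi> - \<eta>"] by (simp add: has_bochner_integral_iff)
      also have "of_real c * cnj (F \<eta>) * of_real ((sqrt (2 * pi) / e) ^ CARD('d) * exp (- (norm (\<xi> - \<eta>))\<^sup>2 / (2 * e\<^sup>2))) =
         of_real (c * sqrt (2 * pi) ^ CARD('d)) * of_real (k \<xi> \<eta>) * cnj (F \<eta>)"
        by (simp add: power_divide k_def)
      also have "c * sqrt (2 * pi) ^ CARD('d) = 1" unfolding c_def by (rule two_pi_powr_half)
      finally show ?thesis by simp
    qed
    have "H \<xi> = (LINT \<eta>|lborel. of_real (k \<xi> \<eta>) * cnj (F \<eta>))"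
      using lborel_pair.Fubini_integral[OF i] unfolding Q1 Q2 H_def by simp
    moreover have "integrable lborel (\<lambda>\<eta>. of_real (k \<xi> \<eta>) * cnj (F \<eta>))"
      using lborel_pair.integrable_snd[OF i] unfolding Q2 .
    ultimately have "ennreal (norm (H \<xi>)) \<le> (\<integral>\<^sup>+\<eta>. ennreal (norm (of_real (k \<xi> \<eta>) * cnj (F \<eta>))) \<partial>lborel)"
      using integral_norm_bound_ennreal by metis
    also have "\<dots> = (\<integral>\<^sup>+\<eta>. ennreal (norm (F \<eta>) * k \<xi> \<eta>) \<partial>lborel)"
      using k0 by (intro nn_integral_cong) (simp add: norm_mult mult.commute)
    finally show ?thesis .
  qed
  have K: "(\<integral>\<^sup>+\<eta>. ennreal (c * k \<xi> \<eta>) \<partial>lborel) = 1" for \<xi>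
    unfolding c_def k_def by (rule nn_integral_gaussian_kernel[OF e])
  have K': "(\<integral>\<^sup>+\<xi>. ennreal (c * k \<xi> \<eta>) \<partial>lborel) = 1" for \<eta>
    using K[of \<eta>] unfolding k_def by (simp only: norm_minus_commute)
  have "(\<integral>\<^sup>+x. ennreal ((norm (inv_ft F x))\<^sup>2 * ?G x) \<partial>lborel) = ennreal (LINT x|lborel. (norm (inv_ft F x))\<^sup>2 * ?G x)"
  proof (rule nn_integral_eq_integral)
    show "integrable lborel (\<lambda>x. (norm (inv_ft F x))\<^sup>2 * ?G x)"
      by (rule Bochner_Integration.integrable_bound[OF integrable_mult_right[OF iG, of "B\<^sup>2"]])
         (use B in \<open>auto simp: abs_mult intro!: mult_right_mono power_mono\<close>)
  qed auto
  also have "(LINT x|lborel. (norm (inv_ft F x))\<^sup>2 * ?G x) = Re (LINT \<xi>|lborel. of_real c * F \<xi> * H \<xi>)"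
    using fub1 unfolding P1 P2 by (simp only: integral_complex_of_real Re_complex_of_real)
  also have "ennreal \<dots> \<le> ennreal (norm (LINT \<xi>|lborel. of_real c * F \<xi> * H \<xi>))"
    by (intro ennreal_leI complex_Re_le_cmod)
  also have "\<dots> \<le> (\<integral>\<^sup>+\<xi>. ennreal (norm (of_real c * F \<xi> * H \<xi>)) \<partial>lborel)"
    using int1 unfolding P2 by (rule integral_norm_bound_ennreal)
  also have "\<dots> = (\<integral>\<^sup>+\<xi>. ennreal (c * norm (F \<xi>)) * ennreal (norm (H \<xi>)) \<partial>lborel)"
    using c by (intro nn_integral_cong) (simp add: norm_mult ennreal_mult)
  also have "\<dots> \<le> (\<integral>\<^sup>+\<xi>. ennreal (c * norm (F \<xi>)) * (\<integral>\<^sup>+\<eta>. ennreal (norm (F \<eta>) * k \<xi> \<eta>) \<partial>lborel) \<partial>lborel)"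
    by (intro nn_integral_mono mult_left_mono H_le) auto
  also have "\<dots> = (\<integral>\<^sup>+\<xi>. (\<integral>\<^sup>+\<eta>. ennreal (c * norm (F \<xi>)) * ennreal (norm (F \<eta>) * k \<xi> \<eta>) \<partial>lborel) \<partial>lborel)"
    by (intro nn_integral_cong nn_integral_cmult[symmetric]) measurable
  also have "\<dots> \<le> (\<integral>\<^sup>+\<xi>. (\<integral>\<^sup>+\<eta>. ennreal ((norm (F \<xi>))\<^sup>2 / 2) * ennreal (c * k \<xi> \<eta>) + ennreal ((norm (F \<eta>))\<^sup>2 / 2) * ennreal (c * k \<xi> \<eta>) \<partial>lborel) \<partial>lborel)"
  proof (intro nn_integral_mono)
    fix \<xi> \<eta>
    have ck: "0 \<le> c * k \<xi> \<eta>" using c k0 by simp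
    have "norm (F \<xi>) * norm (F \<eta>) \<le> (norm (F \<xi>))\<^sup>2 / 2 + (norm (F \<eta>))\<^sup>2 / 2"
      using zero_le_power2[of "norm (F \<xi>) - norm (F \<eta>)"] by (simp add: power2_diff)
    from mult_right_mono[OF this ck]
    have "(c * norm (F \<xi>)) * (norm (F \<eta>) * k \<xi> \<eta>) \<le> (norm (F \<xi>))\<^sup>2 / 2 * (c * k \<xi> \<eta>) + (norm (F \<eta>))\<^sup>2 / 2 * (c * k \<xi> \<eta>)"
      unfolding distrib_right by (simp only: mult_ac)
    from ennreal_leI[OF this]
    have "ennreal ((c * norm (F \<xi>)) * (norm (F \<eta>) * k \<xi> \<eta>)) \<le> ennreal ((norm (F \<xi>))\<^sup>2 / 2 * (c * k \<xi> \<eta>)) + ennreal ((norm (F \<eta>))\<^sup>2 / 2 * (c * k \<xi> \<eta>))"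
      using ck by (subst (asm) ennreal_plus) auto
    then show "ennreal (c * norm (F \<xi>)) * ennreal (norm (F \<eta>) * k \<xi> \<eta>) \<le>
      ennreal ((norm (F \<xi>))\<^sup>2 / 2) * ennreal (c * k \<xi> \<eta>) + ennreal ((norm (F \<eta>))\<^sup>2 / 2) * ennreal (c * k \<xi> \<eta>)"
      using c by (subst (asm) (1 2 3) ennreal_mult') auto
  qed
  also have "\<dots> = (\<integral>\<^sup>+\<xi>. (\<integral>\<^sup>+\<eta>. ennreal ((norm (F \<xi>))\<^sup>2 / 2) * ennreal (c * k \<xi> \<eta>) \<partial>lborel) + (\<integral>\<^sup>+\<eta>. ennreal ((norm (F \<eta>))\<^sup>2 / 2) * ennreal (c * k \<xi> \<eta>) \<partial>lborel) \<partial>lborel)"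
    by (intro nn_integral_cong nn_integral_add) measurable
  also have "\<dots> = (\<integral>\<^sup>+\<xi>. (\<integral>\<^sup>+\<eta>. ennreal ((norm (F \<xi>))\<^sup>2 / 2) * ennreal (c * k \<xi> \<eta>) \<partial>lborel) \<partial>lborel) + (\<integral>\<^sup>+\<xi>. (\<integral>\<^sup>+\<eta>. ennreal ((norm (F \<eta>))\<^sup>2 / 2) * ennreal (c * k \<xi> \<eta>) \<partial>lborel) \<partial>lborel)"
    by (rule nn_integral_add) measurable
  also have "(\<integral>\<^sup>+\<xi>. (\<integral>\<^sup>+\<eta>. ennreal ((norm (F \<eta>))\<^sup>2 / 2) * ennreal (c * k \<xi> \<eta>) \<partial>lborel) \<partial>lborel) = (\<integral>\<^sup>+\<eta>. (\<integral>\<^sup>+\<xi>. ennreal ((norm (F \<eta>))\<^sup>2 / 2) * ennreal (c * k \<xi> \<eta>) \<partial>lborel) \<partial>lborel)"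
    by (rule lborel_pair.Fubini'[symmetric]) measurable
  also have "(\<integral>\<^sup>+\<eta>. (\<integral>\<^sup>+\<xi>. ennreal ((norm (F \<eta>))\<^sup>2 / 2) * ennreal (c * k \<xi> \<eta>) \<partial>lborel) \<partial>lborel) = (\<integral>\<^sup>+\<eta>. ennreal ((norm (F \<eta>))\<^sup>2 / 2) \<partial>lborel)"
    by (intro nn_integral_cong, subst nn_integral_cmult) (simp_all add: K')
  also have "(\<integral>\<^sup>+\<xi>. (\<integral>\<^sup>+\<eta>. ennreal ((norm (F \<xi>))\<^sup>2 / 2) * ennreal (c * k \<xi> \<eta>) \<partial>lborel) \<partial>lborel) = (\<integral>\<^sup>+\<xi>. ennreal ((norm (F \<xi>))\<^sup>2 / 2) \<partial>lborel)"
    by (intro nn_integral_cong, subst nn_integral_cmult) (simp_all add: K)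
  also have "(\<integral>\<^sup>+\<xi>. ennreal ((norm (F \<xi>))\<^sup>2 / 2) \<partial>lborel) + (\<integral>\<^sup>+\<xi>. ennreal ((norm (F \<xi>))\<^sup>2 / 2) \<partial>lborel) = (\<integral>\<^sup>+\<xi>. ennreal ((norm (F \<xi>))\<^sup>2 / 2) + ennreal ((norm (F \<xi>))\<^sup>2 / 2) \<partial>lborel)"
    by (rule nn_integral_add[symmetric]) measurable
  also have "\<dots> = (\<integral>\<^sup>+\<xi>. ennreal ((norm (F \<xi>))\<^sup>2) \<partial>lborel)"
    by (intro nn_integral_cong) (simp add: ennreal_plus[symmetric] del: ennreal_plus)
  finally show ?thesis .
qed

text \<open>Fatou's lemma removes the Gaussian factor from the energy bound as e -> 0.\<close>

theorem inv_ft_Plancherel_le: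
  fixes F :: "real ^ 'd::finite \<Rightarrow> complex"
  assumes F: "integrable lebesgue F"
  shows "(\<integral>\<^sup>+x. ennreal ((norm (inv_ft F x))\<^sup>2) \<partial>lebesgue) \<le> (\<integral>\<^sup>+\<xi>. ennreal ((norm (F \<xi>))\<^sup>2) \<partial>lebesgue)"
proof -
  obtain F' where [measurable]: "F' \<in> borel_measurable borel" and eq: "AE \<xi> in lebesgue. F \<xi> = F' \<xi>"
    and iF': "integrable lborel F'" and ieq: "inv_ft F = inv_ft F'"
    by (rule integrable_borel_version[OF F])
  note [measurable] = inv_ft_measurable[OF F, unfolded ieq]
  define e where "e n = 1 / real (Suc n)" for n
  have e: "e \<longlonglongrightarrow> 0" "\<And>n. 0 < e n"
    unfolding e_def using LIMSEQ_inverse_real_of_nat by (auto simp: inverse_eq_divide)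
  have lim: "(\<lambda>n. ennreal ((norm (inv_ft F' x))\<^sup>2 * exp (- (e n * norm x)\<^sup>2 / 2))) \<longlonglongrightarrow> ennreal ((norm (inv_ft F' x))\<^sup>2)" for x
  proof -
    have "(\<lambda>n. (norm (inv_ft F' x))\<^sup>2 * exp (- (e n * norm x)\<^sup>2 / 2)) \<longlonglongrightarrow> (norm (inv_ft F' x))\<^sup>2 * exp (- (0 * norm x)\<^sup>2 / 2)"
      by (intro tendsto_intros e) simp
    then show ?thesis by (intro tendsto_ennrealI) simp
  qed
  have "(\<integral>\<^sup>+x. ennreal ((norm (inv_ft F x))\<^sup>2) \<partial>lebesgue) = (\<integral>\<^sup>+x. ennreal ((norm (inv_ft F' x))\<^sup>2) \<partial>lborel)"
    unfolding ieq by (rule nn_integral_completion)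
  also have "\<dots> = (\<integral>\<^sup>+x. liminf (\<lambda>n. ennreal ((norm (inv_ft F' x))\<^sup>2 * exp (- (e n * norm x)\<^sup>2 / 2))) \<partial>lborel)"
    by (intro nn_integral_cong lim_imp_Liminf[symmetric] lim) auto
  also have "\<dots> \<le> liminf (\<lambda>n. \<integral>\<^sup>+x. ennreal ((norm (inv_ft F' x))\<^sup>2 * exp (- (e n * norm x)\<^sup>2 / 2)) \<partial>lborel)"
    by (intro nn_integral_liminf) measurable
  also have "\<dots> \<le> liminf (\<lambda>n::nat. \<integral>\<^sup>+\<xi>. ennreal ((norm (F' \<xi>))\<^sup>2) \<partial>lborel)"
    by (intro Liminf_mono always_eventually allI inv_ft_gaussian_energy iF' e) measurable
  also have "\<dots> = (\<integral>\<^sup>+\<xi>. ennreal ((norm (F' \<xi>))\<^sup>2) \<partial>lebesgue)"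
    by (simp add: Liminf_const nn_integral_completion)
  also have "\<dots> = (\<integral>\<^sup>+\<xi>. ennreal ((norm (F \<xi>))\<^sup>2) \<partial>lebesgue)"
    by (rule nn_integral_cong_AE) (use eq in \<open>auto elim: eventually_mono\<close>)
  finally show ?thesis .
qed

lemma square_integrable_nn_le:
  assumes "f \<in> borel_measurable M" "(\<integral>\<^sup>+x. ennreal ((norm (f x))\<^sup>2) \<partial>M) \<le> ennreal B"
  shows "square_integrable M f" and "0 \<le> B \<Longrightarrow> ip M f f \<le> B"
proof -
  show s: "square_integrable M f"
    unfolding square_integrable_iff_nn using assms by (auto intro: le_less_trans)
  show "ip M f f \<le> B" if "0 \<le> B"
    using assms(2) that unfolding nn_integral_norm_square[OF s] by (simp add: ennreal_le_iff)
qed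

lemma square_integrable_norm:
  assumes "square_integrable M f"
  shows "square_integrable M (\<lambda>x. norm (f x))" "ip M (\<lambda>x. norm (f x)) (\<lambda>x. norm (f x)) = ip M f f"
  using assms by (auto simp: square_integrable_def ip_self)

lemma square_integrable_mult:
  fixes u v :: "'a \<Rightarrow> complex"
  assumes u: "square_integrable M u" and v: "square_integrable M v"
  shows "integrable M (\<lambda>x. u x * v x)"
    and "norm (LINT x|M. u x * v x) \<le> sqrt (ip M u u) * sqrt (ip M v v)"
    and "(LINT x|M. norm (u x * v x)) \<le> sqrt (ip M u u) * sqrt (ip M v v)"
proof -
  note [measurable] = assms[THEN square_integrable_measurable]
  note n = square_integrable_norm[OF u] square_integrable_norm[OF v]
  have i: "integrable M (\<lambda>x. norm (u x) \<bullet> norm (v x))" by (rule integrable_inner[OF n(1,3)])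
  show "integrable M (\<lambda>x. u x * v x)"
    by (rule Bochner_Integration.integrable_bound[OF i]) (auto simp: norm_mult)
  have "(LINT x|M. norm (u x * v x)) = ip M (\<lambda>x. norm (u x)) (\<lambda>x. norm (v x))"
    by (simp add: ip_def norm_mult)
  also have "\<dots> \<le> sqrt (ip M u u) * sqrt (ip M v v)"
    using ip_Cauchy_Schwarz[OF n(1,3)] unfolding n(2,4) by simp
  finally show le: "(LINT x|M. norm (u x * v x)) \<le> sqrt (ip M u u) * sqrt (ip M v v)" .
  show "norm (LINT x|M. u x * v x) \<le> sqrt (ip M u u) * sqrt (ip M v v)"
    using integral_norm_bound[of M "\<lambda>x. u x * v x"] le by linarith
qed

lemma square_integrable_of_bounded_integrable:
  fixes u :: "'a \<Rightarrow> complex"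
  assumes "integrable M u" "\<And>x. norm (u x) \<le> B"
  shows "square_integrable M u"
  unfolding square_integrable_def
proof
  show "u \<in> borel_measurable M" using assms by auto
  then show "integrable M (\<lambda>x. (norm (u x))\<^sup>2)"
    by (intro Bochner_Integration.integrable_bound[OF integrable_mult_right[OF integrable_norm[OF assms(1)], of B]])
       (auto simp: power2_eq_square intro!: AE_I2 mult_right_mono order_trans[OF assms(2) abs_ge_self] simp: abs_mult)
qed

lemma schwartz_square_integrable:
  assumes "\<phi> \<in> schwartz"
  shows "square_integrable lebesgue \<phi>" "square_integrable lebesgue (schwartz_fourier \<phi>)"
proof -
  obtain B where "\<And>x. norm (\<phi> x) \<le> B / (1 + norm x) ^ 0" using schwartz_bound[OF assms] by metis
  then show "square_integrable lebesgue \<phi>"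
    using schwartz_integrable[OF assms, of 0] by (intro square_integrable_of_bounded_integrable) auto
  obtain B where "\<And>x. norm (schwartz_fourier \<phi> x) \<le> B" using schwartz_fourier_bounded by blast
  then show "square_integrable lebesgue (schwartz_fourier \<phi>)"
    using schwartz_fourier_integrable[OF assms, of 0] by (intro square_integrable_of_bounded_integrable) auto
qed

section \<open>Band-limited truncations\<close>

text \<open>The weight undoes the normalisation g = |xi|^s f^: the result is the transform of f
  restricted to |xi| <= A, while the homogeneous Sobolev norm of f is the \<open>L^2\<close> norm of
  g.\<close>

definition cutoff :: "real \<Rightarrow> real \<Rightarrow> (real ^ 'd::finite \<Rightarrow> complex) \<Rightarrow> real ^ 'd \<Rightarrow> complex" where
  "cutoff s A g \<xi> = of_real (indicator (cball 0 A) \<xi> * norm \<xi> powr (- s)) * g \<xi>"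

definition band_inv :: "real \<Rightarrow> real \<Rightarrow> (real ^ 'd::finite \<Rightarrow> complex) \<Rightarrow> real ^ 'd \<Rightarrow> complex" where
  "band_inv s A g = inv_ft (cutoff s A g)"

text \<open>The inverse Fourier transform of \<open>|\<xi>|\<^sup>-\<^sup>s g\<close> for square-integrable \<open>g\<close>; the limit exists almost
  everywhere (the value of \<open>lim\<close> is irrelevant elsewhere).\<close>

definition full_inv :: "real \<Rightarrow> (real ^ 'd::finite \<Rightarrow> complex) \<Rightarrow> real ^ 'd \<Rightarrow> complex" where
  "full_inv s g x = lim (\<lambda>j. band_inv s (2 ^ j) g x)"

lemma weight_measurable[measurable]:
  "(\<lambda>\<xi>::real ^ 'd::finite. norm \<xi> powr a) \<in> borel_measurable borel"
  by (intro powr_real_measurable) auto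

lemma cball_measurable[measurable]: "cball (0::real ^ 'd::finite) A \<in> sets borel"
  by simp

lemma weight_lebesgue_measurable:
  "(\<lambda>\<xi>::real ^ 'd::finite. norm \<xi> powr a) \<in> borel_measurable lebesgue"
  "(\<lambda>\<xi>::real ^ 'd::finite. indicator (cball 0 A) \<xi> * norm \<xi> powr a :: real) \<in> borel_measurable lebesgue"
  "(\<lambda>\<xi>::real ^ 'd::finite. complex_of_real (indicator (cball 0 A) \<xi> * norm \<xi> powr a)) \<in> borel_measurable lebesgue"
  "(\<lambda>\<xi>::real ^ 'd::finite. indicator (- cball 0 A) \<xi> * norm \<xi> powr a :: real) \<in> borel_measurable lebesgue"
  by (rule measurable_completion, measurable)+

text \<open>The squared \<open>L^2\<close> mass of the transform of f above frequency A, in the same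
  normalisation g = |xi|^s f^.\<close>

definition tail :: "real \<Rightarrow> real \<Rightarrow> (real ^ 'd::finite \<Rightarrow> 'b::real_normed_vector) \<Rightarrow> ennreal" where
  "tail s A g = (\<integral>\<^sup>+\<xi>. ennreal (indicator (- cball 0 A) \<xi> * norm \<xi> powr (- 2 * s) * (norm (g \<xi>))\<^sup>2) \<partial>lebesgue)"

lemma two_power_powr: "((2::real) ^ j) powr (- 2 * s) = (2 powr (- 2 * s)) ^ j"
  by (simp add: powr_realpow[symmetric] powr_powr mult.commute)

context
  fixes s :: real and dt :: "'d::finite itself"
  assumes s: "0 < s" "s < real CARD('d) / 2"
begin

text \<open>The square root of the Riesz kernel integral, of order A^(d - 2s). This is the origin of
  the exponent d/2 - s in all low-frequency bounds.\<close>

lemma cutoff_weight: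
  obtains C where "0 \<le> C" "\<And>A. 0 < A \<Longrightarrow>
    square_integrable lebesgue (\<lambda>\<xi>::real ^ 'd. complex_of_real (indicator (cball 0 A) \<xi> * norm \<xi> powr (- s)))"
    "\<And>A. 0 < A \<Longrightarrow> sqrt (ip lebesgue (\<lambda>\<xi>::real ^ 'd. complex_of_real (indicator (cball 0 A) \<xi> * norm \<xi> powr (- s)))
      (\<lambda>\<xi>. complex_of_real (indicator (cball 0 A) \<xi> * norm \<xi> powr (- s)))) \<le> C * A powr (real CARD('d) / 2 - s)"
proof -
  obtain C where C: "0 \<le> C" "\<And>A. 0 < A \<Longrightarrow>
    (\<integral>\<^sup>+x. indicator (cball 0 A) x * ennreal (norm (x::real ^ 'd) powr (- 2 * s)) \<partial>lebesgue) = ennreal (C * A powr (real CARD('d) - 2 * s))"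
    using riesz_kernel_ball[where 'a="real ^ 'd", of s] s by auto
  let ?w = "\<lambda>A \<xi>::real ^ 'd. complex_of_real (indicator (cball 0 A) \<xi> * norm \<xi> powr (- s))"
  have sq: "(norm (?w A \<xi>))\<^sup>2 = indicator (cball 0 A) \<xi> * norm \<xi> powr (- 2 * s)" for A \<xi>
    by (simp add: norm_mult power_mult_distrib powr_add[symmetric] power2_eq_square split: split_indicator)
  have nn: "(\<integral>\<^sup>+\<xi>. ennreal ((norm (?w A \<xi>))\<^sup>2) \<partial>lebesgue) = ennreal (C * A powr (real CARD('d) - 2 * s))" if "0 < A" for A
    unfolding sq C(2)[OF that, symmetric] by (intro nn_integral_cong) (auto split: split_indicator)
  have m: "?w A \<in> borel_measurable lebesgue" for A
    by (rule weight_lebesgue_measurable)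
  show ?thesis
  proof (rule that[of "sqrt C"])
    show "0 \<le> sqrt C" using C by simp
    fix A :: real assume A: "0 < A"
    show "square_integrable lebesgue (?w A)"
      using nn[OF A] by (intro square_integrable_nn_le(1)[OF m, of _ "C * A powr (real CARD('d) - 2 * s)"]) simp
    have "ip lebesgue (?w A) (?w A) \<le> C * A powr (real CARD('d) - 2 * s)"
      using nn[OF A] C(1) by (intro square_integrable_nn_le(2)[OF m]) auto
    then have "sqrt (ip lebesgue (?w A) (?w A)) \<le> sqrt (C * A powr (real CARD('d) - 2 * s))"
      by (rule real_sqrt_le_mono)
    also have "\<dots> = sqrt C * A powr ((real CARD('d) - 2 * s) / 2)"
      by (simp add: real_sqrt_mult powr_half_sqrt[symmetric] powr_powr)
    also have "(real CARD('d) - 2 * s) / 2 = real CARD('d) / 2 - s" by (simp add: field_simps)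
    finally show "sqrt (ip lebesgue (?w A) (?w A)) \<le> sqrt C * A powr (real CARD('d) / 2 - s)" .
  qed
qed

lemma cutoff_integrable:
  fixes g :: "real ^ 'd \<Rightarrow> complex"
  assumes "square_integrable lebesgue g"
  shows "integrable lebesgue (cutoff s A g)"
proof (cases "0 < A")
  case True
  have "square_integrable lebesgue (\<lambda>\<xi>::real ^ 'd. complex_of_real (indicator (cball 0 A) \<xi> * norm \<xi> powr (- s)))"
    by (rule cutoff_weight) (use True in blast)
  then show ?thesis
    unfolding cutoff_def[abs_def] by (rule square_integrable_mult(1)[OF _ assms])
next
  case False
  have "cutoff s A g = (\<lambda>\<xi>. 0)"
  proof
    fix \<xi> :: "real ^ 'd"
    \<comment> \<open>For A <= 0 the ball contains at most the origin, where
      \<open>0 powr (- s)\<close> takes the value 0.\<close>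
    have "\<xi> = 0 \<or> \<xi> \<notin> cball 0 A" using False norm_le_zero_iff[of \<xi>] by (auto simp del: norm_le_zero_iff)
    then show "cutoff s A g \<xi> = 0" by (auto simp: cutoff_def)
  qed
  then show ?thesis by simp
qed

text \<open>A Bernstein-type bound: Cauchy-Schwarz between the weight on the ball and g. The summand
  1 in the constant only ensures that it is positive.\<close>

lemma band_inv_bound:
  obtains C where "0 < C" "\<And>A (g :: real ^ 'd \<Rightarrow> complex) x. 0 < A \<Longrightarrow> square_integrable lebesgue g \<Longrightarrow>
    norm (band_inv s A g x) \<le> C * A powr (real CARD('d) / 2 - s) * sqrt (ip lebesgue g g)"
proof -
  obtain C where C: "0 \<le> C" "\<And>A. 0 < A \<Longrightarrow>
    square_integrable lebesgue (\<lambda>\<xi>::real ^ 'd. complex_of_real (indicator (cball 0 A) \<xi> * norm \<xi> powr (- s)))"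
    "\<And>A. 0 < A \<Longrightarrow> sqrt (ip lebesgue (\<lambda>\<xi>::real ^ 'd. complex_of_real (indicator (cball 0 A) \<xi> * norm \<xi> powr (- s)))
      (\<lambda>\<xi>. complex_of_real (indicator (cball 0 A) \<xi> * norm \<xi> powr (- s)))) \<le> C * A powr (real CARD('d) / 2 - s)"
    by (rule cutoff_weight) blast
  let ?c = "(2 * pi) powr (- (real CARD('d) / 2))"
  show ?thesis
  proof (rule that[of "?c * C + 1"])
    show "0 < ?c * C + 1" using C(1) by (intro add_nonneg_pos mult_nonneg_nonneg) auto
    fix A :: real and g :: "real ^ 'd \<Rightarrow> complex" and x
    assume A: "0 < A" and g: "square_integrable lebesgue g"
    have "norm (band_inv s A g x) \<le> ?c * (LINT \<xi>|lebesgue. norm (cutoff s A g \<xi>))"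
      unfolding band_inv_def by (rule norm_inv_ft_le)
    also have "\<dots> \<le> ?c * (C * A powr (real CARD('d) / 2 - s) * sqrt (ip lebesgue g g))"
      unfolding cutoff_def
      by (intro mult_left_mono order_trans[OF square_integrable_mult(3)[OF C(2)[OF A] g]] mult_right_mono C(3)[OF A]) auto
    also have "\<dots> = (?c * C) * (A powr (real CARD('d) / 2 - s) * sqrt (ip lebesgue g g))" by (simp only: mult_ac)
    also have "\<dots> \<le> (?c * C + 1) * (A powr (real CARD('d) / 2 - s) * sqrt (ip lebesgue g g))"
      by (intro mult_right_mono) auto
    finally show "norm (band_inv s A g x) \<le> (?c * C + 1) * A powr (real CARD('d) / 2 - s) * sqrt (ip lebesgue g g)"
      by (simp only: mult.assoc)
  qed
qed

lemma tail_le: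
  fixes g :: "real ^ 'd \<Rightarrow> 'b::euclidean_space"
  assumes g: "square_integrable lebesgue g" and A: "0 < A"
  shows "tail s A g \<le> ennreal (A powr (- 2 * s) * ip lebesgue g g)"
proof -
  have "tail s A g \<le> (\<integral>\<^sup>+\<xi>. ennreal (A powr (- 2 * s)) * ennreal ((norm (g \<xi>))\<^sup>2) \<partial>lebesgue)"
    unfolding tail_def
  proof (intro nn_integral_mono)
    fix \<xi> :: "real ^ 'd"
    have "indicator (- cball 0 A) \<xi> * norm \<xi> powr (- 2 * s) \<le> A powr (- 2 * s)"
      using s A by (auto simp: indicator_def intro!: powr_mono2')
    then have "indicator (- cball 0 A) \<xi> * norm \<xi> powr (- 2 * s) * (norm (g \<xi>))\<^sup>2 \<le> A powr (- 2 * s) * (norm (g \<xi>))\<^sup>2"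
      by (rule mult_right_mono) simp
    then show "ennreal (indicator (- cball 0 A) \<xi> * norm \<xi> powr (- 2 * s) * (norm (g \<xi>))\<^sup>2) \<le> ennreal (A powr (- 2 * s)) * ennreal ((norm (g \<xi>))\<^sup>2)"
      unfolding ennreal_mult'[OF powr_ge_zero, symmetric] by (rule ennreal_leI)
  qed
  also have "\<dots> = ennreal (A powr (- 2 * s)) * (\<integral>\<^sup>+\<xi>. ennreal ((norm (g \<xi>))\<^sup>2) \<partial>lebesgue)"
    using square_integrable_measurable[OF g] by (intro nn_integral_cmult) measurable
  also have "\<dots> = ennreal (A powr (- 2 * s) * ip lebesgue g g)"
    unfolding nn_integral_norm_square[OF g] ennreal_mult'[OF powr_ge_zero] ..
  finally show ?thesis .
qed

text \<open>The truncations differ only on the shell between the two radii, where Plancherel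
  applies; enlarging the shell to the complement of the ball makes the bound independent of
  B.\<close>

lemma band_inv_diff_le:
  fixes g :: "real ^ 'd \<Rightarrow> complex"
  assumes g: "square_integrable lebesgue g" and AB: "A \<le> B"
  shows "(\<integral>\<^sup>+x. ennreal ((norm (band_inv s B g x - band_inv s A g x))\<^sup>2) \<partial>lebesgue) \<le> tail s A g"
proof -
  have "(\<integral>\<^sup>+x. ennreal ((norm (band_inv s B g x - band_inv s A g x))\<^sup>2) \<partial>lebesgue) =
    (\<integral>\<^sup>+x. ennreal ((norm (inv_ft (\<lambda>\<xi>. cutoff s B g \<xi> - cutoff s A g \<xi>) x))\<^sup>2) \<partial>lebesgue)"
    unfolding band_inv_def by (simp add: inv_ft_diff[OF cutoff_integrable[OF g] cutoff_integrable[OF g]])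
  also have "\<dots> \<le> (\<integral>\<^sup>+\<xi>. ennreal ((norm (cutoff s B g \<xi> - cutoff s A g \<xi>))\<^sup>2) \<partial>lebesgue)"
    by (intro inv_ft_Plancherel_le Bochner_Integration.integrable_diff cutoff_integrable[OF g])
  also have "\<dots> \<le> tail s A g"
    unfolding tail_def
  proof (intro nn_integral_mono ennreal_leI)
    fix \<xi> :: "real ^ 'd"
    have sq: "(norm \<xi> powr (- s))\<^sup>2 = norm \<xi> powr (- 2 * s)"
      by (simp add: powr_add[symmetric] power2_eq_square)
    have 1: "cutoff s B g \<xi> - cutoff s A g \<xi> = of_real (indicator (cball 0 B - cball 0 A) \<xi> * norm \<xi> powr (- s)) * g \<xi>"
      using AB by (auto simp: cutoff_def indicator_def)
    have "(norm (cutoff s B g \<xi> - cutoff s A g \<xi>))\<^sup>2 = (indicator (cball 0 B - cball 0 A) \<xi>)\<^sup>2 * (norm \<xi> powr (- s))\<^sup>2 * (norm (g \<xi>))\<^sup>2"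
      unfolding 1 by (simp add: norm_mult power_mult_distrib)
    also have "\<dots> \<le> indicator (- cball 0 A) \<xi> * (norm \<xi> powr (- s))\<^sup>2 * (norm (g \<xi>))\<^sup>2"
      by (intro mult_right_mono) (auto simp: indicator_def)
    finally show "(norm (cutoff s B g \<xi> - cutoff s A g \<xi>))\<^sup>2 \<le> indicator (- cball 0 A) \<xi> * norm \<xi> powr (- 2 * s) * (norm (g \<xi>))\<^sup>2"
      unfolding sq .
  qed
  finally show ?thesis .
qed

lemma band_inv_measurable:
  fixes g :: "real ^ 'd \<Rightarrow> complex"
  assumes "square_integrable lebesgue g"
  shows "band_inv s A g \<in> borel_measurable borel"
  unfolding band_inv_def by (intro inv_ft_measurable cutoff_integrable assms)

lemma full_inv_measurable:
  fixes g :: "real ^ 'd \<Rightarrow> complex"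
  assumes "square_integrable lebesgue g"
  shows "full_inv s g \<in> borel_measurable borel"
  unfolding full_inv_def[abs_def] by (intro borel_measurable_lim_metric band_inv_measurable assms)

text \<open>Consecutive dyadic truncations differ in squared \<open>L^2\<close> norm by at most the
  tail at 2^j, which decays geometrically with ratio 2^(-2s).\<close>

lemma full_inv_limit:
  fixes g :: "real ^ 'd \<Rightarrow> complex"
  assumes g: "square_integrable lebesgue g"
  shows "AE x in lebesgue. (\<lambda>j. band_inv s (2 ^ j) g x) \<longlonglongrightarrow> full_inv s g x"
proof -
  have "AE x in lebesgue. convergent (\<lambda>j. band_inv s (2 ^ j) g x)"
  proof (rule AE_convergent_of_geometric_L2)
    show "band_inv s (2 ^ j) g \<in> borel_measurable lebesgue" for j
      using band_inv_measurable[OF g] by (intro measurable_completion) simp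
    show "(\<integral>\<^sup>+x. ennreal ((norm (band_inv s (2 ^ Suc j) g x - band_inv s (2 ^ j) g x))\<^sup>2) \<partial>lebesgue) \<le> ennreal (ip lebesgue g g * (2 powr (- 2 * s)) ^ j)" for j
    proof -
      have "(\<integral>\<^sup>+x. ennreal ((norm (band_inv s (2 ^ Suc j) g x - band_inv s (2 ^ j) g x))\<^sup>2) \<partial>lebesgue) \<le> tail s (2 ^ j) g"
        by (rule band_inv_diff_le[OF g]) simp
      also have "\<dots> \<le> ennreal ((2 ^ j) powr (- 2 * s) * ip lebesgue g g)" by (rule tail_le[OF g]) simp
      finally show ?thesis unfolding two_power_powr by (simp only: mult.commute)
    qed
    show "2 powr (- 2 * s) < 1" using s by (intro powr_less_one) auto
  qed auto
  then show ?thesis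
    unfolding full_inv_def by (auto elim!: eventually_mono simp: convergent_LIMSEQ_iff)
qed

lemma full_inv_band_le:
  fixes g :: "real ^ 'd \<Rightarrow> complex"
  assumes g: "square_integrable lebesgue g"
  shows "(\<integral>\<^sup>+x. ennreal ((norm (full_inv s g x - band_inv s A g x))\<^sup>2) \<partial>lebesgue) \<le> tail s A g"
proof -
  note [measurable] = band_inv_measurable[OF g] full_inv_measurable[OF g]
  have m: "(\<lambda>x. ennreal ((norm (band_inv s (2 ^ j) g x - band_inv s A g x))\<^sup>2)) \<in> borel_measurable lebesgue" for j
    by (rule measurable_completion) measurable
  have "(\<integral>\<^sup>+x. ennreal ((norm (full_inv s g x - band_inv s A g x))\<^sup>2) \<partial>lebesgue) =
     (\<integral>\<^sup>+x. liminf (\<lambda>j. ennreal ((norm (band_inv s (2 ^ j) g x - band_inv s A g x))\<^sup>2)) \<partial>lebesgue)"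
  proof (rule nn_integral_cong_AE)
    show "AE x in lebesgue. ennreal ((norm (full_inv s g x - band_inv s A g x))\<^sup>2) =
       liminf (\<lambda>j. ennreal ((norm (band_inv s (2 ^ j) g x - band_inv s A g x))\<^sup>2))"
      using full_inv_limit[OF g]
    proof eventually_elim
      case (elim x)
      then show ?case
        by (intro lim_imp_Liminf[symmetric] tendsto_ennrealI tendsto_intros) auto
    qed
  qed
  also have "\<dots> \<le> liminf (\<lambda>j. \<integral>\<^sup>+x. ennreal ((norm (band_inv s (2 ^ j) g x - band_inv s A g x))\<^sup>2) \<partial>lebesgue)"
    by (intro nn_integral_liminf m)
  also have "\<dots> \<le> liminf (\<lambda>j::nat. tail s A g)"
  proof (rule Liminf_mono)
    obtain J where J: "A < 2 ^ J" using real_arch_pow[of 2 A] by auto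
    show "\<forall>\<^sub>F j in sequentially. (\<integral>\<^sup>+x. ennreal ((norm (band_inv s (2 ^ j) g x - band_inv s A g x))\<^sup>2) \<partial>lebesgue) \<le> tail s A g"
      using eventually_ge_at_top[of J]
    proof eventually_elim
      case (elim j)
      then have "(2::real) ^ J \<le> 2 ^ j" by (intro power_increasing) auto
      then show ?case using J by (intro band_inv_diff_le g) linarith
    qed
  qed
  also have "\<dots> = tail s A g" by (simp add: Liminf_const)
  finally show ?thesis .
qed

lemma full_inv_band_square_integrable:
  fixes g :: "real ^ 'd \<Rightarrow> complex"
  assumes g: "square_integrable lebesgue g" and A: "0 < A"
  shows "square_integrable lebesgue (\<lambda>x. full_inv s g x - band_inv s A g x)"
    and "ip lebesgue (\<lambda>x. full_inv s g x - band_inv s A g x) (\<lambda>x. full_inv s g x - band_inv s A g x) \<le> A powr (- 2 * s) * ip lebesgue g g"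
proof -
  note [measurable] = band_inv_measurable[OF g] full_inv_measurable[OF g]
  have m: "(\<lambda>x. full_inv s g x - band_inv s A g x) \<in> borel_measurable lebesgue"
    by (rule measurable_completion) measurable
  note le = order_trans[OF full_inv_band_le[OF g] tail_le[OF g A]]
  show "square_integrable lebesgue (\<lambda>x. full_inv s g x - band_inv s A g x)"
    by (rule square_integrable_nn_le(1)[OF m le])
  show "ip lebesgue (\<lambda>x. full_inv s g x - band_inv s A g x) (\<lambda>x. full_inv s g x - band_inv s A g x) \<le> A powr (- 2 * s) * ip lebesgue g g"
    by (rule square_integrable_nn_le(2)[OF m le]) simp
qed

text \<open>A dilation by A turns the cutoffs 2^j into A 2^j, so the limit has to be available along
  these sequences too and not only along the one in the definition.\<close>

lemma full_inv_limit_scaled: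
  fixes g :: "real ^ 'd \<Rightarrow> complex"
  assumes g: "square_integrable lebesgue g" and A: "0 < A"
  shows "AE x in lebesgue. (\<lambda>j. band_inv s (A * 2 ^ j) g x) \<longlonglongrightarrow> full_inv s g x"
proof -
  note [measurable] = band_inv_measurable[OF g] full_inv_measurable[OF g]
  have "AE x in lebesgue. summable (\<lambda>j. norm (full_inv s g x - band_inv s (A * 2 ^ j) g x))"
  proof (rule AE_summable_of_geometric_L2)
    show "(\<lambda>x. norm (full_inv s g x - band_inv s (A * 2 ^ j) g x)) \<in> borel_measurable lebesgue" for j
      by (rule measurable_completion) measurable
    show "(\<integral>\<^sup>+x. ennreal ((norm (full_inv s g x - band_inv s (A * 2 ^ j) g x))\<^sup>2) \<partial>lebesgue) \<le> ennreal (A powr (- 2 * s) * ip lebesgue g g * (2 powr (- 2 * s)) ^ j)" for j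
    proof -
      have "(\<integral>\<^sup>+x. ennreal ((norm (full_inv s g x - band_inv s (A * 2 ^ j) g x))\<^sup>2) \<partial>lebesgue) \<le> ennreal ((A * 2 ^ j) powr (- 2 * s) * ip lebesgue g g)"
        by (rule order_trans[OF full_inv_band_le[OF g] tail_le[OF g]]) (use A in simp)
      also have "(A * 2 ^ j) powr (- 2 * s) * ip lebesgue g g = A powr (- 2 * s) * ip lebesgue g g * (2 powr (- 2 * s)) ^ j"
        unfolding two_power_powr[symmetric] using A by (subst powr_mult) auto
      finally show ?thesis .
    qed
    show "2 powr (- 2 * s) < 1" using s by (intro powr_less_one) auto
  qed auto
  then show ?thesis
  proof eventually_elim
    case (elim x)
    then have "(\<lambda>j. norm (full_inv s g x - band_inv s (A * 2 ^ j) g x)) \<longlonglongrightarrow> 0" by (rule summable_LIMSEQ_zero)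
    then have "(\<lambda>j. norm (band_inv s (A * 2 ^ j) g x - full_inv s g x)) \<longlonglongrightarrow> 0" by (simp only: norm_minus_commute)
    then show ?case by (subst LIM_zero_iff[symmetric], subst tendsto_norm_zero_iff[symmetric])
  qed
qed

end

section \<open>Tempered functions and uniqueness of Fourier transforms\<close>

lemma inverse_power_measurable_lebesgue:
  "(\<lambda>x::real ^ 'd::finite. (1 + norm x) ^ N) \<in> borel_measurable lebesgue"
  "(\<lambda>x::real ^ 'd::finite. inverse ((1 + norm x) ^ N)) \<in> borel_measurable lebesgue"
  by (rule measurable_completion, measurable)+

lemma tempered_measurable:
  fixes f :: "real ^ 'd::finite \<Rightarrow> complex"
  assumes "tempered f"
  shows "f \<in> borel_measurable lebesgue"
proof -
  obtain N where fN: "integrable lebesgue (\<lambda>x. f x /\<^sub>R (1 + norm x) ^ N)" using assms unfolding tempered_def by blast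
  from borel_measurable_scaleR[OF inverse_power_measurable_lebesgue(1) borel_measurable_integrable[OF fN]]
  have "(\<lambda>x. (1 + norm x) ^ N *\<^sub>R (f x /\<^sub>R (1 + norm x) ^ N)) \<in> borel_measurable lebesgue" .
  then show ?thesis by simp
qed

lemma temperedI:
  fixes f :: "real ^ 'd::finite \<Rightarrow> complex" and w :: "real ^ 'd \<Rightarrow> real"
  assumes "f \<in> borel_measurable lebesgue" "integrable lebesgue w"
    "AE x in lebesgue. norm (f x) / (1 + norm x) ^ N \<le> norm (w x)"
  shows "tempered f"
  unfolding tempered_def
proof
  show "integrable lebesgue (\<lambda>x. f x /\<^sub>R (1 + norm x) ^ N)"
    by (rule Bochner_Integration.integrable_bound[OF assms(2)])
       (use assms(1,3) in \<open>auto intro!: borel_measurable_scaleR inverse_power_measurable_lebesgue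
          elim!: eventually_mono simp: divide_inverse mult.commute\<close>)
qed

lemma tempered_integrable: "integrable lebesgue f \<Longrightarrow> tempered f"
  unfolding tempered_def by (intro exI[of _ 0]) simp

lemma tempered_bounded:
  fixes f :: "real ^ 'd::finite \<Rightarrow> complex"
  assumes "f \<in> borel_measurable lebesgue" "\<And>x. norm (f x) \<le> B"
  shows "tempered f"
proof (rule temperedI[OF assms(1)])
  show "integrable lebesgue (\<lambda>x::real ^ 'd. B * (1 / (1 + norm x) ^ (2 * CARD('d))))"
    by (intro integrable_mult_right integrable_inverse_1_plus_norm_power) simp
  show "AE x in lebesgue. norm (f x) / (1 + norm x) ^ (2 * CARD('d)) \<le> norm (B * (1 / (1 + norm x) ^ (2 * CARD('d))))"
    using assms(2) by (intro AE_I2) (auto simp: abs_mult intro!: divide_right_mono order_trans[OF assms(2) abs_ge_self])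
qed

lemma tempered_square_integrable:
  fixes f :: "real ^ 'd::finite \<Rightarrow> complex"
  assumes "square_integrable lebesgue f"
  shows "tempered f"
proof -
  let ?M = "2 * CARD('d)"
  let ?w = "\<lambda>x::real ^ 'd. complex_of_real (1 / (1 + norm x) ^ ?M)"
  have i: "integrable lebesgue ?w"
    by (intro integrable_of_real integrable_inverse_1_plus_norm_power) simp
  have "square_integrable lebesgue ?w"
  proof (rule square_integrable_of_bounded_integrable[OF i, of 1])
    fix x :: "real ^ 'd"
    have "\<bar>1 / y\<bar> \<le> 1" if "1 \<le> y" for y :: real using that by (simp add: abs_if field_simps)
    then show "norm (?w x) \<le> 1" unfolding norm_of_real by (simp add: one_le_power)
  qed
  then have "integrable lebesgue (\<lambda>x. ?w x * f x)" using assms by (rule square_integrable_mult(1))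
  moreover have "?w x * f x = f x /\<^sub>R (1 + norm x) ^ ?M" for x
    by (simp add: scaleR_conv_of_real[where 'a=complex] divide_inverse)
  ultimately show ?thesis unfolding tempered_def by auto
qed

lemma tempered_add:
  fixes f g :: "real ^ 'd::finite \<Rightarrow> complex"
  assumes f: "tempered f" and g: "tempered g"
  shows "tempered (\<lambda>x. f x + g x)"
proof -
  obtain N1 N2 where i: "integrable lebesgue (\<lambda>x. f x /\<^sub>R (1 + norm x) ^ N1)" "integrable lebesgue (\<lambda>x. g x /\<^sub>R (1 + norm x) ^ N2)"
    using assms unfolding tempered_def by blast
  have le: "norm (h x) / (1 + norm x) ^ (N + M) \<le> norm (h x /\<^sub>R (1 + norm x) ^ N)" for h :: "real ^ 'd \<Rightarrow> complex" and x N M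
  proof -
    have "(1 + norm x) ^ N \<le> (1 + norm x) ^ (N + M)" by (rule power_increasing) auto
    then have "norm (h x) / (1 + norm x) ^ (N + M) \<le> norm (h x) / (1 + norm x) ^ N"
      by (intro divide_left_mono) auto
    then show ?thesis by (simp add: divide_inverse mult.commute)
  qed
  show ?thesis
  proof (rule temperedI)
    show "(\<lambda>x. f x + g x) \<in> borel_measurable lebesgue"
      by (intro borel_measurable_add tempered_measurable f g)
    show "integrable lebesgue (\<lambda>x. norm (f x /\<^sub>R (1 + norm x) ^ N1) + norm (g x /\<^sub>R (1 + norm x) ^ N2))"
      using i by (intro Bochner_Integration.integrable_add integrable_norm)
    show "AE x in lebesgue. norm (f x + g x) / (1 + norm x) ^ (N1 + N2) \<le>
       norm (norm (f x /\<^sub>R (1 + norm x) ^ N1) + norm (g x /\<^sub>R (1 + norm x) ^ N2))"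
    proof (rule AE_I2)
      fix x
      have "norm (f x + g x) / (1 + norm x) ^ (N1 + N2) \<le> norm (f x) / (1 + norm x) ^ (N1 + N2) + norm (g x) / (1 + norm x) ^ (N2 + N1)"
        unfolding add.commute[of N2 N1] add_divide_distrib[symmetric] by (intro divide_right_mono norm_triangle_ineq) auto
      also have "\<dots> \<le> norm (f x /\<^sub>R (1 + norm x) ^ N1) + norm (g x /\<^sub>R (1 + norm x) ^ N2)"
        by (intro add_mono le)
      also have "\<dots> \<le> norm (norm (f x /\<^sub>R (1 + norm x) ^ N1) + norm (g x /\<^sub>R (1 + norm x) ^ N2))"
        unfolding real_norm_def by (rule abs_ge_self)
      finally show "norm (f x + g x) / (1 + norm x) ^ (N1 + N2) \<le>
       norm (norm (f x /\<^sub>R (1 + norm x) ^ N1) + norm (g x /\<^sub>R (1 + norm x) ^ N2))" .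
    qed
  qed
qed

lemma tempered_uminus: "tempered f \<Longrightarrow> tempered (\<lambda>x. - f x)"
  unfolding tempered_def by simp

lemma tempered_diff: "tempered f \<Longrightarrow> tempered g \<Longrightarrow> tempered (\<lambda>x. f x - g x)"
  using tempered_add[OF _ tempered_uminus] by fastforce

lemma tempered_schwartz_integrable:
  fixes f :: "real ^ 'd::finite \<Rightarrow> complex"
  assumes f: "tempered f" and phi: "\<phi> \<in> schwartz"
  shows "integrable lebesgue (\<lambda>x. f x * \<phi> x)"
proof -
  obtain N where fN: "integrable lebesgue (\<lambda>x. f x /\<^sub>R (1 + norm x) ^ N)" using f unfolding tempered_def by blast
  obtain B where B: "\<And>x. norm (\<phi> x) \<le> B / (1 + norm x) ^ N" using schwartz_bound[OF phi] by metis
  have m: "\<phi> \<in> borel_measurable lebesgue"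
    using schwartz_measurable[OF phi] by (intro measurable_completion) simp
  show ?thesis
  proof (rule Bochner_Integration.integrable_bound)
    show "integrable lebesgue (\<lambda>x. B *\<^sub>R (f x /\<^sub>R (1 + norm x) ^ N))" by (rule integrable_scaleR_right[OF fN])
    show "(\<lambda>x. f x * \<phi> x) \<in> borel_measurable lebesgue"
      by (intro borel_measurable_times tempered_measurable f m)
    show "AE x in lebesgue. norm (f x * \<phi> x) \<le> norm (B *\<^sub>R (f x /\<^sub>R (1 + norm x) ^ N))"
    proof (rule AE_I2)
      fix x
      have "norm (f x * \<phi> x) \<le> norm (f x) * (B / (1 + norm x) ^ N)"
        unfolding norm_mult by (intro mult_left_mono B) simp
      also have "\<dots> \<le> norm (f x) * (\<bar>B\<bar> / (1 + norm x) ^ N)"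
        by (intro mult_left_mono divide_right_mono) auto
      finally show "norm (f x * \<phi> x) \<le> norm (B *\<^sub>R (f x /\<^sub>R (1 + norm x) ^ N))"
        unfolding norm_mult by (simp add: divide_inverse mult_ac norm_power abs_mult)
    qed
  qed
qed

text \<open>Translated Gaussians are Schwartz functions, so equality of the pairings with them
  determines the transform.\<close>

lemma has_fourier_unique:
  fixes f f' g g' :: "real ^ 'd::finite \<Rightarrow> complex"
  assumes fg: "has_fourier_scalar f g" and fg': "has_fourier_scalar f' g'" and eq: "AE x in lebesgue. f x = f' x"
  shows "AE \<xi> in lebesgue. g \<xi> = g' \<xi>"
proof -
  have t: "tempered f" "tempered f'" "tempered g" "tempered g'"
    using fg fg' by (auto simp: has_fourier_scalar_def)
  have "AE \<xi> in lebesgue. g \<xi> - g' \<xi> = 0"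
  proof (rule zero_of_gaussian_tests)
    show "tempered (\<lambda>\<xi>. g \<xi> - g' \<xi>)" by (intro tempered_diff t)
    fix y :: "real ^ 'd" and e :: real assume e: "0 < e"
    let ?\<phi> = "\<lambda>x::real ^ 'd. of_real (exp (- (norm (x - y))\<^sup>2 / (2 * e\<^sup>2))) :: complex"
    have phi: "?\<phi> \<in> schwartz" by (rule gaussian_translate_schwartz[OF e])
    have m: "schwartz_fourier ?\<phi> \<in> borel_measurable lebesgue"
      using schwartz_fourier_measurable[OF schwartz_measurable[OF phi]] by (intro measurable_completion) simp
    have "(LINT \<xi>|lebesgue. (g \<xi> - g' \<xi>) * ?\<phi> \<xi>) = (LINT \<xi>|lebesgue. g \<xi> * ?\<phi> \<xi>) - (LINT \<xi>|lebesgue. g' \<xi> * ?\<phi> \<xi>)"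
      unfolding left_diff_distrib by (intro Bochner_Integration.integral_diff tempered_schwartz_integrable t phi)
    also have "(LINT \<xi>|lebesgue. g \<xi> * ?\<phi> \<xi>) = (LINT x|lebesgue. f x * schwartz_fourier ?\<phi> x)"
      using fg phi by (simp add: has_fourier_scalar_def)
    also have "\<dots> = (LINT x|lebesgue. f' x * schwartz_fourier ?\<phi> x)"
      by (rule integral_cong_AE) (use eq t tempered_measurable m in \<open>auto elim: eventually_mono intro!: borel_measurable_times\<close>)
    also have "\<dots> = (LINT \<xi>|lebesgue. g' \<xi> * ?\<phi> \<xi>)"
      using fg' phi by (simp add: has_fourier_scalar_def)
    finally show "(LINT \<xi>|lebesgue. (g \<xi> - g' \<xi>) * ?\<phi> \<xi>) = 0" by simp
  qed
  then show ?thesis by simp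
qed

text \<open>Here the tests act on the functions themselves, where only transforms of Schwartz
  functions are at hand; a translated Gaussian is one of them, up to a constant, by
  \<open>schwartz_fourier_gauss_char\<close>.\<close>

lemma has_fourier_inj:
  fixes f f' g g' :: "real ^ 'd::finite \<Rightarrow> complex"
  assumes fg: "has_fourier_scalar f g" and fg': "has_fourier_scalar f' g'" and eq: "AE \<xi> in lebesgue. g \<xi> = g' \<xi>"
  shows "AE x in lebesgue. f x = f' x"
proof -
  have t: "tempered f" "tempered f'" "tempered g" "tempered g'"
    using fg fg' by (auto simp: has_fourier_scalar_def)
  have "AE x in lebesgue. f x - f' x = 0"
  proof (rule zero_of_gaussian_tests)
    show "tempered (\<lambda>x. f x - f' x)" by (intro tempered_diff t)
    fix y :: "real ^ 'd" and e :: real assume e: "0 < e"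
    let ?\<psi> = "\<lambda>x::real ^ 'd. of_real (exp (- (norm (x - y))\<^sup>2 / (2 * e\<^sup>2))) :: complex"
    let ?\<phi> = "gauss_char (e\<^sup>2 / 2) 0 y"
    have psi: "?\<psi> \<in> schwartz" by (rule gaussian_translate_schwartz[OF e])
    have phi: "?\<phi> \<in> schwartz" using e by (intro gauss_char_schwartz) simp
    have hat: "?\<psi> x = of_real (e ^ CARD('d)) * schwartz_fourier ?\<phi> x" for x
      unfolding schwartz_fourier_gauss_char[OF e] using e by (simp add: power_divide)
    have m: "?\<phi> \<in> borel_measurable lebesgue"
      using schwartz_measurable[OF phi] by (intro measurable_completion) simp
    have scale: "(LINT x|lebesgue. u x * ?\<psi> x) = of_real (e ^ CARD('d)) * (LINT x|lebesgue. u x * schwartz_fourier ?\<phi> x)" for u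
      unfolding hat by (subst integral_mult_right_zero[symmetric]) (simp only: mult_ac)
    have "(LINT x|lebesgue. f x * schwartz_fourier ?\<phi> x) = (LINT \<xi>|lebesgue. g \<xi> * ?\<phi> \<xi>)"
      using fg phi by (simp add: has_fourier_scalar_def)
    also have "\<dots> = (LINT \<xi>|lebesgue. g' \<xi> * ?\<phi> \<xi>)"
      by (rule integral_cong_AE) (use eq t tempered_measurable m in \<open>auto elim: eventually_mono intro!: borel_measurable_times\<close>)
    also have "\<dots> = (LINT x|lebesgue. f' x * schwartz_fourier ?\<phi> x)"
      using fg' phi by (simp add: has_fourier_scalar_def)
    finally have "(LINT x|lebesgue. f x * ?\<psi> x) = (LINT x|lebesgue. f' x * ?\<psi> x)"
      unfolding scale by simp
    moreover have "(LINT x|lebesgue. (f x - f' x) * ?\<psi> x) = (LINT x|lebesgue. f x * ?\<psi> x) - (LINT x|lebesgue. f' x * ?\<psi> x)"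
      unfolding left_diff_distrib by (intro Bochner_Integration.integral_diff tempered_schwartz_integrable t psi)
    ultimately show "(LINT x|lebesgue. (f x - f' x) * ?\<psi> x) = 0" by simp
  qed
  then show ?thesis by simp
qed

section \<open>Fourier transforms in weighted spaces\<close>

lemma two_power_powr_tendsto_zero:
  assumes "0 < s"
  shows "(\<lambda>j. ((2::real) ^ j) powr (- 2 * s)) \<longlonglongrightarrow> 0"
proof -
  have "norm (2 powr (- 2 * s)) < 1" using assms powr_less_one[of 2 "- 2 * s"] by simp
  then show ?thesis unfolding two_power_powr by (rule LIMSEQ_power_zero)
qed

text \<open>Splitting at frequency 1 shows that both sides are tempered: the low part is integrable
  with bounded inverse transform, the high part is square-integrable on both sides. The pairing
  identity holds for the truncations and passes to the limit, the error being the tail paired with a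
  square-integrable function.\<close>

lemma full_inv_has_fourier:
  fixes g :: "real ^ 'd::finite \<Rightarrow> complex"
  assumes s: "0 < s" "s < real CARD('d) / 2" and g: "square_integrable lebesgue g"
  shows "has_fourier_scalar (full_inv s g) (\<lambda>\<xi>. of_real (norm \<xi> powr (- s)) * g \<xi>)"
proof -
  let ?g = "\<lambda>\<xi>. of_real (norm \<xi> powr (- s)) * g \<xi>"
  note [measurable] = band_inv_measurable[OF s g] full_inv_measurable[OF s g]
  have mg: "?g \<in> borel_measurable lebesgue"
  proof (rule borel_measurable_times)
    show "(\<lambda>\<xi>::real ^ 'd. complex_of_real (norm \<xi> powr - s)) \<in> borel_measurable lebesgue"
      by (rule measurable_completion) measurable
  qed (use g in \<open>auto simp: square_integrable_def\<close>)
  have t1: "tempered (full_inv s g)"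
  proof -
    have "tempered (\<lambda>x. (full_inv s g x - band_inv s 1 g x) + band_inv s 1 g x)"
    proof (rule tempered_add)
      show "tempered (\<lambda>x. full_inv s g x - band_inv s 1 g x)"
        by (rule tempered_square_integrable[OF full_inv_band_square_integrable(1)[OF s g]]) simp
      show "tempered (band_inv s 1 g)"
      proof (rule tempered_bounded)
        show "band_inv s 1 g \<in> borel_measurable lebesgue" by (rule measurable_completion) measurable
        show "norm (band_inv s 1 g x) \<le> (2 * pi) powr (- (real CARD('d) / 2)) * (LINT \<xi>|lebesgue. norm (cutoff s 1 g \<xi>))" for x
          unfolding band_inv_def by (rule norm_inv_ft_le)
      qed
    qed
    then show ?thesis by simp
  qed
  have t2: "tempered ?g"
  proof -
    have ic: "integrable lebesgue (cutoff s 1 g)" by (rule cutoff_integrable[OF s g])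
    have "square_integrable lebesgue (\<lambda>\<xi>. ?g \<xi> - cutoff s 1 g \<xi>)"
    proof (rule square_integrable_bound[OF g])
      show "(\<lambda>\<xi>. ?g \<xi> - cutoff s 1 g \<xi>) \<in> borel_measurable lebesgue" using mg ic by auto
      show "AE \<xi> in lebesgue. norm (?g \<xi> - cutoff s 1 g \<xi>) \<le> norm (g \<xi>)"
      proof (rule AE_I2)
        fix \<xi> :: "real ^ 'd"
        show "norm (?g \<xi> - cutoff s 1 g \<xi>) \<le> norm (g \<xi>)"
        proof (cases "norm \<xi> \<le> 1")
          case False
          then have "norm \<xi> powr (- s) \<le> 1 powr (- s)" using s by (intro powr_mono2') auto
          then have "norm \<xi> powr (- s) * norm (g \<xi>) \<le> 1 * norm (g \<xi>)" by (intro mult_right_mono) auto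
          then show ?thesis using False by (simp add: cutoff_def norm_mult)
        qed (simp add: cutoff_def)
      qed
    qed
    then have "tempered (\<lambda>\<xi>. (?g \<xi> - cutoff s 1 g \<xi>) + cutoff s 1 g \<xi>)"
      by (intro tempered_add tempered_square_integrable tempered_integrable ic)
    then show ?thesis by simp
  qed
  have "(LINT x|lebesgue. full_inv s g x * schwartz_fourier \<phi> x) = (LINT \<xi>|lebesgue. ?g \<xi> * \<phi> \<xi>)" if phi: "\<phi> \<in> schwartz" for \<phi>
  proof -
    let ?S = "\<lambda>j. band_inv s (2 ^ j) g"
    note sq = schwartz_square_integrable[OF phi]
    have mphi: "\<phi> \<in> borel_measurable lebesgue" using sq by (auto simp: square_integrable_def)
    have mhat: "schwartz_fourier \<phi> \<in> borel_measurable lebesgue" using sq by (auto simp: square_integrable_def)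
    have ihat: "integrable lebesgue (\<lambda>x. ?S j x * schwartz_fourier \<phi> x)" for j
    proof (rule Bochner_Integration.integrable_bound)
      let ?B = "(2 * pi) powr (- (real CARD('d) / 2)) * (LINT \<xi>|lebesgue. norm (cutoff s (2 ^ j) g \<xi>))"
      show "integrable lebesgue (\<lambda>x. ?B *\<^sub>R schwartz_fourier \<phi> x)"
        using schwartz_fourier_integrable[OF phi, of 0] by simp
      have "?S j \<in> borel_measurable lebesgue" by (rule measurable_completion) measurable
      then show "(\<lambda>x. ?S j x * schwartz_fourier \<phi> x) \<in> borel_measurable lebesgue" using mhat by auto
      show "AE x in lebesgue. norm (?S j x * schwartz_fourier \<phi> x) \<le> norm (?B *\<^sub>R schwartz_fourier \<phi> x)"
        unfolding norm_mult norm_scaleR band_inv_def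
        by (intro AE_I2 mult_right_mono order_trans[OF norm_inv_ft_le abs_ge_self]) simp
    qed
    have d: "square_integrable lebesgue (\<lambda>x. full_inv s g x - ?S j x)"
      "ip lebesgue (\<lambda>x. full_inv s g x - ?S j x) (\<lambda>x. full_inv s g x - ?S j x) \<le> (2 ^ j) powr (- 2 * s) * ip lebesgue g g" for j
      by (intro full_inv_band_square_integrable[OF s g], simp)+
    have split: "(LINT x|lebesgue. full_inv s g x * schwartz_fourier \<phi> x) =
       (LINT x|lebesgue. (full_inv s g x - ?S j x) * schwartz_fourier \<phi> x) + (LINT x|lebesgue. ?S j x * schwartz_fourier \<phi> x)" for j
      using Bochner_Integration.integral_add[OF square_integrable_mult(1)[OF d(1)[of j] sq(2)] ihat[of j]]
      by (simp add: left_diff_distrib)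
    have l1: "(\<lambda>j. LINT x|lebesgue. (full_inv s g x - ?S j x) * schwartz_fourier \<phi> x) \<longlonglongrightarrow> 0"
    proof (rule Lim_null_comparison)
      let ?K = "sqrt (ip lebesgue (schwartz_fourier \<phi>) (schwartz_fourier \<phi>))"
      show "\<forall>\<^sub>F j in sequentially. norm (LINT x|lebesgue. (full_inv s g x - ?S j x) * schwartz_fourier \<phi> x) \<le>
         sqrt ((2 ^ j) powr (- 2 * s) * ip lebesgue g g) * ?K"
        by (intro always_eventually allI order_trans[OF square_integrable_mult(2)[OF d(1) sq(2)]] mult_right_mono real_sqrt_le_mono d(2)) auto
      have "(\<lambda>j. sqrt ((2 ^ j) powr (- 2 * s) * ip lebesgue g g) * ?K) \<longlonglongrightarrow> sqrt (0 * ip lebesgue g g) * ?K"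
        by (intro tendsto_intros two_power_powr_tendsto_zero s)
      then show "(\<lambda>j. sqrt ((2 ^ j) powr (- 2 * s) * ip lebesgue g g) * ?K) \<longlonglongrightarrow> 0" by simp
    qed
    have eqj: "(LINT x|lebesgue. ?S j x * schwartz_fourier \<phi> x) = (LINT \<xi>|lebesgue. cutoff s (2 ^ j) g \<xi> * \<phi> \<xi>)" for j
      unfolding band_inv_def by (intro inv_ft_pairing cutoff_integrable[OF s g] phi)
    have l2: "(\<lambda>j. LINT \<xi>|lebesgue. cutoff s (2 ^ j) g \<xi> * \<phi> \<xi>) \<longlonglongrightarrow> (LINT \<xi>|lebesgue. ?g \<xi> * \<phi> \<xi>)"
    proof (rule integral_dominated_convergence[where w="\<lambda>\<xi>. norm (?g \<xi> * \<phi> \<xi>)"])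
      show "integrable lebesgue (\<lambda>\<xi>. norm (?g \<xi> * \<phi> \<xi>))"
        by (intro integrable_norm tempered_schwartz_integrable t2 phi)
      show "(\<lambda>\<xi>. cutoff s (2 ^ j) g \<xi> * \<phi> \<xi>) \<in> borel_measurable lebesgue" for j
        using cutoff_integrable[OF s g, of "2 ^ j"] mphi by auto
      show "(\<lambda>\<xi>. ?g \<xi> * \<phi> \<xi>) \<in> borel_measurable lebesgue" using mg mphi by auto
      show "AE \<xi> in lebesgue. norm (cutoff s (2 ^ j) g \<xi> * \<phi> \<xi>) \<le> norm (?g \<xi> * \<phi> \<xi>)" for j
        by (rule AE_I2) (simp add: cutoff_def norm_mult mult_right_mono indicator_def)
      show "AE \<xi> in lebesgue. (\<lambda>j. cutoff s (2 ^ j) g \<xi> * \<phi> \<xi>) \<longlonglongrightarrow> ?g \<xi> * \<phi> \<xi>"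
      proof (rule AE_I2)
        fix \<xi> :: "real ^ 'd"
        obtain J where J: "norm \<xi> < 2 ^ J" using real_arch_pow[of 2 "norm \<xi>"] by auto
        have "\<forall>\<^sub>F j in sequentially. cutoff s (2 ^ j) g \<xi> = ?g \<xi>"
          using eventually_ge_at_top[of J]
        proof eventually_elim
          case (elim j)
          then have "(2::real) ^ J \<le> 2 ^ j" by (intro power_increasing) auto
          then have "norm \<xi> \<le> 2 ^ j" using J by linarith
          then have "\<xi> \<in> cball 0 (2 ^ j)" by simp
          then show ?case by (simp add: cutoff_def)
        qed
        then show "(\<lambda>j. cutoff s (2 ^ j) g \<xi> * \<phi> \<xi>) \<longlonglongrightarrow> ?g \<xi> * \<phi> \<xi>"
          by (intro tendsto_mult tendsto_const tendsto_eventually)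
      qed
    qed
    have "(\<lambda>j. (LINT x|lebesgue. (full_inv s g x - ?S j x) * schwartz_fourier \<phi> x) + (LINT x|lebesgue. ?S j x * schwartz_fourier \<phi> x))
       \<longlonglongrightarrow> 0 + (LINT \<xi>|lebesgue. ?g \<xi> * \<phi> \<xi>)"
      unfolding eqj by (intro tendsto_add l1 l2)
    then show ?thesis unfolding split[symmetric] by (simp add: LIMSEQ_const_iff)
  qed
  then show ?thesis unfolding has_fourier_scalar_def using t1 t2 by blast
qed

section \<open>Vector-valued transforms\<close>

definition vband_inv :: "real \<Rightarrow> real \<Rightarrow> (real ^ 'd::finite \<Rightarrow> complex ^ 'n::finite) \<Rightarrow> real ^ 'd \<Rightarrow> complex ^ 'n" where
  "vband_inv s A G x = (\<chi> j. band_inv s A (\<lambda>\<xi>. G \<xi> $ j) x)"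

definition vfull_inv :: "real \<Rightarrow> (real ^ 'd::finite \<Rightarrow> complex ^ 'n::finite) \<Rightarrow> real ^ 'd \<Rightarrow> complex ^ 'n" where
  "vfull_inv s G x = (\<chi> j. full_inv s (\<lambda>\<xi>. G \<xi> $ j) x)"

lemma norm_vec_square: "(norm (v :: complex ^ 'n::finite))\<^sup>2 = (\<Sum>j\<in>UNIV. (norm (v $ j))\<^sup>2)"
  unfolding norm_vec_def L2_set_def by (intro real_sqrt_pow2 sum_nonneg) simp

lemma measurable_vec_iff:
  fixes f :: "'a \<Rightarrow> complex ^ 'n::finite"
  shows "f \<in> borel_measurable M \<longleftrightarrow> (\<forall>j. (\<lambda>x. f x $ j) \<in> borel_measurable M)"
proof
  assume f: "f \<in> borel_measurable M"
  show "\<forall>j. (\<lambda>x. f x $ j) \<in> borel_measurable M"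
  proof
    fix j
    have "(\<lambda>v::complex ^ 'n. v $ j) \<in> borel_measurable borel"
      by (intro borel_measurable_continuous_onI continuous_intros)
    then show "(\<lambda>x. f x $ j) \<in> borel_measurable M" using f by (rule measurable_compose[rotated])
  qed
next
  assume f: "\<forall>j. (\<lambda>x. f x $ j) \<in> borel_measurable M"
  have "(\<lambda>x. f x \<bullet> b) \<in> borel_measurable M" if "b \<in> Basis" for b
  proof -
    have "f x \<bullet> b = (\<Sum>j\<in>UNIV. f x $ j \<bullet> b $ j)" for x by (simp add: inner_vec_def)
    then show ?thesis using f by (auto intro!: borel_measurable_sum borel_measurable_inner)
  qed
  then show "f \<in> borel_measurable M" by (simp add: borel_measurable_euclidean_space[where f=f])
qed

lemma square_integrable_vec_iff:
  fixes G :: "'a \<Rightarrow> complex ^ 'n::finite"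
  shows "square_integrable M G \<longleftrightarrow> (\<forall>j. square_integrable M (\<lambda>x. G x $ j))"
proof
  assume G: "square_integrable M G"
  show "\<forall>j. square_integrable M (\<lambda>x. G x $ j)"
  proof
    fix j
    have m: "(\<lambda>x. G x $ j) \<in> borel_measurable M" using G measurable_vec_iff by (auto simp: square_integrable_def)
    show "square_integrable M (\<lambda>x. G x $ j)"
      unfolding square_integrable_def
    proof
      show "integrable M (\<lambda>x. (norm (G x $ j))\<^sup>2)"
        by (rule Bochner_Integration.integrable_bound[of M "\<lambda>x. (norm (G x))\<^sup>2"])
           (use G m Finite_Cartesian_Product.norm_nth_le in \<open>auto simp: square_integrable_def intro!: power_mono\<close>)
    qed (rule m)
  qed
next
  assume "\<forall>j. square_integrable M (\<lambda>x. G x $ j)"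
  then show "square_integrable M G"
    unfolding square_integrable_def norm_vec_square measurable_vec_iff by auto
qed

lemma ip_vec:
  fixes G :: "'a \<Rightarrow> complex ^ 'n::finite"
  assumes "square_integrable M G"
  shows "ip M G G = (\<Sum>j\<in>UNIV. ip M (\<lambda>x. G x $ j) (\<lambda>x. G x $ j))"
  unfolding ip_self norm_vec_square
  by (rule Bochner_Integration.integral_sum) (use assms square_integrable_vec_iff[of M G] in \<open>auto simp: square_integrable_def\<close>)

lemma square_integrable_nth: "square_integrable M G \<Longrightarrow> square_integrable M (\<lambda>x. (G x :: complex ^ 'n::finite) $ j)"
  using square_integrable_vec_iff by blast

context
  fixes s :: real and dt :: "'d::finite itself"
  assumes s: "0 < s" "s < real CARD('d) / 2"
begin

lemma vband_inv_measurable: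
  fixes G :: "real ^ 'd \<Rightarrow> complex ^ 'n::finite"
  assumes "square_integrable lebesgue G"
  shows "vband_inv s A G \<in> borel_measurable borel"
  unfolding measurable_vec_iff vband_inv_def
  using band_inv_measurable[OF s square_integrable_nth[OF assms]] by simp

lemma vfull_inv_measurable:
  fixes G :: "real ^ 'd \<Rightarrow> complex ^ 'n::finite"
  assumes "square_integrable lebesgue G"
  shows "vfull_inv s G \<in> borel_measurable borel"
  unfolding measurable_vec_iff vfull_inv_def
  using full_inv_measurable[OF s square_integrable_nth[OF assms]] by simp

lemma vfull_inv_limit_scaled:
  fixes G :: "real ^ 'd \<Rightarrow> complex ^ 'n::finite"
  assumes G: "square_integrable lebesgue G" and A: "0 < A"
  shows "AE x in lebesgue. (\<lambda>j. vband_inv s (A * 2 ^ j) G x) \<longlonglongrightarrow> vfull_inv s G x"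
proof -
  have "AE x in lebesgue. \<forall>i\<in>UNIV. (\<lambda>j. band_inv s (A * 2 ^ j) (\<lambda>\<xi>. G \<xi> $ i) x) \<longlonglongrightarrow> full_inv s (\<lambda>\<xi>. G \<xi> $ i) x"
    by (intro AE_finite_allI full_inv_limit_scaled[OF s square_integrable_nth[OF G] A]) simp
  then show ?thesis
  proof eventually_elim
    case (elim x)
    then show ?case by (intro vec_tendstoI) (simp add: vband_inv_def vfull_inv_def)
  qed
qed

lemma vfull_inv_band_le:
  fixes G :: "real ^ 'd \<Rightarrow> complex ^ 'n::finite"
  assumes G: "square_integrable lebesgue G"
  shows "(\<integral>\<^sup>+x. ennreal ((norm (vfull_inv s G x - vband_inv s A G x))\<^sup>2) \<partial>lebesgue) \<le> tail s A G"
proof -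
  note Gj = square_integrable_nth[OF G]
  note [measurable] = band_inv_measurable[OF s Gj] full_inv_measurable[OF s Gj]
  have "(\<integral>\<^sup>+x. ennreal ((norm (vfull_inv s G x - vband_inv s A G x))\<^sup>2) \<partial>lebesgue) =
    (\<integral>\<^sup>+x. (\<Sum>j\<in>UNIV. ennreal ((norm (full_inv s (\<lambda>\<xi>. G \<xi> $ j) x - band_inv s A (\<lambda>\<xi>. G \<xi> $ j) x))\<^sup>2)) \<partial>lebesgue)"
    unfolding norm_vec_square by (simp add: vfull_inv_def vband_inv_def sum_ennreal)
  also have "\<dots> = (\<Sum>j\<in>UNIV. \<integral>\<^sup>+x. ennreal ((norm (full_inv s (\<lambda>\<xi>. G \<xi> $ j) x - band_inv s A (\<lambda>\<xi>. G \<xi> $ j) x))\<^sup>2) \<partial>lebesgue)"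
  proof (rule nn_integral_sum)
    show "(\<lambda>x. ennreal ((norm (full_inv s (\<lambda>\<xi>. G \<xi> $ j) x - band_inv s A (\<lambda>\<xi>. G \<xi> $ j) x))\<^sup>2)) \<in> borel_measurable lebesgue" for j
      by (rule measurable_completion) measurable
  qed
  also have "\<dots> \<le> (\<Sum>j\<in>UNIV. tail s A (\<lambda>\<xi>. G \<xi> $ j))"
    by (intro sum_mono full_inv_band_le[OF s Gj])
  also have "\<dots> = tail s A G"
    unfolding tail_def
  proof (subst nn_integral_sum[symmetric])
    show "(\<lambda>\<xi>. ennreal (indicator (- cball 0 A) \<xi> * norm \<xi> powr (- 2 * s) * (norm (G \<xi> $ j))\<^sup>2)) \<in> borel_measurable lebesgue" for j
      using Gj[of j] by (intro measurable_compose[OF _ measurable_ennreal] borel_measurable_times weight_lebesgue_measurable)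
        (auto simp: square_integrable_def)
    show "(\<integral>\<^sup>+\<xi>. (\<Sum>j\<in>UNIV. ennreal (indicator (- cball 0 A) \<xi> * norm \<xi> powr (- 2 * s) * (norm (G \<xi> $ j))\<^sup>2)) \<partial>lebesgue) =
       (\<integral>\<^sup>+\<xi>. ennreal (indicator (- cball 0 A) \<xi> * norm \<xi> powr (- 2 * s) * (norm (G \<xi>))\<^sup>2) \<partial>lebesgue)"
      unfolding norm_vec_square sum_distrib_left by (intro nn_integral_cong sum_ennreal) simp
  qed
  finally show ?thesis .
qed

lemma vband_inv_bound:
  obtains C where "0 < C" "\<And>A (G :: real ^ 'd \<Rightarrow> complex ^ 'n::finite) x. 0 < A \<Longrightarrow> square_integrable lebesgue G \<Longrightarrow>
    norm (vband_inv s A G x) \<le> C * A powr (real CARD('d) / 2 - s) * sqrt (ip lebesgue G G)"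
proof -
  obtain C where C: "0 < C" "\<And>A (g :: real ^ 'd \<Rightarrow> complex) x. 0 < A \<Longrightarrow> square_integrable lebesgue g \<Longrightarrow>
    norm (band_inv s A g x) \<le> C * A powr (real CARD('d) / 2 - s) * sqrt (ip lebesgue g g)"
    by (rule band_inv_bound[OF s]) blast
  show ?thesis
  proof (rule that[OF C(1)])
    fix A :: real and G :: "real ^ 'd \<Rightarrow> complex ^ 'n" and x
    assume A: "0 < A" and G: "square_integrable lebesgue G"
    let ?K = "C * A powr (real CARD('d) / 2 - s)"
    have K: "0 \<le> ?K" using C(1) by simp
    have "(norm (vband_inv s A G x))\<^sup>2 = (\<Sum>j\<in>UNIV. (norm (band_inv s A (\<lambda>\<xi>. G \<xi> $ j) x))\<^sup>2)"
      unfolding norm_vec_square by (simp add: vband_inv_def)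
    also have "\<dots> \<le> (\<Sum>j\<in>UNIV. (?K * sqrt (ip lebesgue (\<lambda>\<xi>. G \<xi> $ j) (\<lambda>\<xi>. G \<xi> $ j)))\<^sup>2)"
      by (intro sum_mono power_mono C(2) A square_integrable_nth G) simp
    also have "\<dots> = (?K * sqrt (ip lebesgue G G))\<^sup>2"
      by (simp add: power_mult_distrib ip_vec[OF G] sum_distrib_left sum_nonneg)
    finally show "norm (vband_inv s A G x) \<le> ?K * sqrt (ip lebesgue G G)"
      by (rule power2_le_imp_le) (use K in auto)
  qed
qed

lemma weight_mult_measurable:
  fixes G :: "real ^ 'd \<Rightarrow> complex ^ 'n::finite"
  assumes "G \<in> borel_measurable lebesgue"
  shows "(\<lambda>\<xi>. (norm \<xi> powr a) *\<^sub>R G \<xi>) \<in> borel_measurable lebesgue"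
  by (intro borel_measurable_scaleR weight_lebesgue_measurable assms)

lemma has_fourier_vfull_inv:
  fixes G :: "real ^ 'd \<Rightarrow> complex ^ 'n::finite"
  assumes G: "square_integrable lebesgue G"
  shows "has_fourier (vfull_inv s G) (\<lambda>\<xi>. (norm \<xi> powr (- s)) *\<^sub>R G \<xi>)"
  unfolding has_fourier_def
proof
  fix j
  show "has_fourier_scalar (\<lambda>x. vfull_inv s G x $ j) (\<lambda>\<xi>. ((norm \<xi> powr (- s)) *\<^sub>R G \<xi>) $ j)"
    using full_inv_has_fourier[OF s square_integrable_nth[OF G, of j]]
    by (simp add: vfull_inv_def scaleR_conv_of_real[where 'a=complex])
qed

text \<open>\<open>inv_fourier\<close> and \<open>fourier\<close> pick unspecified representatives;
  this is the bridge from any such choice to the explicit pointwise limit.\<close>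

lemma has_fourier_eq_vfull_inv:
  fixes f :: "real ^ 'd \<Rightarrow> complex ^ 'n::finite"
  assumes f: "has_fourier f g" and G: "square_integrable lebesgue G"
    and eq: "AE \<xi> in lebesgue. g \<xi> = (norm \<xi> powr (- s)) *\<^sub>R G \<xi>"
  shows "AE x in lebesgue. f x = vfull_inv s G x"
proof -
  have "AE x in lebesgue. \<forall>j\<in>UNIV. f x $ j = vfull_inv s G x $ j"
  proof (rule AE_finite_allI)
    fix j
    show "AE x in lebesgue. f x $ j = vfull_inv s G x $ j"
      by (rule has_fourier_inj[of _ "\<lambda>\<xi>. g \<xi> $ j" _ "\<lambda>\<xi>. ((norm \<xi> powr (- s)) *\<^sub>R G \<xi>) $ j"])
         (use f has_fourier_vfull_inv[OF G] eq in \<open>auto simp: has_fourier_def elim: eventually_mono\<close>)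
  qed simp
  then show ?thesis by (auto simp: vec_eq_iff)
qed

lemma fourier_has_fourier:
  fixes f :: "real ^ 'd \<Rightarrow> complex ^ 'n::finite"
  assumes "has_fourier f g"
  shows "has_fourier f (fourier f)" "AE \<xi> in lebesgue. fourier f \<xi> = g \<xi>"
proof -
  have 1: "has_fourier_scalar (\<lambda>x. f x $ j) (fourier_scalar (\<lambda>x. f x $ j))" for j
  proof -
    have "has_fourier_scalar (\<lambda>x. f x $ j) (\<lambda>\<xi>. g \<xi> $ j)" using assms by (simp add: has_fourier_def)
    then show ?thesis unfolding fourier_scalar_def by (rule someI[of "has_fourier_scalar (\<lambda>x. f x $ j)"])
  qed
  then show "has_fourier f (fourier f)" by (simp add: has_fourier_def fourier_def)
  have "AE \<xi> in lebesgue. \<forall>j\<in>UNIV. fourier_scalar (\<lambda>x. f x $ j) \<xi> = g \<xi> $ j"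
    by (rule AE_finite_allI) (use has_fourier_unique[OF 1] assms in \<open>auto simp: has_fourier_def\<close>)
  then show "AE \<xi> in lebesgue. fourier f \<xi> = g \<xi>" by (auto simp: vec_eq_iff fourier_def elim: eventually_mono)
qed

lemma AE_nonzero_lebesgue: "AE \<xi>::real ^ 'd in lebesgue. \<xi> \<noteq> 0"
  by (rule AE_completion) (rule AE_lborel_singleton)

text \<open>The space and its norm are defined through the chosen representative
  \<open>fourier_scalar\<close>; as transforms are unique almost everywhere, any transform g may
  replace it.\<close>

lemma Hdot_iff:
  fixes f :: "real ^ 'd \<Rightarrow> complex ^ 'n::finite"
  assumes g: "has_fourier f g"
  shows "f \<in> Hdot s \<longleftrightarrow> square_integrable lebesgue (\<lambda>\<xi>. (norm \<xi> powr s) *\<^sub>R g \<xi>)"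
    and "f \<in> Hdot s \<Longrightarrow> Hdot_norm s f = sqrt (ip lebesgue (\<lambda>\<xi>. (norm \<xi> powr s) *\<^sub>R g \<xi>) (\<lambda>\<xi>. (norm \<xi> powr s) *\<^sub>R g \<xi>))"
proof -
  let ?G = "\<lambda>\<xi>. (norm \<xi> powr s) *\<^sub>R g \<xi>"
  have mg: "(\<lambda>\<xi>. g \<xi> $ j) \<in> borel_measurable lebesgue" for j
    using g unfolding has_fourier_def has_fourier_scalar_def by (blast intro: tempered_measurable)
  have mf: "(\<lambda>\<xi>. fourier f \<xi> $ j) \<in> borel_measurable lebesgue" for j
    using fourier_has_fourier(1)[OF g] unfolding has_fourier_def has_fourier_scalar_def by (blast intro: tempered_measurable)
  have eq: "AE \<xi> in lebesgue. fourier_scalar (\<lambda>x. f x $ j) \<xi> = g \<xi> $ j" for j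
    using fourier_has_fourier(2)[OF g] by (auto simp: fourier_def vec_eq_iff elim!: eventually_mono)
  have m1: "(\<lambda>\<xi>. norm \<xi> powr (2 * s) * (cmod (fourier_scalar (\<lambda>x. f x $ j) \<xi>))\<^sup>2) \<in> borel_measurable lebesgue" for j
    using mf[of j] by (auto simp: fourier_def intro!: borel_measurable_times weight_lebesgue_measurable)
  have mG: "(\<lambda>\<xi>. ?G \<xi> $ j) \<in> borel_measurable lebesgue" for j
    using mg[of j] by (auto intro!: borel_measurable_scaleR weight_lebesgue_measurable)
  have sq: "AE \<xi> in lebesgue. norm \<xi> powr (2 * s) * (cmod (fourier_scalar (\<lambda>x. f x $ j) \<xi>))\<^sup>2 = (norm (?G \<xi> $ j))\<^sup>2" for j
    using eq[of j]
  proof eventually_elim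
    case (elim \<xi>)
    have "(norm \<xi> powr s)\<^sup>2 = norm \<xi> powr (2 * s)" by (simp add: power2_eq_square powr_add[symmetric])
    then show ?case by (simp add: elim power_mult_distrib)
  qed
  have m2: "(\<lambda>\<xi>. (norm (?G \<xi> $ j))\<^sup>2) \<in> borel_measurable lebesgue" for j using mG[of j] by measurable
  have int: "integrable lebesgue (\<lambda>\<xi>. norm \<xi> powr (2 * s) * (cmod (fourier_scalar (\<lambda>x. f x $ j) \<xi>))\<^sup>2) \<longleftrightarrow> square_integrable lebesgue (\<lambda>\<xi>. ?G \<xi> $ j)" for j
    unfolding square_integrable_def using mG[of j] integrable_cong_AE[OF m1 m2 sq, of j] by simp
  have ex: "\<exists>g. has_fourier_scalar (\<lambda>x. f x $ j) g" for j using g by (auto simp: has_fourier_def)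
  show "f \<in> Hdot s \<longleftrightarrow> square_integrable lebesgue ?G"
    unfolding Hdot_def Hdot_scalar_def square_integrable_vec_iff[of _ ?G] using ex int by simp
  show "Hdot_norm s f = sqrt (ip lebesgue ?G ?G)" if "f \<in> Hdot s"
  proof -
    have sG: "square_integrable lebesgue ?G"
      using that unfolding Hdot_def Hdot_scalar_def square_integrable_vec_iff[of _ ?G] using int by simp
    have "(Hdot_scalar_norm s (\<lambda>x. f x $ j))\<^sup>2 = ip lebesgue (\<lambda>\<xi>. ?G \<xi> $ j) (\<lambda>\<xi>. ?G \<xi> $ j)" for j
      unfolding Hdot_scalar_norm_def ip_self integral_cong_AE[OF m1 m2 sq]
      by (intro real_sqrt_pow2 integral_nonneg_AE) simp
    then show ?thesis unfolding Hdot_norm_def ip_vec[OF sG] by simp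
  qed
qed

lemma vfull_inv_Hdot:
  fixes G :: "real ^ 'd \<Rightarrow> complex ^ 'n::finite"
  assumes G: "square_integrable lebesgue G"
  shows "vfull_inv s G \<in> Hdot s" "Hdot_norm s (vfull_inv s G) = sqrt (ip lebesgue G G)"
    "AE \<xi> in lebesgue. fourier (vfull_inv s G) \<xi> = (norm \<xi> powr (- s)) *\<^sub>R G \<xi>"
proof -
  note hf = has_fourier_vfull_inv[OF G]
  let ?G = "\<lambda>\<xi>. (norm \<xi> powr s) *\<^sub>R ((norm \<xi> powr (- s)) *\<^sub>R G \<xi>)"
  have mG: "G \<in> borel_measurable lebesgue" using G by (simp add: square_integrable_def)
  have m: "?G \<in> borel_measurable lebesgue" by (intro weight_mult_measurable mG)
  have eq: "AE \<xi> in lebesgue. ?G \<xi> = G \<xi>"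
    using AE_nonzero_lebesgue
  proof eventually_elim
    case (elim \<xi>)
    then show ?case by (simp add: powr_add[symmetric])
  qed
  have sG: "square_integrable lebesgue ?G"
  proof (rule square_integrable_bound[OF G m])
    show "AE \<xi> in lebesgue. norm (?G \<xi>) \<le> norm (G \<xi>)"
      using eq by eventually_elim (simp only: order_refl)
  qed
  show H: "vfull_inv s G \<in> Hdot s" using Hdot_iff(1)[OF hf] sG by simp
  have "ip lebesgue ?G ?G = ip lebesgue G G"
    unfolding ip_self
  proof (rule integral_cong_AE)
    have "(\<lambda>v::complex ^ 'n. (norm v)\<^sup>2) \<in> borel_measurable borel" by measurable
    from measurable_compose[OF m this] measurable_compose[OF mG this]
    show "(\<lambda>\<xi>. (norm (?G \<xi>))\<^sup>2) \<in> borel_measurable lebesgue"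
      "(\<lambda>\<xi>. (norm (G \<xi>))\<^sup>2) \<in> borel_measurable lebesgue" .
    show "AE \<xi> in lebesgue. (norm (?G \<xi>))\<^sup>2 = (norm (G \<xi>))\<^sup>2"
      using eq by eventually_elim (simp only: )
  qed
  then show "Hdot_norm s (vfull_inv s G) = sqrt (ip lebesgue G G)" using Hdot_iff(2)[OF hf H] by simp
  show "AE \<xi> in lebesgue. fourier (vfull_inv s G) \<xi> = (norm \<xi> powr (- s)) *\<^sub>R G \<xi>"
    by (rule fourier_has_fourier(2)[OF hf])
qed

text \<open>Together with \<open>vfull_inv_Hdot\<close> this identifies \<open>Hdot s\<close>
  isometrically with \<open>L^2\<close> through G = |xi|^s f^, so that only square-integrable G are
  considered afterwards.\<close>

lemma Hdot_obtain:
  fixes f :: "real ^ 'd \<Rightarrow> complex ^ 'n::finite"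
  assumes f: "f \<in> Hdot s"
  obtains G where "square_integrable lebesgue G" "Hdot_norm s f = sqrt (ip lebesgue G G)"
    "AE x in lebesgue. f x = vfull_inv s G x"
    "AE \<xi> in lebesgue. fourier f \<xi> = (norm \<xi> powr (- s)) *\<^sub>R G \<xi>"
    "G = (\<lambda>\<xi>. (norm \<xi> powr s) *\<^sub>R fourier f \<xi>)"
proof -
  let ?G = "\<lambda>\<xi>. (norm \<xi> powr s) *\<^sub>R fourier f \<xi>"
  have "\<forall>j. \<exists>g. has_fourier_scalar (\<lambda>x. f x $ j) g"
    using f unfolding Hdot_def Hdot_scalar_def by auto
  then obtain g where "\<forall>j. has_fourier_scalar (\<lambda>x. f x $ j) (g j)"
    by (rule choice[THEN exE])
  then have "has_fourier f (\<lambda>\<xi>. \<chi> j. g j \<xi>)" by (simp add: has_fourier_def)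
  then have hf: "has_fourier f (fourier f)" by (rule fourier_has_fourier(1))
  have G: "square_integrable lebesgue ?G" using Hdot_iff(1)[OF hf] f by simp
  have eq: "AE \<xi> in lebesgue. fourier f \<xi> = (norm \<xi> powr (- s)) *\<^sub>R ?G \<xi>"
    using AE_nonzero_lebesgue
  proof eventually_elim
    case (elim \<xi>)
    then show ?case by (simp add: powr_add[symmetric])
  qed
  show ?thesis
    by (rule that[OF G Hdot_iff(2)[OF hf f] has_fourier_eq_vfull_inv[OF hf G eq] eq refl])
qed

end

section \<open>A refined Sobolev inequality\<close>

lemma nn_integral_powr_interval:
  fixes y c :: real
  assumes "0 < c" "0 \<le> y"
  shows "(\<integral>\<^sup>+t. ennreal (t powr (c - 1)) * indicator {0..y} t \<partial>lborel) = ennreal (y powr c / c)"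
proof -
  have "((\<lambda>t. t powr (c - 1)) has_integral (y powr (c - 1 + 1) / (c - 1 + 1))) {0..y}"
    by (rule has_integral_powr_from_0) (use assms in auto)
  then have "((\<lambda>t. t powr (c - 1)) has_integral (y powr c / c)) {0..y}" by simp
  from nn_integral_has_integral_lebesgue'[OF _ this] show ?thesis by simp
qed

text \<open>One Borel density serves the tails at all radii, so that the integral over levels can be
  exchanged with the frequency integral.\<close>

lemma tail_borel_weight:
  fixes G :: "real ^ 'd::finite \<Rightarrow> complex ^ 'n::finite"
  assumes G: "square_integrable lebesgue G"
  obtains H where "H \<in> borel_measurable borel"
    "AE \<xi> in lebesgue. ennreal (norm \<xi> powr (- 2 * s) * (norm (G \<xi>))\<^sup>2) = H \<xi>"
    "\<And>A. tail s A G = (\<integral>\<^sup>+\<xi>. indicator (- cball 0 A) \<xi> * H \<xi> \<partial>lborel)"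
proof -
  have mG: "G \<in> borel_measurable lebesgue" using G by (simp add: square_integrable_def)
  have "(\<lambda>v::complex ^ 'n. (norm v)\<^sup>2) \<in> borel_measurable borel" by measurable
  from measurable_compose[OF mG this] have m2: "(\<lambda>\<xi>. (norm (G \<xi>))\<^sup>2) \<in> borel_measurable lebesgue" .
  have "(\<lambda>\<xi>. ennreal (norm \<xi> powr (- 2 * s) * (norm (G \<xi>))\<^sup>2)) \<in> borel_measurable lebesgue"
    by (intro measurable_compose[OF _ measurable_ennreal] borel_measurable_times weight_lebesgue_measurable m2)
  then obtain H where H: "H \<in> borel_measurable lborel"
    "AE \<xi> in lborel. ennreal (norm \<xi> powr (- 2 * s) * (norm (G \<xi>))\<^sup>2) = H \<xi>"
    using completion_ex_borel_measurable by blast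
  have t: "tail s A G = (\<integral>\<^sup>+\<xi>. indicator (- cball 0 A) \<xi> * H \<xi> \<partial>lborel)" for A
  proof -
    have "tail s A G = (\<integral>\<^sup>+\<xi>. ennreal (indicator (- cball 0 A) \<xi> * norm \<xi> powr (- 2 * s) * (norm (G \<xi>))\<^sup>2) \<partial>lborel)"
      unfolding tail_def by (rule nn_integral_completion)
    also have "\<dots> = (\<integral>\<^sup>+\<xi>. indicator (- cball 0 A) \<xi> * H \<xi> \<partial>lborel)"
    proof (rule nn_integral_cong_AE)
      show "AE \<xi> in lborel. ennreal (indicator (- cball 0 A) \<xi> * norm \<xi> powr (- 2 * s) * (norm (G \<xi>))\<^sup>2) = indicator (- cball 0 A) \<xi> * H \<xi>"
        using H(2)
      proof eventually_elim
        case (elim \<xi>)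
        then show ?case by (cases "\<xi> \<in> cball 0 A") auto
      qed
    qed
    finally show ?thesis .
  qed
  have "H \<in> borel_measurable borel" using H(1) by simp
  then show ?thesis by (rule that[OF _ AE_completion[OF H(2)] t])
qed

text \<open>If the band-limited parts of \<open>f = vfull_inv s G\<close> are bounded by \<open>B A\<^bsup>d/2 - s\<^esup>\<close>, then on the set where
  \<open>|f| \<ge> t\<close> at least half of \<open>|f|\<close> comes from the frequencies above the \<open>A\<close> with
  \<open>B A\<^bsup>d/2 - s\<^esup> = t/2\<close>. Chebyshev's inequality and integration over the levels \<open>t\<close> give the estimate.\<close>

theorem refined_Sobolev:
  fixes s :: real and G :: "real ^ 'd::finite \<Rightarrow> complex ^ 'n::finite"
  defines "a \<equiv> real CARD('d) / 2 - s"
  defines "p \<equiv> real CARD('d) / a"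
  assumes s: "0 < s" "s < real CARD('d) / 2"
    and G: "square_integrable lebesgue G" and B: "0 \<le> B"
    and bnd: "\<And>A x. 0 < A \<Longrightarrow> norm (vband_inv s A G x) \<le> B * A powr a"
  shows "(\<integral>\<^sup>+x. ennreal (norm (vfull_inv s G x) powr p) \<partial>lborel) \<le>
    ennreal (4 * p / (p - 2) * (2 * B) powr (p - 2) * ip lebesgue G G)"
proof -
  have a: "0 < a" using s by (simp add: a_def)
  \<comment> \<open>From a p = d and d - 2a = 2s. This power of |xi| will cancel the weight
    |xi|^(-2s) of the tail.\<close>
  have ap: "a * (p - 2) = 2 * s" using a by (simp add: p_def right_diff_distrib) (simp add: a_def)
  have p: "2 < p" using ap s a by (metis diff_gt_0_iff_gt mult_pos_pos zero_less_mult_pos zero_less_numeral)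
  have [measurable]: "vfull_inv s G \<in> borel_measurable borel" "\<And>A. vband_inv s A G \<in> borel_measurable borel"
    by (rule vfull_inv_measurable[OF s G], rule vband_inv_measurable[OF s G])
  obtain H where H[measurable]: "H \<in> borel_measurable borel"
    and H_eq: "AE \<xi> in lebesgue. ennreal (norm \<xi> powr (- 2 * s) * (norm (G \<xi>))\<^sup>2) = H \<xi>"
    and H_tail: "\<And>A. tail s A G = (\<integral>\<^sup>+\<xi>. indicator (- cball 0 A) \<xi> * H \<xi> \<partial>lborel)"
    by (rule tail_borel_weight[OF G, of s]) blast
  let ?f = "\<lambda>x. norm (vfull_inv s G x)"
  show ?thesis
  proof (cases "B = 0")
    \<comment> \<open>The radius \<open>\<Lambda> t\<close> used below divides by B. For B = 0 all
      truncations vanish and so does their limit.\<close>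
    case True
    have "AE x in lebesgue. vfull_inv s G x = 0"
      using vfull_inv_limit_scaled[OF s G zero_less_one]
    proof eventually_elim
      case (elim x)
      have "vband_inv s (1 * 2 ^ j) G x = 0" for j
        using bnd[of "1 * 2 ^ j" x] True by simp
      then show ?case using elim by (simp add: LIMSEQ_const_iff)
    qed
    then have "AE x in lborel. vfull_inv s G x = 0" by (simp add: AE_completion_iff)
    then have "(\<integral>\<^sup>+x. ennreal (?f x powr p) \<partial>lborel) = 0"
      by (subst nn_integral_0_iff_AE) (auto elim!: eventually_mono)
    then show ?thesis by simp
  next
    case False
    with B have B: "0 < B" by simp
    define \<Lambda> where "\<Lambda> t = (t / (2 * B)) powr (1 / a)" for t
    have Lam: "0 < \<Lambda> t" "B * \<Lambda> t powr a = t / 2" if "0 < t" for t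
      using that B a by (auto simp: \<Lambda>_def powr_powr)
    have Lam_less: "t \<le> 2 * B * norm \<xi> powr a" if "\<Lambda> t < norm \<xi>" "0 < t" for t and \<xi> :: "real ^ 'd"
    proof -
      have "\<Lambda> t powr a \<le> norm \<xi> powr a" using that a Lam(1)[OF that(2)] by (intro powr_mono2) auto
      then have "B * \<Lambda> t powr a \<le> B * norm \<xi> powr a" using B by simp
      then show ?thesis using Lam(2)[OF that(2)] by simp
    qed
    have level: "(\<integral>\<^sup>+x. indicator {0..?f x} t \<partial>lborel) \<le> ennreal (4 / t\<^sup>2) * tail s (\<Lambda> t) G" if t: "0 < t" for t
    proof -
      have "(\<integral>\<^sup>+x. indicator {0..?f x} t \<partial>lborel) \<le> (\<integral>\<^sup>+x. ennreal (4 / t\<^sup>2) * ennreal ((norm (vfull_inv s G x - vband_inv s (\<Lambda> t) G x))\<^sup>2) \<partial>lborel)"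
      proof (rule nn_integral_mono)
        fix x
        show "indicator {0..?f x} t \<le> ennreal (4 / t\<^sup>2) * ennreal ((norm (vfull_inv s G x - vband_inv s (\<Lambda> t) G x))\<^sup>2)"
        proof (cases "t \<le> ?f x")
          case True
          have "norm (vband_inv s (\<Lambda> t) G x) \<le> t / 2"
            using bnd[OF Lam(1)[OF t], of x] Lam(2)[OF t] by simp
          then have "t / 2 \<le> norm (vfull_inv s G x - vband_inv s (\<Lambda> t) G x)"
            using True norm_triangle_ineq2[of "vfull_inv s G x" "vband_inv s (\<Lambda> t) G x"] by argo
          then have "(t / 2)\<^sup>2 \<le> (norm (vfull_inv s G x - vband_inv s (\<Lambda> t) G x))\<^sup>2"
            using t by (intro power_mono) auto
          then have "1 \<le> 4 / t\<^sup>2 * (norm (vfull_inv s G x - vband_inv s (\<Lambda> t) G x))\<^sup>2"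
            using t by (simp add: power_divide field_simps)
          then have "ennreal 1 \<le> ennreal (4 / t\<^sup>2 * (norm (vfull_inv s G x - vband_inv s (\<Lambda> t) G x))\<^sup>2)"
            by (rule ennreal_leI)
          also have "\<dots> = ennreal (4 / t\<^sup>2) * ennreal ((norm (vfull_inv s G x - vband_inv s (\<Lambda> t) G x))\<^sup>2)"
            by (rule ennreal_mult') simp
          finally show ?thesis using True t by (simp only: ennreal_1 indicator_simps atLeastAtMost_iff less_imp_le)
        qed simp
      qed
      also have "\<dots> = ennreal (4 / t\<^sup>2) * (\<integral>\<^sup>+x. ennreal ((norm (vfull_inv s G x - vband_inv s (\<Lambda> t) G x))\<^sup>2) \<partial>lborel)"
        by (rule nn_integral_cmult) measurable
      also have "(\<integral>\<^sup>+x. ennreal ((norm (vfull_inv s G x - vband_inv s (\<Lambda> t) G x))\<^sup>2) \<partial>lborel) \<le> tail s (\<Lambda> t) G"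
        using vfull_inv_band_le[OF s G, of "\<Lambda> t"] unfolding nn_integral_completion .
      finally show ?thesis by (simp add: mult_left_mono)
    qed
    \<comment> \<open>Layer-cake representation: |f|^p is the integral of p t^(p-1) over 0 <= t <=
      |f|.\<close>
    have "(\<integral>\<^sup>+x. ennreal (?f x powr p) \<partial>lborel) = (\<integral>\<^sup>+x. (\<integral>\<^sup>+t. ennreal p * (ennreal (t powr (p - 1)) * indicator {0..?f x} t) \<partial>lborel) \<partial>lborel)"
    proof (rule nn_integral_cong)
      fix x
      have "(\<integral>\<^sup>+t. ennreal p * (ennreal (t powr (p - 1)) * indicator {0..?f x} t) \<partial>lborel) = ennreal p * ennreal (?f x powr p / p)"
        using p by (subst nn_integral_cmult) (auto simp: nn_integral_powr_interval)
      also have "\<dots> = ennreal (?f x powr p)"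
        using p by (subst ennreal_mult'[symmetric]) auto
      finally show "ennreal (?f x powr p) = (\<integral>\<^sup>+t. ennreal p * (ennreal (t powr (p - 1)) * indicator {0..?f x} t) \<partial>lborel)" ..
    qed
    also have "\<dots> = (\<integral>\<^sup>+t. (\<integral>\<^sup>+x. ennreal p * (ennreal (t powr (p - 1)) * indicator {0..?f x} t) \<partial>lborel) \<partial>lborel)"
      unfolding indicator_def of_bool_def atLeastAtMost_iff by (rule lborel_pair.Fubini') measurable
    also have "\<dots> = (\<integral>\<^sup>+t. ennreal (p * t powr (p - 1)) * (\<integral>\<^sup>+x. indicator {0..?f x} t \<partial>lborel) \<partial>lborel)"
    proof (rule nn_integral_cong)
      fix t :: real
      have "(\<integral>\<^sup>+x. ennreal p * (ennreal (t powr (p - 1)) * indicator {0..?f x} t) \<partial>lborel) = (\<integral>\<^sup>+x. ennreal (p * t powr (p - 1)) * indicator {0..?f x} t \<partial>lborel)"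
        using p by (intro nn_integral_cong) (simp add: ennreal_mult mult.assoc)
      also have "\<dots> = ennreal (p * t powr (p - 1)) * (\<integral>\<^sup>+x. indicator {0..?f x} t \<partial>lborel)"
        unfolding indicator_def of_bool_def atLeastAtMost_iff by (rule nn_integral_cmult) measurable
      finally show "(\<integral>\<^sup>+x. ennreal p * (ennreal (t powr (p - 1)) * indicator {0..?f x} t) \<partial>lborel) = ennreal (p * t powr (p - 1)) * (\<integral>\<^sup>+x. indicator {0..?f x} t \<partial>lborel)" .
    qed
    \<comment> \<open>Insert the Chebyshev bound \<open>level\<close>. Frequencies above
      \<open>\<Lambda> t\<close> are those with t <= 2 B |xi|^a, so for fixed xi the levels range
      over a bounded interval.\<close>
    also have "\<dots> \<le> (\<integral>\<^sup>+t. (\<integral>\<^sup>+\<xi>. H \<xi> * (ennreal (4 * p) * (ennreal (t powr ((p - 2) - 1)) * indicator {0..2 * B * norm \<xi> powr a} t)) \<partial>lborel) \<partial>lborel)"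
    proof (rule nn_integral_mono)
      fix t :: real
      show "ennreal (p * t powr (p - 1)) * (\<integral>\<^sup>+x. indicator {0..?f x} t \<partial>lborel) \<le>
         (\<integral>\<^sup>+\<xi>. H \<xi> * (ennreal (4 * p) * (ennreal (t powr ((p - 2) - 1)) * indicator {0..2 * B * norm \<xi> powr a} t)) \<partial>lborel)"
      proof (cases "0 < t")
        case True
        have e: "p * t powr (p - 1) * (4 / t\<^sup>2) = 4 * p * t powr ((p - 2) - 1)"
        proof -
          have "t powr (p - 1) = t powr ((p - 2) - 1) * t powr 2" unfolding powr_add[symmetric] by simp
          also have "t powr 2 = t\<^sup>2" using True by simp
          finally show ?thesis using True by simp
        qed
        have "ennreal (p * t powr (p - 1)) * (\<integral>\<^sup>+x. indicator {0..?f x} t \<partial>lborel) \<le> ennreal (p * t powr (p - 1)) * (ennreal (4 / t\<^sup>2) * tail s (\<Lambda> t) G)"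
          by (intro mult_left_mono level True) simp
        also have "\<dots> = ennreal (4 * p * t powr ((p - 2) - 1)) * tail s (\<Lambda> t) G"
        proof -
          have "ennreal (4 * p * t powr ((p - 2) - 1)) = ennreal (p * t powr (p - 1)) * ennreal (4 / t\<^sup>2)"
            unfolding e[symmetric] by (rule ennreal_mult') (use p in simp)
          then show ?thesis by (simp only: mult.assoc)
        qed
        also have "\<dots> = (\<integral>\<^sup>+\<xi>. ennreal (4 * p * t powr ((p - 2) - 1)) * (indicator (- cball 0 (\<Lambda> t)) \<xi> * H \<xi>) \<partial>lborel)"
          unfolding H_tail by (rule nn_integral_cmult[symmetric]) measurable
        also have "\<dots> \<le> (\<integral>\<^sup>+\<xi>. H \<xi> * (ennreal (4 * p) * (ennreal (t powr ((p - 2) - 1)) * indicator {0..2 * B * norm \<xi> powr a} t)) \<partial>lborel)"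
        proof (rule nn_integral_mono)
          fix \<xi> :: "real ^ 'd"
          show "ennreal (4 * p * t powr ((p - 2) - 1)) * (indicator (- cball 0 (\<Lambda> t)) \<xi> * H \<xi>) \<le>
             H \<xi> * (ennreal (4 * p) * (ennreal (t powr ((p - 2) - 1)) * indicator {0..2 * B * norm \<xi> powr a} t))"
          proof (cases "\<xi> \<in> cball 0 (\<Lambda> t)")
            case False
            then have "t \<in> {0..2 * B * norm \<xi> powr a}" using Lam_less[of t \<xi>] True by auto
            moreover have "ennreal (4 * p * t powr ((p - 2) - 1)) = ennreal (4 * p) * ennreal (t powr ((p - 2) - 1))"
              using p by (intro ennreal_mult) auto
            ultimately show ?thesis using False by (simp add: mult_ac)
          qed simp
        qed
        finally show ?thesis .
      next
        case False
        have "p * t powr (p - 1) = 0 \<or> (\<integral>\<^sup>+x. indicator {0..?f x} t \<partial>lborel) = 0"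
          using False by (cases "t = 0") auto
        then show ?thesis by auto
      qed
    qed
    also have "\<dots> = (\<integral>\<^sup>+\<xi>. (\<integral>\<^sup>+t. H \<xi> * (ennreal (4 * p) * (ennreal (t powr ((p - 2) - 1)) * indicator {0..2 * B * norm \<xi> powr a} t)) \<partial>lborel) \<partial>lborel)"
      unfolding indicator_def of_bool_def atLeastAtMost_iff by (rule lborel_pair.Fubini') measurable
    \<comment> \<open>The integral over the levels yields (2 B)^(p-2) |xi|^(2s) / (p - 2), and this
      power of |xi| turns the density of the tail back into |G|^2.\<close>
    also have "\<dots> = (\<integral>\<^sup>+\<xi>. ennreal (4 * p / (p - 2) * (2 * B) powr (p - 2)) * ennreal ((norm (G \<xi>))\<^sup>2) \<partial>lborel)"
    proof (rule nn_integral_cong_AE)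
      have "AE \<xi> in lborel. ennreal (norm \<xi> powr (- 2 * s) * (norm (G \<xi>))\<^sup>2) = H \<xi>"
        using H_eq by (simp add: AE_completion_iff)
      moreover have "AE \<xi> in lborel. (\<xi> :: real ^ 'd) \<noteq> 0" by (rule AE_lborel_singleton)
      ultimately show "AE \<xi> in lborel. (\<integral>\<^sup>+t. H \<xi> * (ennreal (4 * p) * (ennreal (t powr ((p - 2) - 1)) * indicator {0..2 * B * norm \<xi> powr a} t)) \<partial>lborel) =
         ennreal (4 * p / (p - 2) * (2 * B) powr (p - 2)) * ennreal ((norm (G \<xi>))\<^sup>2)"
      proof eventually_elim
        case (elim \<xi>)
        let ?y = "2 * B * norm \<xi> powr a"
        have "(\<integral>\<^sup>+t. H \<xi> * (ennreal (4 * p) * (ennreal (t powr ((p - 2) - 1)) * indicator {0..?y} t)) \<partial>lborel) =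
            H \<xi> * (ennreal (4 * p) * (\<integral>\<^sup>+t. ennreal (t powr ((p - 2) - 1)) * indicator {0..?y} t \<partial>lborel))"
          by (subst nn_integral_cmult, measurable, subst nn_integral_cmult) auto
        also have "\<dots> = H \<xi> * (ennreal (4 * p) * ennreal (?y powr (p - 2) / (p - 2)))"
          using p B by (subst nn_integral_powr_interval) auto
        also have "\<dots> = ennreal ((norm \<xi> powr (- 2 * s) * (norm (G \<xi>))\<^sup>2) * (4 * p * (?y powr (p - 2) / (p - 2))))"
          unfolding elim(1)[symmetric] using p by (subst ennreal_mult'[symmetric], simp)+ simp
        also have "?y powr (p - 2) = (2 * B) powr (p - 2) * norm \<xi> powr (2 * s)"
          using B by (simp add: powr_mult powr_powr ap)
        also have "(norm \<xi> powr (- 2 * s) * (norm (G \<xi>))\<^sup>2) * (4 * p * ((2 * B) powr (p - 2) * norm \<xi> powr (2 * s) / (p - 2))) =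
           (norm \<xi> powr (- 2 * s) * norm \<xi> powr (2 * s)) * (4 * p / (p - 2) * (2 * B) powr (p - 2) * (norm (G \<xi>))\<^sup>2)"
          by (simp add: divide_inverse mult_ac)
        also have "norm \<xi> powr (- 2 * s) * norm \<xi> powr (2 * s) = 1"
          using elim(2) unfolding powr_add[symmetric] by simp
        also have "ennreal (1 * (4 * p / (p - 2) * (2 * B) powr (p - 2) * (norm (G \<xi>))\<^sup>2)) =
            ennreal (4 * p / (p - 2) * (2 * B) powr (p - 2)) * ennreal ((norm (G \<xi>))\<^sup>2)"
          using p unfolding mult_1 by (intro ennreal_mult) auto
        finally show ?case .
      qed
    qed
    also have "\<dots> = (\<integral>\<^sup>+\<xi>. ennreal (4 * p / (p - 2) * (2 * B) powr (p - 2)) * ennreal ((norm (G \<xi>))\<^sup>2) \<partial>lebesgue)"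
      by (rule nn_integral_completion[symmetric])
    also have "\<dots> = ennreal (4 * p / (p - 2) * (2 * B) powr (p - 2)) * (\<integral>\<^sup>+\<xi>. ennreal ((norm (G \<xi>))\<^sup>2) \<partial>lebesgue)"
      using square_integrable_measurable[OF G] by (intro nn_integral_cmult) measurable
    also have "\<dots> = ennreal (4 * p / (p - 2) * (2 * B) powr (p - 2) * ip lebesgue G G)"
      unfolding nn_integral_norm_square[OF G] using p by (intro ennreal_mult[symmetric]) auto
    finally show ?thesis .
  qed
qed

section \<open>Linearity of the truncations and of their limits; continuity of the norm
  \<open>N\<close>\<close>

lemma vfull_inv_limit:
  fixes G :: "real ^ 'd::finite \<Rightarrow> complex ^ 'n::finite"
  assumes s: "0 < s" "s < real CARD('d) / 2" and G: "square_integrable lebesgue G"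
  shows "AE x in lebesgue. (\<lambda>j. vband_inv s (2 ^ j) G x) \<longlonglongrightarrow> vfull_inv s G x"
  using vfull_inv_limit_scaled[OF s G zero_less_one] by simp

lemma vband_inv_diff:
  fixes G H :: "real ^ 'd::finite \<Rightarrow> complex ^ 'n::finite"
  assumes s: "0 < s" "s < real CARD('d) / 2"
    and G: "square_integrable lebesgue G" and H: "square_integrable lebesgue H"
  shows "vband_inv s A (\<lambda>\<xi>. G \<xi> - H \<xi>) x = vband_inv s A G x - vband_inv s A H x"
proof -
  have "band_inv s A (\<lambda>\<xi>. (G \<xi> - H \<xi>) $ j) x = band_inv s A (\<lambda>\<xi>. G \<xi> $ j) x - band_inv s A (\<lambda>\<xi>. H \<xi> $ j) x" for j
  proof -
    have "cutoff s A (\<lambda>\<xi>. (G \<xi> - H \<xi>) $ j) = (\<lambda>\<xi>. cutoff s A (\<lambda>\<xi>. G \<xi> $ j) \<xi> - cutoff s A (\<lambda>\<xi>. H \<xi> $ j) \<xi>)"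
      by (simp add: cutoff_def fun_eq_iff right_diff_distrib)
    then show ?thesis
      unfolding band_inv_def
      by (simp add: inv_ft_diff[OF cutoff_integrable[OF s square_integrable_nth[OF G]] cutoff_integrable[OF s square_integrable_nth[OF H]]])
  qed
  then show ?thesis by (simp add: vband_inv_def vec_eq_iff)
qed

lemma vband_inv_cmult:
  fixes G :: "real ^ 'd::finite \<Rightarrow> complex ^ 'n::finite"
  shows "vband_inv s A (\<lambda>\<xi>. c *s G \<xi>) x = c *s vband_inv s A G x"
proof -
  have "band_inv s A (\<lambda>\<xi>. (c *s G \<xi>) $ j) x = c * band_inv s A (\<lambda>\<xi>. G \<xi> $ j) x" for j
  proof -
    have "cutoff s A (\<lambda>\<xi>. (c *s G \<xi>) $ j) = (\<lambda>\<xi>. c * cutoff s A (\<lambda>\<xi>. G \<xi> $ j) \<xi>)"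
      by (simp add: cutoff_def fun_eq_iff)
    then show ?thesis unfolding band_inv_def by (simp add: inv_ft_cmult)
  qed
  then show ?thesis by (simp add: vband_inv_def vec_eq_iff)
qed

lemma norm_vector_scalar_mult: "norm (c *s (v :: complex ^ 'n::finite)) = norm c * norm v"
proof -
  have "(norm (c *s v))\<^sup>2 = (norm c * norm v)\<^sup>2"
    unfolding norm_vec_square power_mult_distrib sum_distrib_left by (simp add: norm_mult power_mult_distrib)
  then show ?thesis by (simp add: power2_eq_iff_nonneg)
qed

lemma scaleR_eq_vector_scalar_mult: "r *\<^sub>R (v :: complex ^ 'n::finite) = of_real r *s v"
  by (simp add: vec_eq_iff scaleR_conv_of_real[where 'a=complex])

lemma measurable_vector_scalar_mult:
  fixes G :: "'a \<Rightarrow> complex ^ 'n::finite"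
  assumes "c \<in> borel_measurable M" "G \<in> borel_measurable M"
  shows "(\<lambda>x. c x *s G x) \<in> borel_measurable M"
  using assms unfolding measurable_vec_iff by (auto intro!: borel_measurable_times)

lemma square_integrable_cmult:
  fixes G :: "'a \<Rightarrow> complex ^ 'n::finite"
  assumes G: "square_integrable M G"
  shows "square_integrable M (\<lambda>x. c *s G x)" "ip M (\<lambda>x. c *s G x) (\<lambda>x. c *s G x) = (norm c)\<^sup>2 * ip M G G"
proof -
  have "(\<lambda>x. c *s G x) \<in> borel_measurable M"
    using G by (intro measurable_vector_scalar_mult) (auto simp: square_integrable_def)
  then show "square_integrable M (\<lambda>x. c *s G x)"
    using G by (auto simp: square_integrable_def norm_vector_scalar_mult power_mult_distrib)
  show "ip M (\<lambda>x. c *s G x) (\<lambda>x. c *s G x) = (norm c)\<^sup>2 * ip M G G"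
    by (simp add: ip_self norm_vector_scalar_mult power_mult_distrib)
qed

lemma vfull_inv_diff:
  fixes G H :: "real ^ 'd::finite \<Rightarrow> complex ^ 'n::finite"
  assumes s: "0 < s" "s < real CARD('d) / 2"
    and G: "square_integrable lebesgue G" and H: "square_integrable lebesgue H"
  shows "AE x in lebesgue. vfull_inv s (\<lambda>\<xi>. G \<xi> - H \<xi>) x = vfull_inv s G x - vfull_inv s H x"
  using vfull_inv_limit[OF s G] vfull_inv_limit[OF s H] vfull_inv_limit[OF s square_integrable_diff[OF G H]]
proof eventually_elim
  case (elim x)
  have "(\<lambda>j. vband_inv s (2 ^ j) (\<lambda>\<xi>. G \<xi> - H \<xi>) x) \<longlonglongrightarrow> vfull_inv s G x - vfull_inv s H x"
    unfolding vband_inv_diff[OF s G H] by (intro tendsto_diff elim)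
  then show ?case using elim(3) LIMSEQ_unique by blast
qed

lemma tendsto_vector_scalar_mult:
  fixes f :: "'a \<Rightarrow> complex ^ 'n::finite"
  assumes "(f \<longlongrightarrow> l) F"
  shows "((\<lambda>x. c *s f x) \<longlongrightarrow> c *s l) F"
  by (rule vec_tendstoI) (auto intro!: tendsto_intros assms)

lemma vfull_inv_cmult:
  fixes G :: "real ^ 'd::finite \<Rightarrow> complex ^ 'n::finite"
  assumes s: "0 < s" "s < real CARD('d) / 2" and G: "square_integrable lebesgue G"
  shows "AE x in lebesgue. vfull_inv s (\<lambda>\<xi>. c *s G \<xi>) x = c *s vfull_inv s G x"
  using vfull_inv_limit[OF s G] vfull_inv_limit[OF s square_integrable_cmult(1)[OF G, of c]]
proof eventually_elim
  case (elim x)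
  have "(\<lambda>j. vband_inv s (2 ^ j) (\<lambda>\<xi>. c *s G \<xi>) x) \<longlonglongrightarrow> c *s vfull_inv s G x"
    unfolding vband_inv_cmult by (intro tendsto_vector_scalar_mult elim)
  then show ?case using elim(2) LIMSEQ_unique by blast
qed

text \<open>Expansion in the standard basis; each summand is enlarged by 1 so that K is visibly
  positive.\<close>

lemma complex_norm_bound:
  assumes "complex_norm N"
  obtains K where "0 < K" "\<And>v. N v \<le> K * norm (v :: complex ^ 'n::finite)"
proof -
  have N: "\<And>v. 0 \<le> N v" "N 0 = 0" "\<And>c v. N (c *s v) = cmod c * N v" "\<And>v w. N (v + w) \<le> N v + N w"
    using assms by (auto simp: complex_norm_def)
  have sum_le: "N (\<Sum>j\<in>J. f j) \<le> (\<Sum>j\<in>J. N (f j))" if "finite J" for J and f :: "'n \<Rightarrow> complex ^ 'n"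
    using that
  proof induction
    case (insert j J)
    then show ?case using N(4)[of "f j" "\<Sum>j\<in>J. f j"] by simp
  qed (simp add: N)
  have "N v \<le> (\<Sum>j\<in>UNIV. N (axis j 1) + 1) * norm v" for v
  proof -
    have "v = (\<Sum>j\<in>UNIV. v $ j *s axis j 1)" by (rule basis_expansion[symmetric])
    then have "N v = N (\<Sum>j\<in>UNIV. v $ j *s axis j 1)" by simp
    also have "\<dots> \<le> (\<Sum>j\<in>UNIV. N (v $ j *s axis j 1))" by (rule sum_le) simp
    also have "\<dots> \<le> (\<Sum>j\<in>UNIV. (N (axis j 1) + 1) * norm v)"
    proof (rule sum_mono)
      fix j
      have "cmod (v $ j) * N (axis j 1) \<le> norm v * (N (axis j 1) + 1)"
        using N(1) Finite_Cartesian_Product.norm_nth_le[of v j] by (intro mult_mono) auto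
      then show "N (v $ j *s axis j 1) \<le> (N (axis j 1) + 1) * norm v" by (simp add: N(3) mult.commute)
    qed
    finally show ?thesis by (simp add: sum_distrib_right)
  qed
  moreover have "0 < (\<Sum>j\<in>(UNIV::'n set). N (axis j 1) + 1)"
    using N(1) by (intro sum_pos) (auto intro: add_nonneg_pos)
  ultimately show ?thesis by (rule that[rotated])
qed

lemma complex_norm_diff_le:
  assumes N: "complex_norm N"
  shows "\<bar>N v - N w\<bar> \<le> N (v - w)"
proof -
  have "N v \<le> N (v - w) + N w" "N w \<le> N (w - v) + N v"
    using N unfolding complex_norm_def by (metis diff_add_cancel)+
  moreover have "N (w - v) = N (v - w)"
  proof -
    have "w - v = (- 1) *s (v - w)" by (simp add: vec_eq_iff)
    moreover have "N ((- 1) *s (v - w)) = cmod (- 1) * N (v - w)" using N unfolding complex_norm_def by blast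
    ultimately show ?thesis by simp
  qed
  ultimately show ?thesis by linarith
qed

lemma complex_norm_continuous:
  assumes N: "complex_norm N"
  shows "continuous_on UNIV (N :: complex ^ 'n::finite \<Rightarrow> real)"
proof -
  obtain K where K: "0 < K" "\<And>v. N v \<le> K * norm (v :: complex ^ 'n)" using complex_norm_bound[OF N] by blast
  have "\<exists>d>0. \<forall>w. dist w v < d \<longrightarrow> dist (N w) (N v) < e" if e: "0 < e" for e v
  proof (intro exI conjI allI impI)
    show "0 < e / K" using e K by simp
    fix w assume "dist w v < e / K"
    then have "K * norm (w - v) < e" using K by (simp add: dist_norm field_simps)
    moreover have "\<bar>N w - N v\<bar> \<le> K * norm (w - v)"
      using complex_norm_diff_le[OF N, of w v] K(2)[of "w - v"] by linarith
    ultimately show "dist (N w) (N v) < e" by (simp add: dist_real_def)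
  qed
  then show ?thesis unfolding continuous_on_iff by auto
qed

lemma complex_norm_measurable:
  "complex_norm N \<Longrightarrow> (N :: complex ^ 'n::finite \<Rightarrow> real) \<in> borel_measurable borel"
  by (intro borel_measurable_continuous_onI complex_norm_continuous)

section \<open>Unitary flows of Fourier multipliers\<close>

text \<open>Homogeneity of h appears as a rescaling of time. The isometry is required on each
  square-integrable G, with an exceptional set depending on t and G, which is the form in which
  unitarity on the Sobolev space provides it.\<close>

locale unitary_flow =
  fixes s k :: real and m :: "real \<Rightarrow> real ^ 'd::finite \<Rightarrow> complex ^ 'n ^ 'n::finite"
    and N :: "complex ^ 'n \<Rightarrow> real"
  assumes s: "0 < s" "s < real CARD('d) / 2" and k: "0 < k" and N: "complex_norm N"
    and m_cont: "\<And>\<xi>. continuous_on UNIV (\<lambda>t. m t \<xi>)"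
    and m_zero: "\<And>\<xi>. m 0 \<xi> = mat 1"
    and m_add: "\<And>t t' \<xi>. m (t + t') \<xi> = m t \<xi> ** m t' \<xi>"
    and m_scale: "\<And>c t \<xi>. 0 < c \<Longrightarrow> m t (c *\<^sub>R \<xi>) = m (c powr k * t) \<xi>"
    and m_iso: "\<And>t G. square_integrable lebesgue G \<Longrightarrow> (\<lambda>\<xi>. m t \<xi> *v G \<xi>) \<in> borel_measurable lebesgue \<and>
        (AE \<xi> in lebesgue. norm (m t \<xi> *v G \<xi>) = norm (G \<xi>))"
begin

text \<open>The flow acts on G = |xi|^s f^ by the same symbol as on the transform of f, because the
  scalar weight commutes with the matrices.\<close>

definition ev :: "real \<Rightarrow> (real ^ 'd \<Rightarrow> complex ^ 'n) \<Rightarrow> real ^ 'd \<Rightarrow> complex ^ 'n" where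
  "ev t G \<xi> = m t \<xi> *v G \<xi>"

definition sol :: "(real ^ 'd \<Rightarrow> complex ^ 'n) \<Rightarrow> real \<Rightarrow> real ^ 'd \<Rightarrow> complex ^ 'n" where
  "sol G t = vfull_inv s (ev t G)"

definition bsol :: "real \<Rightarrow> (real ^ 'd \<Rightarrow> complex ^ 'n) \<Rightarrow> real \<Rightarrow> real ^ 'd \<Rightarrow> complex ^ 'n" where
  "bsol A G t = vband_inv s A (ev t G)"

lemma ev_norm: "square_integrable lebesgue G \<Longrightarrow> AE \<xi> in lebesgue. norm (ev t G \<xi>) = norm (G \<xi>)"
  using m_iso by (simp add: ev_def)

lemma ev_square_integrable:
  assumes G: "square_integrable lebesgue G"
  shows "square_integrable lebesgue (ev t G)"
  by (rule square_integrable_bound[OF G]) (use m_iso[OF G, of t] in \<open>auto simp: ev_def[abs_def] elim: eventually_mono\<close>)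

lemma ip_ev_self:
  assumes G: "square_integrable lebesgue G"
  shows "ip lebesgue (ev t G) (ev t G) = ip lebesgue G G"
proof -
  note [measurable] = square_integrable_measurable[OF G] square_integrable_measurable[OF ev_square_integrable[OF G, of t]]
  show ?thesis
    unfolding ip_self by (rule integral_cong_AE) (use ev_norm[OF G, of t] in \<open>auto elim: eventually_mono\<close>)
qed

lemma ev_ev: "ev t (ev t' G) = ev (t + t') G"
  by (simp add: ev_def[abs_def] m_add matrix_vector_mul_assoc)

lemma ev_zero: "ev 0 G = G"
  by (simp add: ev_def[abs_def] m_zero)

lemma ev_add: "ev t (\<lambda>\<xi>. G \<xi> + H \<xi>) = (\<lambda>\<xi>. ev t G \<xi> + ev t H \<xi>)"
  by (simp add: ev_def[abs_def] matrix_vector_right_distrib)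

lemma ev_diff: "ev t (\<lambda>\<xi>. G \<xi> - H \<xi>) = (\<lambda>\<xi>. ev t G \<xi> - ev t H \<xi>)"
  by (simp add: ev_def[abs_def] matrix_vector_mult_diff_distrib)

lemma ev_scalar: "ev t (\<lambda>\<xi>. c \<xi> *s G \<xi>) = (\<lambda>\<xi>. c \<xi> *s ev t G \<xi>)"
  by (simp add: ev_def[abs_def] vector_scalar_commute)

lemma ip_ev:
  assumes G: "square_integrable lebesgue G" and H: "square_integrable lebesgue H"
  shows "ip lebesgue (ev t G) (ev t H) = ip lebesgue G H"
  using ip_add_self[OF G H] ip_add_self[OF ev_square_integrable[OF G, of t] ev_square_integrable[OF H, of t]]
    ip_ev_self[OF square_integrable_add[OF G H], of t] ip_ev_self[OF G, of t] ip_ev_self[OF H, of t]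
  unfolding ev_add by simp

text \<open>The adjoint of a unitary group element is its inverse. This moves the flow onto test
  functions, so that weak convergence at time 0 gives weak convergence at all times.\<close>

lemma ip_ev_left:
  assumes G: "square_integrable lebesgue G" and H: "square_integrable lebesgue H"
  shows "ip lebesgue (ev t G) H = ip lebesgue G (ev (- t) H)"
proof -
  have "ip lebesgue (ev t G) (ev t (ev (- t) H)) = ip lebesgue G (ev (- t) H)"
    by (rule ip_ev[OF G ev_square_integrable[OF H]])
  then show ?thesis unfolding ev_ev by (simp add: ev_zero)
qed

lemma tail_ev:
  assumes G: "square_integrable lebesgue G"
  shows "tail s A (ev t G) = tail s A G"
  unfolding tail_def by (rule nn_integral_cong_AE) (use ev_norm[OF G, of t] in \<open>auto elim: eventually_mono\<close>)

text \<open>The isometry gives a majorant independent of t, namely the cutoff weight times |G|, so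
  dominated convergence yields joint continuity in (t, x). Joint measurability of
  \<open>bsol\<close>, and of \<open>sol\<close> as its pointwise limit, rests on this.\<close>

lemma bsol_tendsto:
  assumes G: "square_integrable lebesgue G" and t: "\<tau> \<longlonglongrightarrow> t" and x: "y \<longlonglongrightarrow> x"
  shows "(\<lambda>n. bsol A G (\<tau> n) (y n)) \<longlonglongrightarrow> bsol A G t x"
proof (rule vec_tendstoI)
  fix j
  note evj = square_integrable_nth[OF ev_square_integrable[OF G], of _ j]
  let ?W = "\<lambda>\<xi>. norm (cutoff s A (\<lambda>\<xi>. complex_of_real (norm (G \<xi>))) \<xi>)"
  have "square_integrable lebesgue (\<lambda>\<xi>. complex_of_real (norm (G \<xi>)))"
    using G by (auto simp: square_integrable_def)
  then have iW: "integrable lebesgue ?W"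
    by (intro integrable_norm cutoff_integrable[OF s])
  have "(\<lambda>n. LINT \<xi>|lebesgue. exp (\<i> * of_real (y n \<bullet> \<xi>)) * cutoff s A (\<lambda>\<xi>. ev (\<tau> n) G \<xi> $ j) \<xi>) \<longlonglongrightarrow>
     (LINT \<xi>|lebesgue. exp (\<i> * of_real (x \<bullet> \<xi>)) * cutoff s A (\<lambda>\<xi>. ev t G \<xi> $ j) \<xi>)"
  proof (rule integral_dominated_convergence[where w="?W"])
    show "(\<lambda>\<xi>. exp (\<i> * of_real (x \<bullet> \<xi>)) * cutoff s A (\<lambda>\<xi>. ev t G \<xi> $ j) \<xi>) \<in> borel_measurable lebesgue"
      "(\<lambda>\<xi>. exp (\<i> * of_real (y n \<bullet> \<xi>)) * cutoff s A (\<lambda>\<xi>. ev (\<tau> n) G \<xi> $ j) \<xi>) \<in> borel_measurable lebesgue" for n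
      by (intro borel_measurable_integrable integrable_exp_i_mult cutoff_integrable[OF s evj])+
    show "AE \<xi> in lebesgue. norm (exp (\<i> * of_real (y n \<bullet> \<xi>)) * cutoff s A (\<lambda>\<xi>. ev (\<tau> n) G \<xi> $ j) \<xi>) \<le> ?W \<xi>" for n
      using ev_norm[OF G, of "\<tau> n"]
    proof eventually_elim
      case (elim \<xi>)
      have "norm (ev (\<tau> n) G \<xi> $ j) \<le> norm (G \<xi>)"
        using Finite_Cartesian_Product.norm_nth_le[of "ev (\<tau> n) G \<xi>" j] elim by simp
      then have "\<bar>indicator (cball 0 A) \<xi> * norm \<xi> powr (- s)\<bar> * norm (ev (\<tau> n) G \<xi> $ j) \<le> \<bar>indicator (cball 0 A) \<xi> * norm \<xi> powr (- s)\<bar> * norm (G \<xi>)"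
        by (rule mult_left_mono) simp
      then show ?case unfolding cutoff_def norm_mult norm_of_real norm_exp_i_times by simp
    qed
    show "AE \<xi> in lebesgue. (\<lambda>n. exp (\<i> * of_real (y n \<bullet> \<xi>)) * cutoff s A (\<lambda>\<xi>. ev (\<tau> n) G \<xi> $ j) \<xi>) \<longlonglongrightarrow> exp (\<i> * of_real (x \<bullet> \<xi>)) * cutoff s A (\<lambda>\<xi>. ev t G \<xi> $ j) \<xi>"
    proof (rule AE_I2)
      fix \<xi> :: "real ^ 'd"
      have "(\<lambda>n. m (\<tau> n) \<xi>) \<longlonglongrightarrow> m t \<xi>"
        using continuous_on_tendsto_compose[OF m_cont[of \<xi>] t] by simp
      then have "(\<lambda>n. ev (\<tau> n) G \<xi> $ j) \<longlonglongrightarrow> ev t G \<xi> $ j"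
        unfolding ev_def matrix_vector_mult_def vec_lambda_beta by (intro tendsto_intros)
      then show "(\<lambda>n. exp (\<i> * of_real (y n \<bullet> \<xi>)) * cutoff s A (\<lambda>\<xi>. ev (\<tau> n) G \<xi> $ j) \<xi>) \<longlonglongrightarrow> exp (\<i> * of_real (x \<bullet> \<xi>)) * cutoff s A (\<lambda>\<xi>. ev t G \<xi> $ j) \<xi>"
        unfolding cutoff_def
        by (intro tendsto_mult tendsto_const tendsto_exp tendsto_of_real tendsto_inner x)
    qed
  qed (rule iW)
  then show "(\<lambda>n. bsol A G (\<tau> n) (y n) $ j) \<longlonglongrightarrow> bsol A G t x $ j"
    unfolding bsol_def vband_inv_def band_inv_def inv_ft_def vec_lambda_beta by (intro tendsto_intros)
qed

lemma bsol_measurable: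
  assumes G: "square_integrable lebesgue G"
  shows "(\<lambda>(t, x). bsol A G t x) \<in> borel_measurable (borel \<Otimes>\<^sub>M borel)"
proof -
  have "continuous_on UNIV (\<lambda>z. bsol A G (fst z) (snd z))"
    unfolding continuous_on_sequentially comp_def
    using bsol_tendsto[OF G tendsto_fst tendsto_snd] by blast
  then have "(\<lambda>z. bsol A G (fst z) (snd z)) \<in> borel_measurable borel" by (rule borel_measurable_continuous_onI)
  then show ?thesis unfolding borel_prod by (simp add: case_prod_beta')
qed

lemma sol_measurable:
  assumes G: "square_integrable lebesgue G"
  shows "(\<lambda>(t, x). sol G t x) \<in> borel_measurable (borel \<Otimes>\<^sub>M borel)"
  unfolding measurable_vec_iff
proof
  fix j
  have b: "(\<lambda>z. bsol (2 ^ i) G (fst z) (snd z) $ j) \<in> borel_measurable (borel \<Otimes>\<^sub>M borel)" for i :: nat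
    using bsol_measurable[OF G, of "2 ^ i"] unfolding measurable_vec_iff by (simp add: case_prod_beta')
  have "(\<lambda>z. lim (\<lambda>i. bsol (2 ^ i) G (fst z) (snd z) $ j)) \<in> borel_measurable (borel \<Otimes>\<^sub>M borel)"
    by (rule borel_measurable_lim_metric[OF b])
  then show "(\<lambda>x. (case x of (t, x) \<Rightarrow> sol G t x) $ j) \<in> borel_measurable (borel \<Otimes>\<^sub>M borel)"
    by (simp add: case_prod_beta' sol_def bsol_def vfull_inv_def full_inv_def vband_inv_def)
qed

lemma sol_slice_measurable:
  assumes G: "square_integrable lebesgue G"
  shows "sol G t \<in> borel_measurable borel"
  unfolding sol_def by (rule vfull_inv_measurable[OF s ev_square_integrable[OF G]])

lemma sol_bsol_le:
  assumes G: "square_integrable lebesgue G" and A: "0 < A"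
  shows "(\<integral>\<^sup>+x. ennreal ((norm (sol G t x - bsol A G t x))\<^sup>2) \<partial>lborel) \<le> ennreal (A powr (- 2 * s) * ip lebesgue G G)"
proof -
  have "(\<integral>\<^sup>+x. ennreal ((norm (sol G t x - bsol A G t x))\<^sup>2) \<partial>lebesgue) \<le> tail s A (ev t G)"
    unfolding sol_def bsol_def by (rule vfull_inv_band_le[OF s ev_square_integrable[OF G]])
  also have "\<dots> \<le> ennreal (A powr (- 2 * s) * ip lebesgue G G)"
    unfolding tail_ev[OF G] by (rule tail_le[OF s G A])
  finally show ?thesis unfolding nn_integral_completion .
qed

lemma sol_diff:
  assumes "square_integrable lebesgue G" "square_integrable lebesgue H"
  shows "AE x in lborel. sol (\<lambda>\<xi>. G \<xi> - H \<xi>) t x = sol G t x - sol H t x"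
  using vfull_inv_diff[OF s assms[THEN ev_square_integrable], of t t] unfolding sol_def ev_diff AE_completion_iff .

lemma sol_cmult:
  assumes "square_integrable lebesgue G"
  shows "AE x in lborel. sol (\<lambda>\<xi>. c *s G \<xi>) t x = c *s sol G t x"
  using vfull_inv_cmult[OF s ev_square_integrable[OF assms], of c t] unfolding sol_def ev_scalar AE_completion_iff .

lemma bsol_bound:
  obtains C where "0 < C" "\<And>A G t x. 0 < A \<Longrightarrow> square_integrable lebesgue G \<Longrightarrow>
    norm (bsol A G t x) \<le> C * A powr (real CARD('d) / 2 - s) * sqrt (ip lebesgue G G)"
proof -
  obtain C where C: "0 < C" "\<And>A (G :: real ^ 'd \<Rightarrow> complex ^ 'n) x. 0 < A \<Longrightarrow> square_integrable lebesgue G \<Longrightarrow>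
    norm (vband_inv s A G x) \<le> C * A powr (real CARD('d) / 2 - s) * sqrt (ip lebesgue G G)"
    using vband_inv_bound[OF s] by blast
  show ?thesis
    by (rule that[OF C(1)]) (use C(2) ev_square_integrable ip_ev_self in \<open>fastforce simp: bsol_def\<close>)
qed

text \<open>Band-limited values are inner products with elements of \<open>L\<^sup>2\<close>, so they pass to weak limits.\<close>

lemma band_inv_pairing:
  fixes j :: 'n and x :: "real ^ 'd"
  obtains \<phi> \<psi> :: "real ^ 'd \<Rightarrow> complex ^ 'n" where "square_integrable lebesgue \<phi>" "square_integrable lebesgue \<psi>"
    "\<And>G. square_integrable lebesgue G \<Longrightarrow> vband_inv s A G x $ j = Complex (ip lebesgue G \<phi>) (ip lebesgue G \<psi>)"
proof -
  let ?c = "(2 * pi) powr (- (real CARD('d) / 2))"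
  \<comment> \<open>The kernel of evaluation at x. Pairing with its conjugate in the j-th component
    gives the real part, and the factor -i in \<open>\<psi>\<close> turns the imaginary part into a
    real one.\<close>
  define \<kappa> where "\<kappa> \<xi> = of_real ?c * (exp (\<i> * of_real (x \<bullet> \<xi>)) * of_real (indicator (cball 0 A) \<xi> * norm \<xi> powr (- s)))" for \<xi>
  define \<phi> where "\<phi> \<xi> = (axis j (cnj (\<kappa> \<xi>)) :: complex ^ 'n)" for \<xi>
  define \<psi> where "\<psi> \<xi> = (axis j (cnj (- \<i> * \<kappa> \<xi>)) :: complex ^ 'n)" for \<xi>
  have w: "square_integrable lebesgue (\<lambda>\<xi>::real ^ 'd. complex_of_real (indicator (cball 0 A) \<xi> * norm \<xi> powr (- s)))"
  proof (cases "0 < A")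
    case True
    show ?thesis by (rule cutoff_weight[OF s]) (use True in blast)
  next
    case False
    have "\<xi> = 0 \<or> \<xi> \<notin> cball 0 A" for \<xi> :: "real ^ 'd"
      using False norm_le_zero_iff[of \<xi>] by (auto simp del: norm_le_zero_iff)
    then have "(\<lambda>\<xi>::real ^ 'd. complex_of_real (indicator (cball 0 A) \<xi> * norm \<xi> powr (- s))) = (\<lambda>\<xi>. 0)"
      by (auto simp: fun_eq_iff indicator_def)
    then show ?thesis by (simp add: square_integrable_def)
  qed
  have mk: "\<kappa> \<in> borel_measurable lebesgue"
    unfolding \<kappa>_def by (intro borel_measurable_times borel_measurable_const exp_i_measurable_lebesgue weight_lebesgue_measurable)
  have sk: "square_integrable lebesgue \<kappa>"
  proof (rule square_integrable_bound[OF square_integrable_scaleR[OF w, of ?c] mk])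
    show "AE \<xi> in lebesgue. norm (\<kappa> \<xi>) \<le> norm (?c *\<^sub>R complex_of_real (indicator (cball 0 A) \<xi> * norm \<xi> powr (- s)))"
      unfolding \<kappa>_def norm_mult norm_scaleR norm_exp_i_times by simp
  qed
  have ax: "square_integrable lebesgue (\<lambda>\<xi>. axis j (f \<xi>) :: complex ^ 'n)"
    if "f \<in> borel_measurable lebesgue" "\<And>\<xi>. norm (f \<xi>) = norm (\<kappa> \<xi>)" for f
    unfolding square_integrable_vec_iff
  proof
    fix i
    have "(\<lambda>\<xi>. (axis j (f \<xi>) :: complex ^ 'n) $ i) = (\<lambda>\<xi>. if i = j then f \<xi> else 0)"
      by (auto simp: axis_def fun_eq_iff)
    moreover have "square_integrable lebesgue f"
      using square_integrable_bound[OF sk that(1)] that(2) by simp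
    ultimately show "square_integrable lebesgue (\<lambda>\<xi>. (axis j (f \<xi>) :: complex ^ 'n) $ i)"
      by (cases "i = j") (auto simp: square_integrable_def)
  qed
  show ?thesis
  proof (rule that)
    show "square_integrable lebesgue \<phi>" unfolding \<phi>_def
      by (rule ax) (use mk in \<open>auto intro: borel_measurable_cnj\<close>)
    show "square_integrable lebesgue \<psi>" unfolding \<psi>_def
      by (rule ax) (use mk in \<open>auto intro!: borel_measurable_cnj simp del: complex_cnj_mult simp: norm_mult\<close>)
    fix G :: "real ^ 'd \<Rightarrow> complex ^ 'n" assume G: "square_integrable lebesgue G"
    have i: "integrable lebesgue (\<lambda>\<xi>. \<kappa> \<xi> * G \<xi> $ j)"
      by (rule square_integrable_mult(1)[OF sk square_integrable_nth[OF G]])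
    have eq: "vband_inv s A G x $ j = (LINT \<xi>|lebesgue. \<kappa> \<xi> * G \<xi> $ j)"
      unfolding vband_inv_def band_inv_def inv_ft_def cutoff_def \<kappa>_def vec_lambda_beta
      by (subst integral_mult_right_zero[symmetric]) (simp only: mult.assoc)
    have inner: "v \<bullet> axis j z = Re (cnj z * v $ j)" for v :: "complex ^ 'n" and z
      by (simp add: inner_axis inner_complex_def)
    have "Re (vband_inv s A G x $ j) = ip lebesgue G \<phi>"
      unfolding eq ip_def \<phi>_def inner complex_cnj_cnj by (rule integral_Re[OF i, symmetric])
    moreover have "Im (vband_inv s A G x $ j) = ip lebesgue G \<psi>"
      unfolding eq ip_def \<psi>_def inner complex_cnj_cnj by (simp add: integral_Im[OF i, symmetric] mult.assoc add.commute)
    ultimately show "vband_inv s A G x $ j = Complex (ip lebesgue G \<phi>) (ip lebesgue G \<psi>)"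
      by (simp add: complex_eq_iff)
  qed
qed

text \<open>A band-limited value at time t is given by two pairings with \<open>ev t\<close> of the
  data; \<open>ip_ev_left\<close> shifts the flow to the test functions, where weak convergence
  applies.\<close>

lemma bsol_weak_tendsto:
  assumes g: "\<And>i. square_integrable lebesgue (g i)" and G: "square_integrable lebesgue G"
    and weak: "\<And>\<phi>. square_integrable lebesgue \<phi> \<Longrightarrow> (\<lambda>i. ip lebesgue (g i) \<phi>) \<longlonglongrightarrow> ip lebesgue G \<phi>"
  shows "(\<lambda>i. bsol A (g i) t x) \<longlonglongrightarrow> bsol A G t x"
proof (rule vec_tendstoI)
  fix j :: 'n
  obtain \<phi> \<psi> where p: "square_integrable lebesgue \<phi>" "square_integrable lebesgue \<psi>"
    "\<And>G. square_integrable lebesgue G \<Longrightarrow> vband_inv s A G x $ j = Complex (ip lebesgue G \<phi>) (ip lebesgue G \<psi>)"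
    by (rule band_inv_pairing[of A x j]) blast
  have w: "(\<lambda>i. ip lebesgue (ev t (g i)) \<theta>) \<longlonglongrightarrow> ip lebesgue (ev t G) \<theta>" if "square_integrable lebesgue \<theta>" for \<theta>
    unfolding ip_ev_left[OF g that] ip_ev_left[OF G that] by (rule weak[OF ev_square_integrable[OF that]])
  show "(\<lambda>i. bsol A (g i) t x $ j) \<longlonglongrightarrow> bsol A G t x $ j"
    unfolding bsol_def p(3)[OF ev_square_integrable[OF g]] p(3)[OF ev_square_integrable[OF G]]
    by (intro tendsto_Complex w p)
qed

end

section \<open>A one-sided Brezis--Lieb lemma\<close>

text \<open>\<open>\<eta>\<close> is chosen with (1 + eta)^r = 1 + e. If y <= eta x, the left side
  is at most (1 + e) x^r; otherwise x < y / eta and the y term alone dominates.\<close>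

lemma add_powr_le:
  fixes x y r e :: real
  assumes r: "0 < r" and e: "0 < e" and xy: "0 \<le> x" "0 \<le> y"
  defines "\<eta> \<equiv> (1 + e) powr (1 / r) - 1"
  shows "(x + y) powr r \<le> (1 + e) * x powr r + (1 + 1 / \<eta>) powr r * y powr r"
proof -
  have eta: "0 < \<eta>" using r e by (simp add: \<eta>_def)
  show ?thesis
  proof (cases "y \<le> \<eta> * x")
    case True
    then have "(x + y) powr r \<le> ((1 + e) powr (1 / r) * x) powr r"
      using xy r by (intro powr_mono2) (auto simp: \<eta>_def algebra_simps)
    also have "\<dots> = (1 + e) * x powr r" using xy e r by (simp add: powr_mult powr_powr)
    finally show ?thesis by (rule order_trans) simp
  next
    case False
    then have "x + y \<le> (1 + 1 / \<eta>) * y" using eta by (simp add: field_simps)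
    then have "(x + y) powr r \<le> ((1 + 1 / \<eta>) * y) powr r"
      using xy r by (intro powr_mono2) auto
    also have "\<dots> = (1 + 1 / \<eta>) powr r * y powr r" using xy eta by (simp add: powr_mult)
    finally show ?thesis by (rule order_trans) (use e in simp)
  qed
qed

text \<open>The excess W of N(f i)^r over (1 + e) N(f i - F)^r is dominated by a multiple of N(F)^r
  and tends to N(F)^r, so dominated convergence applies to it. Forming the excess before integrating
  leaves room for f i with infinite integrals.\<close>

lemma Brezis_Lieb_upper:
  fixes f :: "nat \<Rightarrow> 'a \<Rightarrow> complex ^ 'n::finite"
  assumes N: "complex_norm N" and f[measurable]: "\<And>i. f i \<in> borel_measurable M" and F[measurable]: "F \<in> borel_measurable M"
    and lim: "AE x in M. (\<lambda>i. f i x) \<longlonglongrightarrow> F x" and r: "0 < r"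
    and fin: "(\<integral>\<^sup>+x. ennreal (N (F x) powr r) \<partial>M) < \<infinity>" and e: "0 < e"
  obtains w where "w \<longlonglongrightarrow> (\<integral>\<^sup>+x. ennreal (N (F x) powr r) \<partial>M)"
    "\<And>i. (\<integral>\<^sup>+x. ennreal (N (f i x) powr r) \<partial>M) \<le> ennreal (1 + e) * (\<integral>\<^sup>+x. ennreal (N (f i x - F x) powr r) \<partial>M) + w i"
proof -
  note [measurable] = complex_norm_measurable[OF N]
  have N0: "0 \<le> N v" for v using N by (simp add: complex_norm_def)
  define Ce where "Ce = (1 + 1 / ((1 + e) powr (1 / r) - 1)) powr r"
  define W where "W i x = max 0 (N (f i x) powr r - (1 + e) * N (f i x - F x) powr r)" for i x
  have [measurable]: "W i \<in> borel_measurable M" for i unfolding W_def by measurable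
  show ?thesis
  proof (rule that[of "\<lambda>i. \<integral>\<^sup>+x. ennreal (W i x) \<partial>M"])
    have "(\<lambda>i. \<integral>\<^sup>+x. ennreal (W i x) \<partial>M) \<longlonglongrightarrow> (\<integral>\<^sup>+x. ennreal (N (F x) powr r) \<partial>M)"
    proof (rule nn_integral_dominated_convergence[where w="\<lambda>x. ennreal (Ce * N (F x) powr r)"])
      show "AE x in M. ennreal (W j x) \<le> ennreal (Ce * N (F x) powr r)" for j
      proof (intro AE_I2 ennreal_leI)
        fix x
        have "N (f j x) \<le> N (f j x - F x) + N (F x)"
          using complex_norm_diff_le[OF N, of "f j x" "F x"] by linarith
        then have "N (f j x) powr r \<le> (N (f j x - F x) + N (F x)) powr r"
          using N0 r by (intro powr_mono2) auto
        also have "\<dots> \<le> (1 + e) * N (f j x - F x) powr r + Ce * N (F x) powr r"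
          unfolding Ce_def by (rule add_powr_le[OF r e N0 N0])
        finally show "W j x \<le> Ce * N (F x) powr r" unfolding W_def Ce_def by simp
      qed
      have "(\<integral>\<^sup>+x. ennreal (Ce * N (F x) powr r) \<partial>M) = (\<integral>\<^sup>+x. ennreal Ce * ennreal (N (F x) powr r) \<partial>M)"
        by (intro nn_integral_cong ennreal_mult) (auto simp: Ce_def)
      also have "\<dots> = ennreal Ce * (\<integral>\<^sup>+x. ennreal (N (F x) powr r) \<partial>M)"
        by (rule nn_integral_cmult) measurable
      also have "\<dots> < \<infinity>" using fin by (simp add: ennreal_mult_less_top)
      finally show "(\<integral>\<^sup>+x. ennreal (Ce * N (F x) powr r) \<partial>M) < \<infinity>" .
      show "AE x in M. (\<lambda>i. ennreal (W i x)) \<longlonglongrightarrow> ennreal (N (F x) powr r)"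
        using lim
      proof eventually_elim
        case (elim x)
        have cN: "(\<lambda>i. N (u i)) \<longlonglongrightarrow> N v" if "u \<longlonglongrightarrow> v" for u v
          using continuous_on_tendsto_compose[OF complex_norm_continuous[OF N] that] by simp
        have 1: "(\<lambda>i. N (f i x)) \<longlonglongrightarrow> N (F x)" by (rule cN[OF elim])
        have "(\<lambda>i. f i x - F x) \<longlonglongrightarrow> F x - F x" by (intro tendsto_diff elim tendsto_const)
        then have "(\<lambda>i. N (f i x - F x)) \<longlonglongrightarrow> N 0" using cN by fastforce
        moreover have "N 0 = 0" using N by (simp add: complex_norm_def)
        ultimately have 2: "(\<lambda>i. N (f i x - F x)) \<longlonglongrightarrow> 0" by simp
        have "(\<lambda>i. N (f i x) powr r) \<longlonglongrightarrow> N (F x) powr r"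
          by (rule tendsto_powr'[OF 1 tendsto_const]) (use r N0 in auto)
        moreover have "(\<lambda>i. N (f i x - F x) powr r) \<longlonglongrightarrow> 0 powr r"
          by (rule tendsto_powr'[OF 2 tendsto_const]) (use r N0 in auto)
        ultimately have "(\<lambda>i. W i x) \<longlonglongrightarrow> max 0 (N (F x) powr r - (1 + e) * 0 powr r)"
          unfolding W_def by (intro tendsto_max tendsto_diff tendsto_mult tendsto_const)
        then show ?case by (intro tendsto_ennrealI) (simp add: max_def)
      qed
    qed measurable
    then show "(\<lambda>i. \<integral>\<^sup>+x. ennreal (W i x) \<partial>M) \<longlonglongrightarrow> (\<integral>\<^sup>+x. ennreal (N (F x) powr r) \<partial>M)" .
    fix i
    have "(\<integral>\<^sup>+x. ennreal (N (f i x) powr r) \<partial>M) \<le> (\<integral>\<^sup>+x. ennreal (1 + e) * ennreal (N (f i x - F x) powr r) + ennreal (W i x) \<partial>M)"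
    proof (rule nn_integral_mono)
      fix x
      have "ennreal (N (f i x) powr r) \<le> ennreal ((1 + e) * N (f i x - F x) powr r + W i x)"
        by (rule ennreal_leI) (simp add: W_def)
      also have "\<dots> = ennreal (1 + e) * ennreal (N (f i x - F x) powr r) + ennreal (W i x)"
        using e by (subst ennreal_plus) (auto simp: W_def ennreal_mult)
      finally show "ennreal (N (f i x) powr r) \<le> ennreal (1 + e) * ennreal (N (f i x - F x) powr r) + ennreal (W i x)" .
    qed
    also have "\<dots> = (\<integral>\<^sup>+x. ennreal (1 + e) * ennreal (N (f i x - F x) powr r) \<partial>M) + (\<integral>\<^sup>+x. ennreal (W i x) \<partial>M)"
      by (rule nn_integral_add) measurable
    also have "(\<integral>\<^sup>+x. ennreal (1 + e) * ennreal (N (f i x - F x) powr r) \<partial>M) = ennreal (1 + e) * (\<integral>\<^sup>+x. ennreal (N (f i x - F x) powr r) \<partial>M)"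
      by (rule nn_integral_cmult) measurable
    finally show "(\<integral>\<^sup>+x. ennreal (N (f i x) powr r) \<partial>M) \<le> ennreal (1 + e) * (\<integral>\<^sup>+x. ennreal (N (f i x - F x) powr r) \<partial>M) + (\<integral>\<^sup>+x. ennreal (W i x) \<partial>M)" .
  qed
qed

section \<open>Interpolation of Lebesgue norms\<close>

lemma ennreal_powr_le:
  assumes "ennreal_powr X (1 / p) \<le> ennreal c" "0 < p" "0 \<le> c"
  shows "X \<le> ennreal (c powr p)"
proof (cases "X = top")
  case True
  then show ?thesis using assms by (simp add: ennreal_powr_def top_unique)
next
  case False
  then have "enn2real X powr (1 / p) \<le> c" using assms by (simp add: ennreal_powr_def ennreal_le_iff)
  then have "(enn2real X powr (1 / p)) powr p \<le> c powr p" using assms by (intro powr_mono2) auto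
  then have "enn2real X \<le> c powr p" using assms by (simp add: powr_powr)
  then have "ennreal (enn2real X) \<le> ennreal (c powr p)" by (rule ennreal_leI)
  moreover have "ennreal (enn2real X) = X" using False by (intro ennreal_enn2real) (simp add: less_top)
  ultimately show ?thesis by (simp only:)
qed

text \<open>Hoelder's inequality between \<open>L^q\<close> and \<open>L^a\<close> with weights p/q
  and (r - p)/a, which add up to 1 by \<open>rel\<close>. The \<open>L^q\<close> norm enters with
  power exactly p, so that integration over time will produce the p-th power of the mixed
  norm.\<close>

lemma Lp_norm_interpolation:
  fixes f :: "'a \<Rightarrow> real" and p q :: ennreal and r a S :: real
  assumes [measurable]: "f \<in> borel_measurable M" and f0: "\<And>x. 0 \<le> f x"
    and p: "0 < p" "p < q" and r: "enn2real p < r" and a: "0 < a" and S: "0 < S"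
    and rel: "(if q = top then 0 else enn2real p / enn2real q) + (r - enn2real p) / a = 1"
    and Sb: "(\<integral>\<^sup>+x. ennreal (f x powr a) \<partial>M) \<le> ennreal S"
  shows "(\<integral>\<^sup>+x. ennreal (f x powr r) \<partial>M) \<le> ennreal_powr (Lp_norm q M (\<lambda>x. ennreal (f x))) (enn2real p) * ennreal (S powr ((r - enn2real p) / a))"
proof -
  define \<pi>' where "\<pi>' = enn2real p"
  have p_fin: "p < top" using p(2) by (rule less_le_trans) simp
  have pi: "0 < \<pi>'" using p p_fin by (simp add: \<pi>'_def enn2real_positive_iff)
  define \<beta> where "\<beta> = (r - \<pi>') / a"
  have beta: "0 < \<beta>" using r a by (simp add: \<beta>_def \<pi>'_def)
  have r0: "0 < r" using r pi by (simp add: \<pi>'_def)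
  show ?thesis
  proof (cases "q = top")
    case True
    \<comment> \<open>The weight of \<open>L^q\<close> is 0 here, so r = p + a, and f^p is bounded
      by the p-th power of the essential supremum.\<close>
    then have b1: "\<beta> = 1" and ra: "r = \<pi>' + a" using rel a by (auto simp: \<beta>_def \<pi>'_def field_simps)
    define Q where "Q = esssup M (\<lambda>x. ennreal (f x))"
    have Q: "Lp_norm q M (\<lambda>x. ennreal (f x)) = Q" using True by (simp add: Lp_norm_def Q_def)
    show ?thesis
    proof (cases "Q = top")
      case True
      then have "ennreal_powr Q \<pi>' * ennreal (S powr \<beta>) = top"
        using S by (simp add: ennreal_powr_def ennreal_top_mult)
      then show ?thesis unfolding Q \<beta>_def \<pi>'_def by simp
    next
      case False
      have ae: "AE x in M. f x \<le> enn2real Q"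
        using esssup_AE[of "\<lambda>x. ennreal (f x)" M]
      proof eventually_elim
        case (elim x)
        then have "enn2real (ennreal (f x)) \<le> enn2real Q" using False unfolding Q_def[symmetric] by (intro enn2real_mono) (auto simp: less_top)
        then show ?case using f0 by simp
      qed
      have "(\<integral>\<^sup>+x. ennreal (f x powr r) \<partial>M) \<le> (\<integral>\<^sup>+x. ennreal (enn2real Q powr \<pi>') * ennreal (f x powr a) \<partial>M)"
      proof (rule nn_integral_mono_AE)
        show "AE x in M. ennreal (f x powr r) \<le> ennreal (enn2real Q powr \<pi>') * ennreal (f x powr a)"
          using ae
        proof eventually_elim
          case (elim x)
          have "f x powr r = f x powr \<pi>' * f x powr a" unfolding ra by (rule powr_add)
          also have "\<dots> \<le> enn2real Q powr \<pi>' * f x powr a"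
            using elim f0 pi by (intro mult_right_mono powr_mono2) auto
          finally show ?case unfolding ennreal_mult'[OF powr_ge_zero, symmetric] by (rule ennreal_leI)
        qed
      qed
      also have "\<dots> = ennreal (enn2real Q powr \<pi>') * (\<integral>\<^sup>+x. ennreal (f x powr a) \<partial>M)"
        by (rule nn_integral_cmult) measurable
      also have "\<dots> \<le> ennreal (enn2real Q powr \<pi>') * ennreal S" by (intro mult_left_mono Sb) simp
      finally show ?thesis
        using False S unfolding Q \<pi>'_def[symmetric] \<beta>_def[symmetric] b1 by (simp add: ennreal_powr_def)
    qed
  next
    case False
    define \<kappa> where "\<kappa> = enn2real q"
    have kp: "\<pi>' < \<kappa>"
      using p(2) False p_fin unfolding \<pi>'_def \<kappa>_def by (metis enn2real_less_iff ennreal_enn2real less_top)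
    have k0: "0 < \<kappa>" using kp pi by simp
    define \<alpha> where "\<alpha> = \<pi>' / \<kappa>"
    have al: "0 < \<alpha>" "\<alpha> + \<beta> = 1" using rel False pi k0 by (auto simp: \<alpha>_def \<beta>_def \<pi>'_def \<kappa>_def)
    have ab: "\<kappa> * \<alpha> = \<pi>'" "a * \<beta> = r - \<pi>'" using k0 a by (auto simp: \<alpha>_def \<beta>_def)
    define I where "I = (\<integral>\<^sup>+x. ennreal (f x powr \<kappa>) \<partial>M)"
    have "Lp_norm q M (\<lambda>x. ennreal (f x)) = ennreal_powr (\<integral>\<^sup>+x. ennreal_powr (ennreal (f x)) \<kappa> \<partial>M) (1 / \<kappa>)"
      using False by (simp add: Lp_norm_def \<kappa>_def)
    also have "(\<integral>\<^sup>+x. ennreal_powr (ennreal (f x)) \<kappa> \<partial>M) = I"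
      unfolding I_def using f0 by (intro nn_integral_cong) (simp add: ennreal_powr_def)
    finally have Q: "Lp_norm q M (\<lambda>x. ennreal (f x)) = ennreal_powr I (1 / \<kappa>)" .
    have QI: "ennreal_powr (ennreal_powr I (1 / \<kappa>)) \<pi>' = ennreal_powr I \<alpha>"
      by (auto simp: ennreal_powr_def powr_powr \<alpha>_def)
    show ?thesis
    proof (cases "I = top")
      case True
      then have "ennreal_powr I \<alpha> * ennreal (S powr \<beta>) = top"
        using S by (simp add: ennreal_powr_def ennreal_top_mult)
      then show ?thesis unfolding Q \<beta>_def[symmetric] \<pi>'_def[symmetric] QI by simp
    next
      case fin: False
      show ?thesis
      proof (cases "I = 0")
        case True
        then have "AE x in M. ennreal (f x powr \<kappa>) = 0"
          unfolding I_def by (subst (asm) nn_integral_0_iff_AE) auto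
        then have "AE x in M. f x = 0" using f0 by (auto elim!: eventually_mono)
        then have "(\<integral>\<^sup>+x. ennreal (f x powr r) \<partial>M) = 0"
          by (subst nn_integral_0_iff_AE) (auto elim!: eventually_mono)
        then show ?thesis by simp
      next
        case nz: False
        define i where "i = enn2real I"
        have I: "I = ennreal i" using fin by (simp add: i_def less_top)
        have i: "0 < i" using nz fin by (simp add: i_def enn2real_positive_iff less_top zero_less_iff_neq_zero)
        \<comment> \<open>Young's inequality for f^kappa / i and f^a / S. Both have integral at most
          1, so integrating the pointwise bound gives Hoelder's inequality with constant alpha +
          beta = 1.\<close>
        have pt: "f x powr r \<le> i powr \<alpha> * S powr \<beta> * (\<alpha> / i * f x powr \<kappa> + \<beta> / S * f x powr a)" for x
        proof (cases "f x = 0")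
          case False
          then have fx: "0 < f x" using f0[of x] by simp
          have "(f x powr \<kappa> / i) powr \<alpha> * (f x powr a / S) powr \<beta> \<le> \<alpha> * (f x powr \<kappa> / i) + \<beta> * (f x powr a / S)"
            by (rule Youngs_inequality_0) (use al beta i S fx in auto)
          then have "i powr \<alpha> * S powr \<beta> * ((f x powr \<kappa> / i) powr \<alpha> * (f x powr a / S) powr \<beta>) \<le> i powr \<alpha> * S powr \<beta> * (\<alpha> * (f x powr \<kappa> / i) + \<beta> * (f x powr a / S))"
            by (rule mult_left_mono) simp
          moreover have "i powr \<alpha> * S powr \<beta> * ((f x powr \<kappa> / i) powr \<alpha> * (f x powr a / S) powr \<beta>) = f x powr (\<kappa> * \<alpha>) * f x powr (a * \<beta>)"
            using i S fx by (simp add: powr_divide powr_powr)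
          moreover have "f x powr (\<kappa> * \<alpha>) * f x powr (a * \<beta>) = f x powr r"
            unfolding ab powr_add[symmetric] by simp
          ultimately show ?thesis by simp
        qed (use r0 i S al beta in simp)
        have "(\<integral>\<^sup>+x. ennreal (f x powr r) \<partial>M) \<le> (\<integral>\<^sup>+x. ennreal (i powr \<alpha> * S powr \<beta>) * (ennreal (\<alpha> / i) * ennreal (f x powr \<kappa>) + ennreal (\<beta> / S) * ennreal (f x powr a)) \<partial>M)"
        proof (rule nn_integral_mono)
          fix x
          have "ennreal (f x powr r) \<le> ennreal (i powr \<alpha> * S powr \<beta> * (\<alpha> / i * f x powr \<kappa> + \<beta> / S * f x powr a))"
            by (rule ennreal_leI[OF pt])
          also have "\<dots> = ennreal (i powr \<alpha> * S powr \<beta>) * (ennreal (\<alpha> / i) * ennreal (f x powr \<kappa>) + ennreal (\<beta> / S) * ennreal (f x powr a))"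
          proof -
            have 1: "ennreal (i powr \<alpha> * S powr \<beta> * Z) = ennreal (i powr \<alpha> * S powr \<beta>) * ennreal Z" for Z
              by (rule ennreal_mult') simp
            have 2: "ennreal (\<alpha> / i * f x powr \<kappa> + \<beta> / S * f x powr a) = ennreal (\<alpha> / i * f x powr \<kappa>) + ennreal (\<beta> / S * f x powr a)"
              by (rule ennreal_plus) (use i S al beta in auto)
            have 3: "ennreal (\<alpha> / i * Z) = ennreal (\<alpha> / i) * ennreal Z" "ennreal (\<beta> / S * Z) = ennreal (\<beta> / S) * ennreal Z" for Z
              by (rule ennreal_mult'; use i S al beta in auto)+
            show ?thesis unfolding 1 2 3 ..
          qed
          finally show "ennreal (f x powr r) \<le> ennreal (i powr \<alpha> * S powr \<beta>) * (ennreal (\<alpha> / i) * ennreal (f x powr \<kappa>) + ennreal (\<beta> / S) * ennreal (f x powr a))" .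
        qed
        also have "\<dots> = ennreal (i powr \<alpha> * S powr \<beta>) * (ennreal (\<alpha> / i) * I + ennreal (\<beta> / S) * (\<integral>\<^sup>+x. ennreal (f x powr a) \<partial>M))"
          unfolding I_def by (subst nn_integral_cmult, measurable, subst nn_integral_add, measurable, subst nn_integral_cmult, measurable, subst nn_integral_cmult, measurable)
        also have "\<dots> \<le> ennreal (i powr \<alpha> * S powr \<beta>) * (ennreal (\<alpha> / i) * ennreal i + ennreal (\<beta> / S) * ennreal S)"
          unfolding I by (intro mult_left_mono add_left_mono Sb) auto
        also have "ennreal (\<alpha> / i) * ennreal i + ennreal (\<beta> / S) * ennreal S = ennreal (\<alpha> + \<beta>)"
          using i S al beta by (simp add: ennreal_mult[symmetric] ennreal_plus[symmetric] del: ennreal_plus)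
        also have "ennreal (i powr \<alpha> * S powr \<beta>) * ennreal (\<alpha> + \<beta>) = ennreal_powr I \<alpha> * ennreal (S powr \<beta>)"
          using fin unfolding al(2) by (simp add: ennreal_powr_def i_def ennreal_mult)
        finally show ?thesis unfolding Q \<beta>_def[symmetric] \<pi>'_def[symmetric] QI .
      qed
    qed
  qed
qed

section \<open>Mixed norms of Borel functions\<close>

lemma ennreal_powr_mult: "0 < a \<Longrightarrow> ennreal_powr (x * y) a = ennreal_powr x a * ennreal_powr y a"
  by (cases x; cases y)
    (auto simp: ennreal_powr_def ennreal_mult_top ennreal_top_mult powr_mult simp flip: ennreal_mult)

lemma ennreal_powr_mono: "0 < a \<Longrightarrow> x \<le> y \<Longrightarrow> ennreal_powr x a \<le> ennreal_powr y a"
  by (cases x; cases y) (auto simp: ennreal_powr_def top_unique intro!: ennreal_leI powr_mono2)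

lemma ennreal_powr_ennreal: "0 \<le> x \<Longrightarrow> ennreal_powr (ennreal x) a = ennreal (x powr a)"
  by (simp add: ennreal_powr_def)

lemma ennreal_powr_powr: "0 < a \<Longrightarrow> ennreal_powr (ennreal_powr x a) b = ennreal_powr x (a * b)"
  by (auto simp: ennreal_powr_def powr_powr)

lemma ennreal_powr_one: "ennreal_powr x 1 = x"
  by (cases x) (auto simp: ennreal_powr_def)

lemma measurable_ennreal_powr[measurable (raw)]:
  assumes [measurable]: "f \<in> borel_measurable M"
  shows "(\<lambda>x. ennreal_powr (f x) a) \<in> borel_measurable M"
proof -
  have "{x \<in> space M. f x = top} \<in> sets M"
    using measurable_sets[OF assms, of "{top}"] by (simp add: vimage_def Int_def conj_commute)
  then show ?thesis unfolding ennreal_powr_def by (intro measurable_If) measurable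
qed

lemma Lp_norm_lebesgue:
  fixes f :: "'a::euclidean_space \<Rightarrow> ennreal"
  assumes f: "f \<in> borel_measurable borel"
  shows "Lp_norm q lebesgue f = Lp_norm q lborel f"
proof -
  have f1: "f \<in> borel_measurable lborel" using f by simp
  have f2: "f \<in> borel_measurable lebesgue" by (rule measurable_completion[OF f1])
  have "esssup lebesgue f = esssup lborel f"
    unfolding esssup_eq_AE[OF f1] esssup_eq_AE[OF f2] AE_completion_iff ..
  then show ?thesis by (simp add: Lp_norm_def nn_integral_completion)
qed

lemma Lp_norm_cong_AE:
  assumes "f \<in> borel_measurable M" "g \<in> borel_measurable M" "AE x in M. f x = g x"
  shows "Lp_norm q M f = Lp_norm q M g"
proof -
  have "(\<integral>\<^sup>+x. ennreal_powr (f x) (enn2real q) \<partial>M) = (\<integral>\<^sup>+x. ennreal_powr (g x) (enn2real q) \<partial>M)"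
    by (rule nn_integral_cong_AE) (use assms(3) in \<open>auto elim: eventually_mono\<close>)
  then show ?thesis using esssup_AE_cong[OF assms] by (simp add: Lp_norm_def)
qed

lemma Lp_norm_mono:
  assumes "f \<in> borel_measurable M" "0 < q" "\<And>x. f x \<le> g x"
  shows "Lp_norm q M f \<le> Lp_norm q M g"
proof (cases "q = top")
  case False
  then have q: "0 < enn2real q" using assms(2) by (simp add: enn2real_positive_iff less_top)
  show ?thesis using False q unfolding Lp_norm_def
    by (simp add: ennreal_powr_mono nn_integral_mono assms(3))
qed (use assms in \<open>simp add: Lp_norm_def esssup_mono\<close>)

text \<open>For q infinite, the essential supremum of a slice exceeds c exactly if the slice exceeds
  c on a set of positive measure, and this measure depends measurably on t by Tonelli.\<close>

lemma borel_measurable_Lp_norm: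
  fixes f :: "'a \<times> 'b::euclidean_space \<Rightarrow> ennreal"
  assumes f[measurable]: "f \<in> borel_measurable (M \<Otimes>\<^sub>M lborel)"
  shows "(\<lambda>t. Lp_norm q lborel (\<lambda>x. f (t, x))) \<in> borel_measurable M"
proof (cases "q = top")
  case True
  have "(\<lambda>t. esssup lborel (\<lambda>x. f (t, x))) \<in> borel_measurable M"
  proof (rule borel_measurableI_greater)
    fix c
    have "c < esssup lborel (\<lambda>x. f (t, x)) \<longleftrightarrow> 0 < (\<integral>\<^sup>+x. indicator {x. c < x} (f (t, x)) \<partial>lborel)" if t: "t \<in> space M" for t
    proof -
      have ft[measurable]: "(\<lambda>x. f (t, x)) \<in> borel_measurable lborel" using t by measurable
      have "(\<integral>\<^sup>+x. indicator {x. c < x} (f (t, x)) \<partial>lborel) = 0 \<longleftrightarrow> (AE x in lborel. f (t, x) \<le> c)"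
        by (subst nn_integral_0_iff_AE) (auto simp: indicator_def not_less)
      also have "\<dots> \<longleftrightarrow> esssup lborel (\<lambda>x. f (t, x)) \<le> c"
        using esssup_I[OF ft] esssup_AE[of "\<lambda>x. f (t, x)" lborel]
        by (auto elim: eventually_mono order_trans)
      finally show ?thesis by (simp add: not_le[symmetric] zero_less_iff_neq_zero)
    qed
    then have "{t \<in> space M. c < esssup lborel (\<lambda>x. f (t, x))} = {t \<in> space M. 0 < (\<integral>\<^sup>+x. indicator {x. c < x} (f (t, x)) \<partial>lborel)}"
      by blast
    also have "\<dots> \<in> sets M" by measurable
    finally show "{t \<in> space M. c < esssup lborel (\<lambda>x. f (t, x))} \<in> sets M" .
  qed
  then show ?thesis using True by (simp add: Lp_norm_def)
next
  case False
  have "(\<lambda>t. ennreal_powr (\<integral>\<^sup>+x. ennreal_powr (f (t, x)) (enn2real q) \<partial>lborel) (1 / enn2real q)) \<in> borel_measurable M"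
    by measurable
  then show ?thesis using False by (simp add: Lp_norm_def)
qed

lemma nn_integral_affine_lborel:
  fixes t :: "'a::euclidean_space" and f :: "'a \<Rightarrow> ennreal"
  assumes c: "0 < c" and f[measurable]: "f \<in> borel_measurable borel"
  shows "(\<integral>\<^sup>+x. f (t + c *\<^sub>R x) \<partial>lborel) = ennreal (c powr (- real DIM('a))) * (\<integral>\<^sup>+x. f x \<partial>lborel)"
proof -
  have "f \<in> borel_measurable lebesgue" by (rule measurable_completion) measurable
  then have "(\<integral>\<^sup>+x. f x \<partial>lborel) = ennreal (c ^ DIM('a)) * (\<integral>\<^sup>+x. f (t + c *\<^sub>R x) \<partial>lborel)"
    using nn_integral_affine_lebesgue[of c f t] c by (simp add: nn_integral_completion)
  moreover have "ennreal (c powr (- real DIM('a))) * ennreal (c ^ DIM('a)) = 1"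
    using c unfolding powr_realpow[OF c, symmetric] by (simp add: ennreal_mult[symmetric] powr_add[symmetric] del: ennreal_mult)
  ultimately show ?thesis by (simp add: mult.assoc[symmetric])
qed

lemma AE_affine_lborel:
  fixes t :: "'a::euclidean_space"
  assumes "c \<noteq> 0" "AE x in lborel. P x"
  shows "AE x in lborel. P (t + c *\<^sub>R x)"
  using AE_affine_lebesgue[of c P t] assms by (simp add: AE_completion_iff)

text \<open>The scaling dimension of the norm: replacing u by u(b x) multiplies the
  \<open>L^q\<close> norm in dimension d by b to the power -\<open>Lp_dim q d\<close>.\<close>

definition Lp_dim :: "ennreal \<Rightarrow> nat \<Rightarrow> real" where
  "Lp_dim q d = (if q = top then 0 else real d / enn2real q)"

lemma Lp_norm_scaling_le:
  fixes u :: "'a::euclidean_space \<Rightarrow> ennreal"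
  assumes q: "0 < q" and c: "0 < c" and b: "0 < b" and u[measurable]: "u \<in> borel_measurable borel"
  shows "Lp_norm q lborel (\<lambda>x. ennreal c * u (b *\<^sub>R x)) \<le> ennreal (c * b powr (- Lp_dim q DIM('a))) * Lp_norm q lborel u"
proof (cases "q = top")
  case True
  have "AE x in lborel. u x \<le> esssup lborel u" by (rule esssup_AE)
  then have "AE x in lborel. u (0 + b *\<^sub>R x) \<le> esssup lborel u"
    by (rule AE_affine_lborel[rotated]) (use b in simp)
  then have "AE x in lborel. ennreal c * u (b *\<^sub>R x) \<le> ennreal c * esssup lborel u"
    by (auto elim!: eventually_mono intro: mult_left_mono)
  then show ?thesis using True b by (simp add: Lp_norm_def Lp_dim_def esssup_I)
next
  case False
  define \<kappa> where "\<kappa> = enn2real q"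
  have k: "0 < \<kappa>" using False q by (simp add: \<kappa>_def enn2real_positive_iff less_top)
  have "(\<integral>\<^sup>+x. ennreal_powr (ennreal c * u (b *\<^sub>R x)) \<kappa> \<partial>lborel) = (\<integral>\<^sup>+x. ennreal (c powr \<kappa>) * ennreal_powr (u (0 + b *\<^sub>R x)) \<kappa> \<partial>lborel)"
    using c by (simp add: ennreal_powr_mult[OF k] ennreal_powr_ennreal)
  also have "\<dots> = ennreal (c powr \<kappa>) * (\<integral>\<^sup>+x. ennreal_powr (u (0 + b *\<^sub>R x)) \<kappa> \<partial>lborel)"
    by (rule nn_integral_cmult) measurable
  also have "(\<integral>\<^sup>+x. ennreal_powr (u (0 + b *\<^sub>R x)) \<kappa> \<partial>lborel) = ennreal (b powr (- real DIM('a))) * (\<integral>\<^sup>+x. ennreal_powr (u x) \<kappa> \<partial>lborel)"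
    by (rule nn_integral_affine_lborel[OF b]) measurable
  finally have "Lp_norm q lborel (\<lambda>x. ennreal c * u (b *\<^sub>R x)) = ennreal (c * b powr (- Lp_dim q DIM('a))) * Lp_norm q lborel u"
    using False k c by (simp add: Lp_norm_def \<kappa>_def[symmetric] ennreal_powr_mult ennreal_powr_ennreal powr_powr
        Lp_dim_def mult.assoc[symmetric] ennreal_mult)
  then show ?thesis by simp
qed

lemma nn_integral_gaussian_finite:
  "(\<integral>\<^sup>+x. ennreal (exp (- (1 * norm (x::'a::euclidean_space))\<^sup>2 / 2)) \<partial>lborel) < \<infinity>"
  using has_bochner_integral_gaussian_real[of 1, where 'a='a]
  by (subst nn_integral_eq_integral) (auto simp: has_bochner_integral_iff)

section \<open>Weak convergence of data gives almost everywhere convergence of solutions along a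
  subsequence\<close>

context unitary_flow
begin

lemma sol_measurable_lborel[measurable]:
  assumes "square_integrable lebesgue G"
  shows "(\<lambda>z. sol G (fst z) (snd z)) \<in> borel_measurable (lborel \<Otimes>\<^sub>M lborel)"
  using sol_measurable[OF assms] by (simp add: case_prod_beta' cong: measurable_cong_sets)

lemma bsol_measurable_lborel[measurable]:
  assumes "square_integrable lebesgue G"
  shows "(\<lambda>z. bsol A G (fst z) (snd z)) \<in> borel_measurable (lborel \<Otimes>\<^sub>M lborel)"
  using bsol_measurable[OF assms] by (simp add: case_prod_beta' cong: measurable_cong_sets)

text \<open>High-frequency errors are controlled in \<open>L^2\<close> of x uniformly in t,
  band-limited ones only in supremum norm. A positive integrable weight makes both integrable over
  space-time. The factors 1 match the form of the Gaussian integral with e = 1.\<close>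

definition gauss_weight :: "real \<times> (real ^ 'd) \<Rightarrow> real" where
  "gauss_weight z = exp (- (1 * norm (fst z))\<^sup>2 / 2) * exp (- (1 * norm (snd z))\<^sup>2 / 2)"

lemma gauss_weight_measurable[measurable]: "gauss_weight \<in> borel_measurable (lborel \<Otimes>\<^sub>M lborel)"
  unfolding gauss_weight_def[abs_def] by measurable

lemma gauss_weight_nonneg: "0 \<le> gauss_weight z"
  by (simp add: gauss_weight_def)

lemma gauss_weight_slice:
  fixes f :: "real \<times> (real ^ 'd) \<Rightarrow> real"
  assumes f[measurable]: "f \<in> borel_measurable (lborel \<Otimes>\<^sub>M lborel)" and f0: "\<And>z. 0 \<le> f z"
    and b: "\<And>t. (\<integral>\<^sup>+x. ennreal (f (t, x)) \<partial>lborel) \<le> ennreal B" and B: "0 \<le> B"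
  shows "(\<integral>\<^sup>+z. ennreal (gauss_weight z * f z) \<partial>(lborel \<Otimes>\<^sub>M lborel)) \<le> ennreal (sqrt (2 * pi) * B)"
proof -
  have g1: "(\<integral>\<^sup>+t. ennreal (exp (- (1 * norm (t::real))\<^sup>2 / 2)) \<partial>lborel) = ennreal (sqrt (2 * pi))"
    using has_bochner_integral_gaussian_real[of 1, where 'a=real]
    by (subst nn_integral_eq_integral) (auto simp: has_bochner_integral_iff)
  have "(\<integral>\<^sup>+z. ennreal (gauss_weight z * f z) \<partial>(lborel \<Otimes>\<^sub>M lborel)) = (\<integral>\<^sup>+t. \<integral>\<^sup>+x. ennreal (gauss_weight (t, x) * f (t, x)) \<partial>lborel \<partial>lborel)"
    by (rule lborel.nn_integral_fst[symmetric]) measurable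
  also have "\<dots> \<le> (\<integral>\<^sup>+t. ennreal (exp (- (1 * norm (t::real))\<^sup>2 / 2)) * ennreal B \<partial>lborel)"
  proof (rule nn_integral_mono)
    fix t :: real
    have "(\<integral>\<^sup>+x. ennreal (gauss_weight (t, x) * f (t, x)) \<partial>lborel) \<le> (\<integral>\<^sup>+x. ennreal (exp (- (1 * norm t)\<^sup>2 / 2)) * ennreal (f (t, x)) \<partial>lborel)"
    proof (rule nn_integral_mono)
      fix x :: "real ^ 'd"
      have "gauss_weight (t, x) * f (t, x) \<le> exp (- (1 * norm t)\<^sup>2 / 2) * f (t, x)"
        by (intro mult_right_mono f0) (simp add: gauss_weight_def)
      then show "ennreal (gauss_weight (t, x) * f (t, x)) \<le> ennreal (exp (- (1 * norm t)\<^sup>2 / 2)) * ennreal (f (t, x))"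
        by (subst ennreal_mult[symmetric]) (auto intro: ennreal_leI f0)
    qed
    also have "\<dots> = ennreal (exp (- (1 * norm t)\<^sup>2 / 2)) * (\<integral>\<^sup>+x. ennreal (f (t, x)) \<partial>lborel)"
      by (rule nn_integral_cmult) measurable
    also have "\<dots> \<le> ennreal (exp (- (1 * norm t)\<^sup>2 / 2)) * ennreal B"
      by (intro mult_left_mono b) simp
    finally show "(\<integral>\<^sup>+x. ennreal (gauss_weight (t, x) * f (t, x)) \<partial>lborel) \<le> ennreal (exp (- (1 * norm t)\<^sup>2 / 2)) * ennreal B" .
  qed
  also have "\<dots> = ennreal (sqrt (2 * pi)) * ennreal B"
    by (subst nn_integral_multc) (auto simp: g1[simplified])
  finally show ?thesis using B by (simp add: ennreal_mult)
qed

text \<open>For each cutoff A the difference of solutions splits into two high-frequency parts, of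
  squared size A^(-2s) uniformly in i, and a band-limited part that tends to 0 pointwise with a
  uniform bound. Taking A large first and then i large gives weighted \<open>L^2\<close>
  convergence.\<close>

lemma weak_AE_subseq:
  assumes g: "\<And>i. square_integrable lebesgue (g i)" "\<And>i. ip lebesgue (g i) (g i) \<le> 1"
    and G: "square_integrable lebesgue G"
    and weak: "\<And>\<phi>. square_integrable lebesgue \<phi> \<Longrightarrow> (\<lambda>i. ip lebesgue (g i) \<phi>) \<longlonglongrightarrow> ip lebesgue G \<phi>"
  obtains \<rho> :: "nat \<Rightarrow> nat" where "strict_mono \<rho>"
    "AE z in lborel \<Otimes>\<^sub>M lborel. (\<lambda>i. sol (g (\<rho> i)) (fst z) (snd z)) \<longlonglongrightarrow> sol G (fst z) (snd z)"
proof -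
  let ?M = "lborel \<Otimes>\<^sub>M lborel :: (real \<times> (real ^ 'd)) measure"
  note [measurable] = sol_measurable_lborel[OF g(1)] sol_measurable_lborel[OF G]
    bsol_measurable_lborel[OF g(1)] bsol_measurable_lborel[OF G]
  define E where "E i = (\<integral>\<^sup>+z. ennreal (gauss_weight z * (norm (sol (g i) (fst z) (snd z) - sol G (fst z) (snd z)))\<^sup>2) \<partial>?M)" for i
  define T where "T A i = (\<integral>\<^sup>+z. ennreal (gauss_weight z * (norm (bsol A (g i) (fst z) (snd z) - bsol A G (fst z) (snd z)))\<^sup>2) \<partial>?M)" for A i
  define b where "b = ip lebesgue G G"
  define Q where "Q = sqrt (2 * pi)"
  have b0: "0 \<le> b" by (simp add: b_def)
  have outer: "(\<integral>\<^sup>+z. ennreal (gauss_weight z * (norm (sol H (fst z) (snd z) - bsol A H (fst z) (snd z)))\<^sup>2) \<partial>?M) \<le> ennreal (Q * (A powr (- 2 * s) * B))"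
    if H: "square_integrable lebesgue H" and A: "0 < A" and B: "ip lebesgue H H \<le> B" for H A B
    unfolding Q_def
  proof (rule gauss_weight_slice)
    note [measurable] = sol_measurable_lborel[OF H] bsol_measurable_lborel[OF H]
    show "(\<lambda>z. (norm (sol H (fst z) (snd z) - bsol A H (fst z) (snd z)))\<^sup>2) \<in> borel_measurable ?M" by measurable
    have B0: "0 \<le> B" using B ip_self_nonneg[of lebesgue H] by linarith
    then show "0 \<le> A powr (- 2 * s) * B" by simp
    show "(\<integral>\<^sup>+x. ennreal ((norm (sol H (fst (t, x)) (snd (t, x)) - bsol A H (fst (t, x)) (snd (t, x))))\<^sup>2) \<partial>lborel) \<le> ennreal (A powr (- 2 * s) * B)" for t
      unfolding fst_conv snd_conv
      by (rule order_trans[OF sol_bsol_le[OF H A]]) (intro ennreal_leI mult_left_mono B, simp)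
  qed simp
  \<comment> \<open>The factors 3 come from (x + y + z)^2 <= 3 (x^2 + y^2 + z^2); the two
    high-frequency contributions add up to 1 + b by the norm bounds on g i and G.\<close>
  have split: "E i \<le> ennreal (3 * (Q * (A powr (- 2 * s) * (1 + b)))) + 3 * T A i" if A: "0 < A" for A i
  proof -
    let ?u = "\<lambda>z. sol (g i) (fst z) (snd z)" and ?v = "\<lambda>z. bsol A (g i) (fst z) (snd z)"
    let ?w = "\<lambda>z. bsol A G (fst z) (snd z)" and ?x = "\<lambda>z. sol G (fst z) (snd z)"
    have pt: "(norm (u - x))\<^sup>2 \<le> 3 * (norm (u - v))\<^sup>2 + 3 * (norm (x - w))\<^sup>2 + 3 * (norm (v - w))\<^sup>2" for u v w x :: "complex ^ 'n"
    proof -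
      have "norm (u - x) \<le> norm (u - v) + norm (x - w) + norm (v - w)"
        using norm_triangle_ineq[of "(u - v) + (w - x)" "v - w"] norm_triangle_ineq[of "u - v" "w - x"] by (simp add: norm_minus_commute)
      then have "(norm (u - x))\<^sup>2 \<le> (norm (u - v) + norm (x - w) + norm (v - w))\<^sup>2" by (intro power_mono) auto
      also have "\<dots> \<le> 3 * (norm (u - v))\<^sup>2 + 3 * (norm (x - w))\<^sup>2 + 3 * (norm (v - w))\<^sup>2"
        using zero_le_power2[of "norm (u - v) - norm (x - w)"] zero_le_power2[of "norm (u - v) - norm (v - w)"] zero_le_power2[of "norm (x - w) - norm (v - w)"]
        by (simp add: power2_eq_square algebra_simps)
      finally show ?thesis .
    qed
    have "E i \<le> (\<integral>\<^sup>+z. 3 * ennreal (gauss_weight z * (norm (?u z - ?v z))\<^sup>2) + 3 * ennreal (gauss_weight z * (norm (?x z - ?w z))\<^sup>2) + 3 * ennreal (gauss_weight z * (norm (?v z - ?w z))\<^sup>2) \<partial>?M)"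
      unfolding E_def
    proof (rule nn_integral_mono)
      fix z
      have "gauss_weight z * (norm (?u z - ?x z))\<^sup>2 \<le> gauss_weight z * (3 * (norm (?u z - ?v z))\<^sup>2 + 3 * (norm (?x z - ?w z))\<^sup>2 + 3 * (norm (?v z - ?w z))\<^sup>2)"
        by (intro mult_left_mono pt gauss_weight_nonneg)
      also have "\<dots> = 3 * (gauss_weight z * (norm (?u z - ?v z))\<^sup>2) + 3 * (gauss_weight z * (norm (?x z - ?w z))\<^sup>2) + 3 * (gauss_weight z * (norm (?v z - ?w z))\<^sup>2)"
        by (simp add: algebra_simps)
      finally have "ennreal (gauss_weight z * (norm (?u z - ?x z))\<^sup>2) \<le> ennreal (3 * (gauss_weight z * (norm (?u z - ?v z))\<^sup>2) + 3 * (gauss_weight z * (norm (?x z - ?w z))\<^sup>2) + 3 * (gauss_weight z * (norm (?v z - ?w z))\<^sup>2))"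
        by (rule ennreal_leI)
      then show "ennreal (gauss_weight z * (norm (?u z - ?x z))\<^sup>2) \<le> 3 * ennreal (gauss_weight z * (norm (?u z - ?v z))\<^sup>2) + 3 * ennreal (gauss_weight z * (norm (?x z - ?w z))\<^sup>2) + 3 * ennreal (gauss_weight z * (norm (?v z - ?w z))\<^sup>2)"
        by (simp add: gauss_weight_nonneg ennreal_mult' mult_nonneg_nonneg)
    qed
    also have "\<dots> = 3 * (\<integral>\<^sup>+z. ennreal (gauss_weight z * (norm (?u z - ?v z))\<^sup>2) \<partial>?M) + 3 * (\<integral>\<^sup>+z. ennreal (gauss_weight z * (norm (?x z - ?w z))\<^sup>2) \<partial>?M) + 3 * T A i"
      unfolding T_def by (simp add: nn_integral_add nn_integral_cmult)
    also have "\<dots> \<le> 3 * ennreal (Q * (A powr (- 2 * s) * 1)) + 3 * ennreal (Q * (A powr (- 2 * s) * b)) + 3 * T A i"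
      by (intro add_mono mult_left_mono outer A g G order.refl) (auto simp: b_def g)
    also have "3 * ennreal (Q * (A powr (- 2 * s) * 1)) + 3 * ennreal (Q * (A powr (- 2 * s) * b)) = ennreal (3 * (Q * (A powr (- 2 * s) * (1 + b))))"
    proof -
      have "ennreal (3 * (Q * (A powr (- 2 * s) * (1 + b)))) = ennreal (3 * (Q * (A powr (- 2 * s) * 1)) + 3 * (Q * (A powr (- 2 * s) * b)))"
        by (simp add: algebra_simps)
      then show ?thesis using b0 by (simp add: Q_def ennreal_mult')
    qed
    finally show ?thesis .
  qed
  \<comment> \<open>At fixed A both band-limited parts are bounded by constants, so the weight times
    a constant is an integrable majorant, and weak convergence gives the pointwise limit 0.\<close>
  have T_lim_fin: "T A \<longlonglongrightarrow> 0 \<and> (\<forall>i. T A i < \<infinity>)" if A: "0 < A" for A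
  proof -
    obtain C where C: "0 < C" "\<And>A G t x. 0 < A \<Longrightarrow> square_integrable lebesgue G \<Longrightarrow>
      norm (bsol A G t x) \<le> C * A powr (real CARD('d) / 2 - s) * sqrt (ip lebesgue G G)"
      by (rule bsol_bound) blast
    define K where "K = C * A powr (real CARD('d) / 2 - s) * 1 + C * A powr (real CARD('d) / 2 - s) * sqrt b"
    have dom: "ennreal (gauss_weight z * (norm (bsol A (g i) (fst z) (snd z) - bsol A G (fst z) (snd z)))\<^sup>2) \<le> ennreal (gauss_weight z * K\<^sup>2)" for i z
      proof (intro ennreal_leI mult_left_mono gauss_weight_nonneg power_mono)
        have "norm (bsol A (g i) (fst z) (snd z)) \<le> C * A powr (real CARD('d) / 2 - s) * 1"
          by (rule order_trans[OF C(2)[OF A g(1)]]) (intro mult_left_mono, use g(2)[of i] C(1) in auto)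
        then show "norm (bsol A (g i) (fst z) (snd z) - bsol A G (fst z) (snd z)) \<le> K"
          unfolding K_def b_def by (intro order_trans[OF norm_triangle_ineq4] add_mono C(2) A G)
      qed simp
    have Kfin: "(\<integral>\<^sup>+z. ennreal (gauss_weight z * K\<^sup>2) \<partial>?M) < \<infinity>"
    proof -
      have "(\<integral>\<^sup>+z. ennreal (gauss_weight z * K\<^sup>2) \<partial>?M) = (\<integral>\<^sup>+t. \<integral>\<^sup>+x. ennreal (gauss_weight (t, x) * K\<^sup>2) \<partial>lborel \<partial>lborel)"
        by (rule lborel.nn_integral_fst[symmetric]) measurable
      also have "\<dots> = (\<integral>\<^sup>+t. \<integral>\<^sup>+x. ennreal (K\<^sup>2 * exp (- (1 * norm (t::real))\<^sup>2 / 2)) * ennreal (exp (- (1 * norm (x::real ^ 'd))\<^sup>2 / 2)) \<partial>lborel \<partial>lborel)"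
        by (intro nn_integral_cong) (simp add: gauss_weight_def ennreal_mult[symmetric] mult.commute mult.left_commute del: ennreal_mult)
      also have "\<dots> = (\<integral>\<^sup>+t. ennreal (K\<^sup>2) * ennreal (exp (- (1 * norm (t::real))\<^sup>2 / 2)) * (\<integral>\<^sup>+x. ennreal (exp (- (1 * norm (x::real ^ 'd))\<^sup>2 / 2)) \<partial>lborel) \<partial>lborel)"
        by (intro nn_integral_cong) (simp add: nn_integral_cmult ennreal_mult)
      also have "\<dots> = ennreal (K\<^sup>2) * (\<integral>\<^sup>+t. ennreal (exp (- (1 * norm (t::real))\<^sup>2 / 2)) \<partial>lborel) * (\<integral>\<^sup>+x. ennreal (exp (- (1 * norm (x::real ^ 'd))\<^sup>2 / 2)) \<partial>lborel)"
        by (simp add: nn_integral_multc nn_integral_cmult)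
      also have "\<dots> < \<infinity>" using nn_integral_gaussian_finite[where 'a=real] nn_integral_gaussian_finite[where 'a="real ^ 'd"] by (simp add: ennreal_mult_less_top)
      finally show ?thesis .
    qed
    have "(\<lambda>i. \<integral>\<^sup>+z. ennreal (gauss_weight z * (norm (bsol A (g i) (fst z) (snd z) - bsol A G (fst z) (snd z)))\<^sup>2) \<partial>?M) \<longlonglongrightarrow> (\<integral>\<^sup>+z. ennreal 0 \<partial>?M)"
    proof (rule nn_integral_dominated_convergence[where w="\<lambda>z. ennreal (gauss_weight z * K\<^sup>2)"])
      show "AE z in ?M. ennreal (gauss_weight z * (norm (bsol A (g i) (fst z) (snd z) - bsol A G (fst z) (snd z)))\<^sup>2) \<le> ennreal (gauss_weight z * K\<^sup>2)" for i
        by (rule AE_I2[OF dom])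
      show "(\<integral>\<^sup>+z. ennreal (gauss_weight z * K\<^sup>2) \<partial>?M) < \<infinity>" by (rule Kfin)
      show "AE z in ?M. (\<lambda>i. ennreal (gauss_weight z * (norm (bsol A (g i) (fst z) (snd z) - bsol A G (fst z) (snd z)))\<^sup>2)) \<longlonglongrightarrow> ennreal 0"
      proof (intro AE_I2 tendsto_ennrealI)
        fix z
        have "(\<lambda>i. gauss_weight z * (norm (bsol A (g i) (fst z) (snd z) - bsol A G (fst z) (snd z)))\<^sup>2) \<longlonglongrightarrow> gauss_weight z * (norm (bsol A G (fst z) (snd z) - bsol A G (fst z) (snd z)))\<^sup>2"
          by (intro tendsto_intros bsol_weak_tendsto[OF g(1) G weak])
        then show "(\<lambda>i. gauss_weight z * (norm (bsol A (g i) (fst z) (snd z) - bsol A G (fst z) (snd z)))\<^sup>2) \<longlonglongrightarrow> 0" by simp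
      qed
    qed measurable
    moreover have "T A i < \<infinity>" for i
      unfolding T_def by (rule le_less_trans[OF nn_integral_mono[OF dom] Kfin])
    ultimately show ?thesis unfolding T_def by simp
  qed
  have fin: "E i < \<infinity>" for i
    by (rule le_less_trans[OF split[of 1]]) (use T_lim_fin[of 1] in \<open>auto simp: ennreal_mult_less_top\<close>)
  have E0: "E \<longlonglongrightarrow> 0"
  proof (rule order_tendstoI)
    fix a :: ennreal assume "0 < a"
    then obtain \<epsilon>' where e': "0 < \<epsilon>'" "\<epsilon>' < a" using dense by blast
    define \<epsilon> where "\<epsilon> = enn2real \<epsilon>'"
    have "\<epsilon>' < top" using e'(2) by (rule less_le_trans) simp
    then have e: "0 < \<epsilon>" "ennreal \<epsilon> < a" using e' by (simp_all add: \<epsilon>_def enn2real_positive_iff)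
    \<comment> \<open>The solution of 3 Q A^(-2s) (1 + b) = epsilon / 2.\<close>
    define A where "A = (\<epsilon> / (6 * Q * (1 + b))) powr (- 1 / (2 * s))"
    have A: "0 < A" using e b0 by (simp add: A_def Q_def)
    have "3 * (Q * (A powr (- 2 * s) * (1 + b))) = \<epsilon> / 2"
      using e b0 s by (simp add: A_def Q_def powr_powr)
    then have le: "E i \<le> ennreal (\<epsilon> / 2) + 3 * T A i" for i using split[OF A] by metis
    have "(\<lambda>i. ennreal (\<epsilon> / 2) + 3 * T A i) \<longlonglongrightarrow> ennreal (\<epsilon> / 2) + 3 * 0"
      by (intro tendsto_add tendsto_const ennreal_tendsto_cmult T_lim_fin[THEN conjunct1] A) auto
    moreover have "ennreal (\<epsilon> / 2) + 3 * 0 < a" using e(1) order_le_less_trans[OF ennreal_leI[of "\<epsilon> / 2" \<epsilon>] e(2)] by simp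
    ultimately have "\<forall>\<^sub>F i in sequentially. ennreal (\<epsilon> / 2) + 3 * T A i < a" by (rule order_tendstoD)
    then show "\<forall>\<^sub>F i in sequentially. E i < a" by eventually_elim (rule le_less_trans[OF le])
  qed simp
  let ?h = "\<lambda>i z. gauss_weight z * (norm (sol (g i) (fst z) (snd z) - sol G (fst z) (snd z)))\<^sup>2"
  have int: "integrable ?M (?h i)" for i
    using fin[of i] by (intro integrableI_nonneg) (auto simp: E_def gauss_weight_nonneg)
  have "(\<lambda>i. \<integral>z. norm (?h i z) \<partial>?M) = (\<lambda>i. enn2real (E i))"
    unfolding E_def by (subst integral_eq_nn_integral) (auto simp: gauss_weight_nonneg fun_eq_iff)
  moreover have "(\<lambda>i. enn2real (E i)) \<longlonglongrightarrow> enn2real 0"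
    using E0 by (intro tendsto_enn2real) auto
  ultimately have "(\<lambda>i. \<integral>z. norm (?h i z) \<partial>?M) \<longlonglongrightarrow> 0" by simp
  from tendsto_L1_AE_subseq[OF int this]
  obtain \<rho> where rho: "strict_mono \<rho>" "AE z in ?M. (\<lambda>i. ?h (\<rho> i) z) \<longlonglongrightarrow> 0" by blast
  have "AE z in ?M. (\<lambda>i. sol (g (\<rho> i)) (fst z) (snd z)) \<longlonglongrightarrow> sol G (fst z) (snd z)"
    using rho(2)
  proof eventually_elim
    case (elim z)
    have "0 < gauss_weight z" by (simp add: gauss_weight_def)
    then have "(\<lambda>i. (norm (sol (g (\<rho> i)) (fst z) (snd z) - sol G (fst z) (snd z)))\<^sup>2) \<longlonglongrightarrow> 0"
      using tendsto_mult_left[OF elim, of "inverse (gauss_weight z)"] by (simp add: mult.assoc[symmetric])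
    then have "(\<lambda>i. norm (sol (g (\<rho> i)) (fst z) (snd z) - sol G (fst z) (snd z))) \<longlonglongrightarrow> 0"
      using tendsto_real_sqrt by fastforce
    then show ?case by (metis Lim_null tendsto_norm_zero_iff)
  qed
  then show ?thesis by (rule that[OF rho(1)])
qed

end

section \<open>Symmetries of the estimate\<close>

lemma Lp_norm_eq_0:
  assumes "f \<in> borel_measurable M" "0 < q" "Lp_norm q M f = 0"
  shows "AE x in M. f x = 0"
proof (cases "q = top")
  case True
  then show ?thesis using assms(3) esssup_AE[of f M] by (simp add: Lp_norm_def)
next
  case False
  then have q: "0 < enn2real q" using assms(2) by (simp add: enn2real_positive_iff less_top)
  have z: "ennreal_powr x a = 0 \<longleftrightarrow> x = 0" for x a by (cases x) (auto simp: ennreal_powr_def)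
  have "(\<integral>\<^sup>+x. ennreal_powr (f x) (enn2real q) \<partial>M) = 0" using False assms(3) by (simp add: Lp_norm_def z)
  then show ?thesis using assms(1) by (subst (asm) nn_integral_0_iff_AE) (auto simp: z)
qed

text \<open>\<open>\<alpha>\<close> is the amplitude exponent of the dilations preserving the
  Sobolev norm; alpha r = k + d says that the same dilations, with time scaled by the k-th power,
  preserve the space-time \<open>L^r\<close> norm.\<close>

locale scaled_flow = unitary_flow s k m N
  for s k :: real and m :: "real \<Rightarrow> real ^ 'd::finite \<Rightarrow> complex ^ 'n ^ 'n::finite" and N +
  fixes \<alpha> r :: real
  assumes alpha_eq: "\<alpha> = real CARD('d) / 2 - s" and r_eq: "r = (k + real CARD('d)) / \<alpha>"
begin

lemma alpha_pos: "0 < \<alpha>" using s by (simp add: alpha_eq)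

lemma r_pos: "0 < r" using alpha_pos k by (simp add: r_eq)

text \<open>A spacetime translation to \<open>(t0, x0)\<close> and a dilation by \<open>A\<close>, acting on \<open>|\<xi>|\<^sup>s f^(\<xi>)\<close>; the factor
  \<open>A\<^bsup>d/2\<^esup>\<close> preserves the \<open>L\<^sup>2\<close> norm.\<close>

definition symm :: "real \<Rightarrow> real \<Rightarrow> real ^ 'd \<Rightarrow> (real ^ 'd \<Rightarrow> complex ^ 'n) \<Rightarrow> real ^ 'd \<Rightarrow> complex ^ 'n" where
  "symm A t0 x0 G \<xi> = (of_real (A powr (real CARD('d) / 2)) * exp (\<i> * of_real ((A *\<^sub>R x0) \<bullet> \<xi>))) *s ev t0 G (A *\<^sub>R \<xi>)"

lemma symm_square_integrable:
  assumes G: "square_integrable lebesgue G" and A: "0 < A"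
  shows "square_integrable lebesgue (symm A t0 x0 G)" "ip lebesgue (symm A t0 x0 G) (symm A t0 x0 G) = ip lebesgue G G"
proof -
  note ev = ev_square_integrable[OF G, of t0]
  have m: "(\<lambda>\<xi>. ev t0 G (0 + A *\<^sub>R \<xi>)) \<in> borel_measurable lebesgue"
    by (rule borel_measurable_affine_lebesgue) (use A square_integrable_measurable[OF ev] in auto)
  have m': "symm A t0 x0 G \<in> borel_measurable lebesgue"
    unfolding symm_def[abs_def]
    by (intro measurable_vector_scalar_mult borel_measurable_times borel_measurable_const exp_i_measurable_lebesgue) (use m in simp)
  have n: "(norm (symm A t0 x0 G \<xi>))\<^sup>2 = A ^ CARD('d) * (norm (ev t0 G (0 + A *\<^sub>R \<xi>)))\<^sup>2" for \<xi>
  proof -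
    have "(A powr (real CARD('d) / 2))\<^sup>2 = A ^ CARD('d)"
      using A by (simp add: power2_eq_square powr_add[symmetric] powr_realpow)
    then show ?thesis unfolding symm_def norm_vector_scalar_mult norm_mult norm_exp_i_times
      by (simp add: power_mult_distrib)
  qed
  have mn: "(\<lambda>\<xi>. (norm (ev t0 G \<xi>))\<^sup>2) \<in> borel_measurable lebesgue"
    using square_integrable_measurable[OF ev] by measurable
  have i: "integrable lebesgue (\<lambda>\<xi>. (norm (ev t0 G \<xi>))\<^sup>2)" using ev by (simp add: square_integrable_def)
  have "integrable lebesgue (\<lambda>\<xi>. A ^ CARD('d) * (norm (ev t0 G (0 + A *\<^sub>R \<xi>)))\<^sup>2)"
    using integral_affine_lebesgue(2)[OF _ mn, of A 0] i A by (intro integrable_mult_right) auto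
  then show "square_integrable lebesgue (symm A t0 x0 G)" using m' by (simp add: square_integrable_def n)
  have "ip lebesgue (ev t0 G) (ev t0 G) = ip lebesgue (symm A t0 x0 G) (symm A t0 x0 G)"
    unfolding ip_self n using integral_affine_lebesgue(1)[OF _ mn, of A 0] A by simp
  then show "ip lebesgue (symm A t0 x0 G) (symm A t0 x0 G) = ip lebesgue G G" using ip_ev_self[OF G] by simp
qed

text \<open>Homogeneity trades the dilation in frequency for a change of time, and the group law
  combines it with the shift \<open>t0\<close>; the scalar phase commutes with the flow.\<close>

lemma ev_symm:
  assumes A: "0 < A"
  shows "ev t (symm A t0 x0 G) = symm A (A powr (- k) * t + t0) x0 G"
proof
  fix \<xi>
  have "m (A powr (- k) * t) (A *\<^sub>R \<xi>) = m t \<xi>"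
    unfolding m_scale[OF A] using A by (simp add: mult.assoc[symmetric] powr_add[symmetric])
  then show "ev t (symm A t0 x0 G) \<xi> = symm A (A powr (- k) * t + t0) x0 G \<xi>"
    unfolding ev_def symm_def m_add by (simp add: vector_scalar_commute matrix_vector_mul_assoc)
qed

text \<open>Substituting eta = A xi, the Jacobian gives A^d, the weight A^(-s) and the normalisation
  A^(-d/2), together A^alpha. The cutoff radius B becomes A B.\<close>

lemma vband_inv_symm:
  assumes G: "square_integrable lebesgue G" and A: "0 < A"
  shows "vband_inv s B (symm A t0 x0 G) y = (A powr (- \<alpha>)) *\<^sub>R vband_inv s (A * B) (ev t0 G) (x0 + (1 / A) *\<^sub>R y)"
proof -
  let ?z = "x0 + (1 / A) *\<^sub>R y"
  have "band_inv s B (\<lambda>\<xi>. symm A t0 x0 G \<xi> $ j) y = (A powr (- \<alpha>)) *\<^sub>R band_inv s (A * B) (\<lambda>\<xi>. ev t0 G \<xi> $ j) ?z" for j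
  proof -
    let ?F = "\<lambda>\<eta>. exp (\<i> * of_real (?z \<bullet> \<eta>)) * cutoff s (A * B) (\<lambda>\<xi>. ev t0 G \<xi> $ j) \<eta>"
    let ?E = "\<lambda>\<xi>. exp (\<i> * of_real (y \<bullet> \<xi>)) * cutoff s B (\<lambda>\<xi>. symm A t0 x0 G \<xi> $ j) \<xi>"
    have mF: "?F \<in> borel_measurable lebesgue"
      by (intro borel_measurable_integrable integrable_exp_i_mult cutoff_integrable[OF s square_integrable_nth[OF ev_square_integrable[OF G]]])
    have pt: "?F (0 + A *\<^sub>R \<xi>) = of_real (A powr (- s - real CARD('d) / 2)) * ?E \<xi>" for \<xi>
    proof -
      have c: "indicator (cball 0 (A * B)) (A *\<^sub>R \<xi>) = (indicator (cball 0 B) \<xi> :: real)"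
        using A by (auto simp: indicator_def)
      have e: "exp (\<i> * of_real (?z \<bullet> (A *\<^sub>R \<xi>))) = exp (\<i> * of_real (y \<bullet> \<xi>)) * exp (\<i> * of_real ((A *\<^sub>R x0) \<bullet> \<xi>))"
        using A by (simp add: exp_add[symmetric] inner_add_left algebra_simps)
      have w: "complex_of_real (norm (A *\<^sub>R \<xi>) powr (- s)) = of_real (A powr (- s - real CARD('d) / 2)) * of_real (A powr (real CARD('d) / 2)) * of_real (norm \<xi> powr (- s))"
        unfolding of_real_mult[symmetric] powr_add[symmetric] using A by (simp add: powr_mult)
      show ?thesis
        unfolding add_0 cutoff_def c e of_real_mult w symm_def vector_smult_component by (simp only: mult_ac)
    qed
    have "(LINT \<eta>|lebesgue. ?F \<eta>) = A ^ CARD('d) *\<^sub>R (of_real (A powr (- s - real CARD('d) / 2)) * (LINT \<xi>|lebesgue. ?E \<xi>))"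
      using integral_affine_lebesgue(1)[OF _ mF, of A 0] A unfolding pt by simp
    also have "\<dots> = (A powr \<alpha>) *\<^sub>R (LINT \<xi>|lebesgue. ?E \<xi>)"
    proof -
      have "A ^ CARD('d) * A powr (- s - real CARD('d) / 2) = A powr \<alpha>"
        unfolding powr_realpow[OF A, symmetric] powr_add[symmetric] by (simp add: alpha_eq field_simps)
      then show ?thesis by (simp add: scaleR_conv_of_real mult.assoc[symmetric] flip: of_real_mult of_real_power)
    qed
    finally have "(A powr (- \<alpha>)) *\<^sub>R (LINT \<eta>|lebesgue. ?F \<eta>) = (LINT \<xi>|lebesgue. ?E \<xi>)"
      using A by (simp add: powr_add[symmetric])
    then show ?thesis unfolding band_inv_def inv_ft_def by (simp only: mult_scaleR_right[symmetric])
  qed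
  then show ?thesis unfolding vband_inv_def by (simp add: vec_eq_iff)
qed

lemma bsol_symm:
  assumes "square_integrable lebesgue G" "0 < A"
  shows "bsol B (symm A t0 x0 G) t y = (A powr (- \<alpha>)) *\<^sub>R bsol (A * B) G (A powr (- k) * t + t0) (x0 + (1 / A) *\<^sub>R y)"
  unfolding bsol_def ev_symm[OF assms(2)] by (rule vband_inv_symm[OF assms])

text \<open>The defining cutoffs 2^j for the transformed data correspond to the cutoffs A 2^j for G,
  so the limit along scaled dyadic radii is used.\<close>

lemma sol_symm:
  assumes G: "square_integrable lebesgue G" and A: "0 < A"
  shows "AE y in lborel. sol (symm A t0 x0 G) t y = (A powr (- \<alpha>)) *\<^sub>R sol G (A powr (- k) * t + t0) (x0 + (1 / A) *\<^sub>R y)"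
proof -
  let ?t = "A powr (- k) * t + t0"
  have 1: "AE x in lborel. (\<lambda>j. bsol (A * 2 ^ j) G ?t x) \<longlonglongrightarrow> sol G ?t x"
    using vfull_inv_limit_scaled[OF s ev_square_integrable[OF G, of ?t] A] unfolding AE_completion_iff bsol_def sol_def .
  have 2: "AE y in lborel. (\<lambda>j. bsol (2 ^ j) (symm A t0 x0 G) t y) \<longlonglongrightarrow> sol (symm A t0 x0 G) t y"
    using vfull_inv_limit[OF s ev_square_integrable[OF symm_square_integrable(1)[OF G A, of t0 x0], of t]] unfolding AE_completion_iff bsol_def sol_def .
  have "AE y in lborel. (\<lambda>j. bsol (A * 2 ^ j) G ?t (x0 + (1 / A) *\<^sub>R y)) \<longlonglongrightarrow> sol G ?t (x0 + (1 / A) *\<^sub>R y)"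
    by (rule AE_affine_lborel[OF _ 1]) (use A in simp)
  then show ?thesis
    using 2
  proof eventually_elim
    case (elim y)
    have "(\<lambda>j. bsol (2 ^ j) (symm A t0 x0 G) t y) \<longlonglongrightarrow> (A powr (- \<alpha>)) *\<^sub>R sol G ?t (x0 + (1 / A) *\<^sub>R y)"
      unfolding bsol_symm[OF G A] by (intro tendsto_scaleR tendsto_const elim(1))
    then show ?case using LIMSEQ_unique elim(2) by blast
  qed
qed

lemma N_nonneg: "0 \<le> N v" using N by (simp add: complex_norm_def)

lemma N_cmult: "N (c *s v) = cmod c * N v" using N by (simp add: complex_norm_def)

lemma N_scaleR: "0 \<le> c \<Longrightarrow> N (c *\<^sub>R v) = c * N v"
  by (simp add: scaleR_eq_vector_scalar_mult N_cmult)

text \<open>The r-th power of the norm to be maximized, over the product measure because almost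
  everywhere convergence and the Brezis--Lieb bound refer to space-time.\<close>

definition J :: "(real ^ 'd \<Rightarrow> complex ^ 'n) \<Rightarrow> ennreal" where
  "J G = (\<integral>\<^sup>+z. ennreal (N (sol G (fst z) (snd z)) powr r) \<partial>(lborel \<Otimes>\<^sub>M lborel))"

lemma N_sol_measurable:
  assumes G: "square_integrable lebesgue G"
  shows "(\<lambda>z. N (sol G (fst z) (snd z))) \<in> borel_measurable (lborel \<Otimes>\<^sub>M lborel)"
  using measurable_compose[OF sol_measurable_lborel[OF G] complex_norm_measurable[OF N]] .

lemma N_sol_slice_measurable:
  assumes G: "square_integrable lebesgue G"
  shows "(\<lambda>x. N (sol G t x)) \<in> borel_measurable borel"
  using measurable_compose[OF sol_slice_measurable[OF G] complex_norm_measurable[OF N]] .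

text \<open>Linearity and the symmetries of \<open>sol\<close> hold for almost all x at each fixed
  time; in iterated form they can be inserted slice by slice.\<close>

lemma J_iterated:
  assumes G: "square_integrable lebesgue G"
  shows "J G = (\<integral>\<^sup>+t. \<integral>\<^sup>+x. ennreal (N (sol G t x) powr r) \<partial>lborel \<partial>lborel)"
proof -
  note [measurable] = N_sol_measurable[OF G]
  show ?thesis unfolding J_def by (subst lborel.nn_integral_fst[symmetric]) simp_all
qed

lemma J_cmult:
  assumes G: "square_integrable lebesgue G"
  shows "J (\<lambda>\<xi>. c *s G \<xi>) = ennreal (cmod c powr r) * J G"
proof -
  note [measurable] = N_sol_measurable[OF G]
  note [measurable] = N_sol_slice_measurable[OF G]
  have "J (\<lambda>\<xi>. c *s G \<xi>) = (\<integral>\<^sup>+t. \<integral>\<^sup>+x. ennreal (cmod c powr r) * ennreal (N (sol G t x) powr r) \<partial>lborel \<partial>lborel)"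
    unfolding J_iterated[OF square_integrable_cmult(1)[OF G]]
  proof (rule nn_integral_cong, rule nn_integral_cong_AE)
    fix t
    show "AE x in lborel. ennreal (N (sol (\<lambda>\<xi>. c *s G \<xi>) t x) powr r) = ennreal (cmod c powr r) * ennreal (N (sol G t x) powr r)"
      using sol_cmult[OF G, of c t]
      by eventually_elim (simp add: N_cmult powr_mult N_nonneg ennreal_mult)
  qed
  also have "\<dots> = (\<integral>\<^sup>+t. ennreal (cmod c powr r) * (\<integral>\<^sup>+x. ennreal (N (sol G t x) powr r) \<partial>lborel) \<partial>lborel)"
    by (simp add: nn_integral_cmult)
  also have "\<dots> = ennreal (cmod c powr r) * J G"
  proof -
    have "(\<lambda>t. \<integral>\<^sup>+x. ennreal (N (sol G (fst (t, x)) (snd (t, x))) powr r) \<partial>lborel) \<in> borel_measurable lborel"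
      by measurable
    then show ?thesis unfolding J_iterated[OF G] by (simp add: nn_integral_cmult)
  qed
  finally show ?thesis .
qed

lemma J_diff:
  assumes G: "square_integrable lebesgue G" and H: "square_integrable lebesgue H"
  shows "J (\<lambda>\<xi>. G \<xi> - H \<xi>) = (\<integral>\<^sup>+z. ennreal (N (sol G (fst z) (snd z) - sol H (fst z) (snd z)) powr r) \<partial>(lborel \<Otimes>\<^sub>M lborel))"
proof -
  note [measurable] = sol_measurable_lborel[OF G] sol_measurable_lborel[OF H] complex_norm_measurable[OF N]
  have "(\<integral>\<^sup>+z. ennreal (N (sol G (fst z) (snd z) - sol H (fst z) (snd z)) powr r) \<partial>(lborel \<Otimes>\<^sub>M lborel)) =
      (\<integral>\<^sup>+t. \<integral>\<^sup>+x. ennreal (N (sol G t x - sol H t x) powr r) \<partial>lborel \<partial>lborel)"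
    by (subst lborel.nn_integral_fst[symmetric]) simp_all
  also have "\<dots> = J (\<lambda>\<xi>. G \<xi> - H \<xi>)"
    unfolding J_iterated[OF square_integrable_diff[OF G H]]
  proof (rule nn_integral_cong, rule nn_integral_cong_AE)
    fix t
    show "AE x in lborel. ennreal (N (sol G t x - sol H t x) powr r) = ennreal (N (sol (\<lambda>\<xi>. G \<xi> - H \<xi>) t x) powr r)"
      using sol_diff[OF G H, of t] by eventually_elim simp
  qed
  finally show ?thesis ..
qed

text \<open>The powers A^(-alpha r) from the amplitude, A^d from space and A^k from time cancel
  because alpha r = k + d.\<close>

lemma J_symm:
  assumes G: "square_integrable lebesgue G" and A: "0 < A"
  shows "J (symm A t0 x0 G) = J G"
proof -
  note [measurable] = N_sol_measurable[OF G] N_sol_slice_measurable[OF G]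
  define I where "I t = (\<integral>\<^sup>+x. ennreal (N (sol G t x) powr r) \<partial>lborel)" for t
  have mI: "I \<in> borel_measurable borel"
  proof -
    have "(\<lambda>t. \<integral>\<^sup>+x. ennreal (N (sol G (fst (t, x)) (snd (t, x))) powr r) \<partial>lborel) \<in> borel_measurable lborel"
      by measurable
    then show ?thesis by (simp add: I_def[abs_def])
  qed
  let ?c = "A powr (- \<alpha> * r) * A powr real CARD('d)"
  have "J (symm A t0 x0 G) = (\<integral>\<^sup>+t. ennreal ?c * I (t0 + (A powr (- k)) *\<^sub>R t) \<partial>lborel)"
    unfolding J_iterated[OF symm_square_integrable(1)[OF G A]]
  proof (rule nn_integral_cong)
    fix t :: real
    let ?t = "A powr (- k) * t + t0"
    have "(\<integral>\<^sup>+x. ennreal (N (sol (symm A t0 x0 G) t x) powr r) \<partial>lborel) = (\<integral>\<^sup>+y. ennreal (A powr (- \<alpha> * r)) * ennreal (N (sol G ?t (x0 + (1 / A) *\<^sub>R y)) powr r) \<partial>lborel)"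
    proof (rule nn_integral_cong_AE)
      show "AE y in lborel. ennreal (N (sol (symm A t0 x0 G) t y) powr r) = ennreal (A powr (- \<alpha> * r)) * ennreal (N (sol G ?t (x0 + (1 / A) *\<^sub>R y)) powr r)"
        using sol_symm[OF G A, of t0 x0 t]
      proof eventually_elim
        case (elim y)
        show ?case unfolding elim N_scaleR[OF powr_ge_zero]
          by (simp only: powr_mult powr_powr ennreal_mult'[OF powr_ge_zero])
      qed
    qed
    also have "\<dots> = ennreal (A powr (- \<alpha> * r)) * (\<integral>\<^sup>+y. ennreal (N (sol G ?t (x0 + (1 / A) *\<^sub>R y)) powr r) \<partial>lborel)"
      by (rule nn_integral_cmult) measurable
    also have "(\<integral>\<^sup>+y. ennreal (N (sol G ?t (x0 + (1 / A) *\<^sub>R y)) powr r) \<partial>lborel) = ennreal ((1 / A) powr (- real CARD('d))) * I ?t"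
      unfolding I_def using A by (subst nn_integral_affine_lborel) simp_all
    also have "(1 / A) powr (- real CARD('d)) = A powr real CARD('d)"
      using A by (simp add: powr_divide powr_minus divide_simps)
    finally show "(\<integral>\<^sup>+x. ennreal (N (sol (symm A t0 x0 G) t x) powr r) \<partial>lborel) = ennreal ?c * I (t0 + (A powr (- k)) *\<^sub>R t)"
      by (simp add: ennreal_mult mult.assoc add.commute)
  qed
  also have "\<dots> = ennreal ?c * (\<integral>\<^sup>+t. I (t0 + (A powr (- k)) *\<^sub>R t) \<partial>lborel)"
    by (rule nn_integral_cmult) (use mI in measurable)
  also have "(\<integral>\<^sup>+t. I (t0 + (A powr (- k)) *\<^sub>R t) \<partial>lborel) = ennreal ((A powr (- k)) powr (- real 1)) * (\<integral>\<^sup>+t. I t \<partial>lborel)"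
    using A nn_integral_affine_lborel[OF _ mI, of "A powr (- k)" t0] by simp
  also have "ennreal ?c * (ennreal ((A powr (- k)) powr (- real 1)) * (\<integral>\<^sup>+t. I t \<partial>lborel)) = (\<integral>\<^sup>+t. I t \<partial>lborel)"
  proof -
    have "- \<alpha> * r + real CARD('d) + k = 0" using alpha_pos by (simp add: r_eq)
    moreover have "?c * (A powr (- k)) powr (- real 1) = A powr (- \<alpha> * r + real CARD('d) + k)"
      by (simp only: powr_powr powr_add[symmetric]) simp
    ultimately have "?c * (A powr (- k)) powr (- real 1) = 1" using A by simp
    then have "ennreal ?c * ennreal ((A powr (- k)) powr (- real 1)) = 1"
      by (subst ennreal_mult[symmetric]) simp_all
    then show ?thesis by (simp only: mult.assoc[symmetric] mult_1)
  qed
  finally show ?thesis unfolding J_iterated[OF G] I_def .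
qed

end

section \<open>Consequences of the Strichartz estimate\<close>

locale strichartz_flow = scaled_flow s k m N \<alpha> r
  for s k :: real and m :: "real \<Rightarrow> real ^ 'd::finite \<Rightarrow> complex ^ 'n ^ 'n::finite" and N and \<alpha> r +
  fixes p q :: ennreal and C :: real
  assumes p: "0 < p" "p < q" and C: "0 < C"
    and strichartz: "\<And>G. square_integrable lebesgue G \<Longrightarrow> mixed_norm N p q (sol G) \<le> ennreal (C * sqrt (ip lebesgue G G))"
begin

definition phi :: "(real ^ 'd \<Rightarrow> complex ^ 'n) \<Rightarrow> real \<Rightarrow> ennreal" where
  "phi G t = Lp_norm q lborel (\<lambda>x. ennreal (N (sol G t x)))"

lemma q_pos: "0 < q" using p by (rule less_trans)

lemma p_fin: "p < top" using p(2) by (rule less_le_trans) simp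

lemma phi_measurable:
  assumes G: "square_integrable lebesgue G"
  shows "phi G \<in> borel_measurable borel"
proof -
  note [measurable] = N_sol_measurable[OF G]
  have "(\<lambda>t. Lp_norm q lborel (\<lambda>x. (\<lambda>z. ennreal (N (sol G (fst z) (snd z)))) (t, x))) \<in> borel_measurable lborel"
    by (rule borel_measurable_Lp_norm) measurable
  then show ?thesis by (simp add: phi_def[abs_def])
qed

lemma Lp_norm_phi:
  assumes G: "square_integrable lebesgue G"
  shows "Lp_norm p lborel (phi G) \<le> ennreal (C * sqrt (ip lebesgue G G))"
proof -
  note [measurable] = N_sol_slice_measurable[OF G]
  have "mixed_norm N p q (sol G) = Lp_norm p lebesgue (phi G)"
    unfolding mixed_norm_def phi_def[abs_def] by (subst Lp_norm_lebesgue[of "\<lambda>x. ennreal (N (sol G t x))" q for t]) simp_all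
  then show ?thesis using strichartz[OF G] by (simp add: Lp_norm_lebesgue[OF phi_measurable[OF G]])
qed

text \<open>The exponent collects k/p from time stretched by A^k, d/q from space stretched by A, and
  -alpha from the amplitude.\<close>

lemma Lp_norm_phi_symm:
  assumes G: "square_integrable lebesgue G" and A: "0 < A"
  shows "Lp_norm p lborel (phi (symm A 0 0 G)) \<le> ennreal (A powr (k * Lp_dim p 1 + Lp_dim q CARD('d) - \<alpha>)) * Lp_norm p lborel (phi G)"
proof -
  let ?c = "A powr (- \<alpha>) * (1 / A) powr (- Lp_dim q CARD('d))"
  have le: "phi (symm A 0 0 G) t \<le> ennreal ?c * phi G ((A powr (- k)) *\<^sub>R t)" for t
  proof -
    let ?t = "A powr (- k) * t + 0"
    note [measurable] = N_sol_slice_measurable[OF G] N_sol_slice_measurable[OF symm_square_integrable(1)[OF G A]]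
    have "phi (symm A 0 0 G) t = Lp_norm q lborel (\<lambda>y. ennreal (A powr (- \<alpha>)) * ennreal (N (sol G ?t ((1 / A) *\<^sub>R y))))"
      unfolding phi_def
    proof (rule Lp_norm_cong_AE)
      show "AE y in lborel. ennreal (N (sol (symm A 0 0 G) t y)) = ennreal (A powr (- \<alpha>)) * ennreal (N (sol G ?t ((1 / A) *\<^sub>R y)))"
        using sol_symm[OF G A, of 0 0 t]
      proof eventually_elim
        case (elim y)
        show ?case unfolding elim N_scaleR[OF powr_ge_zero] add_0 by (rule ennreal_mult') simp
      qed
    qed measurable
    also have "\<dots> \<le> ennreal ?c * phi G ((A powr (- k)) *\<^sub>R t)"
      using Lp_norm_scaling_le[OF q_pos, of "A powr (- \<alpha>)" "1 / A" "\<lambda>x. ennreal (N (sol G ?t x))"] A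
      by (simp add: phi_def)
    finally show ?thesis .
  qed
  note [measurable] = phi_measurable[OF G] phi_measurable[OF symm_square_integrable(1)[OF G A]]
  have "Lp_norm p lborel (phi (symm A 0 0 G)) \<le> Lp_norm p lborel (\<lambda>t. ennreal ?c * phi G ((A powr (- k)) *\<^sub>R t))"
    by (rule Lp_norm_mono[OF _ p(1) le]) measurable
  also have "\<dots> \<le> ennreal (?c * (A powr (- k)) powr (- Lp_dim p DIM(real))) * Lp_norm p lborel (phi G)"
    by (rule Lp_norm_scaling_le[OF p(1)]) (use A in auto)
  also have "?c * (A powr (- k)) powr (- Lp_dim p DIM(real)) = A powr (k * Lp_dim p 1 + Lp_dim q CARD('d) - \<alpha>)"
  proof -
    have "(1 / A) powr (- Lp_dim q CARD('d)) = A powr Lp_dim q CARD('d)"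
      using A by (simp add: powr_divide powr_minus divide_simps)
    then show ?thesis using A by (simp add: powr_powr powr_add[symmetric] algebra_simps)
  qed
  finally show ?thesis .
qed

lemma symm_inverse:
  assumes "0 < A"
  shows "symm A 0 0 (symm (1 / A) 0 0 G) = G"
  using assms by (simp add: fun_eq_iff symm_def ev_zero vector_smult_assoc powr_divide flip: of_real_mult)

text \<open>G is the dilate by A of data with the same \<open>L^2\<close> norm, so the Strichartz
  estimate for G holds with an additional factor A^theta for every A > 0. If theta is not 0, this
  factor can be made arbitrarily small and the mixed norm vanishes.\<close>

lemma scaling_relation_or_trivial:
  assumes ne: "k * Lp_dim p 1 + Lp_dim q CARD('d) \<noteq> \<alpha>" and G: "square_integrable lebesgue G"
  shows "J G = 0"
proof -
  define \<theta> where "\<theta> = k * Lp_dim p 1 + Lp_dim q CARD('d) - \<alpha>"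
  have th: "\<theta> \<noteq> 0" using ne by (simp add: \<theta>_def)
  define c where "c = C * sqrt (ip lebesgue G G)"
  have c0: "0 \<le> c" using C by (simp add: c_def)
  have le: "Lp_norm p lborel (phi G) \<le> ennreal (A powr \<theta> * c)" if A: "0 < A" for A
  proof -
    have A': "0 < 1 / A" using A by simp
    note H = symm_square_integrable[OF G A', of 0 0]
    have "Lp_norm p lborel (phi G) \<le> ennreal (A powr \<theta>) * Lp_norm p lborel (phi (symm (1 / A) 0 0 G))"
      using Lp_norm_phi_symm[OF H(1) A] unfolding symm_inverse[OF A] \<theta>_def .
    also have "\<dots> \<le> ennreal (A powr \<theta>) * ennreal c"
      using Lp_norm_phi[OF H(1)] unfolding H(2) c_def by (intro mult_left_mono) auto
    finally show ?thesis by (simp add: ennreal_mult c0)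
  qed
  have "Lp_norm p lborel (phi G) = 0"
  proof (rule ccontr)
    assume "Lp_norm p lborel (phi G) \<noteq> 0"
    then obtain e' where e': "0 < e'" "e' < Lp_norm p lborel (phi G)"
      using dense by (metis zero_less_iff_neq_zero)
    define e where "e = enn2real e'"
    have "e' < top" using e'(2) by (rule less_le_trans) simp
    then have e: "0 < e" "ennreal e < Lp_norm p lborel (phi G)" using e' by (simp_all add: e_def enn2real_positive_iff)
    \<comment> \<open>The exponent 1 / theta covers both signs of theta and gives A^theta = e / (c +
      1).\<close>
    define A where "A = (e / (c + 1)) powr (1 / \<theta>)"
    have A: "0 < A" using e c0 by (simp add: A_def)
    have "A powr \<theta> * c = e * (c / (c + 1))" using th e c0 by (simp add: A_def powr_powr)
    also have "\<dots> \<le> e * 1" using e c0 by (intro mult_left_mono) auto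
    finally have "ennreal (A powr \<theta> * c) \<le> ennreal e" by (intro ennreal_leI) simp
    then show False using le[OF A] e(2) by (meson leD order.trans)
  qed
  from Lp_norm_eq_0[OF _ p(1) this] phi_measurable[OF G]
  have "AE t in lborel. phi G t = 0" by simp
  then have "AE t in lborel. (\<integral>\<^sup>+x. ennreal (N (sol G t x) powr r) \<partial>lborel) = 0"
  proof eventually_elim
    case (elim t)
    note [measurable] = N_sol_slice_measurable[OF G]
    have "AE x in lborel. ennreal (N (sol G t x)) = 0"
      by (rule Lp_norm_eq_0[OF _ q_pos]) (use elim in \<open>simp_all add: phi_def\<close>)
    then show ?case
      by (subst nn_integral_0_iff_AE) (auto elim!: eventually_mono simp: N_nonneg antisym)
  qed
  then show ?thesis unfolding J_iterated[OF G] by (subst nn_integral_cong_AE[where v="\<lambda>_. 0"]) auto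
qed

text \<open>\<open>\<sigma>\<close> = d / alpha is the Sobolev exponent 2d / (d - 2s). At each time
  \<open>L^r\<close> is interpolated between \<open>L^q\<close> and \<open>L^\<sigma>\<close>; the
  refined Sobolev inequality bounds the latter uniformly in time by a power of B, and the former
  appears with power p, as in the Strichartz estimate. Since p < q, the weight
  \<open>\<beta>\<close> is positive, and with sigma > 2 the exponent (sigma - 2) beta is
  positive.\<close>

lemma J_bound:
  assumes rel: "k * Lp_dim p 1 + Lp_dim q CARD('d) = \<alpha>"
  obtains L \<gamma> where "0 < \<gamma>" "0 \<le> L" "\<And>G B. square_integrable lebesgue G \<Longrightarrow> ip lebesgue G G \<le> 1 \<Longrightarrow> 0 < B \<Longrightarrow>
     (\<And>A t x. 0 < A \<Longrightarrow> norm (bsol A G t x) \<le> B * A powr \<alpha>) \<Longrightarrow> J G \<le> ennreal (L * B powr \<gamma>)"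
proof -
  obtain K where K: "0 < K" "\<And>v. N v \<le> K * norm v"
    by (rule complex_norm_bound[OF N]) blast
  define d where "d = real CARD('d)"
  define b where "b = real CARD('d) / 2 - s"
  define \<pi>' where "\<pi>' = enn2real p"
  define \<sigma> where "\<sigma> = d / b"
  define \<beta> where "\<beta> = (r - \<pi>') / \<sigma>"
  have d: "0 < d" "0 < b" "r = (k + d) / b" using s by (simp_all add: d_def b_def r_eq alpha_eq)
  have pi: "0 < \<pi>'" using p p_fin by (simp add: \<pi>'_def enn2real_positive_iff)
  have sig: "2 < \<sigma>" using s d by (simp add: \<sigma>_def b_def d_def field_simps)
  \<comment> \<open>The scaling relation multiplied by p reads p b = k + d p / q; together with r b
    = k + d and sigma = d / b it becomes the relation between the interpolation weights.\<close>
  have rel1: "(if q = top then 0 else \<pi>' / enn2real q) + (r - \<pi>') / \<sigma> = 1"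
  proof -
    have "k / \<pi>' + (if q = top then 0 else d / enn2real q) = b"
      using rel p_fin[THEN less_imp_neq] by (auto simp: Lp_dim_def \<pi>'_def b_def d_def alpha_eq)
    then have "\<pi>' * b = k + (if q = top then 0 else d * (\<pi>' / enn2real q))"
      using pi by (auto simp: algebra_simps)
    then have "(if q = top then 0 else \<pi>' / enn2real q) * d + (k + d - \<pi>' * b) = d"
      by (auto simp: algebra_simps)
    moreover have "(r - \<pi>') / \<sigma> = (k + d - \<pi>' * b) / d" using d by (simp add: \<sigma>_def d(3) field_simps)
    moreover have "X + Y = 1" if "X * d + Z = d" "Y = Z / d" for X Y Z
    proof -
      have "(X + Y) * d = 1 * d" using that d(1) by (simp add: distrib_right)
      then show ?thesis using d(1) by simp
    qed
    ultimately show ?thesis by blast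
  qed
  have "(if q = top then 0 else \<pi>' / enn2real q) < 1"
    using p(2) p_fin pi unfolding \<pi>'_def
    by (auto simp: divide_less_eq_1 enn2real_positive_iff less_top[symmetric] enn2real_less_iff)
  then have "0 < (r - \<pi>') / \<sigma>" using rel1 by linarith
  then have beta: "0 < \<beta>" "\<pi>' < r" using sig by (simp_all add: \<beta>_def zero_less_divide_iff)
  \<comment> \<open>The bound for the sigma-th power of the spatial \<open>L^\<sigma>\<close> norm;
    K passes from the Euclidean norm to N.\<close>
  define S where "S B = K powr \<sigma> * (4 * \<sigma> / (\<sigma> - 2) * (2 * B) powr (\<sigma> - 2))" for B :: real
  have S0: "0 < S B" if "0 < B" for B using that K sig by (simp add: S_def)
  define L where "L = (K powr \<sigma> * (4 * \<sigma> / (\<sigma> - 2) * 2 powr (\<sigma> - 2))) powr \<beta> * C powr \<pi>'"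
  show ?thesis
  proof (rule that[of "(\<sigma> - 2) * \<beta>" L])
    show "0 < (\<sigma> - 2) * \<beta>" using sig beta by simp
    show "0 \<le> L" by (simp add: L_def)
    fix G :: "real ^ 'd \<Rightarrow> complex ^ 'n" and B
    assume G: "square_integrable lebesgue G" and G1: "ip lebesgue G G \<le> 1" and B: "0 < B"
      and bd: "\<And>A t x. 0 < A \<Longrightarrow> norm (bsol A G t x) \<le> B * A powr \<alpha>"
    have Sb: "(\<integral>\<^sup>+x. ennreal (N (sol G t x) powr \<sigma>) \<partial>lborel) \<le> ennreal (S B)" for t
    proof -
      have [measurable]: "sol G t \<in> borel_measurable borel" by (rule sol_slice_measurable[OF G])
      have "(\<integral>\<^sup>+x. ennreal (N (sol G t x) powr \<sigma>) \<partial>lborel) \<le> (\<integral>\<^sup>+x. ennreal (K powr \<sigma>) * ennreal (norm (sol G t x) powr \<sigma>) \<partial>lborel)"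
      proof (rule nn_integral_mono)
        fix x
        have "N (sol G t x) powr \<sigma> \<le> (K * norm (sol G t x)) powr \<sigma>"
          using sig by (intro powr_mono2 K(2) N_nonneg) auto
        also have "\<dots> = K powr \<sigma> * norm (sol G t x) powr \<sigma>" using K by (simp add: powr_mult)
        finally show "ennreal (N (sol G t x) powr \<sigma>) \<le> ennreal (K powr \<sigma>) * ennreal (norm (sol G t x) powr \<sigma>)"
          unfolding ennreal_mult'[OF powr_ge_zero, symmetric] by (rule ennreal_leI)
      qed
      also have "\<dots> = ennreal (K powr \<sigma>) * (\<integral>\<^sup>+x. ennreal (norm (sol G t x) powr \<sigma>) \<partial>lborel)"
        by (rule nn_integral_cmult) measurable
      also have "\<dots> \<le> ennreal (K powr \<sigma>) * ennreal (4 * \<sigma> / (\<sigma> - 2) * (2 * B) powr (\<sigma> - 2) * ip lebesgue G G)"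
        using refined_Sobolev[OF s ev_square_integrable[OF G, of t], of B] B bd
        unfolding \<sigma>_def d_def b_def alpha_eq sol_def bsol_def ip_ev_self[OF G] by (intro mult_left_mono) auto
      also have "\<dots> \<le> ennreal (K powr \<sigma>) * ennreal (4 * \<sigma> / (\<sigma> - 2) * (2 * B) powr (\<sigma> - 2) * 1)"
        using G1 sig by (intro mult_left_mono ennreal_leI) auto
      also have "\<dots> = ennreal (S B)" unfolding S_def mult_1_right ennreal_mult'[OF powr_ge_zero] ..
      finally show ?thesis .
    qed
    have "J G \<le> (\<integral>\<^sup>+t. ennreal_powr (phi G t) \<pi>' * ennreal (S B powr \<beta>) \<partial>lborel)"
      unfolding J_iterated[OF G]
    proof (rule nn_integral_mono)
      fix t
      show "(\<integral>\<^sup>+x. ennreal (N (sol G t x) powr r) \<partial>lborel) \<le> ennreal_powr (phi G t) \<pi>' * ennreal (S B powr \<beta>)"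
        unfolding phi_def \<pi>'_def \<beta>_def
        by (rule Lp_norm_interpolation[OF _ N_nonneg p _ _ _ rel1[unfolded \<pi>'_def] Sb])
          (use N_sol_slice_measurable[OF G, of t] beta sig S0[OF B] in \<open>simp_all add: \<pi>'_def\<close>)
    qed
    also have "\<dots> = (\<integral>\<^sup>+t. ennreal_powr (phi G t) \<pi>' \<partial>lborel) * ennreal (S B powr \<beta>)"
      by (rule nn_integral_multc) (use phi_measurable[OF G] in measurable)
    also have "\<dots> \<le> ennreal (C powr \<pi>') * ennreal (S B powr \<beta>)"
    proof (rule mult_right_mono)
      have "C * sqrt (ip lebesgue G G) \<le> C" using C G1 by simp
      then have "Lp_norm p lborel (phi G) \<le> ennreal C"
        by (rule order_trans[OF Lp_norm_phi[OF G] ennreal_leI])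
      then show "(\<integral>\<^sup>+t. ennreal_powr (phi G t) \<pi>' \<partial>lborel) \<le> ennreal (C powr \<pi>')"
        using p_fin[THEN less_imp_neq] pi C by (intro ennreal_powr_le) (simp_all add: Lp_norm_def \<pi>'_def)
    qed simp
    also have "\<dots> = ennreal (L * B powr ((\<sigma> - 2) * \<beta>))"
    proof -
      have "S B = K powr \<sigma> * (4 * \<sigma> / (\<sigma> - 2) * 2 powr (\<sigma> - 2)) * B powr (\<sigma> - 2)"
        using B by (simp add: S_def powr_mult)
      then have "S B powr \<beta> = (K powr \<sigma> * (4 * \<sigma> / (\<sigma> - 2) * 2 powr (\<sigma> - 2))) powr \<beta> * B powr ((\<sigma> - 2) * \<beta>)"
        by (simp only: powr_mult powr_powr)
      then show ?thesis by (simp add: L_def ennreal_mult[symmetric] mult_ac del: ennreal_mult)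
    qed
    finally show "J G \<le> ennreal (L * B powr ((\<sigma> - 2) * \<beta>))" .
  qed
qed

end

section \<open>Existence of maximizers\<close>

context scaled_flow
begin

text \<open>Since 2 alpha = d - 2s < d + k. The strict inequality x^(r/2) < x on (0, 1) at the end
  of the argument rests on this.\<close>

lemma r_gt_2: "2 < r"
proof -
  have "2 * \<alpha> < k + real CARD('d)" using s k by (simp add: alpha_eq)
  then show ?thesis using alpha_pos by (simp add: r_eq pos_less_divide_eq)
qed

text \<open>\<open>sol\<close> is a pointwise limit and need not vanish everywhere for a null G; the
  low-frequency bound and the tail estimate at A = 1 show that it vanishes almost
  everywhere.\<close>

lemma J_null:
  assumes G: "square_integrable lebesgue G" and z: "ip lebesgue G G = 0"
  shows "J G = 0"
proof -
  obtain C where C: "\<And>A G t x. 0 < A \<Longrightarrow> square_integrable lebesgue G \<Longrightarrow>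
      norm (bsol A G t x) \<le> C * A powr (real CARD('d) / 2 - s) * sqrt (ip lebesgue G G)"
    by (rule bsol_bound) blast
  have b: "bsol 1 G t x = 0" for t x using C[of 1 G t x] G z by simp
  have [measurable]: "sol G t \<in> borel_measurable borel" for t by (rule sol_slice_measurable[OF G])
  have "(\<integral>\<^sup>+x. ennreal (N (sol G t x) powr r) \<partial>lborel) = 0" for t
  proof -
    have "(\<integral>\<^sup>+x. ennreal ((norm (sol G t x))\<^sup>2) \<partial>lborel) = 0"
      using sol_bsol_le[OF G, of 1 t] by (simp add: b z)
    then have "AE x in lborel. sol G t x = 0"
      by (subst (asm) nn_integral_0_iff_AE) auto
    moreover have "N 0 = 0" using N by (simp add: complex_norm_def)
    ultimately show ?thesis
      by (subst nn_integral_cong_AE[where v="\<lambda>_. 0"]) (auto elim!: eventually_mono)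
  qed
  then show ?thesis unfolding J_iterated[OF G] by simp
qed

end

text \<open>Makes the set of competitors nonempty and serves as the maximizer when the supremum is
  0.\<close>

lemma unit_square_integrable:
  obtains G :: "real ^ 'd::finite \<Rightarrow> complex ^ 'n::finite" where "square_integrable lebesgue G" "ip lebesgue G G = 1"
proof
  define e :: "complex ^ 'n" where "e = axis undefined 1"
  let ?G = "\<lambda>\<xi>::real ^ 'd. indicator (cbox 0 One) \<xi> *\<^sub>R e"
  have n: "(norm (?G \<xi>))\<^sup>2 = indicator (cbox 0 One) \<xi>" for \<xi>
    by (simp add: e_def indicator_def)
  show "square_integrable lebesgue ?G"
    unfolding square_integrable_def n by (intro conjI) (auto simp: integrable_indicator_iff lmeasurable_cbox fmeasurable_def emeasure_lborel_cbox_eq intro!: measurable_completion)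
  show "ip lebesgue ?G ?G = 1"
    unfolding ip_self n by (simp add: content_unit flip: lmeasure_integral lmeasurable_cbox)
qed

context strichartz_flow
begin

theorem exists_maximizer:
  obtains \<Lambda> G where "\<Lambda> < top" "\<And>H. square_integrable lebesgue H \<Longrightarrow> J H \<le> \<Lambda> * ennreal (sqrt (ip lebesgue H H) powr r)"
    "square_integrable lebesgue G" "ip lebesgue G G = 1" "J G = \<Lambda>"
proof -
  obtain U :: "real ^ 'd \<Rightarrow> complex ^ 'n" where U: "square_integrable lebesgue U" "ip lebesgue U U = 1"
    by (rule unit_square_integrable)
  show ?thesis
  proof (cases "k * Lp_dim p 1 + Lp_dim q CARD('d) = \<alpha>")
    \<comment> \<open>Then J vanishes on all data, and every normalised element is a maximizer with
      supremum 0.\<close>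
    case False
    show ?thesis
      by (rule that[of 0 U]) (use U scaling_relation_or_trivial[OF False] in auto)
  next
    case rel: True
    obtain L \<gamma> where L: "0 < \<gamma>" "0 \<le> L" "\<And>G B. square_integrable lebesgue G \<Longrightarrow> ip lebesgue G G \<le> 1 \<Longrightarrow> 0 < B \<Longrightarrow>
        (\<And>A t x. 0 < A \<Longrightarrow> norm (bsol A G t x) \<le> B * A powr \<alpha>) \<Longrightarrow> J G \<le> ennreal (L * B powr \<gamma>)"
      by (rule J_bound[OF rel]) blast
    obtain C where C: "0 < C" "\<And>A G t x. 0 < A \<Longrightarrow> square_integrable lebesgue G \<Longrightarrow>
        norm (bsol A G t x) \<le> C * A powr \<alpha> * sqrt (ip lebesgue G G)"
      by (rule bsol_bound) (simp add: alpha_eq)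
    define \<Lambda> where "\<Lambda> = (SUP G\<in>{G. square_integrable lebesgue G \<and> ip lebesgue G G = 1}. J G)"
    have up1: "J G \<le> \<Lambda>" if "square_integrable lebesgue G" "ip lebesgue G G = 1" for G
      unfolding \<Lambda>_def using that by (intro SUP_upper) auto
    have "\<Lambda> \<le> ennreal (L * C powr \<gamma>)"
      unfolding \<Lambda>_def
    proof (rule SUP_least, clarify)
      fix G :: "real ^ 'd \<Rightarrow> complex ^ 'n"
      assume G: "square_integrable lebesgue G" "ip lebesgue G G = 1"
      show "J G \<le> ennreal (L * C powr \<gamma>)"
        by (rule L(3)[OF G(1) _ C(1)]) (use C(2)[OF _ G(1)] G(2) in auto)
    qed
    then have Lfin: "\<Lambda> < top" by (rule le_less_trans) simp
    have up: "J H \<le> \<Lambda> * ennreal (sqrt (ip lebesgue H H) powr r)" if H: "square_integrable lebesgue H" for H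
    proof (cases "ip lebesgue H H = 0")
      case True
      then show ?thesis using J_null[OF H] by simp
    next
      case False
      define c where "c = sqrt (ip lebesgue H H)"
      have c: "0 < c" "c\<^sup>2 = ip lebesgue H H" using False by (simp_all add: c_def less_le)
      let ?c = "complex_of_real (1 / c)"
      have "ip lebesgue (\<lambda>\<xi>. ?c *s H \<xi>) (\<lambda>\<xi>. ?c *s H \<xi>) = 1"
        unfolding square_integrable_cmult(2)[OF H] using c False by (simp add: norm_divide power_divide)
      from up1[OF square_integrable_cmult(1)[OF H] this]
      have le: "ennreal ((1 / c) powr r) * J H \<le> \<Lambda>"
        unfolding J_cmult[OF H] using c by (simp add: norm_divide)
      have "c powr r * (1 / c) powr r = 1" using c by (simp add: powr_divide)
      then have "ennreal (c powr r) * ennreal ((1 / c) powr r) = 1" by (subst ennreal_mult[symmetric]) simp_all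
      then have "J H = ennreal (c powr r) * (ennreal ((1 / c) powr r) * J H)" by (simp only: mult.assoc[symmetric] mult_1)
      also have "\<dots> \<le> ennreal (c powr r) * \<Lambda>" by (intro mult_left_mono le) simp
      finally show ?thesis unfolding c_def by (simp add: mult.commute)
    qed
    show ?thesis
    proof (cases "\<Lambda> = 0")
      case True
      then show ?thesis using that[of 0 U] U up up1[OF U] by simp
    next
      case nz: False
      define l where "l = enn2real \<Lambda>"
      have l: "\<Lambda> = ennreal l" "0 < l" using Lfin nz by (simp_all add: l_def enn2real_positive_iff zero_less_iff_neq_zero)
      \<comment> \<open>With this B, L B^gamma = l L / (2 (L + 1)) < l, so late members of a
        maximizing sequence exceed the bound that \<open>L(3)\<close> gives when all rescaled
        band-limited values are at most B.\<close>
      define B where "B = (l / (2 * (L + 1))) powr (1 / \<gamma>)"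
      have B: "0 < B" using l L by (simp add: B_def)
      have LB: "L * B powr \<gamma> < l"
      proof -
        have "L * B powr \<gamma> = l * (L / (2 * (L + 1)))" using l L by (simp add: B_def powr_powr)
        also have "\<dots> < l * 1" using l L by (intro mult_strict_left_mono) (auto simp: divide_less_eq)
        finally show ?thesis by simp
      qed
      obtain f :: "nat \<Rightarrow> ennreal" where f: "incseq f" "range f \<subseteq> J ` {G. square_integrable lebesgue G \<and> ip lebesgue G G = 1}" "\<Lambda> = (SUP i. f i)"
        unfolding \<Lambda>_def using ennreal_Sup_countable_SUP[of "J ` {G. square_integrable lebesgue G \<and> ip lebesgue G G = 1}"] U by blast
      have f_lim: "f \<longlonglongrightarrow> \<Lambda>" unfolding f(3) by (rule LIMSEQ_SUP[OF f(1)])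
      have "ennreal (L * B powr \<gamma>) < \<Lambda>" unfolding l(1) using LB l(2) by (intro ennreal_lessI) auto
      from order_tendstoD(1)[OF f_lim this] obtain i0 where i0: "\<And>i. i0 \<le> i \<Longrightarrow> ennreal (L * B powr \<gamma>) < f i"
        unfolding eventually_sequentially by blast
      have "\<exists>H. square_integrable lebesgue H \<and> ip lebesgue H H = 1 \<and> J H = f (i + i0) \<and> B < norm (bsol 1 H 0 0)" for i
      proof -
        have "f (i + i0) \<in> J ` {G. square_integrable lebesgue G \<and> ip lebesgue G G = 1}" using f(2) by auto
        then obtain g where g: "square_integrable lebesgue g" "ip lebesgue g g = 1" "J g = f (i + i0)" by auto
        \<comment> \<open>Otherwise the improved estimate would put \<open>J g\<close> at or below L
          B^gamma, contrary to the choice of \<open>i0\<close>. The symmetry with these parameters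
          moves the large value to frequency scale 1 and to the origin.\<close>
        have "\<exists>A t x. 0 < A \<and> \<not> norm (bsol A g t x) \<le> B * A powr \<alpha>"
        proof (rule ccontr)
          assume "\<not> ?thesis"
          then have "J g \<le> ennreal (L * B powr \<gamma>)" using g B by (intro L(3)) auto
          then show False using i0[of "i + i0"] g(3) by simp
        qed
        then obtain A t x where A: "0 < A" "B * A powr \<alpha> < norm (bsol A g t x)" by (auto simp: not_le)
        have "norm (bsol 1 (symm A t x g) 0 0) = A powr (- \<alpha>) * norm (bsol A g t x)"
          unfolding bsol_symm[OF g(1) A(1)] by simp
        moreover have "A powr (- \<alpha>) * (B * A powr \<alpha>) < A powr (- \<alpha>) * norm (bsol A g t x)"
          using A by (intro mult_strict_left_mono) auto
        moreover have "A powr (- \<alpha>) * (B * A powr \<alpha>) = B" using A(1) by (simp add: powr_minus)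
        ultimately have "B < norm (bsol 1 (symm A t x g) 0 0)" by simp
        then show ?thesis
          using symm_square_integrable[OF g(1) A(1), of t x] J_symm[OF g(1) A(1), of t x] g(2,3)
          by (intro exI[of _ "symm A t x g"]) simp
      qed
      then have "\<exists>h. \<forall>i. square_integrable lebesgue (h i) \<and> ip lebesgue (h i) (h i) = 1 \<and> J (h i) = f (i + i0) \<and> B < norm (bsol 1 (h i) 0 0)"
        by (intro choice) blast
      then obtain h where h: "\<And>i. square_integrable lebesgue (h i)" "\<And>i. ip lebesgue (h i) (h i) = 1"
          "\<And>i. J (h i) = f (i + i0)" "\<And>i. B < norm (bsol 1 (h i) 0 0)"
        by blast
      have h1: "ip lebesgue (h i) (h i) \<le> 1" for i by (simp add: h(2))
      obtain \<sigma> G where sig: "strict_mono (\<sigma> :: nat \<Rightarrow> nat)" "square_integrable lebesgue G"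
          "\<And>\<phi>. square_integrable lebesgue \<phi> \<Longrightarrow> (\<lambda>j. ip lebesgue (h (\<sigma> j)) \<phi>) \<longlonglongrightarrow> ip lebesgue G \<phi>"
        by (rule square_integrable_weak_compactness[of lebesgue h 1, OF h(1) h1]) blast
      note G = sig(2)
      obtain \<rho> where rho: "strict_mono (\<rho> :: nat \<Rightarrow> nat)"
          "AE z in lborel \<Otimes>\<^sub>M lborel. (\<lambda>i. sol (h (\<sigma> (\<rho> i))) (fst z) (snd z)) \<longlonglongrightarrow> sol G (fst z) (snd z)"
        by (rule weak_AE_subseq[of "\<lambda>i. h (\<sigma> i)", OF h(1) _ G sig(3)]) (auto simp: h(2))
      define v where "v i = h (\<sigma> (\<rho> i))" for i
      have v: "\<And>i. square_integrable lebesgue (v i)" "\<And>i. ip lebesgue (v i) (v i) = 1"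
        by (simp_all add: v_def h)
      have v_lim: "(\<lambda>i. ip lebesgue (v i) G) \<longlonglongrightarrow> ip lebesgue G G"
        using LIMSEQ_subseq_LIMSEQ[OF sig(3)[OF G] rho(1)] by (simp add: v_def comp_def)
      have Jv: "(\<lambda>i. J (v i)) \<longlonglongrightarrow> \<Lambda>"
        using LIMSEQ_subseq_LIMSEQ[OF LIMSEQ_ignore_initial_segment[OF f_lim, of i0] strict_mono_o[OF sig(1) rho(1)]]
        by (simp add: v_def h(3) comp_def)
      define b where "b = ip lebesgue G G"
      have b0: "0 < b"
      proof -
        have "(\<lambda>i. bsol 1 (h (\<sigma> i)) 0 0) \<longlonglongrightarrow> bsol 1 G 0 0"
          by (rule bsol_weak_tendsto[OF h(1) G sig(3)])
        then have "B \<le> norm (bsol 1 G 0 0)"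
          using h(4) by (intro tendsto_lowerbound[OF tendsto_norm]) (auto intro!: always_eventually less_imp_le)
        then have "0 < C * 1 powr \<alpha> * sqrt b" using C(2)[of 1 G 0 0] G B by (simp add: b_def)
        then show ?thesis using C(1) by (simp add: zero_less_mult_iff)
      qed
      \<comment> \<open>Weak convergence makes the cross term tend to b, so the squared norm of the
        remainder tends to 1 - 2b + b: limit and remainder share the unit mass.\<close>
      have diff_lim: "(\<lambda>i. ip lebesgue (\<lambda>\<xi>. v i \<xi> - G \<xi>) (\<lambda>\<xi>. v i \<xi> - G \<xi>)) \<longlonglongrightarrow> 1 - b"
      proof -
        have "(\<lambda>i. 1 - 2 * ip lebesgue (v i) G + b) \<longlonglongrightarrow> 1 - 2 * b + b"
          unfolding b_def by (intro tendsto_intros v_lim)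
        then show ?thesis unfolding ip_diff_self[OF v(1) G] v(2) b_def by simp
      qed
      have b1: "b \<le> 1"
        using tendsto_lowerbound[OF diff_lim, of 0] by simp
      have JG: "J G \<le> ennreal (l * b powr (r / 2))"
      proof -
        have "sqrt b powr r = b powr (r / 2)" using b0 by (simp add: powr_half_sqrt[symmetric] powr_powr)
        then show ?thesis using up[OF G] l unfolding b_def by (simp add: ennreal_mult)
      qed
      define j where "j = enn2real (J G)"
      have j: "J G = ennreal j" "0 \<le> j" "j \<le> l * b powr (r / 2)"
        using JG l b0 by (auto simp: j_def enn2real_leI intro!: ennreal_enn2real[symmetric] le_less_trans[OF JG])
      \<comment> \<open>The Brezis--Lieb bound splits J (v i) into a remainder and J G; the estimate
        \<open>up\<close> with the best constant is then applied to the remainder, whose norm is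
        known in the limit.\<close>
      have key: "l \<le> (1 + e) * (l * (1 - b) powr (r / 2)) + j" if e: "0 < e" for e
      proof -
        obtain w where w: "w \<longlonglongrightarrow> J G" "\<And>i. J (v i) \<le> ennreal (1 + e) * J (\<lambda>\<xi>. v i \<xi> - G \<xi>) + w i"
        proof (rule Brezis_Lieb_upper[OF N, of "\<lambda>i z. sol (v i) (fst z) (snd z)" "lborel \<Otimes>\<^sub>M lborel" "\<lambda>z. sol G (fst z) (snd z)" r e])
          show "AE z in lborel \<Otimes>\<^sub>M lborel. (\<lambda>i. sol (v i) (fst z) (snd z)) \<longlonglongrightarrow> sol G (fst z) (snd z)"
            using rho(2) by (simp add: v_def)
          show "(\<integral>\<^sup>+z. ennreal (N (sol G (fst z) (snd z)) powr r) \<partial>(lborel \<Otimes>\<^sub>M lborel)) < \<infinity>"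
            using j(1) by (simp add: J_def[symmetric])
        qed (use sol_measurable_lborel[OF v(1)] sol_measurable_lborel[OF G] r_pos e that J_diff[OF v(1) G] J_def in auto)
        let ?d = "\<lambda>i. sqrt (ip lebesgue (\<lambda>\<xi>. v i \<xi> - G \<xi>) (\<lambda>\<xi>. v i \<xi> - G \<xi>)) powr r"
        have d: "(\<lambda>i. ?d i) \<longlonglongrightarrow> sqrt (1 - b) powr r"
          by (rule tendsto_powr'[OF tendsto_real_sqrt[OF diff_lim] tendsto_const]) (use r_pos in auto)
        have "J (v i) \<le> ennreal ((1 + e) * (l * ?d i)) + w i" for i
        proof -
          have "J (v i) \<le> ennreal (1 + e) * (\<Lambda> * ennreal (?d i)) + w i"
            by (rule order_trans[OF w(2)]) (intro add_right_mono mult_left_mono up square_integrable_diff v G, simp)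
          then show ?thesis using e l by (simp add: ennreal_mult)
        qed
        moreover have "(\<lambda>i. ennreal ((1 + e) * (l * ?d i)) + w i) \<longlonglongrightarrow> ennreal ((1 + e) * (l * sqrt (1 - b) powr r)) + J G"
          by (intro tendsto_add tendsto_ennrealI tendsto_mult tendsto_const d w)
        ultimately have "\<Lambda> \<le> ennreal ((1 + e) * (l * sqrt (1 - b) powr r)) + J G"
          by (intro LIMSEQ_le[OF Jv]) auto
        then have "ennreal l \<le> ennreal ((1 + e) * (l * sqrt (1 - b) powr r) + j)"
          using l j e by (simp add: ennreal_plus)
        then have "l \<le> (1 + e) * (l * sqrt (1 - b) powr r) + j"
          using l j e by (subst (asm) ennreal_le_iff) auto
        moreover have "sqrt (1 - b) powr r = (1 - b) powr (r / 2)"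
          using b1 by (simp add: powr_half_sqrt[symmetric] powr_powr)
        ultimately show ?thesis by simp
      qed
      \<comment> \<open>Let e -> 0. The choice e = epsilon / (Y + 1) covers Y = 0 as well.\<close>
      have key0: "l \<le> l * (1 - b) powr (r / 2) + j"
      proof (rule field_le_epsilon)
        fix \<epsilon> :: real assume eps: "0 < \<epsilon>"
        define Y where "Y = l * (1 - b) powr (r / 2)"
        have Y: "0 \<le> Y" using l by (simp add: Y_def)
        have "l \<le> (1 + \<epsilon> / (Y + 1)) * Y + j" unfolding Y_def using eps Y by (intro key) (simp add: Y_def)
        also have "\<dots> \<le> Y + \<epsilon> + j" using Y eps by (simp add: field_simps)
        finally show "l \<le> l * (1 - b) powr (r / 2) + j + \<epsilon>" by (simp add: Y_def)
      qed
      \<comment> \<open>For 0 < b < 1 both b^(r/2) < b and (1 - b)^(r/2) < 1 - b, so the two shares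
        could not add up to the full constant l.\<close>
      have "b = 1"
      proof (rule ccontr)
        assume "b \<noteq> 1"
        then have b2: "b < 1" using b1 by simp
        have "b powr (r / 2) < b powr 1" using b0 b2 r_gt_2 by (intro powr_less_mono') auto
        moreover have "(1 - b) powr (r / 2) < (1 - b) powr 1" using b0 b2 r_gt_2 by (intro powr_less_mono') auto
        ultimately have "(1 - b) powr (r / 2) + b powr (r / 2) < 1" using b0 b2 by simp
        then have "l * ((1 - b) powr (r / 2) + b powr (r / 2)) < l * 1" using l by (intro mult_strict_left_mono)
        then show False using key0 j(3) by (simp add: distrib_left)
      qed
      then have "j = l" using key0 j(3) by simp
      show ?thesis
        by (rule that[OF Lfin up G]) (use \<open>b = 1\<close> \<open>j = l\<close> b_def j l in auto)
    qed
  qed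
qed

end

section \<open>The matrix exponential\<close>

definition mpow :: "complex ^ 'n ^ 'n \<Rightarrow> nat \<Rightarrow> complex ^ 'n ^ 'n::finite" where
  "mpow A m = (((**) A) ^^ m) (mat 1)"

lemma mpow_0: "mpow A 0 = mat 1" and mpow_Suc: "mpow A (Suc m) = A ** mpow A m"
  by (simp_all add: mpow_def)

lemma mpow_add: "mpow A (m + l) = mpow A m ** mpow A l"
  by (induction m) (simp_all add: mpow_0 mpow_Suc matrix_mul_assoc)

lemma mpow_scale: "mpow (\<chi> i j. c * A $ i $ j) m $ i $ j = c ^ m * mpow A m $ i $ j"
  by (induction m arbitrary: i j)
    (simp_all add: mpow_0 mpow_Suc matrix_matrix_mult_def sum_distrib_left mult_ac)

text \<open>Entrywise geometric growth takes the role of a submultiplicative norm: n times the sum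
  of all moduli of entries works as K.\<close>

lemma mpow_bound:
  fixes A :: "complex ^ 'n ^ 'n::finite"
  obtains K where "\<And>m i j. norm (mpow A m $ i $ j) \<le> K ^ m"
proof -
  define a where "a = (\<Sum>i\<in>UNIV. \<Sum>j\<in>UNIV. norm (A $ i $ j))"
  have a: "norm (A $ i $ j) \<le> a" for i j
  proof -
    have "norm (A $ i $ j) \<le> (\<Sum>j\<in>UNIV. norm (A $ i $ j))" by (rule member_le_sum) auto
    also have "\<dots> \<le> a" unfolding a_def by (rule member_le_sum[of i UNIV "\<lambda>i. \<Sum>j\<in>UNIV. norm (A $ i $ j)"]) (auto intro: sum_nonneg)
    finally show ?thesis .
  qed
  have "norm (mpow A m $ i $ j) \<le> (real CARD('n) * a) ^ m" for m i j
  proof (induction m arbitrary: i j)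
    case 0
    then show ?case by (simp add: mpow_0 mat_def)
  next
    case (Suc m)
    have "norm (mpow A (Suc m) $ i $ j) \<le> (\<Sum>l\<in>UNIV. norm (A $ i $ l * mpow A m $ l $ j))"
      by (simp add: mpow_Suc matrix_matrix_mult_def norm_sum)
    also have "\<dots> \<le> (\<Sum>l\<in>(UNIV :: 'n set). a * (real CARD('n) * a) ^ m)"
      by (intro sum_mono, subst norm_mult, intro mult_mono a Suc) (use a order_trans[OF norm_ge_zero a] in auto)
    finally show ?case by simp
  qed
  then show ?thesis by (rule that)
qed

lemma mpow_summable:
  fixes A :: "complex ^ 'n ^ 'n::finite"
  shows "summable (\<lambda>m. norm (mpow A m $ i $ j / fact m * z ^ m))"
proof -
  obtain K where K: "\<And>m i j. norm (mpow A m $ i $ j) \<le> K ^ m" using mpow_bound by blast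
  show ?thesis
  proof (rule summable_comparison_test')
    show "summable (\<lambda>m. (K * norm z) ^ m / fact m)"
      using summable_exp[of "K * norm z"] by (simp add: field_simps)
    show "norm (norm (mpow A m $ i $ j / fact m * z ^ m)) \<le> (K * norm z) ^ m / fact m" if "0 \<le> m" for m
      using K[of m i j] by (simp add: norm_mult norm_divide norm_power power_mult_distrib divide_right_mono mult_right_mono)
  qed
qed

text \<open>Each entry of the exponential of z A is a power series in z converging everywhere, which
  reduces addition and continuity to scalar series.\<close>

lemma matrix_exp_nth:
  "matrix_exp (\<chi> i j. z * A $ i $ j) $ i $ j = (\<Sum>m. mpow A m $ i $ j / fact m * z ^ m)"
proof -
  let ?E = "\<chi> i j. (\<Sum>m. mpow A m $ i $ j / fact m * z ^ m)"
  have "(\<lambda>m. (1 / fact m) *\<^sub>R mpow (\<chi> i j. z * A $ i $ j) m) sums ?E"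
    unfolding sums_def
  proof (intro vec_tendstoI)
    fix i j
    have "(\<lambda>m. mpow A m $ i $ j / fact m * z ^ m) sums (\<Sum>m. mpow A m $ i $ j / fact m * z ^ m)"
      by (rule summable_sums[OF summable_norm_cancel[OF mpow_summable]])
    then show "(\<lambda>n. (\<Sum>m<n. (1 / fact m) *\<^sub>R mpow (\<chi> i j. z * A $ i $ j) m) $ i $ j) \<longlonglongrightarrow> ?E $ i $ j"
      unfolding sums_def by (simp add: mpow_scale scaleR_conv_of_real[where 'a=complex] mult_ac divide_inverse)
  qed
  then have "matrix_exp (\<chi> i j. z * A $ i $ j) = ?E"
    unfolding matrix_exp_def mpow_def by (rule sums_unique[symmetric])
  then show ?thesis by simp
qed

text \<open>Entrywise Cauchy products, summed over the inner index of the matrix product, collapse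
  by additivity of matrix powers; the remaining sum is the binomial expansion of (z + w)^m.\<close>

lemma matrix_exp_add:
  "matrix_exp (\<chi> i j. (z + w) * A $ i $ j) = matrix_exp (\<chi> i j. z * A $ i $ j) ** matrix_exp (\<chi> i j. w * A $ i $ j)"
proof -
  have "matrix_exp (\<chi> i j. (z + w) * A $ i $ j) $ i $ j = (matrix_exp (\<chi> i j. z * A $ i $ j) ** matrix_exp (\<chi> i j. w * A $ i $ j)) $ i $ j" for i j
  proof -
    have "(\<lambda>m. \<Sum>l\<in>UNIV. \<Sum>q\<le>m. (mpow A q $ i $ l / fact q * z ^ q) * (mpow A (m - q) $ l $ j / fact (m - q) * w ^ (m - q))) sums
        (\<Sum>l\<in>UNIV. matrix_exp (\<chi> i j. z * A $ i $ j) $ i $ l * matrix_exp (\<chi> i j. w * A $ i $ j) $ l $ j)"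
      unfolding matrix_exp_nth by (intro sums_sum Cauchy_product_sums mpow_summable)
    moreover have "(\<Sum>l\<in>UNIV. \<Sum>q\<le>m. (mpow A q $ i $ l / fact q * z ^ q) * (mpow A (m - q) $ l $ j / fact (m - q) * w ^ (m - q)))
        = mpow A m $ i $ j / fact m * (z + w) ^ m" for m
    proof -
      have "(\<Sum>l\<in>UNIV. \<Sum>q\<le>m. (mpow A q $ i $ l / fact q * z ^ q) * (mpow A (m - q) $ l $ j / fact (m - q) * w ^ (m - q)))
          = (\<Sum>q\<le>m. z ^ q * w ^ (m - q) / (fact q * fact (m - q)) * (\<Sum>l\<in>UNIV. mpow A q $ i $ l * mpow A (m - q) $ l $ j))"
        unfolding sum_distrib_left by (subst sum.swap) (simp add: divide_inverse mult_ac)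
      also have "\<dots> = (\<Sum>q\<le>m. z ^ q * w ^ (m - q) / (fact q * fact (m - q)) * mpow A m $ i $ j)"
      proof (rule sum.cong[OF refl])
        fix q assume "q \<in> {..m}"
        then have "mpow A m = mpow A q ** mpow A (m - q)" by (simp add: mpow_add[symmetric])
        then show "z ^ q * w ^ (m - q) / (fact q * fact (m - q)) * (\<Sum>l\<in>UNIV. mpow A q $ i $ l * mpow A (m - q) $ l $ j)
            = z ^ q * w ^ (m - q) / (fact q * fact (m - q)) * mpow A m $ i $ j"
          by (simp add: matrix_matrix_mult_def)
      qed
      also have "\<dots> = (\<Sum>q\<le>m. of_nat (m choose q) * z ^ q * w ^ (m - q)) * (mpow A m $ i $ j / fact m)"
        unfolding sum_distrib_right by (rule sum.cong[OF refl]) (simp add: binomial_fact field_simps)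
      finally show ?thesis by (simp add: binomial_ring mult.commute)
    qed
    ultimately show ?thesis
      unfolding matrix_exp_nth[of "z + w"] matrix_matrix_mult_def by (simp add: sums_iff)
  qed
  then show ?thesis by (simp add: vec_eq_iff)
qed

lemma matrix_exp_zero: "matrix_exp (\<chi> i j. 0 * A $ i $ j) = mat 1"
proof -
  have "(\<Sum>m. mpow A m $ i $ j / fact m * 0 ^ m) = mat 1 $ i $ j" for i j
    using sums_unique[OF powser_sums_zero, of "\<lambda>m. mpow A m $ i $ j / fact m"] by (simp add: mpow_0)
  then show ?thesis unfolding vec_eq_iff matrix_exp_nth by simp
qed

lemma matrix_exp_continuous: "continuous_on UNIV (\<lambda>z. matrix_exp (\<chi> i j. z * A $ i $ j))"
proof (rule continuous_at_imp_continuous_on, rule ballI, unfold isCont_def, intro vec_tendstoI)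
  fix z i j
  have "isCont (\<lambda>z. \<Sum>m. mpow A m $ i $ j / fact m * z ^ m) z"
    by (rule isCont_powser_converges_everywhere[OF summable_norm_cancel[OF mpow_summable]])
  then show "((\<lambda>z. matrix_exp (\<chi> i j. z * A $ i $ j) $ i $ j) \<longlongrightarrow> matrix_exp (\<chi> i j. z * A $ i $ j) $ i $ j) (at z)"
    unfolding matrix_exp_nth isCont_def .
qed

lemma propagator_symbol_zero: "propagator_symbol h 0 \<xi> = mat 1"
  unfolding propagator_symbol_def of_real_0 mult_zero_right by (rule matrix_exp_zero)

lemma propagator_symbol_add:
  "propagator_symbol h (t + t') \<xi> = propagator_symbol h t \<xi> ** propagator_symbol h t' \<xi>"
  unfolding propagator_symbol_def of_real_add distrib_left by (rule matrix_exp_add)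

lemma propagator_symbol_continuous: "continuous_on UNIV (\<lambda>t. propagator_symbol h t \<xi>)"
proof -
  have "continuous_on UNIV (\<lambda>t. \<i> * complex_of_real t)" by (intro continuous_intros)
  then show ?thesis
    unfolding propagator_symbol_def by (intro continuous_on_compose2[OF matrix_exp_continuous]) auto
qed

lemma propagator_symbol_scale:
  assumes "h (c *\<^sub>R \<xi>) = (c powr k) *\<^sub>R h \<xi>"
  shows "propagator_symbol h t (c *\<^sub>R \<xi>) = propagator_symbol h (c powr k * t) \<xi>"
  unfolding propagator_symbol_def assms by (simp add: scaleR_conv_of_real[where 'a=complex] mult_ac)

section \<open>The propagator as a unitary flow\<close>

text \<open>Completeness of Lebesgue measure. It gives measurability of the symbol applied to G,
  which is known only to agree almost everywhere with a measurable function.\<close>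

lemma borel_measurable_lebesgue_cong_AE:
  fixes f g :: "'a::euclidean_space \<Rightarrow> 'b::topological_space"
  assumes f: "f \<in> borel_measurable lebesgue" and eq: "AE x in lebesgue. f x = g x"
  shows "g \<in> borel_measurable lebesgue"
proof (rule measurableI)
  fix S :: "'b set" assume S: "S \<in> sets borel"
  have A: "f -` S \<inter> space lebesgue \<in> sets lebesgue" using f S by (rule measurable_sets)
  have "AE x in lebesgue. x \<in> f -` S \<inter> space lebesgue \<longleftrightarrow> x \<in> g -` S \<inter> space lebesgue"
    using eq by eventually_elim simp
  then show "g -` S \<inter> space lebesgue \<in> sets lebesgue"
    by (rule completion.in_sets_AE[OF _ A]) simp
qed simp

lemma has_fourier_measurable:
  fixes f :: "real ^ 'd::finite \<Rightarrow> complex ^ 'n::finite"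
  assumes "has_fourier f g"
  shows "f \<in> borel_measurable lebesgue" "g \<in> borel_measurable lebesgue"
  using assms unfolding has_fourier_def has_fourier_scalar_def measurable_vec_iff by (auto intro: tempered_measurable)

lemma fourier_multiplier_has_fourier:
  "multiplier_defined m f \<Longrightarrow> has_fourier (fourier_multiplier m f) (\<lambda>\<xi>. m \<xi> *v fourier f \<xi>)"
  unfolding multiplier_defined_def fourier_multiplier_def inv_fourier_def by (rule someI_ex[of "\<lambda>g. has_fourier g (\<lambda>\<xi>. m \<xi> *v fourier f \<xi>)"])

text \<open>Unitarity is applied to \<open>vfull_inv s G\<close>. Its chosen transform is |xi|^(-s)
  G almost everywhere, and multiplying back by |xi|^s turns the equality of Sobolev norms into one
  of \<open>L^2\<close> norms.\<close>

lemma multiplier_isometry: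
  fixes m :: "real ^ 'd::finite \<Rightarrow> complex ^ 'n ^ 'n::finite"
  assumes s: "0 < s" "s < real CARD('d) / 2"
    and m: "\<And>f. f \<in> Hdot s \<Longrightarrow> multiplier_defined m f"
    and iso: "\<And>f. f \<in> Hdot s \<Longrightarrow> fourier_multiplier m f \<in> Hdot s \<and> Hdot_norm s (fourier_multiplier m f) = Hdot_norm s f"
    and G: "square_integrable lebesgue G"
  shows "square_integrable lebesgue (\<lambda>\<xi>. m \<xi> *v G \<xi>)"
    and "ip lebesgue (\<lambda>\<xi>. m \<xi> *v G \<xi>) (\<lambda>\<xi>. m \<xi> *v G \<xi>) = ip lebesgue G G"
proof -
  define f where "f = vfull_inv s G"
  note f = vfull_inv_Hdot[OF s G, folded f_def]
  note hf = fourier_multiplier_has_fourier[OF m[OF f(1)]]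
  let ?H = "\<lambda>\<xi>. (norm \<xi> powr s) *\<^sub>R (m \<xi> *v fourier f \<xi>)"
  have H: "square_integrable lebesgue ?H" "Hdot_norm s (fourier_multiplier m f) = sqrt (ip lebesgue ?H ?H)"
    using Hdot_iff[OF s hf] iso[OF f(1)] by auto
  have eq: "AE \<xi> in lebesgue. ?H \<xi> = m \<xi> *v G \<xi>"
    using f(3) AE_nonzero_lebesgue[OF s]
  proof eventually_elim
    case (elim \<xi>)
    have "?H \<xi> = (norm \<xi> powr s * norm \<xi> powr (- s)) *\<^sub>R (m \<xi> *v G \<xi>)"
      unfolding elim(1) scaleR_eq_vector_scalar_mult vector_scalar_commute[symmetric] by (simp add: vector_smult_assoc)
    then show ?case using elim(2) by (simp add: powr_minus)
  qed
  have meas: "(\<lambda>\<xi>. m \<xi> *v G \<xi>) \<in> borel_measurable lebesgue"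
    by (rule borel_measurable_lebesgue_cong_AE[OF square_integrable_measurable[OF H(1)] eq])
  show sq: "square_integrable lebesgue (\<lambda>\<xi>. m \<xi> *v G \<xi>)"
  proof (rule square_integrable_bound[OF H(1) meas])
    show "AE \<xi> in lebesgue. norm (m \<xi> *v G \<xi>) \<le> norm (?H \<xi>)"
      using eq by eventually_elim (simp only: order_refl)
  qed
  have "ip lebesgue ?H ?H = ip lebesgue (\<lambda>\<xi>. m \<xi> *v G \<xi>) (\<lambda>\<xi>. m \<xi> *v G \<xi>)"
    unfolding ip_self
  proof (rule integral_cong_AE)
    show "(\<lambda>\<xi>. (norm (?H \<xi>))\<^sup>2) \<in> borel_measurable lebesgue" "(\<lambda>\<xi>. (norm (m \<xi> *v G \<xi>))\<^sup>2) \<in> borel_measurable lebesgue"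
      using H(1) sq by (auto simp: square_integrable_def intro: borel_measurable_integrable)
    show "AE \<xi> in lebesgue. (norm (?H \<xi>))\<^sup>2 = (norm (m \<xi> *v G \<xi>))\<^sup>2" using eq by eventually_elim simp
  qed
  moreover have "sqrt (ip lebesgue ?H ?H) = sqrt (ip lebesgue G G)"
    using H(2) iso[OF f(1)] f(2) by simp
  ultimately show "ip lebesgue (\<lambda>\<xi>. m \<xi> *v G \<xi>) (\<lambda>\<xi>. m \<xi> *v G \<xi>) = ip lebesgue G G" by simp
qed

text \<open>Applying the isometry to the truncations of \<open>G\<close> to measurable sets localises it in frequency.\<close>

lemma multiplier_isometry_pointwise:
  fixes m :: "real ^ 'd::finite \<Rightarrow> complex ^ 'n ^ 'n::finite"
  assumes s: "0 < s" "s < real CARD('d) / 2"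
    and m: "\<And>f. f \<in> Hdot s \<Longrightarrow> multiplier_defined m f"
    and iso: "\<And>f. f \<in> Hdot s \<Longrightarrow> fourier_multiplier m f \<in> Hdot s \<and> Hdot_norm s (fourier_multiplier m f) = Hdot_norm s f"
    and G: "square_integrable lebesgue G"
  shows "AE \<xi> in lebesgue. norm (m \<xi> *v G \<xi>) = norm (G \<xi>)"
proof -
  have iso': "square_integrable lebesgue (\<lambda>\<xi>. m \<xi> *v H \<xi>)"
      "ip lebesgue (\<lambda>\<xi>. m \<xi> *v H \<xi>) (\<lambda>\<xi>. m \<xi> *v H \<xi>) = ip lebesgue H H"
    if "square_integrable lebesgue H" for H
    by (rule multiplier_isometry[OF s _ _ that]; use m iso in blast)+
  have "AE \<xi> in lebesgue. (norm (m \<xi> *v G \<xi>))\<^sup>2 = (norm (G \<xi>))\<^sup>2"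
  proof (rule density_unique_real)
    show "integrable lebesgue (\<lambda>\<xi>. (norm (m \<xi> *v G \<xi>))\<^sup>2)" "integrable lebesgue (\<lambda>\<xi>. (norm (G \<xi>))\<^sup>2)"
      using iso'(1)[OF G] G by (simp_all add: square_integrable_def)
    fix S :: "(real ^ 'd) set" assume S: "S \<in> sets lebesgue"
    let ?G = "\<lambda>\<xi>. indicator S \<xi> *\<^sub>R G \<xi>"
    have GS: "square_integrable lebesgue ?G"
      by (rule square_integrable_bound[OF G])
        (use S square_integrable_measurable[OF G] in \<open>auto simp: indicator_def intro!: borel_measurable_scaleR borel_measurable_indicator\<close>)
    \<comment> \<open>The matrix acts pointwise and linearly, so the indicator passes through it and
      the isometry for the truncation becomes equality of the two integrals over S.\<close>
    have n: "(norm (m \<xi> *v ?G \<xi>))\<^sup>2 = indicator S \<xi> * (norm (m \<xi> *v G \<xi>))\<^sup>2" "(norm (?G \<xi>))\<^sup>2 = indicator S \<xi> * (norm (G \<xi>))\<^sup>2" for \<xi>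
      by (auto simp: indicator_def)
    show "(LINT \<xi>:S|lebesgue. (norm (m \<xi> *v G \<xi>))\<^sup>2) = (LINT \<xi>:S|lebesgue. (norm (G \<xi>))\<^sup>2)"
      using iso'(2)[OF GS] unfolding ip_self n set_lebesgue_integral_def by simp
  qed
  then show ?thesis by eventually_elim simp
qed

context scaled_flow
begin

lemma mixed_norm_J:
  assumes G: "square_integrable lebesgue G"
  shows "mixed_norm N (ennreal r) (ennreal r) (sol G) = ennreal_powr (J G) (1 / r)"
proof -
  note [measurable] = N_sol_slice_measurable[OF G] N_sol_measurable[OF G]
  define I where "I t = (\<integral>\<^sup>+x. ennreal (N (sol G t x) powr r) \<partial>lborel)" for t
  have inner: "Lp_norm (ennreal r) lebesgue (\<lambda>x. ennreal (N (sol G t x))) = ennreal_powr (I t) (1 / r)" for t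
    using r_pos by (simp add: Lp_norm_def I_def nn_integral_completion ennreal_powr_ennreal N_nonneg)
  have "mixed_norm N (ennreal r) (ennreal r) (sol G) = ennreal_powr (\<integral>\<^sup>+t. I t \<partial>lebesgue) (1 / r)"
    unfolding mixed_norm_def inner using r_pos by (simp add: Lp_norm_def ennreal_powr_powr ennreal_powr_one)
  also have "(\<integral>\<^sup>+t. I t \<partial>lebesgue) = J G"
    unfolding nn_integral_completion J_iterated[OF G] I_def ..
  finally show ?thesis .
qed

end

theorem theorem1p1:
  fixes h :: "real ^ 'd::finite \<Rightarrow> complex ^ 'n ^ 'n::finite"
    and N :: "complex ^ 'n \<Rightarrow> real"
    and s k C r :: real and p q M :: ennreal
  assumes s: "0 < s" "s < real CARD('d) / 2"
    and k: "0 < k"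
    and homogeneous: "\<And>c \<xi>. 0 < c \<Longrightarrow> h (c *\<^sub>R \<xi>) = (c powr k) *\<^sub>R h \<xi>"
    and norm: "complex_norm N"
    and well_posed: "globally_well_posed s h"
    and propagator_defined:
      "\<And>t f. f \<in> Hdot s \<Longrightarrow> multiplier_defined (propagator_symbol h t) f"
    and propagator_solves:
      "\<And>f. f \<in> Hdot s \<Longrightarrow> cauchy_solution s h f (\<lambda>t. propagator h t f)"
    and unitary: "\<And>t f. f \<in> Hdot s \<Longrightarrow>
      propagator h t f \<in> Hdot s \<and> Hdot_norm s (propagator h t f) = Hdot_norm s f"
    and pq: "2 \<le> p" "p < q"
    and C: "0 < C"
    and strichartz: "\<And>f. f \<in> Hdot s \<Longrightarrow>
      mixed_norm N p q (\<lambda>t. propagator h t f) \<le> ennreal (C * Hdot_norm s f)"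
    and r: "r = 2 * (k + real CARD('d)) / (real CARD('d) - 2 * s)"
    and M: "M = (SUP f\<in>{f \<in> Hdot s. Hdot_norm s f = 1}.
      mixed_norm N (ennreal r) (ennreal r) (\<lambda>t. propagator h t f))"
  shows "M < \<infinity> \<and>
    (\<forall>f\<in>Hdot s. mixed_norm N (ennreal r) (ennreal r) (\<lambda>t. propagator h t f)
       \<le> M * ennreal (Hdot_norm s f)) \<and>
    (\<exists>f\<^sub>0\<in>Hdot s. Hdot_norm s f\<^sub>0 = 1 \<and>
       mixed_norm N (ennreal r) (ennreal r) (\<lambda>t. propagator h t f\<^sub>0) = M)"
proof -
  define \<alpha> where "\<alpha> = real CARD('d) / 2 - s"
  have r_eq: "r = (k + real CARD('d)) / \<alpha>"
  proof -
    have "real CARD('d) - 2 * s = 2 * \<alpha>" by (simp add: \<alpha>_def)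
    then have "r = (2 * (k + real CARD('d))) / (2 * \<alpha>)" by (simp only: r)
    also have "\<dots> = (k + real CARD('d)) / \<alpha>" by (rule mult_divide_mult_cancel_left) simp
    finally show ?thesis .
  qed
  \<comment> \<open>The isometry of the symbol is extracted from unitarity; the group law,
    continuity in time and scaling are properties of the matrix exponential, the last one through
    homogeneity of h.\<close>
  interpret scaled_flow s k "propagator_symbol h" N \<alpha> r
  proof
    fix t and G :: "real ^ 'd \<Rightarrow> complex ^ 'n" assume G: "square_integrable lebesgue G"
    have "square_integrable lebesgue (\<lambda>\<xi>. propagator_symbol h t \<xi> *v G \<xi>)"
      by (rule multiplier_isometry[OF s _ _ G]; use propagator_defined unitary[unfolded propagator_def] in blast)
    moreover have "AE \<xi> in lebesgue. norm (propagator_symbol h t \<xi> *v G \<xi>) = norm (G \<xi>)"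
      by (rule multiplier_isometry_pointwise[OF s _ _ G]; use propagator_defined unitary[unfolded propagator_def] in blast)
    ultimately show "(\<lambda>\<xi>. propagator_symbol h t \<xi> *v G \<xi>) \<in> borel_measurable lebesgue \<and>
        (AE \<xi> in lebesgue. norm (propagator_symbol h t \<xi> *v G \<xi>) = norm (G \<xi>))"
      using square_integrable_measurable by blast
  next
    show "propagator_symbol h t (c *\<^sub>R \<xi>) = propagator_symbol h (c powr k * t) \<xi>" if "0 < c" for c t \<xi>
      by (rule propagator_symbol_scale) (rule homogeneous[OF that])
  qed (fact s k norm propagator_symbol_continuous propagator_symbol_zero propagator_symbol_add \<alpha>_def r_eq)+
  \<comment> \<open>At each time the propagator is some chosen inverse transform, equal almost
    everywhere to the explicit \<open>sol G t\<close>; the spatial norm inside the mixed norm does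
    not see the difference.\<close>
  have prop_mixed: "mixed_norm N p' q' (\<lambda>t. propagator h t f) = mixed_norm N p' q' (sol G)"
    if f: "f \<in> Hdot s" and G: "square_integrable lebesgue G"
      and fG: "AE \<xi> in lebesgue. fourier f \<xi> = (norm \<xi> powr (- s)) *\<^sub>R G \<xi>" for f G p' q'
  proof -
    have "Lp_norm q' lebesgue (\<lambda>x. ennreal (N (propagator h t f x))) = Lp_norm q' lebesgue (\<lambda>x. ennreal (N (sol G t x)))" for t
    proof (rule Lp_norm_cong_AE)
      have hf: "has_fourier (propagator h t f) (\<lambda>\<xi>. propagator_symbol h t \<xi> *v fourier f \<xi>)"
        unfolding propagator_def by (rule fourier_multiplier_has_fourier[OF propagator_defined[OF f]])
      have "AE \<xi> in lebesgue. propagator_symbol h t \<xi> *v fourier f \<xi> = (norm \<xi> powr (- s)) *\<^sub>R ev t G \<xi>"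
        using fG by eventually_elim (simp add: ev_def scaleR_eq_vector_scalar_mult vector_scalar_commute)
      from has_fourier_eq_vfull_inv[OF s hf ev_square_integrable[OF G] this]
      show "AE x in lebesgue. ennreal (N (propagator h t f x)) = ennreal (N (sol G t x))"
        unfolding sol_def by eventually_elim simp
      show "(\<lambda>x. ennreal (N (propagator h t f x))) \<in> borel_measurable lebesgue"
        using measurable_compose[OF has_fourier_measurable(1)[OF hf] complex_norm_measurable[OF norm]] by measurable
      show "(\<lambda>x. ennreal (N (sol G t x))) \<in> borel_measurable lebesgue"
        using N_sol_slice_measurable[OF G, of t] by (intro measurable_completion) measurable
    qed
    then show ?thesis by (simp add: mixed_norm_def)
  qed
  interpret strichartz_flow s k "propagator_symbol h" N \<alpha> r p q C
  proof
    show "0 < p" using pq(1) by (rule less_le_trans[rotated]) simp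
    fix G :: "real ^ 'd \<Rightarrow> complex ^ 'n" assume G: "square_integrable lebesgue G"
    note f = vfull_inv_Hdot[OF s G]
    show "mixed_norm N p q (sol G) \<le> ennreal (C * sqrt (ip lebesgue G G))"
      using strichartz[OF f(1)] unfolding prop_mixed[OF f(1) G f(3)] f(2) .
  qed (fact pq C)+
  obtain \<Lambda> G where max: "\<Lambda> < top" "\<And>H. square_integrable lebesgue H \<Longrightarrow> J H \<le> \<Lambda> * ennreal (sqrt (ip lebesgue H H) powr r)"
    and G: "square_integrable lebesgue G" "ip lebesgue G G = 1" "J G = \<Lambda>"
    by (rule exists_maximizer) blast
  \<comment> \<open>\<open>\<Lambda>\<close> is the supremum of r-th powers, so its r-th root is the
    candidate for M.\<close>
  define K where "K = ennreal_powr \<Lambda> (1 / r)"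
  have le: "mixed_norm N (ennreal r) (ennreal r) (\<lambda>t. propagator h t f) \<le> K * ennreal (Hdot_norm s f)" if f: "f \<in> Hdot s" for f
  proof -
    obtain H where H: "square_integrable lebesgue H" "Hdot_norm s f = sqrt (ip lebesgue H H)"
      "AE \<xi> in lebesgue. fourier f \<xi> = (norm \<xi> powr (- s)) *\<^sub>R H \<xi>"
      by (rule Hdot_obtain[OF s f]) blast
    have "ennreal_powr (J H) (1 / r) \<le> ennreal_powr (\<Lambda> * ennreal (sqrt (ip lebesgue H H) powr r)) (1 / r)"
      using r_pos by (intro ennreal_powr_mono max(2) H) simp
    also have "\<dots> = K * ennreal (Hdot_norm s f)"
      using r_pos by (simp add: ennreal_powr_mult ennreal_powr_ennreal powr_powr K_def H(2))
    finally show ?thesis unfolding prop_mixed[OF f H(1,3)] mixed_norm_J[OF H(1)] .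
  qed
  define f0 where "f0 = vfull_inv s G"
  note f0 = vfull_inv_Hdot[OF s G(1), folded f0_def]
  have f0_norm: "Hdot_norm s f0 = 1" using f0(2) G(2) by simp
  have f0_max: "mixed_norm N (ennreal r) (ennreal r) (\<lambda>t. propagator h t f0) = K"
    unfolding prop_mixed[OF f0(1) G(1) f0(3)] mixed_norm_J[OF G(1)] G(3) K_def ..
  have "M = K"
    unfolding M
  proof (rule antisym)
    show "(SUP f\<in>{f \<in> Hdot s. Hdot_norm s f = 1}. mixed_norm N (ennreal r) (ennreal r) (\<lambda>t. propagator h t f)) \<le> K"
      using le by (intro SUP_least) fastforce
    show "K \<le> (SUP f\<in>{f \<in> Hdot s. Hdot_norm s f = 1}. mixed_norm N (ennreal r) (ennreal r) (\<lambda>t. propagator h t f))"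
      unfolding f0_max[symmetric] using f0(1) f0_norm by (intro SUP_upper) simp
  qed
  moreover have "K < \<infinity>" using max(1) by (simp add: K_def ennreal_powr_def)
  ultimately show ?thesis using le f0(1) f0_norm f0_max by blast
qed

end
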